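(* Let $H$ be a commutative Hopf algebra. Consider two Galois co-objects $C$ and $D$ for $H$. Then the herd associated to the composed Galois co-object $C\otimes_H D$ coincides with the herd obtained by composing the herd associated to $C$ and the herd associated to $D$, using the smash coproduct given by the map $\sigma$ described in the context.
   Context: $k$ is a commutative ring and $\otimes=\otimes_k$. $H$ is a Hopf algebra over $k$, faithfully flat over $k$, with bijective antipode $S$ (when $H$ is commutative, $S^{-1}=S$), counit $\varepsilon_H$ and coproduct $\Delta_H(h)=h_{(1)}\otimes h_{(2)}$. Identity maps are denoted by the objects. Galois co-objects: a right $H$-module coalgebra is a $k$-coalgebra $C$ (coproduct $\Delta_C(c)=c_{(1)}\otimes c_{(2)}$, counit $\varepsilon_C$) that is a right $H$-module with $\Delta_C(ch)=c_{(1)}h_{(1)}\otimes c_{(2)}h_{(2)}$ and $\varepsilon_C(ch)=\varepsilon_C(c)\varepsilon_H(h)$. A right $(H,C)$-Hopf module is a right $H$-module $M$ with a right $C$-coaction $m\mapsto m_{(0)}\otimes m_{(1)}$ such that $(mh)_{(0)}\otimes(mh)_{(1)}=m_{(0)}h_{(1)}\otimes m_{(1)}h_{(2)}$; with $H$-linear $C$-colinear maps these form the category $\mathbf{M}^C_H(H)$. $C$ is a Galois co-object for $H$ if the functor $-\otimes C:\mathbf{M}_k\to\mathbf{M}^C_H(H)$ and its left adjoint $-\otimes_H k$ are inverse equivalences. Then the map $\delta_C:C\otimes H\to C\otimes C$, $\delta_C(c\otimes h)=c_{(1)}\otimes c_{(2)}h$, is bijective. If $C$, $D$ are Galois co-objects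 for commutative $H$, then so is $C\otimes_H D$ (the composed Galois co-object), with $H$-action $(c\otimes_H d)h=c\otimes_H dh=ch\otimes_H d$ and coproduct $c\otimes_H d\mapsto(c_{(1)}\otimes_H d_{(1)})\otimes(c_{(2)}\otimes_H d_{(2)})$. Herds: let $T$ be an $H$-bimodule. A formal dual of $T$ is an $H$-bimodule $\widehat{T}$ with $H$-bimodule maps $\mathrm{ev}:\widehat{T}\otimes T\to H$ and $\widehat{\mathrm{ev}}:T\otimes\widehat{T}\to H$ such that $\widehat{\mathrm{ev}}(x\otimes\hat{x})y=x\,\mathrm{ev}(\hat{x}\otimes y)$ and $\hat{x}\,\widehat{\mathrm{ev}}(x\otimes\hat{y})=\mathrm{ev}(\hat{x}\otimes x)\hat{y}$. $T$ is an $H$-$H$ herd (over the unit map $k\to H$ on both sides) with pen $\widehat{T}$ and shepherd $\gamma$ if $\gamma:T\to T\otimes\widehat{T}\otimes T$ is a $k$-linear map such that, for all $x\in T$, $(\widehat{\mathrm{ev}}\otimes T)(\gamma(x))=1_H\otimes x$, $(T\otimes\mathrm{ev})(\gamma(x))=x\otimes 1_H$, and $(\gamma\otimes\widehat{T}\otimes T)\circ\gamma=(T\otimes\widehat{T}\otimes\gamma)\circ\gamma$. Herd associated to a Galois co-object $C$ ($H$ commutative): $C$ is an $H$-bimodule with equal left and right actions; the pen $\widehat{C}$ is $C$ as a $k$-module, and is an $H$-bimodule with equal left and right actions $h\rightharpoonup\hat{c}=\hat{c}S^{-1}(h)$; the evaluation maps are $\mathrm{ev}_C=(\varepsilon_C\otimes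 H)\circ\delta_C^{-1}:\widehat{C}\otimes C\to H$ and $\widehat{\mathrm{ev}}_C=S\circ\mathrm{ev}_C:C\otimes\widehat{C}\to H$; the shepherd is $\Delta_C^2=(\Delta_C\otimes C)\circ\Delta_C:C\to C\otimes\widehat{C}\otimes C$. In particular this applies to the Galois co-object $C\otimes_H D$. Smash coproduct: write $\Delta_{C,H}^2:C\to C\otimes_H\widehat{C}\otimes C$ and $\Delta_{D,H}^2:D\to D\otimes\widehat{D}\otimes_H D$ for the projections of $\Delta_C^2$ and $\Delta_D^2$. Let $\mathcal{C}=\widehat{C}\otimes C$ be the $H$-coring with coproduct $\widehat{C}\otimes\Delta^2_{C,H}$ and counit $\mathrm{ev}_C$, and $\mathcal{D}=D\otimes\widehat{D}$ the $H$-coring with coproduct $\Delta^2_{D,H}\otimes\widehat{D}$ and counit $\widehat{\mathrm{ev}}_D$. Let $\sigma:\mathcal{C}\otimes_H\mathcal{D}\to\mathcal{D}\otimes_H\mathcal{C}$ be the (well-defined) $H$-bimodule map determined, for all $c\in C$, $d\in D$, $h\in H$, by $$\sigma(c_{(1)}\otimes c_{(2)}\otimes_H d_{(1)}\otimes d_{(2)}h)=d_{(1)}\otimes d_{(2)}\otimes_H c_{(1)}\otimes c_{(2)}S(h).$$ It defines a smash coproduct, i.e. $\mathcal{D}\otimes_H\mathcal{C}$ is an $H$-coring with coproduct $(\mathcal{D}\otimes_H\sigma\otimes_H\mathcal{C})\circ(\Delta_{\mathcal{D}}\otimes_H\Delta_{\mathcal{C}})$ and counit $\varepsilon_{\mathcal{D}}\otimes_H\varepsilon_{\mathcal{C}}$.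 Composed herd: the composition of the herds $C$ and $D$ using $\sigma$ is the $H$-bimodule $C\otimes_H D$ with pen $\widehat{D}\otimes_H\widehat{C}$, evaluation maps $\mathrm{ev}_D\circ(\widehat{D}\otimes_H\mathrm{ev}_C\otimes_H D)$ and $\widehat{\mathrm{ev}}_C\circ(C\otimes_H\widehat{\mathrm{ev}}_D\otimes_H\widehat{C})$, and shepherd $(C\otimes_H\sigma\otimes_H D)\circ(\Delta^2_{C,H}\otimes_H\Delta^2_{D,H}):C\otimes_H D\to C\otimes_H D\otimes\widehat{D}\otimes_H\widehat{C}\otimes C\otimes_H D$. *)

theory Defs
  imports "HOL-Algebra.Free_Abelian_Groups" "HOL-Algebra.Module"
begin

section \<open>Bimodules over commutative rings\<close>

text \<open>The additive group and the left action are those of the library record \<^typ>\<open>('r, 'a) module\<close>;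
  the ring fields \<open>mult\<close> and \<open>one\<close> which that record inherits are never used.\<close>

record ('r, 's, 'a) bimodule = "('r, 'a) module" +
  rsmult :: "'a \<Rightarrow> 's \<Rightarrow> 'a"

definition right_module :: "('r, 's, 'a, 'z) bimodule_scheme \<Rightarrow> ('s, 'a) module" where
  "right_module M = \<lparr>carrier = carrier M, mult = mult M, one = one M, zero = zero M, add = add M,
     smult = (\<lambda>s x. rsmult M x s)\<rparr>"

text \<open>Both rings are commutative here, so that a right action is the same as a left action.\<close>

definition is_bimodule ::
  "('r, 'x) ring_scheme \<Rightarrow> ('s, 'y) ring_scheme \<Rightarrow> ('r, 's, 'a, 'z) bimodule_scheme \<Rightarrow> bool" where
  "is_bimodule R S M \<longleftrightarrow> module R M \<and> module S (right_module M) \<and>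
     (\<forall>r\<in>carrier R. \<forall>s\<in>carrier S. \<forall>x\<in>carrier M.
        r \<odot>\<^bsub>M\<^esub> (rsmult M x s) = rsmult M (r \<odot>\<^bsub>M\<^esub> x) s)"

definition bihom ::
  "('r, 'x) ring_scheme \<Rightarrow> ('s, 'y) ring_scheme \<Rightarrow> ('r, 's, 'a, 'z) bimodule_scheme \<Rightarrow>
     ('r, 's, 'b, 'w) bimodule_scheme \<Rightarrow> ('a \<Rightarrow> 'b) set" where
  "bihom R S M N = {f \<in> hom (add_monoid M) (add_monoid N).
     (\<forall>r\<in>carrier R. \<forall>x\<in>carrier M. f (r \<odot>\<^bsub>M\<^esub> x) = r \<odot>\<^bsub>N\<^esub> f x) \<and>
     (\<forall>s\<in>carrier S. \<forall>x\<in>carrier M. f (rsmult M x s) = rsmult N (f x) s)}"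

definition biiso ::
  "('r, 'x) ring_scheme \<Rightarrow> ('s, 'y) ring_scheme \<Rightarrow> ('r, 's, 'a, 'z) bimodule_scheme \<Rightarrow>
     ('r, 's, 'b, 'w) bimodule_scheme \<Rightarrow> ('a \<Rightarrow> 'b) set" where
  "biiso R S M N = {f \<in> bihom R S M N. bij_betw f (carrier M) (carrier N)}"

definition regular :: "('a, 'z) ring_scheme \<Rightarrow> ('a, 'a) module" where
  "regular R = \<lparr>carrier = carrier R, mult = mult R, one = one R, zero = zero R, add = add R,
     smult = mult R\<rparr>"

text \<open>A module over a commutative ring, with equal left and right actions.\<close>

definition bimod_of :: "('r, 'a, 'z) module_scheme \<Rightarrow> ('r, 'r, 'a) bimodule" where
  "bimod_of M = \<lparr>carrier = carrier M, mult = mult M, one = one M, zero = zero M, add = add M,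
     smult = smult M, rsmult = (\<lambda>x r. r \<odot>\<^bsub>M\<^esub> x)\<rparr>"

text \<open>Restriction of scalars along \<open>f\<close>, on the left and on the right.\<close>

definition lrestr :: "('q \<Rightarrow> 'r) \<Rightarrow> ('r, 's, 'a, 'z) bimodule_scheme \<Rightarrow> ('q, 's, 'a) bimodule" where
  "lrestr f M = \<lparr>carrier = carrier M, mult = mult M, one = one M, zero = zero M, add = add M,
     smult = (\<lambda>q x. f q \<odot>\<^bsub>M\<^esub> x), rsmult = rsmult M\<rparr>"

definition rrestr :: "('q \<Rightarrow> 's) \<Rightarrow> ('r, 's, 'a, 'z) bimodule_scheme \<Rightarrow> ('r, 'q, 'a) bimodule" where
  "rrestr f M = \<lparr>carrier = carrier M, mult = mult M, one = one M, zero = zero M, add = add M,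
     smult = smult M, rsmult = (\<lambda>x q. rsmult M x (f q))\<rparr>"

section \<open>Tensor products\<close>

text \<open>\<open>M \<otimes>\<^sub>S N\<close> is the free abelian group on \<open>M \<times> N\<close> modulo the bilinearity and \<open>S\<close>-balancing
  relations; its elements are cosets of formal sums.\<close>

type_synonym ('a, 'b) tens = "(('a \<times> 'b) \<Rightarrow>\<^sub>0 int) set"

definition tensor_relations ::
  "('s, 'y) ring_scheme \<Rightarrow> ('r, 's, 'a, 'z) bimodule_scheme \<Rightarrow> ('s, 't, 'b, 'w) bimodule_scheme \<Rightarrow>
     ('a, 'b) tens" where
  "tensor_relations S M N =
     {frag_of (x \<oplus>\<^bsub>M\<^esub> x', y) - frag_of (x, y) - frag_of (x', y) | x x' y.
        x \<in> carrier M \<and> x' \<in> carrier M \<and> y \<in> carrier N} \<union>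
     {frag_of (x, y \<oplus>\<^bsub>N\<^esub> y') - frag_of (x, y) - frag_of (x, y') | x y y'.
        x \<in> carrier M \<and> y \<in> carrier N \<and> y' \<in> carrier N} \<union>
     {frag_of (rsmult M x s, y) - frag_of (x, s \<odot>\<^bsub>N\<^esub> y) | x s y.
        x \<in> carrier M \<and> s \<in> carrier S \<and> y \<in> carrier N}"

definition tensor_group ::
  "('s, 'y) ring_scheme \<Rightarrow> ('r, 's, 'a, 'z) bimodule_scheme \<Rightarrow> ('s, 't, 'b, 'w) bimodule_scheme \<Rightarrow>
     ('a, 'b) tens ring" where
  "tensor_group S M N =
     (let F = free_Abelian_group (carrier M \<times> carrier N);
          Q = F Mod (generate F (tensor_relations S M N))
      in \<lparr>carrier = carrier Q, mult = (\<lambda>_ _. undefined), one = undefined,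
          zero = one Q, add = mult Q\<rparr>)"

text \<open>The elementary tensor \<open>x \<otimes> y\<close> in \<open>T = M \<otimes>\<^sub>S N\<close> is the coset of \<open>(x, y)\<close>. The factors need not be
  passed as arguments, because the zero of \<open>T\<close> is the subgroup of relations.\<close>

definition etens :: "(('a, 'b) tens, 'z) ring_scheme \<Rightarrow> 'a \<Rightarrow> 'b \<Rightarrow> ('a, 'b) tens" where
  "etens T x y = {frag_of (x, y) + r | r. r \<in> \<zero>\<^bsub>T\<^esub>}"

text \<open>For a balanced biadditive \<open>f\<close> into \<open>A\<close>, \<open>tlift A f\<close> is the additive map with \<open>x \<otimes> y \<mapsto> f x y\<close>: it
  sends a coset to the common value of \<open>f\<close> on the formal sums in it. It is used only for such \<open>f\<close>.\<close>

definition tlift :: "('c, 'z) ring_scheme \<Rightarrow> ('a \<Rightarrow> 'b \<Rightarrow> 'c) \<Rightarrow> ('a, 'b) tens \<Rightarrow> 'c" where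
  "tlift A f t = (THE v. \<forall>w\<in>t. v =
     (\<Oplus>\<^bsub>A\<^esub>p\<in>Poly_Mapping.keys w. add_pow A (Poly_Mapping.lookup w p) (f (fst p) (snd p))))"

text \<open>\<open>f \<otimes> g\<close>, as a map into the tensor product \<open>T\<close>.\<close>

definition tmap ::
  "(('c, 'd) tens, 'z) ring_scheme \<Rightarrow> ('a \<Rightarrow> 'c) \<Rightarrow> ('b \<Rightarrow> 'd) \<Rightarrow> ('a, 'b) tens \<Rightarrow> ('c, 'd) tens" where
  "tmap T f g = tlift T (\<lambda>x y. etens T (f x) (g y))"

text \<open>\<open>(x \<otimes> x', y \<otimes> y') \<mapsto> f x y \<otimes> g x' y'\<close>, as a map into the tensor product \<open>T\<close>.\<close>

definition tmap2 ::
  "(('e, 'f) tens, 'z) ring_scheme \<Rightarrow> ('a \<Rightarrow> 'c \<Rightarrow> 'e) \<Rightarrow> ('b \<Rightarrow> 'd \<Rightarrow> 'f) \<Rightarrow>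
     ('a, 'b) tens \<Rightarrow> ('c, 'd) tens \<Rightarrow> ('e, 'f) tens" where
  "tmap2 T f g t u = tlift T (\<lambda>x x'. tlift T (\<lambda>y y'. etens T (f x y) (g x' y')) u) t"

text \<open>The tensor product of an \<open>R\<close>-\<open>S\<close>-bimodule and an \<open>S\<close>-\<open>T\<close>-bimodule is an \<open>R\<close>-\<open>T\<close>-bimodule.\<close>

definition tensor ::
  "('r, 's, 'a, 'z) bimodule_scheme \<Rightarrow> ('s, 'y) ring_scheme \<Rightarrow> ('s, 't, 'b, 'w) bimodule_scheme \<Rightarrow>
     ('r, 't, ('a, 'b) tens) bimodule"
  (\<open>(_ \<boxtimes>\<^bsub>_\<^esub> _)\<close> [72, 0, 73] 72) where
  "M \<boxtimes>\<^bsub>S\<^esub> N =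
     (let T = tensor_group S M N
      in \<lparr>carrier = carrier T, mult = mult T, one = one T, zero = zero T, add = add T,
          smult = (\<lambda>r. tmap T (\<lambda>x. r \<odot>\<^bsub>M\<^esub> x) (\<lambda>y. y)),
          rsmult = (\<lambda>t s. tmap T (\<lambda>x. x) (\<lambda>y. rsmult N y s) t)\<rparr>)"

section \<open>Coalgebras and commutative Hopf algebras\<close>

definition coalgebra ::
  "('k, 'x) ring_scheme \<Rightarrow> ('k, 'k, 'a, 'z) bimodule_scheme \<Rightarrow> ('a \<Rightarrow> ('a, 'a) tens) \<Rightarrow>
     ('a \<Rightarrow> 'k) \<Rightarrow> bool" where
  "coalgebra k N \<Delta> \<epsilon> \<longleftrightarrow>
     (let N2 = N \<boxtimes>\<^bsub>k\<^esub> N; N3 = N2 \<boxtimes>\<^bsub>k\<^esub> N in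
        \<Delta> \<in> bihom k k N N2 \<and> \<epsilon> \<in> bihom k k N (bimod_of (regular k)) \<and>
        (\<forall>x\<in>carrier N.
           tmap N3 \<Delta> (\<lambda>z. z) (\<Delta> x) =
             tlift N3 (\<lambda>u w. tlift N3 (\<lambda>v z. etens N3 (etens N2 u v) z) (\<Delta> w)) (\<Delta> x) \<and>
           tlift N (\<lambda>u v. \<epsilon> u \<odot>\<^bsub>N\<^esub> v) (\<Delta> x) = x \<and>
           tlift N (\<lambda>u v. rsmult N u (\<epsilon> v)) (\<Delta> x) = x))"

record ('k, 'h) hopf = "('k, 'h) module" +
  hcomult :: "'h \<Rightarrow> ('h, 'h) tens"
  hcounit :: "'h \<Rightarrow> 'k"
  antipode :: "'h \<Rightarrow> 'h"

text \<open>Commutativity of \<open>H\<close> is part of the library locale \<^locale>\<open>algebra\<close>.\<close>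

definition commutative_hopf_algebra ::
  "('k, 'x) ring_scheme \<Rightarrow> ('k, 'h, 'z) hopf_scheme \<Rightarrow> bool" where
  "commutative_hopf_algebra k H \<longleftrightarrow>
     (let HH = bimod_of H \<boxtimes>\<^bsub>k\<^esub> bimod_of H in
        algebra k H \<and>
        coalgebra k (bimod_of H) (hcomult H) (hcounit H) \<and>
        (\<forall>g\<in>carrier H. \<forall>h\<in>carrier H.
           hcomult H (g \<otimes>\<^bsub>H\<^esub> h) = tmap2 HH (mult H) (mult H) (hcomult H g) (hcomult H h)) \<and>
        hcomult H \<one>\<^bsub>H\<^esub> = etens HH \<one>\<^bsub>H\<^esub> \<one>\<^bsub>H\<^esub> \<and>
        hcounit H \<in> ring_hom H k \<and>
        antipode H \<in> bihom k k (bimod_of H) (bimod_of H) \<and>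
        (\<forall>h\<in>carrier H.
           tlift H (\<lambda>u v. antipode H u \<otimes>\<^bsub>H\<^esub> v) (hcomult H h) = hcounit H h \<odot>\<^bsub>H\<^esub> \<one>\<^bsub>H\<^esub> \<and>
           tlift H (\<lambda>u v. u \<otimes>\<^bsub>H\<^esub> antipode H v) (hcomult H h) = hcounit H h \<odot>\<^bsub>H\<^esub> \<one>\<^bsub>H\<^esub>) \<and>
        bij_betw (antipode H) (carrier H) (carrier H))"

definition antipode_inv :: "('k, 'h, 'z) hopf_scheme \<Rightarrow> 'h \<Rightarrow> 'h" where
  "antipode_inv H = inv_into (carrier H) (antipode H)"

text \<open>In this and the later definitions with an \<^typ>\<open>'u itself\<close> argument, "all modules" are the
  modules with carrier in the type \<open>'u\<close>, which plays the role of the universe of sets.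

  \<open>H\<close> is faithfully flat if a sequence \<open>M \<rightarrow> N \<rightarrow> P\<close> is exact if and only if
  \<open>H \<otimes> M \<rightarrow> H \<otimes> N \<rightarrow> H \<otimes> P\<close> is.\<close>

definition faithfully_flat ::
  "'u itself \<Rightarrow> ('k, 'x) ring_scheme \<Rightarrow> ('k, 'h, 'z) module_scheme \<Rightarrow> bool" where
  "faithfully_flat U k H \<longleftrightarrow>
     (\<forall>(M :: ('k, 'u) module) (N :: ('k, 'u) module) (P :: ('k, 'u) module) f g.
        module k M \<and> module k N \<and> module k P \<and>
        f \<in> bihom k k (bimod_of M) (bimod_of N) \<and> g \<in> bihom k k (bimod_of N) (bimod_of P) \<longrightarrow>
        (let HM = bimod_of H \<boxtimes>\<^bsub>k\<^esub> bimod_of M; HN = bimod_of H \<boxtimes>\<^bsub>k\<^esub> bimod_of N; HP = bimod_of H \<boxtimes>\<^bsub>k\<^esub> bimod_of P in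
           f ` carrier M = {y \<in> carrier N. g y = \<zero>\<^bsub>P\<^esub>} \<longleftrightarrow>
           tmap HN (\<lambda>h. h) f ` carrier HM =
             {t \<in> carrier HN. tmap HP (\<lambda>h. h) g t = \<zero>\<^bsub>HP\<^esub>}))"

text \<open>Every \<open>H\<close>-module is a \<open>k\<close>-module by restriction along the unit map \<open>k \<rightarrow> H\<close>.\<close>

definition unit_map :: "('k, 'h, 'z) module_scheme \<Rightarrow> 'k \<Rightarrow> 'h" where
  "unit_map H a = a \<odot>\<^bsub>H\<^esub> \<one>\<^bsub>H\<^esub>"

definition lk :: "('k, 'h, 'z) module_scheme \<Rightarrow> ('h, 's, 'a, 'w) bimodule_scheme \<Rightarrow> ('k, 's, 'a) bimodule"
  where "lk H M = lrestr (unit_map H) M"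

definition rk :: "('k, 'h, 'z) module_scheme \<Rightarrow> ('r, 'h, 'a, 'w) bimodule_scheme \<Rightarrow> ('r, 'k, 'a) bimodule"
  where "rk H M = rrestr (unit_map H) M"

definition kk :: "('k, 'h, 'z) module_scheme \<Rightarrow> ('h, 'h, 'a, 'w) bimodule_scheme \<Rightarrow> ('k, 'k, 'a) bimodule"
  where "kk H M = lk H (rk H M)"

section \<open>Galois co-objects\<close>

text \<open>The underlying \<open>k\<close>-module of \<open>C\<close> is \<open>kk H (bimod_of C)\<close>. As \<open>H\<close> is commutative, the right
  \<open>H\<close>-action on \<open>C\<close> is written as the action of an \<open>H\<close>-module.\<close>

record ('k, 'h, 'c) module_coalgebra = "('h, 'c) module" +
  comult :: "'c \<Rightarrow> ('c, 'c) tens"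
  counit :: "'c \<Rightarrow> 'k"

definition is_module_coalgebra ::
  "('k, 'x) ring_scheme \<Rightarrow> ('k, 'h, 'z) hopf_scheme \<Rightarrow> ('k, 'h, 'c, 'w) module_coalgebra_scheme \<Rightarrow> bool"
  where
  "is_module_coalgebra k H C \<longleftrightarrow>
     (let Ck = kk H (bimod_of C) in
        module H C \<and> coalgebra k Ck (comult C) (counit C) \<and>
        (\<forall>c\<in>carrier C. \<forall>h\<in>carrier H.
           comult C (h \<odot>\<^bsub>C\<^esub> c) =
             tmap2 (Ck \<boxtimes>\<^bsub>k\<^esub> Ck) (\<lambda>c h. h \<odot>\<^bsub>C\<^esub> c) (\<lambda>c h. h \<odot>\<^bsub>C\<^esub> c) (comult C c) (hcomult H h) \<and>
           counit C (h \<odot>\<^bsub>C\<^esub> c) = counit C c \<otimes>\<^bsub>k\<^esub> hcounit H h))"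

definition hopf_module ::
  "('k, 'x) ring_scheme \<Rightarrow> ('k, 'h, 'z) hopf_scheme \<Rightarrow> ('k, 'h, 'c, 'w) module_coalgebra_scheme \<Rightarrow>
     ('h, 'm, 'v) module_scheme \<Rightarrow> ('m \<Rightarrow> ('m, 'c) tens) \<Rightarrow> bool" where
  "hopf_module k H C M \<rho> \<longleftrightarrow>
     (let Mk = kk H (bimod_of M); Ck = kk H (bimod_of C);
          MC = Mk \<boxtimes>\<^bsub>k\<^esub> Ck; MCC = MC \<boxtimes>\<^bsub>k\<^esub> Ck in
        module H M \<and> \<rho> \<in> bihom k k Mk MC \<and>
        (\<forall>m\<in>carrier M.
           tmap MCC \<rho> (\<lambda>c. c) (\<rho> m) =
             tlift MCC (\<lambda>n c. tlift MCC (\<lambda>d e. etens MCC (etens MC n d) e) (comult C c)) (\<rho> m) \<and>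
           tlift M (\<lambda>n c. counit C c \<odot>\<^bsub>Mk\<^esub> n) (\<rho> m) = m) \<and>
        (\<forall>m\<in>carrier M. \<forall>h\<in>carrier H.
           \<rho> (h \<odot>\<^bsub>M\<^esub> m) =
             tmap2 MC (\<lambda>m h. h \<odot>\<^bsub>M\<^esub> m) (\<lambda>c h. h \<odot>\<^bsub>C\<^esub> c) (\<rho> m) (hcomult H h)))"

text \<open>\<open>k\<close> as an \<open>H\<close>-\<open>k\<close>-bimodule via the counit of \<open>H\<close>, and the functor \<open>- \<otimes>\<^sub>H k\<close>.\<close>

definition triv :: "('k, 'x) ring_scheme \<Rightarrow> ('k, 'h, 'z) hopf_scheme \<Rightarrow> ('h, 'k, 'k) bimodule" where
  "triv k H = lrestr (hcounit H) (bimod_of (regular k))"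

definition coinv ::
  "('k, 'x) ring_scheme \<Rightarrow> ('k, 'h, 'z) hopf_scheme \<Rightarrow> ('k, 'h, 'm, 'v) bimodule_scheme \<Rightarrow>
     ('k, 'k, ('m, 'k) tens) bimodule" where
  "coinv k H M = M \<boxtimes>\<^bsub>H\<^esub> triv k H"

text \<open>The unit \<open>M \<rightarrow> (M \<otimes>\<^sub>H k) \<otimes> C, m \<mapsto> (m\<^sub>0 \<otimes>\<^sub>H 1) \<otimes> m\<^sub>1\<close> and the counit
  \<open>(N \<otimes> C) \<otimes>\<^sub>H k \<rightarrow> N, (n \<otimes> c) \<otimes>\<^sub>H a \<mapsto> n \<epsilon>(c) a\<close> of the adjunction between \<open>- \<otimes>\<^sub>H k\<close> and \<open>- \<otimes> C\<close>.\<close>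

definition galois_unit ::
  "('k, 'x) ring_scheme \<Rightarrow> ('k, 'h, 'z) hopf_scheme \<Rightarrow> ('k, 'h, 'c, 'w) module_coalgebra_scheme \<Rightarrow>
     ('h, 'm, 'v) module_scheme \<Rightarrow> ('m \<Rightarrow> ('m, 'c) tens) \<Rightarrow> 'm \<Rightarrow> (('m, 'k) tens, 'c) tens" where
  "galois_unit k H C M \<rho> m =
     (let Q = coinv k H (lk H (bimod_of M))
      in tmap (Q \<boxtimes>\<^bsub>k\<^esub> lk H (bimod_of C)) (\<lambda>n. etens Q n \<one>\<^bsub>k\<^esub>) (\<lambda>c. c) (\<rho> m))"

definition galois_counit ::
  "('k, 'h, 'c, 'w) module_coalgebra_scheme \<Rightarrow> ('k, 'n, 'v) module_scheme \<Rightarrow>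
     (('n, 'c) tens, 'k) tens \<Rightarrow> 'n" where
  "galois_counit C N = tlift N (\<lambda>t a. a \<odot>\<^bsub>N\<^esub> tlift N (\<lambda>n c. counit C c \<odot>\<^bsub>N\<^esub> n) t)"

text \<open>The functor \<open>- \<otimes> C\<close> and its left adjoint \<open>- \<otimes>\<^sub>H k\<close> are inverse equivalences, i.e. the unit and
  the counit are natural isomorphisms. Both are natural morphisms in the respective categories for
  any module coalgebra, and the isomorphisms in either category are the bijective morphisms.\<close>

definition galois_coobject ::
  "'u itself \<Rightarrow> ('k, 'x) ring_scheme \<Rightarrow> ('k, 'h, 'z) hopf_scheme \<Rightarrow>
     ('k, 'h, 'c, 'w) module_coalgebra_scheme \<Rightarrow> bool" where
  "galois_coobject U k H C \<longleftrightarrow> is_module_coalgebra k H C \<and>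
     (\<forall>(M :: ('h, 'u) module) \<rho>. hopf_module k H C M \<rho> \<longrightarrow>
        bij_betw (galois_unit k H C M \<rho>) (carrier M)
          (carrier (coinv k H (lk H (bimod_of M)) \<boxtimes>\<^bsub>k\<^esub> lk H (bimod_of C)))) \<and>
     (\<forall>N :: ('k, 'u) module. module k N \<longrightarrow>
        bij_betw (galois_counit C N) (carrier (coinv k H (bimod_of N \<boxtimes>\<^bsub>k\<^esub> lk H (bimod_of C)))) (carrier N))"

definition compose_coobjects ::
  "('k, 'x) ring_scheme \<Rightarrow> ('k, 'h, 'z) hopf_scheme \<Rightarrow> ('k, 'h, 'c, 'w) module_coalgebra_scheme \<Rightarrow>
     ('k, 'h, 'd, 'v) module_coalgebra_scheme \<Rightarrow> ('k, 'h, ('c, 'd) tens) module_coalgebra" where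
  "compose_coobjects k H C D =
     (let E = bimod_of C \<boxtimes>\<^bsub>H\<^esub> bimod_of D; E2 = kk H E \<boxtimes>\<^bsub>k\<^esub> kk H E
      in \<lparr>carrier = carrier E, mult = mult E, one = one E, zero = zero E, add = add E,
          smult = smult E,
          comult = tlift E2 (\<lambda>c d. tmap2 E2 (etens E) (etens E) (comult C c) (comult D d)),
          counit = tlift k (\<lambda>c d. counit C c \<otimes>\<^bsub>k\<^esub> counit D d)\<rparr>)"

section \<open>Herds\<close>

record ('h, 't, 'p) herd =
  bimod :: "('h, 'h, 't) bimodule"
  pen :: "('h, 'h, 'p) bimodule"
  ev :: "('p, 't) tens \<Rightarrow> 'h"
  evh :: "('t, 'p) tens \<Rightarrow> 'h"
  shepherd :: "'t \<Rightarrow> (('t, 'p) tens, 't) tens"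

text \<open>The \<open>H\<close>-bimodules \<open>T \<otimes> \<^bold>T\<close>, \<open>\<^bold>T \<otimes> T\<close> and \<open>T \<otimes> \<^bold>T \<otimes> T\<close>, where \<open>\<^bold>T\<close> is the pen of \<open>T\<close>. Iterated
  tensor products are bracketed to the left.\<close>

definition TP :: "('k, 'x) ring_scheme \<Rightarrow> ('k, 'h, 'z) module_scheme \<Rightarrow> ('h, 't, 'p) herd \<Rightarrow>
    ('h, 'h, ('t, 'p) tens) bimodule" where
  "TP k H X = rk H (bimod X) \<boxtimes>\<^bsub>k\<^esub> lk H (pen X)"

definition PT :: "('k, 'x) ring_scheme \<Rightarrow> ('k, 'h, 'z) module_scheme \<Rightarrow> ('h, 't, 'p) herd \<Rightarrow>
    ('h, 'h, ('p, 't) tens) bimodule" where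
  "PT k H X = rk H (pen X) \<boxtimes>\<^bsub>k\<^esub> lk H (bimod X)"

definition TPT :: "('k, 'x) ring_scheme \<Rightarrow> ('k, 'h, 'z) module_scheme \<Rightarrow> ('h, 't, 'p) herd \<Rightarrow>
    ('h, 'h, (('t, 'p) tens, 't) tens) bimodule" where
  "TPT k H X = rk H (TP k H X) \<boxtimes>\<^bsub>k\<^esub> lk H (bimod X)"

text \<open>The two \<open>k\<close>-actions on \<open>T\<close> and on the pen agree, as all structures live over \<open>k\<close>.\<close>

definition k_central ::
  "('k, 'x) ring_scheme \<Rightarrow> ('k, 'h, 'z) module_scheme \<Rightarrow> ('h, 'h, 'a, 'w) bimodule_scheme \<Rightarrow> bool" where
  "k_central k H M \<longleftrightarrow>
     (\<forall>a\<in>carrier k. \<forall>x\<in>carrier M. unit_map H a \<odot>\<^bsub>M\<^esub> x = rsmult M x (unit_map H a))"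

definition formal_dual ::
  "('k, 'x) ring_scheme \<Rightarrow> ('k, 'h, 'z) module_scheme \<Rightarrow> ('h, 't, 'p) herd \<Rightarrow> bool" where
  "formal_dual k H X \<longleftrightarrow>
     (let T = bimod X; P = pen X in
        is_bimodule H H T \<and> k_central k H T \<and> is_bimodule H H P \<and> k_central k H P \<and>
        ev X \<in> bihom H H (PT k H X) (bimod_of (regular H)) \<and>
        evh X \<in> bihom H H (TP k H X) (bimod_of (regular H)) \<and>
        (\<forall>x\<in>carrier T. \<forall>p\<in>carrier P. \<forall>y\<in>carrier T.
           evh X (etens (TP k H X) x p) \<odot>\<^bsub>T\<^esub> y = rsmult T x (ev X (etens (PT k H X) p y))) \<and>
        (\<forall>p\<in>carrier P. \<forall>x\<in>carrier T. \<forall>q\<in>carrier P.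
           rsmult P p (evh X (etens (TP k H X) x q)) = ev X (etens (PT k H X) p x) \<odot>\<^bsub>P\<^esub> q))"

definition is_herd ::
  "('k, 'x) ring_scheme \<Rightarrow> ('k, 'h, 'z) module_scheme \<Rightarrow> ('h, 't, 'p) herd \<Rightarrow> bool" where
  "is_herd k H X \<longleftrightarrow>
     (let T = bimod X; P = pen X; \<gamma> = shepherd X;
          T2 = TP k H X; T3 = TPT k H X;
          T4 = rk H T3 \<boxtimes>\<^bsub>k\<^esub> lk H P; T5 = rk H T4 \<boxtimes>\<^bsub>k\<^esub> lk H T;
          HT = bimod_of H \<boxtimes>\<^bsub>k\<^esub> lk H T; TH = rk H T \<boxtimes>\<^bsub>k\<^esub> bimod_of H
      in formal_dual k H X \<and>
         \<gamma> \<in> bihom k k (kk H T) (kk H T3) \<and>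
         (\<forall>x\<in>carrier T.
            tmap HT (evh X) (\<lambda>z. z) (\<gamma> x) = etens HT \<one>\<^bsub>H\<^esub> x \<and>
            tlift TH (\<lambda>t z. tlift TH (\<lambda>y p. etens TH y (ev X (etens (PT k H X) p z))) t) (\<gamma> x) =
              etens TH x \<one>\<^bsub>H\<^esub> \<and>
            tmap T5 (tmap T4 \<gamma> (\<lambda>p. p)) (\<lambda>z. z) (\<gamma> x) =
              tlift T5 (\<lambda>t y.
                tlift T5 (\<lambda>u z.
                  tlift T5 (\<lambda>w p. etens T5 (etens T4 (etens T3 t w) p) z) u) (\<gamma> y)) (\<gamma> x)))"

text \<open>Two herds with the same underlying bimodule, whose pens are identified by \<open>\<theta>\<close>. Bimodules are
  compared on their carriers, since the values of record functions elsewhere carry no meaning.\<close>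

definition herds_coincide_via ::
  "('k, 'x) ring_scheme \<Rightarrow> ('k, 'h, 'z) module_scheme \<Rightarrow> ('p \<Rightarrow> 'q) \<Rightarrow>
     ('h, 't, 'p) herd \<Rightarrow> ('h, 't, 'q) herd \<Rightarrow> bool" where
  "herds_coincide_via k H \<theta> X Y \<longleftrightarrow>
     is_herd k H X \<and> is_herd k H Y \<and>
     (\<lambda>x. x) \<in> biiso H H (bimod X) (bimod Y) \<and>
     \<theta> \<in> biiso H H (pen X) (pen Y) \<and>
     (\<forall>t\<in>carrier (PT k H X). ev X t = ev Y (tmap (PT k H Y) \<theta> (\<lambda>x. x) t)) \<and>
     (\<forall>t\<in>carrier (TP k H X). evh X t = evh Y (tmap (TP k H Y) (\<lambda>x. x) \<theta> t)) \<and>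
     (\<forall>x\<in>carrier (bimod X).
        tmap (TPT k H Y) (tmap (TP k H Y) (\<lambda>x. x) \<theta>) (\<lambda>x. x) (shepherd X x) = shepherd Y x)"

subsection \<open>The herd associated to a Galois co-object\<close>

definition galois_map ::
  "('k, 'x) ring_scheme \<Rightarrow> ('k, 'h, 'z) hopf_scheme \<Rightarrow> ('k, 'h, 'c, 'w) module_coalgebra_scheme \<Rightarrow>
     ('c, 'h) tens \<Rightarrow> ('c, 'c) tens" where
  "galois_map k H C =
     (let CC = kk H (bimod_of C) \<boxtimes>\<^bsub>k\<^esub> kk H (bimod_of C)
      in tlift CC (\<lambda>c h. tmap CC (\<lambda>x. x) (\<lambda>y. h \<odot>\<^bsub>C\<^esub> y) (comult C c)))"

definition galois_ev ::
  "('k, 'x) ring_scheme \<Rightarrow> ('k, 'h, 'z) hopf_scheme \<Rightarrow> ('k, 'h, 'c, 'w) module_coalgebra_scheme \<Rightarrow>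
     ('c, 'c) tens \<Rightarrow> 'h" where
  "galois_ev k H C t = tlift H (\<lambda>c h. counit C c \<odot>\<^bsub>H\<^esub> h)
     (inv_into (carrier (kk H (bimod_of C) \<boxtimes>\<^bsub>k\<^esub> bimod_of H)) (galois_map k H C) t)"

text \<open>The antipode is \<open>k\<close>-linear, so that the twisted \<open>H\<close>-action on the pen induces the same
  \<open>k\<close>-module structure on \<open>C\<close>.\<close>

definition galois_herd ::
  "('k, 'x) ring_scheme \<Rightarrow> ('k, 'h, 'z) hopf_scheme \<Rightarrow> ('k, 'h, 'c, 'w) module_coalgebra_scheme \<Rightarrow>
     ('h, 'c, 'c) herd" where
  "galois_herd k H C =
     (let Ck = kk H (bimod_of C)
      in \<lparr>bimod = bimod_of C,
          pen = lrestr (antipode_inv H) (rrestr (antipode_inv H) (bimod_of C)),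
          ev = galois_ev k H C,
          evh = (\<lambda>t. antipode H (galois_ev k H C t)),
          shepherd = (\<lambda>c. tmap ((Ck \<boxtimes>\<^bsub>k\<^esub> Ck) \<boxtimes>\<^bsub>k\<^esub> Ck) (comult C) (\<lambda>x. x) (comult C c))\<rparr>)"

subsection \<open>Composition of herds\<close>

text \<open>The smash map \<open>\<sigma> : (\<^bold>C \<otimes> C) \<otimes>\<^sub>H (D \<otimes> \<^bold>D) \<rightarrow> (D \<otimes> \<^bold>D) \<otimes>\<^sub>H (\<^bold>C \<otimes> C)\<close> is determined on its
  domain by the equation below. There \<open>comult C c\<close> is an element of \<open>\<^bold>C \<otimes> C\<close>, because \<open>\<^bold>C\<close> and \<open>C\<close> have the same
  underlying \<open>k\<close>-module, and likewise for \<open>D\<close>; the factor \<open>h\<close> acts by the untwisted action of \<open>D\<close>.\<close>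

definition is_sigma ::
  "('k, 'x) ring_scheme \<Rightarrow> ('k, 'h, 'z) hopf_scheme \<Rightarrow> ('k, 'h, 'c, 'w) module_coalgebra_scheme \<Rightarrow>
     ('k, 'h, 'd, 'v) module_coalgebra_scheme \<Rightarrow>
     ((('c, 'c) tens, ('d, 'd) tens) tens \<Rightarrow> (('d, 'd) tens, ('c, 'c) tens) tens) \<Rightarrow> bool" where
  "is_sigma k H C D \<sigma> \<longleftrightarrow>
     (let CC = PT k H (galois_herd k H C); DD = TP k H (galois_herd k H D);
          A = CC \<boxtimes>\<^bsub>H\<^esub> DD; B = DD \<boxtimes>\<^bsub>H\<^esub> CC
      in \<sigma> \<in> bihom H H A B \<and>
         (\<forall>c\<in>carrier C. \<forall>d\<in>carrier D. \<forall>h\<in>carrier H.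
            \<sigma> (etens A (comult C c) (tmap DD (\<lambda>x. x) (\<lambda>y. h \<odot>\<^bsub>D\<^esub> y) (comult D d))) =
              etens B (comult D d) (tmap CC (\<lambda>x. x) (\<lambda>y. antipode H h \<odot>\<^bsub>C\<^esub> y) (comult C c))))"

definition sigma ::
  "('k, 'x) ring_scheme \<Rightarrow> ('k, 'h, 'z) hopf_scheme \<Rightarrow> ('k, 'h, 'c, 'w) module_coalgebra_scheme \<Rightarrow>
     ('k, 'h, 'd, 'v) module_coalgebra_scheme \<Rightarrow>
     (('c, 'c) tens, ('d, 'd) tens) tens \<Rightarrow> (('d, 'd) tens, ('c, 'c) tens) tens" where
  "sigma k H C D = (SOME \<sigma>. is_sigma k H C D \<sigma>)"

text \<open>The composite of the herds \<open>X\<close> and \<open>Y\<close>, where \<open>\<C> = \<^bold>X \<otimes> X\<close> and \<open>\<D> = Y \<otimes> \<^bold>Y\<close>. The shepherd is the composite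
  \<open>X \<otimes>\<^sub>H Y \<rightarrow> (X \<otimes>\<^sub>H \<C>) \<otimes>\<^sub>H (\<D> \<otimes>\<^sub>H Y) \<rightarrow> (X \<otimes>\<^sub>H (\<D> \<otimes>\<^sub>H \<C>)) \<otimes>\<^sub>H Y\<close> of the tensor product of the projected shepherds
  (\<open>projX\<close>, \<open>projY\<close>) and \<open>X \<otimes>\<^sub>H \<sigma> \<otimes>\<^sub>H Y\<close> (\<open>mid\<close>), followed by the canonical isomorphism \<open>reassoc\<close> to
  \<open>((X \<otimes>\<^sub>H Y) \<otimes> (\<^bold>Y \<otimes>\<^sub>H \<^bold>X)) \<otimes> (X \<otimes>\<^sub>H Y)\<close>.\<close>

definition compose_herds ::
  "('k, 'x) ring_scheme \<Rightarrow> ('k, 'h, 'z) hopf_scheme \<Rightarrow> ('h, 't, 'p) herd \<Rightarrow> ('h, 's, 'q) herd \<Rightarrow>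
     ((('p, 't) tens, ('s, 'q) tens) tens \<Rightarrow> (('s, 'q) tens, ('p, 't) tens) tens) \<Rightarrow>
     ('h, ('t, 's) tens, ('q, 'p) tens) herd" where
  "compose_herds k H X Y \<sigma> =
     (let E = bimod X \<boxtimes>\<^bsub>H\<^esub> bimod Y; P = pen Y \<boxtimes>\<^bsub>H\<^esub> pen X;
          EP = rk H E \<boxtimes>\<^bsub>k\<^esub> lk H P; EPE = rk H EP \<boxtimes>\<^bsub>k\<^esub> lk H E;
          CC = PT k H X; DD = TP k H Y;
          XC = bimod X \<boxtimes>\<^bsub>H\<^esub> CC; DY = DD \<boxtimes>\<^bsub>H\<^esub> bimod Y;
          CD = CC \<boxtimes>\<^bsub>H\<^esub> DD; XDC = bimod X \<boxtimes>\<^bsub>H\<^esub> (DD \<boxtimes>\<^bsub>H\<^esub> CC); XDCY = XDC \<boxtimes>\<^bsub>H\<^esub> bimod Y;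
          projX = tlift XC (\<lambda>t x'. tlift XC (\<lambda>x p. etens XC x (etens CC p x')) t);
          projY = tlift DY (\<lambda>t y'. etens DY t y');
          mid = (\<lambda>u v. tlift XDCY (\<lambda>x a.
                   tlift XDCY (\<lambda>b y. etens XDCY (etens XDC x (\<sigma> (etens CD a b))) y) v) u);
          reassoc = tlift EPE (\<lambda>w y'. tlift EPE (\<lambda>x r. tlift EPE (\<lambda>b a.
                   tlift EPE (\<lambda>y q. tlift EPE (\<lambda>p x'.
                     etens EPE (etens EP (etens E x y) (etens P q p)) (etens E x' y')) a) b) r) w)
      in \<lparr>bimod = E,
          pen = P,
          ev = tlift H (\<lambda>f e. tlift H (\<lambda>q p. tlift H (\<lambda>x y.
                 ev Y (etens (PT k H Y) q (ev X (etens CC p x) \<odot>\<^bsub>bimod Y\<^esub> y))) e) f),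
          evh = tlift H (\<lambda>e f. tlift H (\<lambda>x y. tlift H (\<lambda>q p.
                 evh X (etens (TP k H X) (rsmult (bimod X) x (evh Y (etens DD y q))) p)) f) e),
          shepherd = tlift EPE (\<lambda>x y. reassoc (mid (projX (shepherd X x)) (projY (shepherd Y y))))\<rparr>)"

text \<open>The flip \<open>x \<otimes> y \<mapsto> y \<otimes> x\<close>, as a map into the tensor product \<open>T\<close>.\<close>

definition flip :: "(('b, 'a) tens, 'z) ring_scheme \<Rightarrow> ('a, 'b) tens \<Rightarrow> ('b, 'a) tens" where
  "flip T = tlift T (\<lambda>x y. etens T y x)"

end

theory Submission
  imports Defs
begin

text \<open>The equivalence of categories is used only through bijectivity of the Galois map, obtained from the unit
  at the Hopf module \<open>C \<otimes> H\<close>. The map \<open>(c \<otimes>\<^sub>H d) \<otimes> (c' \<otimes>\<^sub>H d') \<mapsto> ev\<^sub>C(c, c') ev\<^sub>D(d, d')\<close> satisfies the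
  equations that characterise the evaluation of \<open>C \<otimes>\<^sub>H D\<close>, so the evaluations agree after the flip of the pens. Since \<open>\<sigma>\<close>
  flips \<open>\<Delta>(c) \<otimes>\<^sub>H \<Delta>(d)\<close>, coassociativity turns the composed shepherd into the iterated coproduct of \<open>C \<otimes>\<^sub>H D\<close>.
  The herd axioms are then transported along the flip.\<close>

section \<open>Tensor products of abelian groups with actions\<close>

text \<open>The modules in \<open>galois_coobject\<close> have their carriers in the universe type
  \<open>'u\<close>, whereas C \<otimes> H consists of cosets of formal sums; a cardinality bound
  provides an injection into \<open>'u\<close>, along which this Hopf module is transported. Its
  coinvariants (C \<otimes> H) \<otimes>_H k are C, which turns the unit of the adjunction into
  \<delta>_C. For C \<otimes>_H D the Galois map is inverted explicitly: a linear E with E(c1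
  \<otimes> c2 h) = \<epsilon>(c) h and x1 E(x2 \<otimes> y) = \<epsilon>(x) y forces \<delta> to be
  bijective with evaluation E.

  The map \<open>sigma\<close> is a choice, so some map with its defining property has to be
  exhibited. The formula on elementary tensors is forced by c \<otimes> c' = ev(c \<otimes> c'1)
  \<Delta>(c'2) and d \<otimes> d' = d1 \<otimes> d2 ev(d3 \<otimes> d'); the work lies in showing
  that it is H-balanced.

  Sweedler sums are rendered as nested \<open>tlift\<close>s over coproducts, and every step of a
  calculation has to know that the summand is linear in each variable. Commutativity of
  \<open>H\<close> makes S an involution, which removes S^-1 from the pens.\<close>

lemma (in comm_group) finprod_frag_hom:
  assumes f: "\<And>p. p \<in> S \<Longrightarrow> f p \<in> carrier G"
  shows "(\<lambda>w. finprod G (\<lambda>p. f p [^] Poly_Mapping.lookup w p) (Poly_Mapping.keys w))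
    \<in> hom (free_Abelian_group S) G" (is "?h \<in> _")
proof (rule homI)
  have fc: "f p [^] (n :: int) \<in> carrier G" if "p \<in> S" for p n
    using f[OF that] by (rule int_pow_closed)
  \<comment> \<open>Supports may shrink by cancellation in \<open>v + w\<close>, so all products are
    extended to one finite \<open>K\<close>; the additional factors have exponent 0.\<close>
  have sup: "?h w = finprod G (\<lambda>p. f p [^] Poly_Mapping.lookup w p) K"
    if "finite K" "Poly_Mapping.keys w \<subseteq> K" "K \<subseteq> S" for w K
  proof (rule finprod_mono_neutral_cong_left)
    show "f p [^] Poly_Mapping.lookup w p = \<one>" if "p \<in> K - Poly_Mapping.keys w" for p
      using that by (simp add: not_in_keys_iff_lookup_eq_zero)
    show "(\<lambda>p. f p [^] Poly_Mapping.lookup w p) \<in> K \<rightarrow> carrier G"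
      by (rule Pi_I, rule fc, rule subsetD[OF that(3)])
  qed (use that in auto)
  show "?h w \<in> carrier G" if "w \<in> carrier (free_Abelian_group S)" for w
    by (intro finprod_closed Pi_I fc) (use that in auto)
  fix v w
  assume vw: "v \<in> carrier (free_Abelian_group S)" "w \<in> carrier (free_Abelian_group S)"
  define K where "K = Poly_Mapping.keys v \<union> Poly_Mapping.keys w"
  have K: "finite K" "K \<subseteq> S" "Poly_Mapping.keys v \<subseteq> K" "Poly_Mapping.keys w \<subseteq> K"
    "Poly_Mapping.keys (v + w) \<subseteq> K"
    using vw keys_add[of v w] by (auto simp: K_def)
  have cl: "(\<lambda>p. f p [^] Poly_Mapping.lookup u p) \<in> K \<rightarrow> carrier G" for u :: "_ \<Rightarrow>\<^sub>0 int"
    by (rule Pi_I, rule fc, rule subsetD[OF K(2)])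
  have "?h (v + w) = finprod G (\<lambda>p. f p [^] Poly_Mapping.lookup (v + w) p) K"
    using K by (intro sup)
  also have "\<dots> = finprod G (\<lambda>p. f p [^] Poly_Mapping.lookup v p \<otimes> f p [^] Poly_Mapping.lookup w p) K"
  proof (rule finprod_cong')
    show "(\<lambda>p. f p [^] Poly_Mapping.lookup v p \<otimes> f p [^] Poly_Mapping.lookup w p) \<in> K \<rightarrow> carrier G"
      by (intro Pi_I m_closed fc) (use K(2) in auto)
    show "f p [^] Poly_Mapping.lookup (v + w) p = f p [^] Poly_Mapping.lookup v p \<otimes> f p [^] Poly_Mapping.lookup w p"
      if "p \<in> K" for p
      using f[of p] K(2) that by (auto simp: lookup_add int_pow_mult)
  qed simp
  also have "\<dots> = finprod G (\<lambda>p. f p [^] Poly_Mapping.lookup v p) K \<otimes>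
      finprod G (\<lambda>p. f p [^] Poly_Mapping.lookup w p) K"
    by (rule finprod_multf[OF cl cl])
  also have "\<dots> = ?h v \<otimes> ?h w"
    using sup[of K v] sup[of K w] K by simp
  finally show "?h (v \<otimes>\<^bsub>free_Abelian_group S\<^esub> w) = ?h v \<otimes> ?h w" by simp
qed

text \<open>The tensor relations and the induction rule for free abelian groups are phrased with
  differences, which \<open>hom\<close> does not mention.\<close>

lemma hom_free_Abelian_group_diff:
  assumes A: "abelian_group A" and h: "h \<in> hom (free_Abelian_group K) (add_monoid A)"
    and ab: "a \<in> carrier (free_Abelian_group K)" "b \<in> carrier (free_Abelian_group K)"
  shows "h (a - b) = h a \<ominus>\<^bsub>A\<^esub> h b"
proof -
  interpret A: abelian_group A by fact
  interpret h: group_hom "free_Abelian_group K" "add_monoid A" h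
    using h A.a_group by (simp add: group_hom_def group_hom_axioms_def)
  have "inv\<^bsub>free_Abelian_group K\<^esub> b = - b" using ab(2) by simp
  then have "a - b = a \<otimes>\<^bsub>free_Abelian_group K\<^esub> inv\<^bsub>free_Abelian_group K\<^esub> b" by simp
  also have "h \<dots> = h a \<otimes>\<^bsub>add_monoid A\<^esub> h (inv\<^bsub>free_Abelian_group K\<^esub> b)"
    using ab by (intro h.hom_mult) (auto simp del: carrier_free_Abelian_group_iff)
  also have "h (inv\<^bsub>free_Abelian_group K\<^esub> b) = inv\<^bsub>add_monoid A\<^esub> (h b)"
    using ab(2) by (rule h.hom_inv)
  finally show ?thesis by (simp add: a_minus_def a_inv_def)
qed

text \<open>The sum inside \<open>tlift\<close>, taken for one fixed representative. Additivity is
  proved at this level; independence of the representative is a separate matter.\<close>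

definition lin_ext :: "('c, 'z) ring_scheme \<Rightarrow> ('a \<Rightarrow> 'b \<Rightarrow> 'c) \<Rightarrow> (('a \<times> 'b) \<Rightarrow>\<^sub>0 int) \<Rightarrow> 'c" where
  "lin_ext A f w =
     (\<Oplus>\<^bsub>A\<^esub>p\<in>Poly_Mapping.keys w. add_pow A (Poly_Mapping.lookup w p) (f (fst p) (snd p)))"

lemma lin_ext_hom:
  assumes "abelian_group A" "\<And>x y. x \<in> X \<Longrightarrow> y \<in> Y \<Longrightarrow> f x y \<in> carrier A"
  shows "lin_ext A f \<in> hom (free_Abelian_group (X \<times> Y)) (add_monoid A)"
proof -
  interpret A: comm_group "add_monoid A"
    using assms(1) by (rule abelian_group.a_comm_group)
  have "lin_ext A f = (\<lambda>w. finprod (add_monoid A)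
      (\<lambda>p. f (fst p) (snd p) [^]\<^bsub>add_monoid A\<^esub> Poly_Mapping.lookup w p) (Poly_Mapping.keys w))"
    by (auto simp: lin_ext_def finsum_def add_pow_def)
  then show ?thesis
    using A.finprod_frag_hom[of "X \<times> Y" "\<lambda>p. f (fst p) (snd p)"] assms(2) by auto
qed

lemma lin_ext_frag_of [simp]:
  assumes "abelian_group A" "f x y \<in> carrier A"
  shows "lin_ext A f (frag_of (x, y)) = f x y"
proof -
  interpret A: abelian_group A by fact
  show ?thesis
    using assms(2) by (simp add: lin_ext_def add_pow_int_ge)
qed

lemma tlift_lin_ext: "tlift A f t = (THE v. \<forall>w\<in>t. v = lin_ext A f w)"
  by (simp add: tlift_def lin_ext_def)

text \<open>\<open>finsum\<close> and \<open>add_pow\<close> read only the carrier, the addition and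
  the zero of their ring record. Targets with the same additive group are therefore interchangeable,
  whatever actions or multiplications they carry.\<close>

lemma tlift_cong_ring:
  assumes "carrier A = carrier B" "add A = add B" "zero A = zero B"
  shows "tlift A = (tlift B :: ('a \<Rightarrow> 'b \<Rightarrow> 'c) \<Rightarrow> _)"
proof -
  have "finsum A = (finsum B :: ('a \<times> 'b \<Rightarrow> _) \<Rightarrow> _)"
    using assms by (intro ext) (simp add: finsum_def finprod_def)
  moreover have "add_pow A = (add_pow B :: int \<Rightarrow> _)"
    using assms by (intro ext) (simp add: add_pow_def int_pow_def nat_pow_def m_inv_def Let_def)
  ultimately show ?thesis by (intro ext) (simp add: tlift_def)
qed

lemma etens_cong_ring: "zero T = zero U \<Longrightarrow> etens T = etens U"
  by (intro ext) (simp add: etens_def)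

lemma tmap_cong_ring:
  assumes "carrier A = carrier B" "add A = add B" "zero A = zero B"
  shows "tmap A = tmap B"
  by (intro ext) (simp only: tmap_def tlift_cong_ring[OF assms] etens_cong_ring[OF assms(3)])

text \<open>Just the closure conditions behind the relations, so that the quotient construction can
  be carried out before any module law is available.\<close>

definition tensorable ::
  "('s, 'y) ring_scheme \<Rightarrow> ('r, 's, 'a, 'z) bimodule_scheme \<Rightarrow> ('s, 't, 'b, 'w) bimodule_scheme \<Rightarrow> bool"
  where
  "tensorable S M N \<longleftrightarrow> abelian_group M \<and> abelian_group N \<and>
     (\<forall>x\<in>carrier M. \<forall>s\<in>carrier S. rsmult M x s \<in> carrier M) \<and>
     (\<forall>s\<in>carrier S. \<forall>y\<in>carrier N. s \<odot>\<^bsub>N\<^esub> y \<in> carrier N)"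

definition balanced ::
  "('s, 'y) ring_scheme \<Rightarrow> ('r, 's, 'a, 'z) bimodule_scheme \<Rightarrow> ('s, 't, 'b, 'w) bimodule_scheme \<Rightarrow>
     ('c, 'v) ring_scheme \<Rightarrow> ('a \<Rightarrow> 'b \<Rightarrow> 'c) \<Rightarrow> bool" where
  "balanced S M N A f \<longleftrightarrow>
     (\<forall>x\<in>carrier M. \<forall>y\<in>carrier N. f x y \<in> carrier A) \<and>
     (\<forall>x\<in>carrier M. \<forall>x'\<in>carrier M. \<forall>y\<in>carrier N. f (x \<oplus>\<^bsub>M\<^esub> x') y = f x y \<oplus>\<^bsub>A\<^esub> f x' y) \<and>
     (\<forall>x\<in>carrier M. \<forall>y\<in>carrier N. \<forall>y'\<in>carrier N. f x (y \<oplus>\<^bsub>N\<^esub> y') = f x y \<oplus>\<^bsub>A\<^esub> f x y') \<and>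
     (\<forall>x\<in>carrier M. \<forall>s\<in>carrier S. \<forall>y\<in>carrier N. f (rsmult M x s) y = f x (s \<odot>\<^bsub>N\<^esub> y))"

lemma tensor_sel [simp]:
  "carrier (M \<boxtimes>\<^bsub>S\<^esub> N) = carrier (tensor_group S M N)"
  "zero (M \<boxtimes>\<^bsub>S\<^esub> N) = zero (tensor_group S M N)"
  "add (M \<boxtimes>\<^bsub>S\<^esub> N) = add (tensor_group S M N)"
  by (simp_all add: tensor_def Let_def)

lemma tensor_record_ops:
  "etens (M \<boxtimes>\<^bsub>S\<^esub> N) = etens (tensor_group S M N)"
  "tlift (M \<boxtimes>\<^bsub>S\<^esub> N) = tlift (tensor_group S M N)"
  "tmap (M \<boxtimes>\<^bsub>S\<^esub> N) = tmap (tensor_group S M N)"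
  by (rule etens_cong_ring tlift_cong_ring tmap_cong_ring; simp)+

text \<open>The definition of \<open>tensor\<close> has to express the actions through the bare
  group, since the record is only being built there; both have the same additive part.\<close>

lemma tensor_smult:
  "r \<odot>\<^bsub>M \<boxtimes>\<^bsub>S\<^esub> N\<^esub> t = tmap (M \<boxtimes>\<^bsub>S\<^esub> N) (\<lambda>x. r \<odot>\<^bsub>M\<^esub> x) (\<lambda>y. y) t"
  "rsmult (M \<boxtimes>\<^bsub>S\<^esub> N) t s = tmap (M \<boxtimes>\<^bsub>S\<^esub> N) (\<lambda>x. x) (\<lambda>y. rsmult N y s) t"
  unfolding tensor_record_ops by (simp_all add: tensor_def Let_def)

section \<open>The quotient group and its universal property\<close>

context
  fixes S :: "('s, 'y) ring_scheme"
    and M :: "('r, 's, 'a, 'z) bimodule_scheme" and N :: "('s, 't, 'b, 'w) bimodule_scheme"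
  assumes T: "tensorable S M N"
begin

abbreviation (input) "FF \<equiv> free_Abelian_group (carrier M \<times> carrier N)"
abbreviation (input) "RR \<equiv> generate FF (tensor_relations S M N)"

lemma relations_in_free: "tensor_relations S M N \<subseteq> carrier FF"
proof -
  interpret M: abelian_group M using T by (simp add: tensorable_def)
  interpret N: abelian_group N using T by (simp add: tensorable_def)
  have d: "a - b \<in> carrier FF" if "a \<in> carrier FF" "b \<in> carrier FF" for a b
    using that keys_diff[of a b] by auto
  note [simp del] = carrier_free_Abelian_group_iff
  show ?thesis
    using T unfolding tensor_relations_def tensorable_def
    by (intro subsetI, elim UnE CollectE exE conjE) (simp_all add: d)
qed

lemma relations_normal: "RR \<lhd> FF"
  by (intro comm_group.subgroup_imp_normal abelian_free_Abelian_group group.generate_is_subgroup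
      group_free_Abelian_group relations_in_free)

lemma tensor_group_sel:
  "carrier (tensor_group S M N) = carrier (FF Mod RR)"
  "add (tensor_group S M N) = monoid.mult (FF Mod RR)"
  "zero (tensor_group S M N) = RR"
  by (simp_all add: tensor_group_def Let_def FactGroup_def)

lemma tensor_add_monoid: "comm_group (add_monoid (tensor_group S M N))"
proof -
  have "comm_group (FF Mod RR)"
    by (intro comm_group.abelian_FactGroup abelian_free_Abelian_group)
      (rule normal_imp_subgroup[OF relations_normal])
  moreover have "add_monoid (tensor_group S M N) = FF Mod RR"
    by (simp add: tensor_group_def Let_def FactGroup_def)
  ultimately show ?thesis by simp
qed

lemma tensor_group_abelian: "abelian_group (tensor_group S M N)"
  using tensor_add_monoid
  by (auto simp: abelian_group_def abelian_group_axioms_def abelian_monoid_def comm_group_def)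

lemma etens_coset: "etens (tensor_group S M N) x y = RR #>\<^bsub>FF\<^esub> frag_of (x, y)"
  by (auto simp: etens_def tensor_group_sel r_coset_def add.commute)

lemma carrier_tensor_group_coset:
  "carrier (tensor_group S M N) = (\<lambda>w. RR #>\<^bsub>FF\<^esub> w) ` carrier FF"
  unfolding tensor_group_sel carrier_FactGroup ..

lemma coset_add:
  assumes "v \<in> carrier FF" "w \<in> carrier FF"
  shows "(RR #>\<^bsub>FF\<^esub> v) \<oplus>\<^bsub>tensor_group S M N\<^esub> (RR #>\<^bsub>FF\<^esub> w) = RR #>\<^bsub>FF\<^esub> (v + w)"
  using normal.rcos_sum[OF relations_normal assms] by (simp add: tensor_group_sel)

lemma coset_eqI:
  assumes "v - w \<in> RR" "v \<in> carrier FF" "w \<in> carrier FF"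
  shows "RR #>\<^bsub>FF\<^esub> v = RR #>\<^bsub>FF\<^esub> w"
proof -
  have "v \<in> RR #>\<^bsub>FF\<^esub> w"
    using assms by (auto simp: r_coset_def intro!: bexI[of _ "v - w"])
  then show ?thesis
    using group.repr_independence[OF group_free_Abelian_group _ assms(3) normal_imp_subgroup[OF relations_normal]]
    by metis
qed

lemma etens_closed0: "x \<in> carrier M \<Longrightarrow> y \<in> carrier N \<Longrightarrow>
    etens (tensor_group S M N) x y \<in> carrier (tensor_group S M N)"
  unfolding etens_coset carrier_tensor_group_coset by (intro imageI) simp

lemma balanced_etens0: "balanced S M N (tensor_group S M N) (etens (tensor_group S M N))"
proof -
  interpret M: abelian_group M using T by (simp add: tensorable_def)
  interpret N: abelian_group N using T by (simp add: tensorable_def)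
  have add: "etens (tensor_group S M N) a b \<oplus>\<^bsub>tensor_group S M N\<^esub> etens (tensor_group S M N) a' b'
      = RR #>\<^bsub>FF\<^esub> (frag_of (a, b) + frag_of (a', b'))"
    if "a \<in> carrier M" "a' \<in> carrier M" "b \<in> carrier N" "b' \<in> carrier N" for a a' b b'
    unfolding etens_coset using that by (intro coset_add) auto
  have k: "Poly_Mapping.keys (frag_of p + frag_of q) \<subseteq> {p, q}" for p q :: "'a \<times> 'b"
    using keys_add[of "frag_of p" "frag_of q"] by auto
  have kk: "frag_of p + frag_of q \<in> carrier FF"
    if "p \<in> carrier M \<times> carrier N" "q \<in> carrier M \<times> carrier N" for p q
    using that k[of p q] by auto
  have gen: "r \<in> tensor_relations S M N \<Longrightarrow> r \<in> RR" for r by (rule generate.incl)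
  show ?thesis
    unfolding balanced_def
  proof (intro conjI ballI)
    fix x y assume "x \<in> carrier M" "y \<in> carrier N"
    then show "etens (tensor_group S M N) x y \<in> carrier (tensor_group S M N)"
      by (rule etens_closed0)
  next
    fix x x' y assume a: "x \<in> carrier M" "x' \<in> carrier M" "y \<in> carrier N"
    show "etens (tensor_group S M N) (x \<oplus>\<^bsub>M\<^esub> x') y =
      etens (tensor_group S M N) x y \<oplus>\<^bsub>tensor_group S M N\<^esub> etens (tensor_group S M N) x' y"
      unfolding add[OF a(1,2,3,3)] unfolding etens_coset
    proof (rule coset_eqI)
      show "frag_of (x \<oplus>\<^bsub>M\<^esub> x', y) - (frag_of (x, y) + frag_of (x', y)) \<in> RR"
        using a by (intro gen) (auto simp: tensor_relations_def diff_diff_eq)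
    qed (use a in \<open>auto intro: kk simp del: carrier_free_Abelian_group_iff\<close>)
  next
    fix x y y' assume a: "x \<in> carrier M" "y \<in> carrier N" "y' \<in> carrier N"
    show "etens (tensor_group S M N) x (y \<oplus>\<^bsub>N\<^esub> y') =
      etens (tensor_group S M N) x y \<oplus>\<^bsub>tensor_group S M N\<^esub> etens (tensor_group S M N) x y'"
      unfolding add[OF a(1,1,2,3)] unfolding etens_coset
    proof (rule coset_eqI)
      show "frag_of (x, y \<oplus>\<^bsub>N\<^esub> y') - (frag_of (x, y) + frag_of (x, y')) \<in> RR"
        using a by (intro gen) (auto simp: tensor_relations_def diff_diff_eq)
    qed (use a in \<open>auto intro: kk simp del: carrier_free_Abelian_group_iff\<close>)
  next
    fix x s y assume a: "x \<in> carrier M" "s \<in> carrier S" "y \<in> carrier N"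
    show "etens (tensor_group S M N) (rsmult M x s) y = etens (tensor_group S M N) x (s \<odot>\<^bsub>N\<^esub> y)"
      unfolding etens_coset
    proof (rule coset_eqI)
      show "frag_of (rsmult M x s, y) - frag_of (x, s \<odot>\<^bsub>N\<^esub> y) \<in> RR"
        using a by (intro gen) (auto simp: tensor_relations_def)
    qed (use a T in \<open>auto simp: tensorable_def\<close>)
  qed
qed

text \<open>Each of the three kinds of relations is sent to zero by \<open>lin_ext A f\<close>
  because \<open>f\<close> is balanced, so the generated subgroup lies in the kernel and the value
  is constant on a coset. This is what makes the definite description in \<open>tlift\<close>
  meaningful.\<close>

lemma tlift_coset:
  assumes A: "abelian_group A" and f: "balanced S M N A f" and w: "w \<in> carrier FF"
  shows "tlift A f (RR #>\<^bsub>FF\<^esub> w) = lin_ext A f w"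
proof -
  interpret A: abelian_group A by fact
  have fc: "f x y \<in> carrier A" if "x \<in> carrier M" "y \<in> carrier N" for x y
    using f that by (simp add: balanced_def)
  let ?h = "lin_ext A f"
  interpret h: group_hom FF "add_monoid A" ?h
    using lin_ext_hom[OF A fc] A.a_group
    by (simp add: group_hom_def group_hom_axioms_def)
  note minus = hom_free_Abelian_group_diff[OF A lin_ext_hom[OF A fc]]
  have "tensor_relations S M N \<subseteq> kernel FF (add_monoid A) ?h"
  proof
    fix r assume r: "r \<in> tensor_relations S M N"
    then have rc: "r \<in> carrier FF" using relations_in_free by blast
    interpret M: abelian_group M using T by (simp add: tensorable_def)
    interpret N: abelian_group N using T by (simp add: tensorable_def)
    have d: "a - b \<in> carrier FF" if "a \<in> carrier FF" "b \<in> carrier FF" for a b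
      using that keys_diff[of a b] by auto
    have fr: "frag_of (x, y) \<in> carrier FF" if "x \<in> carrier M" "y \<in> carrier N" for x y
      using that by simp
    have e: "?h (frag_of (x, y)) = f x y" if "x \<in> carrier M" "y \<in> carrier N" for x y
      using lin_ext_frag_of[of A f x y] A fc[OF that] by simp
    have canc: "(u \<oplus>\<^bsub>A\<^esub> v) \<ominus>\<^bsub>A\<^esub> u \<ominus>\<^bsub>A\<^esub> v = \<zero>\<^bsub>A\<^esub>" if "u \<in> carrier A" "v \<in> carrier A" for u v
      using that A.r_neg[of "u \<oplus>\<^bsub>A\<^esub> v"] by (simp add: a_minus_def A.minus_add A.a_ac)
    have "?h r = \<zero>\<^bsub>A\<^esub>"
      using r unfolding tensor_relations_def
    proof (elim UnE CollectE exE conjE)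
      fix x x' y
      assume a: "r = frag_of (x \<oplus>\<^bsub>M\<^esub> x', y) - frag_of (x, y) - frag_of (x', y)"
        "x \<in> carrier M" "x' \<in> carrier M" "y \<in> carrier N"
      have xx: "x \<oplus>\<^bsub>M\<^esub> x' \<in> carrier M" using a by simp
      have "?h r = f (x \<oplus>\<^bsub>M\<^esub> x') y \<ominus>\<^bsub>A\<^esub> f x y \<ominus>\<^bsub>A\<^esub> f x' y"
        using a xx unfolding a(1) by (simp only: minus d fr e)
      also have "f (x \<oplus>\<^bsub>M\<^esub> x') y = f x y \<oplus>\<^bsub>A\<^esub> f x' y"
        using a f unfolding balanced_def by blast
      finally show ?thesis using a canc fc by simp
    next
      fix x y y'
      assume a: "r = frag_of (x, y \<oplus>\<^bsub>N\<^esub> y') - frag_of (x, y) - frag_of (x, y')"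
        "x \<in> carrier M" "y \<in> carrier N" "y' \<in> carrier N"
      have yy: "y \<oplus>\<^bsub>N\<^esub> y' \<in> carrier N" using a by simp
      have "?h r = f x (y \<oplus>\<^bsub>N\<^esub> y') \<ominus>\<^bsub>A\<^esub> f x y \<ominus>\<^bsub>A\<^esub> f x y'"
        using a yy unfolding a(1) by (simp only: minus d fr e)
      also have "f x (y \<oplus>\<^bsub>N\<^esub> y') = f x y \<oplus>\<^bsub>A\<^esub> f x y'"
        using a f unfolding balanced_def by blast
      finally show ?thesis using a canc fc by simp
    next
      fix x s y
      assume a: "r = frag_of (rsmult M x s, y) - frag_of (x, s \<odot>\<^bsub>N\<^esub> y)"
        "x \<in> carrier M" "s \<in> carrier S" "y \<in> carrier N"
      have c: "rsmult M x s \<in> carrier M" "s \<odot>\<^bsub>N\<^esub> y \<in> carrier N"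
        using a T by (simp_all add: tensorable_def)
      have "?h r = f (rsmult M x s) y \<ominus>\<^bsub>A\<^esub> f x (s \<odot>\<^bsub>N\<^esub> y)"
        using a c unfolding a(1) by (simp only: minus fr e)
      also have "f (rsmult M x s) y = f x (s \<odot>\<^bsub>N\<^esub> y)"
        using a f unfolding balanced_def by blast
      finally show ?thesis using a fc c by (simp add: a_minus_def A.r_neg)
    qed
    with rc show "r \<in> kernel FF (add_monoid A) ?h" by (simp add: kernel_def)
  qed
  then have ker: "RR \<subseteq> kernel FF (add_monoid A) ?h"
    using group.generate_subgroup_incl[OF group_free_Abelian_group _ h.subgroup_kernel] by blast
  have eq: "?h v = ?h w" if "v \<in> RR #>\<^bsub>FF\<^esub> w" for v
  proof -
    from that obtain r where r: "r \<in> RR" "v = r + w" by (auto simp: r_coset_def)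
    then have "r \<in> carrier FF" "?h r = \<zero>\<^bsub>A\<^esub>" using ker by (auto simp: kernel_def)
    moreover have "?h w \<in> carrier A" using h.hom_closed[OF w] by simp
    ultimately show ?thesis using h.hom_mult[of r w] w r by simp
  qed
  have ww: "w \<in> RR #>\<^bsub>FF\<^esub> w"
    using generate.one[of FF "tensor_relations S M N"] by (auto simp: r_coset_def)
  show ?thesis
    unfolding tlift_lin_ext
  proof (rule the_equality)
    show "\<forall>v\<in>RR #>\<^bsub>FF\<^esub> w. ?h w = ?h v" using eq[symmetric] by blast
    show "u = ?h w" if "\<forall>v\<in>RR #>\<^bsub>FF\<^esub> w. u = ?h v" for u using that ww by blast
  qed
qed

lemma tlift_etens0:
  assumes "abelian_group A" "balanced S M N A f" "x \<in> carrier M" "y \<in> carrier N"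
  shows "tlift A f (etens (tensor_group S M N) x y) = f x y"
  using assms unfolding etens_coset by (subst tlift_coset) (auto simp: balanced_def)

lemma tlift_closed0:
  assumes "abelian_group A" "balanced S M N A f" "t \<in> carrier (tensor_group S M N)"
  shows "tlift A f t \<in> carrier A"
proof -
  obtain w where w: "w \<in> carrier FF" "t = RR #>\<^bsub>FF\<^esub> w"
    using assms(3) unfolding carrier_tensor_group_coset by blast
  have "lin_ext A f \<in> hom FF (add_monoid A)"
    using assms by (intro lin_ext_hom) (auto simp: balanced_def)
  then show ?thesis using w assms by (auto simp: tlift_coset hom_def simp del: carrier_free_Abelian_group_iff)
qed

lemma tlift_add0:
  assumes "abelian_group A" "balanced S M N A f" "t \<in> carrier (tensor_group S M N)"
    "u \<in> carrier (tensor_group S M N)"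
  shows "tlift A f (t \<oplus>\<^bsub>tensor_group S M N\<^esub> u) = tlift A f t \<oplus>\<^bsub>A\<^esub> tlift A f u"
proof -
  obtain v w where w: "v \<in> carrier FF" "t = RR #>\<^bsub>FF\<^esub> v" "w \<in> carrier FF" "u = RR #>\<^bsub>FF\<^esub> w"
    using assms(3,4) unfolding carrier_tensor_group_coset by blast
  have h: "lin_ext A f \<in> hom FF (add_monoid A)"
    using assms by (intro lin_ext_hom) (auto simp: balanced_def)
  have "v + w \<in> carrier FF" using w(1,3) keys_add[of v w] by auto
  then show ?thesis using w assms hom_mult[OF h, of v w]
    by (simp add: tlift_coset coset_add del: carrier_free_Abelian_group_iff)
qed

text \<open>Pulled back to the free abelian group, the set of formal sums on which two homomorphisms
  agree contains the generators and is closed under differences.\<close>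

lemma tensor_ext0:
  assumes A: "abelian_group A"
    and f: "f \<in> hom (add_monoid (tensor_group S M N)) (add_monoid A)"
    and g: "g \<in> hom (add_monoid (tensor_group S M N)) (add_monoid A)"
    and eq: "\<And>x y. x \<in> carrier M \<Longrightarrow> y \<in> carrier N \<Longrightarrow>
      f (etens (tensor_group S M N) x y) = g (etens (tensor_group S M N) x y)"
    and t: "t \<in> carrier (tensor_group S M N)"
  shows "f t = g t"
proof -
  interpret A: abelian_group A by fact
  let ?T = "tensor_group S M N"
  let ?q = "\<lambda>w. RR #>\<^bsub>FF\<^esub> w"
  interpret T: abelian_group ?T by (rule tensor_group_abelian)
  have q: "?q \<in> hom FF (add_monoid ?T)"
  proof (rule homI)
    show "?q w \<in> carrier (add_monoid ?T)" if "w \<in> carrier FF" for w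
      using that unfolding partial_object.select_convs carrier_tensor_group_coset by (rule imageI)
    show "?q (v \<otimes>\<^bsub>FF\<^esub> w) = ?q v \<otimes>\<^bsub>add_monoid ?T\<^esub> ?q w"
      if "v \<in> carrier FF" "w \<in> carrier FF" for v w
      using coset_add[OF that] by simp
  qed
  have fh: "f \<circ> ?q \<in> hom FF (add_monoid A)" and gh: "g \<circ> ?q \<in> hom FF (add_monoid A)"
    using q f g by (blast intro: hom_compose)+
  obtain w where w: "w \<in> carrier FF" "t = ?q w"
    using t unfolding carrier_tensor_group_coset by blast
  have "(f \<circ> ?q) w = (g \<circ> ?q) w"
  proof (rule free_Abelian_group_induct[of w "carrier M \<times> carrier N"])
    show "Poly_Mapping.keys w \<subseteq> carrier M \<times> carrier N" using w by simp
    show "(f \<circ> ?q) 0 = (g \<circ> ?q) 0"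
      using hom_one[OF fh group_free_Abelian_group A.a_group] hom_one[OF gh group_free_Abelian_group A.a_group]
      by simp
    fix a b :: "('a \<times> 'b) \<Rightarrow>\<^sub>0 int"
    assume ab: "Poly_Mapping.keys a \<subseteq> carrier M \<times> carrier N" "Poly_Mapping.keys b \<subseteq> carrier M \<times> carrier N"
      "(f \<circ> ?q) a = (g \<circ> ?q) a" "(f \<circ> ?q) b = (g \<circ> ?q) b"
    then show "(f \<circ> ?q) (a - b) = (g \<circ> ?q) (a - b)"
      using hom_free_Abelian_group_diff[OF A fh, of a b] hom_free_Abelian_group_diff[OF A gh, of a b]
      by simp
  next
    fix p assume "p \<in> carrier M \<times> carrier N"
    then show "(f \<circ> ?q) (frag_of p) = (g \<circ> ?q) (frag_of p)"
      using eq unfolding etens_coset by (cases p) simp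
  qed
  with w show ?thesis by simp
qed

end

text \<open>Only the two inner actions occur in the relations, and only on the carriers. The groups
  come out equal, not merely isomorphic, so that terms over differently built records can be
  rewritten into each other.\<close>

lemma tensor_group_cong:
  assumes "carrier M = carrier M'" "carrier N = carrier N'" "add M = add M'" "add N = add N'"
    and "\<And>x s. x \<in> carrier M \<Longrightarrow> s \<in> carrier S \<Longrightarrow> rsmult M x s = rsmult M' x s"
    and "\<And>y s. y \<in> carrier N \<Longrightarrow> s \<in> carrier S \<Longrightarrow> s \<odot>\<^bsub>N\<^esub> y = s \<odot>\<^bsub>N'\<^esub> y"
  shows "tensor_group S M N = tensor_group S M' N'"
proof -
  have "{frag_of (rsmult M x s, y) - frag_of (x, s \<odot>\<^bsub>N\<^esub> y) | x s y.
        x \<in> carrier M \<and> s \<in> carrier S \<and> y \<in> carrier N} =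
      {frag_of (rsmult M' x s, y) - frag_of (x, s \<odot>\<^bsub>N'\<^esub> y) | x s y.
        x \<in> carrier M' \<and> s \<in> carrier S \<and> y \<in> carrier N'}"
    by (intro Collect_cong ex_cong1) (use assms in auto)
  then have "tensor_relations S M N = tensor_relations S M' N'"
    unfolding tensor_relations_def by (simp only: assms(1-4))
  then show ?thesis unfolding tensor_group_def using assms by simp
qed

section \<open>Additive maps, and the universal property in terms of them\<close>

definition additive ::
  "('a, 'x) ring_scheme \<Rightarrow> ('b, 'y) ring_scheme \<Rightarrow> ('a \<Rightarrow> 'b) \<Rightarrow> bool" where
  "additive A B f \<longleftrightarrow> abelian_group A \<and> abelian_group B \<and> (\<forall>x\<in>carrier A. f x \<in> carrier B) \<and>
     (\<forall>x\<in>carrier A. \<forall>y\<in>carrier A. f (x \<oplus>\<^bsub>A\<^esub> y) = f x \<oplus>\<^bsub>B\<^esub> f y)"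

lemma additive_closed: "additive A B f \<Longrightarrow> x \<in> carrier A \<Longrightarrow> f x \<in> carrier B"
  by (simp add: additive_def)

lemma additive_add: "additive A B f \<Longrightarrow> x \<in> carrier A \<Longrightarrow> y \<in> carrier A \<Longrightarrow> f (x \<oplus>\<^bsub>A\<^esub> y) = f x \<oplus>\<^bsub>B\<^esub> f y"
  by (simp add: additive_def)

lemma additive_id: "abelian_group A \<Longrightarrow> additive A A (\<lambda>x. x)"
  by (simp add: additive_def)

lemma additive_comp: "additive B D g \<Longrightarrow> additive A B f \<Longrightarrow> additive A D (\<lambda>x. g (f x))"
  by (simp add: additive_def)

lemma additive_sum:
  assumes "additive A B f" "additive A B g"
  shows "additive A B (\<lambda>x. f x \<oplus>\<^bsub>B\<^esub> g x)"
proof -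
  interpret B: abelian_group B using assms(1) by (simp add: additive_def)
  show ?thesis using assms by (simp add: additive_def B.a_ac)
qed

lemma abelian_group_cong:
  assumes "abelian_group A" "carrier A = carrier B" "add A = add B" "zero A = zero B"
  shows "abelian_group B"
proof -
  interpret A: abelian_group A by fact
  show ?thesis
  proof (rule abelian_groupI)
    fix x assume "x \<in> carrier B"
    then have "\<ominus>\<^bsub>A\<^esub> x \<in> carrier B" "\<ominus>\<^bsub>A\<^esub> x \<oplus>\<^bsub>B\<^esub> x = \<zero>\<^bsub>B\<^esub>"
      using assms(2-4)[symmetric] by (simp_all add: A.l_neg)
    then show "\<exists>y\<in>carrier B. y \<oplus>\<^bsub>B\<^esub> x = \<zero>\<^bsub>B\<^esub>" by blast
  qed (use assms(2-4)[symmetric] in \<open>simp_all add: A.a_ac\<close>)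
qed

lemma additive_hom:
  assumes "additive A B f" shows "f \<in> hom (add_monoid A) (add_monoid B)"
  using assms by (auto simp: additive_def hom_def)

lemma additive_cong_ring:
  assumes "carrier A = carrier A'" "add A = add A'" "zero A = zero A'"
    "carrier B = carrier B'" "add B = add B'" "zero B = zero B'"
  shows "additive A B f = additive A' B' f"
proof -
  have "abelian_group A = abelian_group A'"
    using abelian_group_cong[of A A'] abelian_group_cong[of A' A] assms by auto
  moreover have "abelian_group B = abelian_group B'"
    using abelian_group_cong[of B B'] abelian_group_cong[of B' B] assms by auto
  ultimately show ?thesis using assms by (simp add: additive_def)
qed

lemma additive_cong:
  assumes "additive A B f" "\<And>x. x \<in> carrier A \<Longrightarrow> f x = g x"
  shows "additive A B g"
proof -
  interpret A: abelian_group A using assms(1) by (simp add: additive_def)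
  show ?thesis using assms(1) unfolding additive_def by (simp add: assms(2)[symmetric])
qed

lemma tensor_abelian: "tensorable S M N \<Longrightarrow> abelian_group (M \<boxtimes>\<^bsub>S\<^esub> N)"
  by (rule abelian_group_cong[OF tensor_group_abelian]) simp_all

lemma balanced_etens: "tensorable S M N \<Longrightarrow> balanced S M N (M \<boxtimes>\<^bsub>S\<^esub> N) (etens (M \<boxtimes>\<^bsub>S\<^esub> N))"
  using balanced_etens0[of S M N] by (simp add: balanced_def tensor_record_ops)

lemma additive_tlift:
  assumes "tensorable S M N" "abelian_group A" "balanced S M N A f"
  shows "additive (M \<boxtimes>\<^bsub>S\<^esub> N) A (tlift A f)"
  using assms by (simp add: additive_def tensor_abelian tlift_add0 tlift_closed0)

lemma tlift_etens_gen:
  assumes "tensorable S M N" "abelian_group A" "balanced S M N A f" "x \<in> carrier M" "y \<in> carrier N"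
  shows "tlift A f (etens (M \<boxtimes>\<^bsub>S\<^esub> N) x y) = f x y"
  using assms by (simp add: tensor_record_ops tlift_etens0)

lemma tensor_ext_gen:
  assumes "tensorable S M N" "additive (M \<boxtimes>\<^bsub>S\<^esub> N) A f" "additive (M \<boxtimes>\<^bsub>S\<^esub> N) A g"
    "\<And>x y. x \<in> carrier M \<Longrightarrow> y \<in> carrier N \<Longrightarrow>
      f (etens (M \<boxtimes>\<^bsub>S\<^esub> N) x y) = g (etens (M \<boxtimes>\<^bsub>S\<^esub> N) x y)"
    "t \<in> carrier (M \<boxtimes>\<^bsub>S\<^esub> N)"
  shows "f t = g t"
proof (rule tensor_ext0[OF assms(1), of A])
  show "abelian_group A" using assms(2) by (simp add: additive_def)
  have "additive (tensor_group S M N) A f" "additive (tensor_group S M N) A g"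
    using assms(2,3) by (simp_all cong: additive_cong_ring)
  then show "f \<in> hom (add_monoid (tensor_group S M N)) (add_monoid A)"
    "g \<in> hom (add_monoid (tensor_group S M N)) (add_monoid A)"
    by (simp_all only: additive_hom)
qed (use assms(4,5) in \<open>simp_all add: tensor_record_ops\<close>)

lemma balancedI:
  assumes "\<And>y. y \<in> carrier N \<Longrightarrow> additive M A (\<lambda>x. f x y)"
    "\<And>x. x \<in> carrier M \<Longrightarrow> additive N A (\<lambda>y. f x y)"
    "\<And>x s y. x \<in> carrier M \<Longrightarrow> s \<in> carrier S \<Longrightarrow> y \<in> carrier N \<Longrightarrow>
      f (rsmult M x s) y = f x (s \<odot>\<^bsub>N\<^esub> y)"
  shows "balanced S M N A f"
  using assms unfolding balanced_def by (simp add: additive_def)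

lemma balanced_additive:
  assumes "tensorable S M N" "abelian_group A" "balanced S M N A f"
  shows "y \<in> carrier N \<Longrightarrow> additive M A (\<lambda>x. f x y)"
    "x \<in> carrier M \<Longrightarrow> additive N A (\<lambda>y. f x y)"
  using assms by (simp_all add: balanced_def additive_def tensorable_def)

subsection \<open>Bimodules\<close>

lemma bimodule_tensorable:
  assumes "is_bimodule R S M" "is_bimodule S T N" shows "tensorable S M N"
proof -
  have m: "module R M" "module S (right_module M)" "module S N"
    using assms by (simp_all add: is_bimodule_def)
  show ?thesis
    using module.smult_closed[OF m(2)] module.smult_closed[OF m(3)] m
    by (simp add: tensorable_def right_module_def module_def)
qed

lemma is_bimodule_laws:
  assumes "is_bimodule R S M"
  shows "cring R" "cring S" "abelian_group M"
    "r \<in> carrier R \<Longrightarrow> x \<in> carrier M \<Longrightarrow> r \<odot>\<^bsub>M\<^esub> x \<in> carrier M"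
    "s \<in> carrier S \<Longrightarrow> x \<in> carrier M \<Longrightarrow> rsmult M x s \<in> carrier M"
    "r \<in> carrier R \<Longrightarrow> additive M M (\<lambda>x. r \<odot>\<^bsub>M\<^esub> x)"
    "s \<in> carrier S \<Longrightarrow> additive M M (\<lambda>x. rsmult M x s)"
    "r \<in> carrier R \<Longrightarrow> r' \<in> carrier R \<Longrightarrow> x \<in> carrier M \<Longrightarrow>
      (r \<oplus>\<^bsub>R\<^esub> r') \<odot>\<^bsub>M\<^esub> x = r \<odot>\<^bsub>M\<^esub> x \<oplus>\<^bsub>M\<^esub> r' \<odot>\<^bsub>M\<^esub> x"
    "s \<in> carrier S \<Longrightarrow> s' \<in> carrier S \<Longrightarrow> x \<in> carrier M \<Longrightarrow>
      rsmult M x (s \<oplus>\<^bsub>S\<^esub> s') = rsmult M x s \<oplus>\<^bsub>M\<^esub> rsmult M x s'"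
    "r \<in> carrier R \<Longrightarrow> r' \<in> carrier R \<Longrightarrow> x \<in> carrier M \<Longrightarrow>
      (r \<otimes>\<^bsub>R\<^esub> r') \<odot>\<^bsub>M\<^esub> x = r \<odot>\<^bsub>M\<^esub> (r' \<odot>\<^bsub>M\<^esub> x)"
    "s \<in> carrier S \<Longrightarrow> s' \<in> carrier S \<Longrightarrow> x \<in> carrier M \<Longrightarrow>
      rsmult M x (s \<otimes>\<^bsub>S\<^esub> s') = rsmult M (rsmult M x s') s"
    "x \<in> carrier M \<Longrightarrow> \<one>\<^bsub>R\<^esub> \<odot>\<^bsub>M\<^esub> x = x"
    "x \<in> carrier M \<Longrightarrow> rsmult M x \<one>\<^bsub>S\<^esub> = x"
    "r \<in> carrier R \<Longrightarrow> s \<in> carrier S \<Longrightarrow> x \<in> carrier M \<Longrightarrow>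
      r \<odot>\<^bsub>M\<^esub> (rsmult M x s) = rsmult M (r \<odot>\<^bsub>M\<^esub> x) s"
proof -
  interpret L: module R M using assms by (simp add: is_bimodule_def)
  interpret R: module S "right_module M" using assms by (simp add: is_bimodule_def)
  show "cring R" "cring S" "abelian_group M" by unfold_locales
  show "r \<in> carrier R \<Longrightarrow> x \<in> carrier M \<Longrightarrow> r \<odot>\<^bsub>M\<^esub> x \<in> carrier M" by simp
  show "s \<in> carrier S \<Longrightarrow> x \<in> carrier M \<Longrightarrow> rsmult M x s \<in> carrier M"
    using R.smult_closed[of s x] by (simp add: right_module_def)
  show "r \<in> carrier R \<Longrightarrow> additive M M (\<lambda>x. r \<odot>\<^bsub>M\<^esub> x)"
    using L.abelian_group_axioms by (simp add: additive_def L.smult_r_distr)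
  show "s \<in> carrier S \<Longrightarrow> additive M M (\<lambda>x. rsmult M x s)"
    using R.smult_closed[of s] R.smult_r_distr[of s] L.abelian_group_axioms
    by (simp add: additive_def right_module_def)
  show "r \<in> carrier R \<Longrightarrow> r' \<in> carrier R \<Longrightarrow> x \<in> carrier M \<Longrightarrow>
      (r \<oplus>\<^bsub>R\<^esub> r') \<odot>\<^bsub>M\<^esub> x = r \<odot>\<^bsub>M\<^esub> x \<oplus>\<^bsub>M\<^esub> r' \<odot>\<^bsub>M\<^esub> x"
    by (rule L.smult_l_distr)
  show "s \<in> carrier S \<Longrightarrow> s' \<in> carrier S \<Longrightarrow> x \<in> carrier M \<Longrightarrow>
      rsmult M x (s \<oplus>\<^bsub>S\<^esub> s') = rsmult M x s \<oplus>\<^bsub>M\<^esub> rsmult M x s'"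
    using R.smult_l_distr[of s s' x] by (simp add: right_module_def)
  show "r \<in> carrier R \<Longrightarrow> r' \<in> carrier R \<Longrightarrow> x \<in> carrier M \<Longrightarrow>
      (r \<otimes>\<^bsub>R\<^esub> r') \<odot>\<^bsub>M\<^esub> x = r \<odot>\<^bsub>M\<^esub> (r' \<odot>\<^bsub>M\<^esub> x)"
    by (rule L.smult_assoc1)
  show "s \<in> carrier S \<Longrightarrow> s' \<in> carrier S \<Longrightarrow> x \<in> carrier M \<Longrightarrow>
      rsmult M x (s \<otimes>\<^bsub>S\<^esub> s') = rsmult M (rsmult M x s') s"
    using R.smult_assoc1[of s s' x] by (simp add: right_module_def)
  show "x \<in> carrier M \<Longrightarrow> \<one>\<^bsub>R\<^esub> \<odot>\<^bsub>M\<^esub> x = x" by simp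
  show "x \<in> carrier M \<Longrightarrow> rsmult M x \<one>\<^bsub>S\<^esub> = x"
    using R.smult_one[of x] by (simp add: right_module_def)
  show "r \<in> carrier R \<Longrightarrow> s \<in> carrier S \<Longrightarrow> x \<in> carrier M \<Longrightarrow>
      r \<odot>\<^bsub>M\<^esub> (rsmult M x s) = rsmult M (r \<odot>\<^bsub>M\<^esub> x) s"
    using assms by (simp add: is_bimodule_def)
qed

lemma is_bimoduleI:
  assumes "cring R" "cring S" "abelian_group M"
    "\<And>r. r \<in> carrier R \<Longrightarrow> additive M M (\<lambda>x. r \<odot>\<^bsub>M\<^esub> x)"
    "\<And>s. s \<in> carrier S \<Longrightarrow> additive M M (\<lambda>x. rsmult M x s)"
    "\<And>r r' x. r \<in> carrier R \<Longrightarrow> r' \<in> carrier R \<Longrightarrow> x \<in> carrier M \<Longrightarrow>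
      (r \<oplus>\<^bsub>R\<^esub> r') \<odot>\<^bsub>M\<^esub> x = r \<odot>\<^bsub>M\<^esub> x \<oplus>\<^bsub>M\<^esub> r' \<odot>\<^bsub>M\<^esub> x"
    "\<And>s s' x. s \<in> carrier S \<Longrightarrow> s' \<in> carrier S \<Longrightarrow> x \<in> carrier M \<Longrightarrow>
      rsmult M x (s \<oplus>\<^bsub>S\<^esub> s') = rsmult M x s \<oplus>\<^bsub>M\<^esub> rsmult M x s'"
    "\<And>r r' x. r \<in> carrier R \<Longrightarrow> r' \<in> carrier R \<Longrightarrow> x \<in> carrier M \<Longrightarrow>
      (r \<otimes>\<^bsub>R\<^esub> r') \<odot>\<^bsub>M\<^esub> x = r \<odot>\<^bsub>M\<^esub> (r' \<odot>\<^bsub>M\<^esub> x)"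
    "\<And>s s' x. s \<in> carrier S \<Longrightarrow> s' \<in> carrier S \<Longrightarrow> x \<in> carrier M \<Longrightarrow>
      rsmult M x (s \<otimes>\<^bsub>S\<^esub> s') = rsmult M (rsmult M x s') s"
    "\<And>x. x \<in> carrier M \<Longrightarrow> \<one>\<^bsub>R\<^esub> \<odot>\<^bsub>M\<^esub> x = x"
    "\<And>x. x \<in> carrier M \<Longrightarrow> rsmult M x \<one>\<^bsub>S\<^esub> = x"
    "\<And>r s x. r \<in> carrier R \<Longrightarrow> s \<in> carrier S \<Longrightarrow> x \<in> carrier M \<Longrightarrow>
      r \<odot>\<^bsub>M\<^esub> (rsmult M x s) = rsmult M (r \<odot>\<^bsub>M\<^esub> x) s"
  shows "is_bimodule R S M"
  unfolding is_bimodule_def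
proof (intro conjI ballI)
  show "module R M"
    by (rule moduleI) (use assms(1,3,6,8,10) additive_add[OF assms(4)] additive_closed[OF assms(4)] in simp_all)
  have "abelian_group (right_module M)"
    by (rule abelian_group_cong[OF assms(3)]) (simp_all add: right_module_def)
  then show "module S (right_module M)"
    by (intro moduleI)
      (use assms(2,7,9,11) additive_add[OF assms(5)] additive_closed[OF assms(5)] in
        \<open>simp_all add: right_module_def\<close>)
qed (rule assms(12))

lemma additive_tmap:
  assumes M: "is_bimodule R S M" and N: "is_bimodule S T N"
    and M': "is_bimodule R' S M'" and N': "is_bimodule S T' N'"
    and f: "additive M M' f" "\<And>x s. x \<in> carrier M \<Longrightarrow> s \<in> carrier S \<Longrightarrow> f (rsmult M x s) = rsmult M' (f x) s"
    and g: "additive N N' g" "\<And>y s. y \<in> carrier N \<Longrightarrow> s \<in> carrier S \<Longrightarrow> g (s \<odot>\<^bsub>N\<^esub> y) = s \<odot>\<^bsub>N'\<^esub> g y"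
  shows "additive (M \<boxtimes>\<^bsub>S\<^esub> N) (M' \<boxtimes>\<^bsub>S\<^esub> N') (tmap (M' \<boxtimes>\<^bsub>S\<^esub> N') f g)" (is ?A)
    and "x \<in> carrier M \<Longrightarrow> y \<in> carrier N \<Longrightarrow>
      tmap (M' \<boxtimes>\<^bsub>S\<^esub> N') f g (etens (M \<boxtimes>\<^bsub>S\<^esub> N) x y) = etens (M' \<boxtimes>\<^bsub>S\<^esub> N') (f x) (g y)"
proof -
  note T = bimodule_tensorable[OF M N] and T' = bimodule_tensorable[OF M' N']
  note ab = tensor_abelian[OF T']
  note b = balanced_additive[OF T' ab balanced_etens[OF T']]
  have "balanced S M N (M' \<boxtimes>\<^bsub>S\<^esub> N') (\<lambda>x y. etens (M' \<boxtimes>\<^bsub>S\<^esub> N') (f x) (g y))"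
  proof (rule balancedI)
    show "additive M (M' \<boxtimes>\<^bsub>S\<^esub> N') (\<lambda>x. etens (M' \<boxtimes>\<^bsub>S\<^esub> N') (f x) (g y))" if "y \<in> carrier N" for y
      using additive_comp[OF b(1) f(1)] additive_closed[OF g(1) that] by blast
    show "additive N (M' \<boxtimes>\<^bsub>S\<^esub> N') (\<lambda>y. etens (M' \<boxtimes>\<^bsub>S\<^esub> N') (f x) (g y))" if "x \<in> carrier M" for x
      using additive_comp[OF b(2) g(1)] additive_closed[OF f(1) that] by blast
    show "etens (M' \<boxtimes>\<^bsub>S\<^esub> N') (f (rsmult M x s)) (g y) = etens (M' \<boxtimes>\<^bsub>S\<^esub> N') (f x) (g (s \<odot>\<^bsub>N\<^esub> y))"
      if "x \<in> carrier M" "s \<in> carrier S" "y \<in> carrier N" for x s y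
    proof -
      have "\<forall>x\<in>carrier M'. \<forall>s\<in>carrier S. \<forall>y\<in>carrier N'.
          etens (M' \<boxtimes>\<^bsub>S\<^esub> N') (rsmult M' x s) y = etens (M' \<boxtimes>\<^bsub>S\<^esub> N') x (s \<odot>\<^bsub>N'\<^esub> y)"
        using balanced_etens[OF T'] unfolding balanced_def by blast
      then show ?thesis
        using that f(2) g(2) additive_closed[OF f(1)] additive_closed[OF g(1)] by simp
    qed
  qed
  then show ?A and "x \<in> carrier M \<Longrightarrow> y \<in> carrier N \<Longrightarrow>
      tmap (M' \<boxtimes>\<^bsub>S\<^esub> N') f g (etens (M \<boxtimes>\<^bsub>S\<^esub> N) x y) = etens (M' \<boxtimes>\<^bsub>S\<^esub> N') (f x) (g y)"
    unfolding tmap_def by (simp_all only: additive_tlift[OF T ab] tlift_etens_gen[OF T ab])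
qed

lemma etens_rules:
  assumes "is_bimodule R S M" "is_bimodule S T N"
  shows "x \<in> carrier M \<Longrightarrow> y \<in> carrier N \<Longrightarrow> etens (M \<boxtimes>\<^bsub>S\<^esub> N) x y \<in> carrier (M \<boxtimes>\<^bsub>S\<^esub> N)"
    "y \<in> carrier N \<Longrightarrow> additive M (M \<boxtimes>\<^bsub>S\<^esub> N) (\<lambda>x. etens (M \<boxtimes>\<^bsub>S\<^esub> N) x y)"
    "x \<in> carrier M \<Longrightarrow> additive N (M \<boxtimes>\<^bsub>S\<^esub> N) (\<lambda>y. etens (M \<boxtimes>\<^bsub>S\<^esub> N) x y)"
    "x \<in> carrier M \<Longrightarrow> s \<in> carrier S \<Longrightarrow> y \<in> carrier N \<Longrightarrow>
      etens (M \<boxtimes>\<^bsub>S\<^esub> N) (rsmult M x s) y = etens (M \<boxtimes>\<^bsub>S\<^esub> N) x (s \<odot>\<^bsub>N\<^esub> y)"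
proof -
  note T = bimodule_tensorable[OF assms]
  note b = balanced_additive[OF T tensor_abelian[OF T] balanced_etens[OF T]]
  show "x \<in> carrier M \<Longrightarrow> y \<in> carrier N \<Longrightarrow> etens (M \<boxtimes>\<^bsub>S\<^esub> N) x y \<in> carrier (M \<boxtimes>\<^bsub>S\<^esub> N)"
    using additive_closed[OF b(1)] .
  show "y \<in> carrier N \<Longrightarrow> additive M (M \<boxtimes>\<^bsub>S\<^esub> N) (\<lambda>x. etens (M \<boxtimes>\<^bsub>S\<^esub> N) x y)" by (rule b)
  show "x \<in> carrier M \<Longrightarrow> additive N (M \<boxtimes>\<^bsub>S\<^esub> N) (\<lambda>y. etens (M \<boxtimes>\<^bsub>S\<^esub> N) x y)" by (rule b)
  show "x \<in> carrier M \<Longrightarrow> s \<in> carrier S \<Longrightarrow> y \<in> carrier N \<Longrightarrow>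
      etens (M \<boxtimes>\<^bsub>S\<^esub> N) (rsmult M x s) y = etens (M \<boxtimes>\<^bsub>S\<^esub> N) x (s \<odot>\<^bsub>N\<^esub> y)"
    using balanced_etens[OF T] unfolding balanced_def by blast
qed

text \<open>All actions are of the form f \<otimes> g, hence additive, and each bimodule law is an
  equation between additive maps that holds on elementary tensors.\<close>

lemma tensor_bimodule:
  assumes M: "is_bimodule R S M" and N: "is_bimodule S T N"
  shows "is_bimodule R T (M \<boxtimes>\<^bsub>S\<^esub> N)"
    and "r \<in> carrier R \<Longrightarrow> x \<in> carrier M \<Longrightarrow> y \<in> carrier N \<Longrightarrow>
      r \<odot>\<^bsub>M \<boxtimes>\<^bsub>S\<^esub> N\<^esub> etens (M \<boxtimes>\<^bsub>S\<^esub> N) x y = etens (M \<boxtimes>\<^bsub>S\<^esub> N) (r \<odot>\<^bsub>M\<^esub> x) y"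
    and "s \<in> carrier T \<Longrightarrow> x \<in> carrier M \<Longrightarrow> y \<in> carrier N \<Longrightarrow>
      rsmult (M \<boxtimes>\<^bsub>S\<^esub> N) (etens (M \<boxtimes>\<^bsub>S\<^esub> N) x y) s = etens (M \<boxtimes>\<^bsub>S\<^esub> N) x (rsmult N y s)"
proof -
  note lM = is_bimodule_laws[OF M] and lN = is_bimodule_laws[OF N]
  note T = bimodule_tensorable[OF M N]
  note ab = tensor_abelian[OF T]
  note e = etens_rules[OF M N]
  note ext = tensor_ext_gen[OF T, where A = "M \<boxtimes>\<^bsub>S\<^esub> N"]
  have l: "additive (M \<boxtimes>\<^bsub>S\<^esub> N) (M \<boxtimes>\<^bsub>S\<^esub> N) (\<lambda>t. r \<odot>\<^bsub>M \<boxtimes>\<^bsub>S\<^esub> N\<^esub> t)" if "r \<in> carrier R" for r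
    unfolding tensor_smult
    by (rule additive_tmap[OF M N M N]) (use that lM lN in \<open>simp_all add: additive_id\<close>)
  have r: "additive (M \<boxtimes>\<^bsub>S\<^esub> N) (M \<boxtimes>\<^bsub>S\<^esub> N) (\<lambda>t. rsmult (M \<boxtimes>\<^bsub>S\<^esub> N) t s)" if "s \<in> carrier T" for s
    unfolding tensor_smult
    by (rule additive_tmap[OF M N M N]) (use that lM lN in \<open>simp_all add: additive_id\<close>)
  have le: "r \<odot>\<^bsub>M \<boxtimes>\<^bsub>S\<^esub> N\<^esub> etens (M \<boxtimes>\<^bsub>S\<^esub> N) x y = etens (M \<boxtimes>\<^bsub>S\<^esub> N) (r \<odot>\<^bsub>M\<^esub> x) y"
    if "r \<in> carrier R" "x \<in> carrier M" "y \<in> carrier N" for r x y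
    unfolding tensor_smult
    by (rule additive_tmap(2)[OF M N M N]) (use that lM lN in \<open>simp_all add: additive_id\<close>)
  have re: "rsmult (M \<boxtimes>\<^bsub>S\<^esub> N) (etens (M \<boxtimes>\<^bsub>S\<^esub> N) x y) s = etens (M \<boxtimes>\<^bsub>S\<^esub> N) x (rsmult N y s)"
    if "s \<in> carrier T" "x \<in> carrier M" "y \<in> carrier N" for s x y
    unfolding tensor_smult
    by (rule additive_tmap(2)[OF M N M N]) (use that lM lN in \<open>simp_all add: additive_id\<close>)
  show "r \<in> carrier R \<Longrightarrow> x \<in> carrier M \<Longrightarrow> y \<in> carrier N \<Longrightarrow>
      r \<odot>\<^bsub>M \<boxtimes>\<^bsub>S\<^esub> N\<^esub> etens (M \<boxtimes>\<^bsub>S\<^esub> N) x y = etens (M \<boxtimes>\<^bsub>S\<^esub> N) (r \<odot>\<^bsub>M\<^esub> x) y" by (rule le)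
  show "s \<in> carrier T \<Longrightarrow> x \<in> carrier M \<Longrightarrow> y \<in> carrier N \<Longrightarrow>
      rsmult (M \<boxtimes>\<^bsub>S\<^esub> N) (etens (M \<boxtimes>\<^bsub>S\<^esub> N) x y) s = etens (M \<boxtimes>\<^bsub>S\<^esub> N) x (rsmult N y s)" by (rule re)
  interpret R: cring R by (rule lM)
  interpret T: cring T by (rule lN)
  show "is_bimodule R T (M \<boxtimes>\<^bsub>S\<^esub> N)"
  proof (rule is_bimoduleI)
    fix r r' t assume a: "r \<in> carrier R" "r' \<in> carrier R" and t: "t \<in> carrier (M \<boxtimes>\<^bsub>S\<^esub> N)"
    show "(r \<oplus>\<^bsub>R\<^esub> r') \<odot>\<^bsub>M \<boxtimes>\<^bsub>S\<^esub> N\<^esub> t = r \<odot>\<^bsub>M \<boxtimes>\<^bsub>S\<^esub> N\<^esub> t \<oplus>\<^bsub>M \<boxtimes>\<^bsub>S\<^esub> N\<^esub> r' \<odot>\<^bsub>M \<boxtimes>\<^bsub>S\<^esub> N\<^esub> t"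
      using l[of "r \<oplus>\<^bsub>R\<^esub> r'"] additive_sum[OF l[of r] l[of r']] _ t
      by (rule ext) (use a in \<open>simp_all only: le lM additive_add[OF e(2)] R.a_closed\<close>)
    show "(r \<otimes>\<^bsub>R\<^esub> r') \<odot>\<^bsub>M \<boxtimes>\<^bsub>S\<^esub> N\<^esub> t = r \<odot>\<^bsub>M \<boxtimes>\<^bsub>S\<^esub> N\<^esub> (r' \<odot>\<^bsub>M \<boxtimes>\<^bsub>S\<^esub> N\<^esub> t)"
      using l[of "r \<otimes>\<^bsub>R\<^esub> r'"] additive_comp[OF l[of r] l[of r']] _ t
      by (rule ext) (use a in \<open>simp_all only: le lM R.m_closed\<close>)
  next
    fix s s' t assume a: "s \<in> carrier T" "s' \<in> carrier T" and t: "t \<in> carrier (M \<boxtimes>\<^bsub>S\<^esub> N)"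
    show "rsmult (M \<boxtimes>\<^bsub>S\<^esub> N) t (s \<oplus>\<^bsub>T\<^esub> s') =
        rsmult (M \<boxtimes>\<^bsub>S\<^esub> N) t s \<oplus>\<^bsub>M \<boxtimes>\<^bsub>S\<^esub> N\<^esub> rsmult (M \<boxtimes>\<^bsub>S\<^esub> N) t s'"
      using r[of "s \<oplus>\<^bsub>T\<^esub> s'"] additive_sum[OF r[of s] r[of s']] _ t
      by (rule ext) (use a in \<open>simp_all only: re lN additive_add[OF e(3)] T.a_closed\<close>)
    show "rsmult (M \<boxtimes>\<^bsub>S\<^esub> N) t (s \<otimes>\<^bsub>T\<^esub> s') = rsmult (M \<boxtimes>\<^bsub>S\<^esub> N) (rsmult (M \<boxtimes>\<^bsub>S\<^esub> N) t s') s"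
      using r[of "s \<otimes>\<^bsub>T\<^esub> s'"] additive_comp[OF r[of s] r[of s']] _ t
      by (rule ext) (use a in \<open>simp_all only: re lN T.m_closed\<close>)
  next
    fix q s t assume a: "q \<in> carrier R" "s \<in> carrier T" and t: "t \<in> carrier (M \<boxtimes>\<^bsub>S\<^esub> N)"
    show "q \<odot>\<^bsub>M \<boxtimes>\<^bsub>S\<^esub> N\<^esub> rsmult (M \<boxtimes>\<^bsub>S\<^esub> N) t s = rsmult (M \<boxtimes>\<^bsub>S\<^esub> N) (q \<odot>\<^bsub>M \<boxtimes>\<^bsub>S\<^esub> N\<^esub> t) s"
      using additive_comp[OF l[of q] r[of s]] additive_comp[OF r[of s] l[of q]] _ t
      by (rule ext) (use a in \<open>simp_all only: re le lN lM\<close>)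
  next
    fix t assume t: "t \<in> carrier (M \<boxtimes>\<^bsub>S\<^esub> N)"
    show "\<one>\<^bsub>R\<^esub> \<odot>\<^bsub>M \<boxtimes>\<^bsub>S\<^esub> N\<^esub> t = t"
      using l[of "\<one>\<^bsub>R\<^esub>"] additive_id[OF ab] _ t
      by (rule ext) (simp_all only: le lM R.one_closed)
    show "rsmult (M \<boxtimes>\<^bsub>S\<^esub> N) t \<one>\<^bsub>T\<^esub> = t"
      using r[of "\<one>\<^bsub>T\<^esub>"] additive_id[OF ab] _ t
      by (rule ext) (simp_all only: re lN T.one_closed)
  qed (fact lM lN ab l r)+
qed

subsection \<open>Linear and bilinear maps over the base ring\<close>

text \<open>A module over the commutative ring \<open>k\<close>, kept in the form of a bimodule so
  that \<open>tensor\<close> applies to it on either side.\<close>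

definition kmod :: "('k, 'x) ring_scheme \<Rightarrow> ('k, 'k, 'a, 'z) bimodule_scheme \<Rightarrow> bool" where
  "kmod k M \<longleftrightarrow> is_bimodule k k M \<and> (\<forall>a\<in>carrier k. \<forall>x\<in>carrier M. rsmult M x a = a \<odot>\<^bsub>M\<^esub> x)"

text \<open>The \<open>kmod\<close> conditions on both ends are included so that rules about
  composites carry no side conditions on the modules.\<close>

definition klin :: "('k, 'x) ring_scheme \<Rightarrow> ('k, 'k, 'a, 'z) bimodule_scheme \<Rightarrow>
    ('k, 'k, 'b, 'w) bimodule_scheme \<Rightarrow> ('a \<Rightarrow> 'b) \<Rightarrow> bool" where
  "klin k M N f \<longleftrightarrow> kmod k M \<and> kmod k N \<and> additive M N f \<and>
     (\<forall>a\<in>carrier k. \<forall>x\<in>carrier M. f (a \<odot>\<^bsub>M\<^esub> x) = a \<odot>\<^bsub>N\<^esub> f x)"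

definition kbil :: "('k, 'x) ring_scheme \<Rightarrow> ('k, 'k, 'a, 'z) bimodule_scheme \<Rightarrow>
    ('k, 'k, 'b, 'w) bimodule_scheme \<Rightarrow> ('k, 'k, 'c, 'v) bimodule_scheme \<Rightarrow> ('a \<Rightarrow> 'b \<Rightarrow> 'c) \<Rightarrow> bool" where
  "kbil k M N A f \<longleftrightarrow> kmod k M \<and> kmod k N \<and>
     (\<forall>y\<in>carrier N. klin k M A (\<lambda>x. f x y)) \<and> (\<forall>x\<in>carrier M. klin k N A (\<lambda>y. f x y))"

text \<open>The closure rules collected in \<open>kl\<close> follow the syntax of an expression:
  linearity in a chosen variable of a nested Sweedler sum is reduced to the variable itself. This
  settles the linearity condition that accompanies almost every step below.\<close>

named_theorems kl

lemma kmod_laws: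
  assumes "kmod k M"
  shows "cring k" "abelian_group M" "is_bimodule k k M"
    "a \<in> carrier k \<Longrightarrow> x \<in> carrier M \<Longrightarrow> a \<odot>\<^bsub>M\<^esub> x \<in> carrier M"
    "a \<in> carrier k \<Longrightarrow> x \<in> carrier M \<Longrightarrow> rsmult M x a = a \<odot>\<^bsub>M\<^esub> x"
    "a \<in> carrier k \<Longrightarrow> b \<in> carrier k \<Longrightarrow> x \<in> carrier M \<Longrightarrow>
      (a \<otimes>\<^bsub>k\<^esub> b) \<odot>\<^bsub>M\<^esub> x = a \<odot>\<^bsub>M\<^esub> (b \<odot>\<^bsub>M\<^esub> x)"
    "a \<in> carrier k \<Longrightarrow> b \<in> carrier k \<Longrightarrow> x \<in> carrier M \<Longrightarrow>
      (a \<oplus>\<^bsub>k\<^esub> b) \<odot>\<^bsub>M\<^esub> x = a \<odot>\<^bsub>M\<^esub> x \<oplus>\<^bsub>M\<^esub> b \<odot>\<^bsub>M\<^esub> x"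
    "a \<in> carrier k \<Longrightarrow> additive M M (\<lambda>x. a \<odot>\<^bsub>M\<^esub> x)"
    "x \<in> carrier M \<Longrightarrow> \<one>\<^bsub>k\<^esub> \<odot>\<^bsub>M\<^esub> x = x"
    "\<zero>\<^bsub>M\<^esub> \<in> carrier M"
  using assms is_bimodule_laws[of k k M] abelian_group.axioms(1)[of M] abelian_monoid.zero_closed[of M]
  by (simp_all add: kmod_def)

lemma klin_laws:
  assumes "klin k M N f"
  shows "kmod k M" "kmod k N" "additive M N f" "x \<in> carrier M \<Longrightarrow> f x \<in> carrier N"
    "x \<in> carrier M \<Longrightarrow> y \<in> carrier M \<Longrightarrow> f (x \<oplus>\<^bsub>M\<^esub> y) = f x \<oplus>\<^bsub>N\<^esub> f y"
    "a \<in> carrier k \<Longrightarrow> x \<in> carrier M \<Longrightarrow> f (a \<odot>\<^bsub>M\<^esub> x) = a \<odot>\<^bsub>N\<^esub> f x"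
  using assms by (simp_all add: klin_def additive_def)

lemma klinI:
  assumes "kmod k M" "kmod k N" "\<And>x. x \<in> carrier M \<Longrightarrow> f x \<in> carrier N"
    "\<And>x y. x \<in> carrier M \<Longrightarrow> y \<in> carrier M \<Longrightarrow> f (x \<oplus>\<^bsub>M\<^esub> y) = f x \<oplus>\<^bsub>N\<^esub> f y"
    "\<And>a x. a \<in> carrier k \<Longrightarrow> x \<in> carrier M \<Longrightarrow> f (a \<odot>\<^bsub>M\<^esub> x) = a \<odot>\<^bsub>N\<^esub> f x"
  shows "klin k M N f"
  using assms kmod_laws(2)[of k M] kmod_laws(2)[of k N] by (simp add: klin_def additive_def)

lemma klin_cong:
  assumes "klin k M N f" "\<And>x. x \<in> carrier M \<Longrightarrow> f x = g x"
  shows "klin k M N g"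
  using assms kmod_laws(4)[of k M] additive_cong[of M N f g] unfolding klin_def by auto

lemma kbil_laws:
  assumes "kbil k M N A f"
  shows "kmod k M" "kmod k N" "kmod k A"
    "y \<in> carrier N \<Longrightarrow> klin k M A (\<lambda>x. f x y)"
    "x \<in> carrier M \<Longrightarrow> klin k N A (\<lambda>y. f x y)"
    "x \<in> carrier M \<Longrightarrow> y \<in> carrier N \<Longrightarrow> f x y \<in> carrier A"
  using assms kmod_laws(10)[of k N] klin_laws(2,4)[of k M A "\<lambda>x. f x _"] unfolding kbil_def by blast+

lemma kbil_intro:
  assumes "kmod k M" "kmod k N"
    "\<And>y. y \<in> carrier N \<Longrightarrow> klin k M A (\<lambda>x. f x y)"
    "\<And>x. x \<in> carrier M \<Longrightarrow> klin k N A (\<lambda>y. f x y)"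
  shows "kbil k M N A f"
  using assms by (simp add: kbil_def)

lemma kbil_cong:
  assumes "kbil k M N A f" "\<And>x y. x \<in> carrier M \<Longrightarrow> y \<in> carrier N \<Longrightarrow> f x y = g x y"
  shows "kbil k M N A g"
  using assms unfolding kbil_def by (auto intro: klin_cong)

lemma kmod_tensorable: "kmod k M \<Longrightarrow> kmod k N \<Longrightarrow> tensorable k M N"
  by (auto simp: kmod_def intro: bimodule_tensorable)

lemma kbil_balanced: "kbil k M N A f \<Longrightarrow> balanced k M N A f"
proof (rule balancedI)
  assume f: "kbil k M N A f"
  fix x s y assume a: "x \<in> carrier M" "s \<in> carrier k" "y \<in> carrier N"
  show "f (rsmult M x s) y = f x (s \<odot>\<^bsub>N\<^esub> y)"
    using a klin_laws(6)[OF kbil_laws(4)[OF f a(3)] a(2,1)] klin_laws(6)[OF kbil_laws(5)[OF f a(1)] a(2,3)]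
      kmod_laws(5)[OF kbil_laws(1)[OF f] a(2,1)] by simp
qed (auto dest: kbil_laws klin_laws)

lemma kmod_tensor:
  assumes "kmod k M" "kmod k N" shows "kmod k (M \<boxtimes>\<^bsub>k\<^esub> N)"
proof -
  note M = kmod_laws(3)[OF assms(1)] and N = kmod_laws(3)[OF assms(2)]
  note T = tensor_bimodule[OF M N]
  note TL = is_bimodule_laws[OF T(1)]
  have "rsmult (M \<boxtimes>\<^bsub>k\<^esub> N) t a = a \<odot>\<^bsub>M \<boxtimes>\<^bsub>k\<^esub> N\<^esub> t" if "a \<in> carrier k" "t \<in> carrier (M \<boxtimes>\<^bsub>k\<^esub> N)" for a t
    using kmod_tensorable[OF assms] TL(7)[OF that(1)] TL(6)[OF that(1)] _ that(2)
  proof (rule tensor_ext_gen)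
    fix x y assume "x \<in> carrier M" "y \<in> carrier N"
    then show "rsmult (M \<boxtimes>\<^bsub>k\<^esub> N) (etens (M \<boxtimes>\<^bsub>k\<^esub> N) x y) a = a \<odot>\<^bsub>M \<boxtimes>\<^bsub>k\<^esub> N\<^esub> etens (M \<boxtimes>\<^bsub>k\<^esub> N) x y"
      using that(1) etens_rules(4)[OF M N, of x a y]
      by (simp only: T kmod_laws(5)[OF assms(1)] kmod_laws(5)[OF assms(2)])
  qed
  then show ?thesis using T(1) by (simp add: kmod_def)
qed

lemma kbil_etens:
  assumes M: "kmod k M" and N: "kmod k N" shows "kbil k M N (M \<boxtimes>\<^bsub>k\<^esub> N) (etens (M \<boxtimes>\<^bsub>k\<^esub> N))"
proof -
  note e = etens_rules[OF kmod_laws(3)[OF M] kmod_laws(3)[OF N]]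
  note T = tensor_bimodule[OF kmod_laws(3)[OF M] kmod_laws(3)[OF N]]
  have "etens (M \<boxtimes>\<^bsub>k\<^esub> N) x (a \<odot>\<^bsub>N\<^esub> y) = a \<odot>\<^bsub>M \<boxtimes>\<^bsub>k\<^esub> N\<^esub> etens (M \<boxtimes>\<^bsub>k\<^esub> N) x y"
    if "x \<in> carrier M" "y \<in> carrier N" "a \<in> carrier k" for x y a
    using e(4)[of x a y] that by (simp only: T kmod_laws(5)[OF M])
  then show ?thesis
    unfolding kbil_def klin_def using M N e(2,3) T(2) kmod_tensor[OF M N] by simp
qed

lemma kmod_k_tensor [kl]: "kmod k M \<Longrightarrow> kmod k N \<Longrightarrow> kmod k (M \<boxtimes>\<^bsub>k\<^esub> N)"
  by (rule kmod_tensor)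

lemma etens_closed [kl]:
  "x \<in> carrier M \<Longrightarrow> y \<in> carrier N \<Longrightarrow> kmod k M \<Longrightarrow> kmod k N \<Longrightarrow>
    etens (M \<boxtimes>\<^bsub>k\<^esub> N) x y \<in> carrier (M \<boxtimes>\<^bsub>k\<^esub> N)"
  by (rule kbil_laws(6)[OF kbil_etens])

lemma tlift_etens:
  assumes "kbil k M N A f" "x \<in> carrier M" "y \<in> carrier N"
  shows "tlift A f (etens (M \<boxtimes>\<^bsub>k\<^esub> N) x y) = f x y"
  using tlift_etens_gen[OF kmod_tensorable kmod_laws(2) kbil_balanced[OF assms(1)] assms(2,3)]
    kbil_laws[OF assms(1)] by blast

lemma klin_tlift0:
  assumes f: "kbil k M N A f" shows "klin k (M \<boxtimes>\<^bsub>k\<^esub> N) A (tlift A f)"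
proof -
  note kb = kbil_laws[OF f]
  note tm = kmod_tensor[OF kb(1,2)]
  note ta = additive_tlift[OF kmod_tensorable[OF kb(1,2)] kmod_laws(2)[OF kb(3)] kbil_balanced[OF f]]
  have "tlift A f (a \<odot>\<^bsub>M \<boxtimes>\<^bsub>k\<^esub> N\<^esub> t) = a \<odot>\<^bsub>A\<^esub> tlift A f t"
    if a: "a \<in> carrier k" and t: "t \<in> carrier (M \<boxtimes>\<^bsub>k\<^esub> N)" for a t
    using kmod_tensorable[OF kb(1,2)] additive_comp[OF ta kmod_laws(8)[OF tm a]]
      additive_comp[OF kmod_laws(8)[OF kb(3) a] ta] _ t
  proof (rule tensor_ext_gen)
    fix x y assume xy: "x \<in> carrier M" "y \<in> carrier N"
    have ax: "a \<odot>\<^bsub>M\<^esub> x \<in> carrier M" using kmod_laws(4)[OF kb(1) a xy(1)] .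
    have "tlift A f (a \<odot>\<^bsub>M \<boxtimes>\<^bsub>k\<^esub> N\<^esub> etens (M \<boxtimes>\<^bsub>k\<^esub> N) x y) = tlift A f (etens (M \<boxtimes>\<^bsub>k\<^esub> N) (a \<odot>\<^bsub>M\<^esub> x) y)"
      by (simp only: tensor_bimodule(2)[OF kmod_laws(3)[OF kb(1)] kmod_laws(3)[OF kb(2)] a xy])
    also have "\<dots> = a \<odot>\<^bsub>A\<^esub> f x y"
      using klin_laws(6)[OF kb(4)[OF xy(2)] a xy(1)] tlift_etens[OF f ax xy(2)] by simp
    finally show "tlift A f (a \<odot>\<^bsub>M \<boxtimes>\<^bsub>k\<^esub> N\<^esub> etens (M \<boxtimes>\<^bsub>k\<^esub> N) x y)
        = a \<odot>\<^bsub>A\<^esub> tlift A f (etens (M \<boxtimes>\<^bsub>k\<^esub> N) x y)"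
      using tlift_etens[OF f xy] by simp
  qed
  then show ?thesis using kb tm ta by (simp add: klin_def)
qed

lemma klin_comp: "klin k N A g \<Longrightarrow> klin k P N f \<Longrightarrow> klin k P A (\<lambda>z. g (f z))"
  unfolding klin_def by (auto intro: additive_comp simp: additive_closed)

lemma klin_id [kl]: "kmod k M \<Longrightarrow> klin k M M (\<lambda>z. z)"
  by (simp add: klin_def additive_id kmod_laws)

lemmas kbilI [kl] = kbil_intro

lemma klin_etens_l [kl]:
  "klin k P M f \<Longrightarrow> y \<in> carrier N \<Longrightarrow> kmod k N \<Longrightarrow> klin k P (M \<boxtimes>\<^bsub>k\<^esub> N) (\<lambda>z. etens (M \<boxtimes>\<^bsub>k\<^esub> N) (f z) y)"
  by (rule klin_comp[OF kbil_laws(4)[OF kbil_etens]]) (auto dest: klin_laws)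

lemma klin_etens_r [kl]:
  "klin k P N f \<Longrightarrow> x \<in> carrier M \<Longrightarrow> kmod k M \<Longrightarrow> klin k P (M \<boxtimes>\<^bsub>k\<^esub> N) (\<lambda>z. etens (M \<boxtimes>\<^bsub>k\<^esub> N) x (f z))"
  by (rule klin_comp[OF kbil_laws(5)[OF kbil_etens]]) (auto dest: klin_laws)

lemma klin_tlift [kl]:
  "klin k P (M \<boxtimes>\<^bsub>k\<^esub> N) g \<Longrightarrow> kbil k M N A f \<Longrightarrow> klin k P A (\<lambda>z. tlift A f (g z))"
  by (rule klin_comp[OF klin_tlift0])

lemma tlift_closed [kl]:
  "t \<in> carrier (M \<boxtimes>\<^bsub>k\<^esub> N) \<Longrightarrow> kbil k M N A f \<Longrightarrow> tlift A f t \<in> carrier A"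
  by (rule klin_laws(4)[OF klin_tlift0])

lemma klin_add:
  assumes "klin k M A f" "klin k M A g" shows "klin k M A (\<lambda>x. f x \<oplus>\<^bsub>A\<^esub> g x)"
proof -
  have A: "kmod k A" using assms klin_laws by blast
  show ?thesis
    using assms additive_sum[of M A f g] additive_add[OF kmod_laws(8)[OF A]] klin_laws(4)[OF assms(1)] klin_laws(4)[OF assms(2)]
    unfolding klin_def by simp
qed

lemma klin_smult [kl]:
  assumes "klin k P A f" "a \<in> carrier k" shows "klin k P A (\<lambda>x. a \<odot>\<^bsub>A\<^esub> f x)"
proof -
  have A: "kmod k A" using assms klin_laws by blast
  interpret k: cring k using A by (rule kmod_laws)
  have "b \<odot>\<^bsub>A\<^esub> (a \<odot>\<^bsub>A\<^esub> x) = a \<odot>\<^bsub>A\<^esub> (b \<odot>\<^bsub>A\<^esub> x)" if "b \<in> carrier k" "x \<in> carrier A" for b x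
    using that assms(2) A by (simp add: kmod_laws(6)[symmetric] k.m_comm)
  then have "klin k A A (\<lambda>x. a \<odot>\<^bsub>A\<^esub> x)"
    using A assms(2) kmod_laws(8)[OF A] by (simp add: klin_def)
  then show ?thesis using assms(1) by (rule klin_comp)
qed

section \<open>Calculation rules for Sweedler sums\<close>

lemma tensor_ext:
  assumes f: "klin k (M \<boxtimes>\<^bsub>k\<^esub> N) A f" and g: "klin k (M \<boxtimes>\<^bsub>k\<^esub> N) A g" and M: "kmod k M" and N: "kmod k N"
    and eq: "\<And>x y. x \<in> carrier M \<Longrightarrow> y \<in> carrier N \<Longrightarrow>
      f (etens (M \<boxtimes>\<^bsub>k\<^esub> N) x y) = g (etens (M \<boxtimes>\<^bsub>k\<^esub> N) x y)"
    and t: "t \<in> carrier (M \<boxtimes>\<^bsub>k\<^esub> N)"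
  shows "f t = g t"
  by (rule tensor_ext_gen[OF kmod_tensorable[OF M N] klin_laws(3)[OF f] klin_laws(3)[OF g] eq t])

text \<open>Both sides are linear in \<open>t\<close> and agree on elementary tensors. In Sweedler
  notation this is the tacit step of pulling a linear map inside the sum.\<close>

lemma tlift_fusion:
  assumes g: "klin k A B g" and f: "kbil k M N A f" and t: "t \<in> carrier (M \<boxtimes>\<^bsub>k\<^esub> N)"
  shows "g (tlift A f t) = tlift B (\<lambda>x y. g (f x y)) t"
proof -
  note kb = kbil_laws[OF f]
  have gf: "kbil k M N B (\<lambda>x y. g (f x y))"
    by (rule kbil_intro[OF kb(1,2)]) (auto intro!: klin_comp[OF g] kb)
  show ?thesis
    by (rule tensor_ext[OF klin_comp[OF g klin_tlift0[OF f]] klin_tlift0[OF gf] kb(1,2) _ t])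
      (simp add: tlift_etens[OF f] tlift_etens[OF gf])
qed

text \<open>Bilinearity is demanded of one side only; the other inherits it from the agreement on
  the carriers.\<close>

lemma tlift_cong:
  assumes f: "kbil k M N A f" and eq: "\<And>x y. x \<in> carrier M \<Longrightarrow> y \<in> carrier N \<Longrightarrow> f x y = g x y"
    and t: "t \<in> carrier (M \<boxtimes>\<^bsub>k\<^esub> N)"
  shows "tlift A f t = tlift A g t"
proof -
  note kb = kbil_laws[OF f]
  have g: "kbil k M N A g" using f eq by (rule kbil_cong)
  show ?thesis
    by (rule tensor_ext[OF klin_tlift0[OF f] klin_tlift0[OF g] kb(1,2) _ t])
      (simp add: tlift_etens[OF f] tlift_etens[OF g] eq)
qed

lemma tlift_id:
  assumes "kmod k M" "kmod k N" "t \<in> carrier (M \<boxtimes>\<^bsub>k\<^esub> N)"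
  shows "tlift (M \<boxtimes>\<^bsub>k\<^esub> N) (etens (M \<boxtimes>\<^bsub>k\<^esub> N)) t = t"
  by (rule tensor_ext[OF klin_tlift0[OF kbil_etens] klin_id assms(1,2) _ assms(3)])
    (simp_all add: assms kmod_tensor tlift_etens[OF kbil_etens])

text \<open>Here the tensor is fixed and the summand varies, in \<open>klin_tlift\<close> it is the
  other way round; together they cover both ways in which a variable can enter a Sweedler sum.
  Linearity in \<open>z\<close> is an identity between linear functions of \<open>t\<close>, so it
  is tested on elementary tensors.\<close>

lemma klin_tlift_param [kl]:
  assumes t: "t \<in> carrier (M \<boxtimes>\<^bsub>k\<^esub> N)" and P: "kmod k P"
    and f: "\<And>z. z \<in> carrier P \<Longrightarrow> kbil k M N A (f z)"
    and fl: "\<And>x y. x \<in> carrier M \<Longrightarrow> y \<in> carrier N \<Longrightarrow> klin k P A (\<lambda>z. f z x y)"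
  shows "klin k P A (\<lambda>z. tlift A (f z) t)"
proof -
  have MNA: "kmod k M" "kmod k N" "kmod k A"
    using kbil_laws(1-3)[OF f[OF kmod_laws(10)[OF P]]] by auto
  show ?thesis
  proof (rule klinI)
    show "tlift A (f z) t \<in> carrier A" if "z \<in> carrier P" for z
      by (rule tlift_closed[OF t f[OF that]])
    fix z w assume zw: "z \<in> carrier P" "w \<in> carrier P"
    have zw': "z \<oplus>\<^bsub>P\<^esub> w \<in> carrier P"
      using zw kmod_laws(2)[OF P] by (simp add: abelian_group.axioms abelian_monoid.a_closed)
    show "tlift A (f (z \<oplus>\<^bsub>P\<^esub> w)) t = tlift A (f z) t \<oplus>\<^bsub>A\<^esub> tlift A (f w) t"
      by (rule tensor_ext[OF klin_tlift0[OF f[OF zw']] klin_add[OF klin_tlift0[OF f[OF zw(1)]] klin_tlift0[OF f[OF zw(2)]]]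
            MNA(1,2) _ t])
        (use zw in \<open>simp add: tlift_etens[OF f] zw' klin_laws(5)[OF fl]\<close>)
  next
    fix a z assume az: "a \<in> carrier k" "z \<in> carrier P"
    have az': "a \<odot>\<^bsub>P\<^esub> z \<in> carrier P" using kmod_laws(4)[OF P] az by blast
    show "tlift A (f (a \<odot>\<^bsub>P\<^esub> z)) t = a \<odot>\<^bsub>A\<^esub> tlift A (f z) t"
      by (rule tensor_ext[OF klin_tlift0[OF f[OF az']] klin_smult[OF klin_tlift0[OF f[OF az(2)]] az(1)] MNA(1,2) _ t])
        (use az in \<open>simp add: tlift_etens[OF f] az' klin_laws(6)[OF fl]\<close>)
  qed (use P MNA in simp_all)
qed

lemma tensor_ext2:
  assumes f: "kbil k (M \<boxtimes>\<^bsub>k\<^esub> N) (P \<boxtimes>\<^bsub>k\<^esub> Q) A f" and g: "kbil k (M \<boxtimes>\<^bsub>k\<^esub> N) (P \<boxtimes>\<^bsub>k\<^esub> Q) A g"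
    and MN: "kmod k M" "kmod k N" and PQ: "kmod k P" "kmod k Q"
    and eq: "\<And>x y u v. x \<in> carrier M \<Longrightarrow> y \<in> carrier N \<Longrightarrow> u \<in> carrier P \<Longrightarrow> v \<in> carrier Q \<Longrightarrow>
      f (etens (M \<boxtimes>\<^bsub>k\<^esub> N) x y) (etens (P \<boxtimes>\<^bsub>k\<^esub> Q) u v) = g (etens (M \<boxtimes>\<^bsub>k\<^esub> N) x y) (etens (P \<boxtimes>\<^bsub>k\<^esub> Q) u v)"
    and t: "t \<in> carrier (M \<boxtimes>\<^bsub>k\<^esub> N)" and s: "s \<in> carrier (P \<boxtimes>\<^bsub>k\<^esub> Q)"
  shows "f t s = g t s"
proof (rule tensor_ext[OF kbil_laws(4)[OF f s] kbil_laws(4)[OF g s] MN _ t])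
  fix x y assume xy: "x \<in> carrier M" "y \<in> carrier N"
  have e: "etens (M \<boxtimes>\<^bsub>k\<^esub> N) x y \<in> carrier (M \<boxtimes>\<^bsub>k\<^esub> N)" by (rule etens_closed[OF xy MN])
  show "f (etens (M \<boxtimes>\<^bsub>k\<^esub> N) x y) s = g (etens (M \<boxtimes>\<^bsub>k\<^esub> N) x y) s"
    by (rule tensor_ext[OF kbil_laws(5)[OF f e] kbil_laws(5)[OF g e] PQ _ s]) (rule eq[OF xy])
qed

text \<open>Fubini for two independent Sweedler sums: on an elementary \<open>t\<close> both sides
  are the same sum over \<open>s\<close>, and both are linear in \<open>t\<close>.\<close>

lemma tlift_swap:
  assumes t: "t \<in> carrier (M \<boxtimes>\<^bsub>k\<^esub> N)" and s: "s \<in> carrier (P \<boxtimes>\<^bsub>k\<^esub> Q)"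
    and MN: "kmod k M" "kmod k N" and PQ: "kmod k P" "kmod k Q"
    and f1: "\<And>x y. x \<in> carrier M \<Longrightarrow> y \<in> carrier N \<Longrightarrow> kbil k P Q A (F x y)"
    and f2: "\<And>u v. u \<in> carrier P \<Longrightarrow> v \<in> carrier Q \<Longrightarrow> kbil k M N A (\<lambda>x y. F x y u v)"
  shows "tlift A (\<lambda>x y. tlift A (F x y) s) t = tlift A (\<lambda>u v. tlift A (\<lambda>x y. F x y u v) t) s"
proof -
  have b1: "kbil k M N A (\<lambda>x y. tlift A (F x y) s)" if s: "s \<in> carrier (P \<boxtimes>\<^bsub>k\<^esub> Q)" for s
    by (rule kbil_intro[OF MN]; rule klin_tlift_param[OF s]) (use MN f1 kbil_laws(4,5)[OF f2] in simp_all)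
  have b2: "kbil k P Q A (\<lambda>u v. tlift A (\<lambda>x y. F x y u v) t)" if t: "t \<in> carrier (M \<boxtimes>\<^bsub>k\<^esub> N)" for t
    by (rule kbil_intro[OF PQ]; rule klin_tlift_param[OF t]) (use PQ f2 kbil_laws(4,5)[OF f1] in simp_all)
  show ?thesis
  proof (rule tensor_ext[OF klin_tlift0[OF b1[OF s]] _ MN _ t])
    show "klin k (M \<boxtimes>\<^bsub>k\<^esub> N) A (\<lambda>t. tlift A (\<lambda>u v. tlift A (\<lambda>x y. F x y u v) t) s)"
      by (rule klin_tlift_param[OF s kmod_tensor[OF MN] b2]) (use klin_tlift0[OF f2] in simp_all)
    fix x y assume xy: "x \<in> carrier M" "y \<in> carrier N"
    have "tlift A (\<lambda>x y. tlift A (F x y) s) (etens (M \<boxtimes>\<^bsub>k\<^esub> N) x y) = tlift A (F x y) s"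
      by (rule tlift_etens[OF b1[OF s] xy])
    also have "\<dots> = tlift A (\<lambda>u v. tlift A (\<lambda>x y. F x y u v) (etens (M \<boxtimes>\<^bsub>k\<^esub> N) x y)) s"
      by (rule tlift_cong[OF f1[OF xy] _ s]) (simp add: tlift_etens[OF f2 xy])
    finally show "tlift A (\<lambda>x y. tlift A (F x y) s) (etens (M \<boxtimes>\<^bsub>k\<^esub> N) x y) =
      tlift A (\<lambda>u v. tlift A (\<lambda>x y. F x y u v) (etens (M \<boxtimes>\<^bsub>k\<^esub> N) x y)) s" .
  qed
qed

text \<open>Curried trilinear maps stand in for maps on a triple tensor product, so that
  coassociativity can be applied without mentioning elements of one.\<close>

definition ktril where
  "ktril k M N P A f \<longleftrightarrow> kmod k M \<and> kmod k N \<and> kmod k P \<and>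
     (\<forall>y\<in>carrier N. \<forall>z\<in>carrier P. klin k M A (\<lambda>x. f x y z)) \<and>
     (\<forall>x\<in>carrier M. \<forall>z\<in>carrier P. klin k N A (\<lambda>y. f x y z)) \<and>
     (\<forall>x\<in>carrier M. \<forall>y\<in>carrier N. klin k P A (\<lambda>z. f x y z))"

lemma ktrilI [kl]:
  assumes "kmod k M" "kmod k N" "kmod k P"
    "\<And>y z. y \<in> carrier N \<Longrightarrow> z \<in> carrier P \<Longrightarrow> klin k M A (\<lambda>x. f x y z)"
    "\<And>x z. x \<in> carrier M \<Longrightarrow> z \<in> carrier P \<Longrightarrow> klin k N A (\<lambda>y. f x y z)"
    "\<And>x y. x \<in> carrier M \<Longrightarrow> y \<in> carrier N \<Longrightarrow> klin k P A (\<lambda>z. f x y z)"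
  shows "ktril k M N P A f"
  using assms by (simp add: ktril_def)

lemma ktril_laws:
  assumes "ktril k M N P A f"
  shows "kmod k M" "kmod k N" "kmod k P" "kmod k A"
    "z \<in> carrier P \<Longrightarrow> kbil k M N A (\<lambda>x y. f x y z)"
    "y \<in> carrier N \<Longrightarrow> kbil k M P A (\<lambda>x z. f x y z)"
    "x \<in> carrier M \<Longrightarrow> kbil k N P A (\<lambda>y z. f x y z)"
    "y \<in> carrier N \<Longrightarrow> z \<in> carrier P \<Longrightarrow> klin k M A (\<lambda>x. f x y z)"
    "x \<in> carrier M \<Longrightarrow> z \<in> carrier P \<Longrightarrow> klin k N A (\<lambda>y. f x y z)"
    "x \<in> carrier M \<Longrightarrow> y \<in> carrier N \<Longrightarrow> klin k P A (\<lambda>z. f x y z)"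
proof -
  show m: "kmod k M" "kmod k N" "kmod k P" using assms by (auto simp: ktril_def)
  have z: "\<zero>\<^bsub>N\<^esub> \<in> carrier N" "\<zero>\<^bsub>P\<^esub> \<in> carrier P" using kmod_laws(10) m by auto
  show "kmod k A" using assms z klin_laws(2) unfolding ktril_def by blast
qed (use assms in \<open>auto simp: ktril_def kbil_def\<close>)

subsection \<open>Coalgebras\<close>

lemma bihom_klin:
  assumes "f \<in> bihom k k M N" "kmod k M" "kmod k N" shows "klin k M N f"
  using assms by (auto simp: bihom_def hom_def intro!: klinI)

locale coalg =
  fixes k :: "('k, 'x) ring_scheme" and N :: "('k, 'k, 'a) bimodule" and \<Delta> :: "'a \<Rightarrow> ('a, 'a) tens"
    and \<epsilon> :: "'a \<Rightarrow> 'k"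
  assumes kmod_N [kl]: "kmod k N" and kmod_k: "kmod k (bimod_of (regular k))"
    and coalgebra: "coalgebra k N \<Delta> \<epsilon>"
begin

lemma comult_klin: "klin k N (N \<boxtimes>\<^bsub>k\<^esub> N) \<Delta>"
  using coalgebra by (intro bihom_klin kmod_N kmod_tensor) (simp add: coalgebra_def Let_def)

lemma counit_klin: "klin k N (bimod_of (regular k)) \<epsilon>"
  using coalgebra by (intro bihom_klin kmod_N kmod_k) (simp add: coalgebra_def Let_def)

lemma comult_lin [kl]: "klin k P N f \<Longrightarrow> klin k P (N \<boxtimes>\<^bsub>k\<^esub> N) (\<lambda>z. \<Delta> (f z))"
  by (rule klin_comp[OF comult_klin])

lemma counit_lin [kl]: "klin k P N f \<Longrightarrow> klin k P (bimod_of (regular k)) (\<lambda>z. \<epsilon> (f z))"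
  by (rule klin_comp[OF counit_klin])

lemma comult_closed [kl]: "x \<in> carrier N \<Longrightarrow> \<Delta> x \<in> carrier (N \<boxtimes>\<^bsub>k\<^esub> N)"
  by (rule klin_laws(4)[OF comult_klin])

lemma counit_closed [kl]: "x \<in> carrier N \<Longrightarrow> \<epsilon> x \<in> carrier k"
  using klin_laws(4)[OF counit_klin, of x] by (simp add: bimod_of_def regular_def)

lemma counit_lin_smult [kl]:
  assumes f: "klin k P N f" and y: "y \<in> carrier A" and A: "kmod k A"
  shows "klin k P A (\<lambda>z. \<epsilon> (f z) \<odot>\<^bsub>A\<^esub> y)"
proof -
  have "klin k (bimod_of (regular k)) A (\<lambda>a. a \<odot>\<^bsub>A\<^esub> y)"
    by (rule klinI) (use kmod_k A y kmod_laws[OF A] in \<open>auto simp: bimod_of_def regular_def\<close>)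
  then show ?thesis by (rule klin_comp) (rule counit_lin[OF f])
qed

text \<open>The counit axiom with a linear map applied to it; in this form it also removes a counit
  factor that sits inside a longer expression.\<close>

lemma counit_l:
  assumes g: "klin k N A g" and c: "c \<in> carrier N"
  shows "tlift A (\<lambda>u v. \<epsilon> u \<odot>\<^bsub>A\<^esub> g v) (\<Delta> c) = g c"
proof -
  have "g c = g (tlift N (\<lambda>u v. \<epsilon> u \<odot>\<^bsub>N\<^esub> v) (\<Delta> c))"
    using coalgebra c by (simp add: coalgebra_def Let_def)
  also have "\<dots> = tlift A (\<lambda>u v. g (\<epsilon> u \<odot>\<^bsub>N\<^esub> v)) (\<Delta> c)"
    by (rule tlift_fusion[OF g _ comult_closed[OF c]]) (assumption | rule kl)+
  also have "\<dots> = tlift A (\<lambda>u v. \<epsilon> u \<odot>\<^bsub>A\<^esub> g v) (\<Delta> c)"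
    by (rule tlift_cong[OF _ _ comult_closed[OF c]])
      (assumption | rule kl klin_comp[OF g] klin_laws(6)[OF g])+
  finally show ?thesis by simp
qed

lemma counit_r:
  assumes g: "klin k N A g" and c: "c \<in> carrier N"
  shows "tlift A (\<lambda>u v. \<epsilon> v \<odot>\<^bsub>A\<^esub> g u) (\<Delta> c) = g c"
proof -
  have b: "kbil k N N N (\<lambda>u v. \<epsilon> v \<odot>\<^bsub>N\<^esub> u)" by (assumption | rule kl)+
  have r: "rsmult N u (\<epsilon> v) = \<epsilon> v \<odot>\<^bsub>N\<^esub> u" if "u \<in> carrier N" "v \<in> carrier N" for u v
    using kmod_laws(5)[OF kmod_N] counit_closed that by simp
  have "g c = g (tlift N (\<lambda>u v. rsmult N u (\<epsilon> v)) (\<Delta> c))"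
    using coalgebra c by (simp add: coalgebra_def Let_def)
  also have "tlift N (\<lambda>u v. rsmult N u (\<epsilon> v)) (\<Delta> c) = tlift N (\<lambda>u v. \<epsilon> v \<odot>\<^bsub>N\<^esub> u) (\<Delta> c)"
    by (rule tlift_cong[OF b _ comult_closed[OF c], symmetric]) (simp add: r)
  also have "g \<dots> = tlift A (\<lambda>u v. g (\<epsilon> v \<odot>\<^bsub>N\<^esub> u)) (\<Delta> c)"
    by (rule tlift_fusion[OF g b comult_closed[OF c]])
  also have "\<dots> = tlift A (\<lambda>u v. \<epsilon> v \<odot>\<^bsub>A\<^esub> g u) (\<Delta> c)"
    by (rule tlift_cong[OF _ _ comult_closed[OF c]])
      (assumption | rule kl klin_comp[OF g] klin_laws(6)[OF g])+
  finally show ?thesis by simp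
qed

text \<open>The linear extension of \<open>G\<close> to the triple tensor product is applied to both
  sides of the coassociativity axiom. The result is the rebracketing rule in the form in which it is
  used inside nested Sweedler sums.\<close>

lemma coassoc:
  assumes G: "ktril k N N N A G" and c: "c \<in> carrier N"
  shows "tlift A (\<lambda>x z. tlift A (\<lambda>u v. G u v z) (\<Delta> x)) (\<Delta> c) =
    tlift A (\<lambda>x z. tlift A (\<lambda>u v. G x u v) (\<Delta> z)) (\<Delta> c)"
proof -
  let ?N2 = "N \<boxtimes>\<^bsub>k\<^esub> N" and ?N3 = "(N \<boxtimes>\<^bsub>k\<^esub> N) \<boxtimes>\<^bsub>k\<^esub> N"
  let ?g = "tlift A (\<lambda>t z. tlift A (\<lambda>u v. G u v z) t)"
  note GL = ktril_laws[OF G]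
  have gb: "kbil k ?N2 N A (\<lambda>t z. tlift A (\<lambda>u v. G u v z) t)"
    by (assumption | rule kl GL(5,8-10))+
  have g: "klin k ?N3 A ?g" by (rule klin_tlift0[OF gb])
  have ge: "?g (etens ?N3 t z) = tlift A (\<lambda>u v. G u v z) t" if "t \<in> carrier ?N2" "z \<in> carrier N" for t z
    by (rule tlift_etens[OF gb that])
  have ge3: "?g (etens ?N3 (etens ?N2 u v) z) = G u v z"
    if "u \<in> carrier N" "v \<in> carrier N" "z \<in> carrier N" for u v z
    using that by (subst ge) (assumption | rule kl tlift_etens[OF GL(5)])+
  have b1: "kbil k N N ?N3 (\<lambda>x z. etens ?N3 (\<Delta> x) z)"
    by (assumption | rule kl)+
  have b3: "kbil k N N ?N3 (\<lambda>v z. etens ?N3 (etens ?N2 u v) z)" if "u \<in> carrier N" for u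
    using that by - (assumption | rule kl)+
  have b2: "kbil k N N ?N3 (\<lambda>u w. tlift ?N3 (\<lambda>v z. etens ?N3 (etens ?N2 u v) z) (\<Delta> w))"
    by (assumption | rule kl)+
  have "tlift A (\<lambda>x z. tlift A (\<lambda>u v. G u v z) (\<Delta> x)) (\<Delta> c) = tlift A (\<lambda>x z. ?g (etens ?N3 (\<Delta> x) z)) (\<Delta> c)"
    by (rule tlift_cong[OF _ _ comult_closed[OF c]])
      (assumption | rule kl GL(5,8-10) ge[symmetric])+
  also have "\<dots> = ?g (tmap ?N3 \<Delta> (\<lambda>z. z) (\<Delta> c))"
    unfolding tmap_def by (rule tlift_fusion[OF g b1 comult_closed[OF c], symmetric])
  also have "tmap ?N3 \<Delta> (\<lambda>z. z) (\<Delta> c) =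
      tlift ?N3 (\<lambda>u w. tlift ?N3 (\<lambda>v z. etens ?N3 (etens ?N2 u v) z) (\<Delta> w)) (\<Delta> c)"
    using coalgebra c by (simp add: coalgebra_def Let_def)
  also have "?g \<dots> = tlift A (\<lambda>u w. ?g (tlift ?N3 (\<lambda>v z. etens ?N3 (etens ?N2 u v) z) (\<Delta> w))) (\<Delta> c)"
    by (rule tlift_fusion[OF g b2 comult_closed[OF c]])
  also have "\<dots> = tlift A (\<lambda>u w. tlift A (\<lambda>v z. ?g (etens ?N3 (etens ?N2 u v) z)) (\<Delta> w)) (\<Delta> c)"
    by (rule tlift_cong[OF _ tlift_fusion[OF g b3 comult_closed] comult_closed[OF c]])
      (assumption | rule kl klin_comp[OF g])+
  also have "\<dots> = tlift A (\<lambda>u w. tlift A (\<lambda>v z. G u v z) (\<Delta> w)) (\<Delta> c)"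
    by (rule tlift_cong[OF _ tlift_cong[OF _ ge3 comult_closed] comult_closed[OF c]])
      (assumption | rule kl klin_comp[OF g])+
  finally show ?thesis .
qed

end

section \<open>Commutative Hopf algebras\<close>

lemma bimod_of_sel [simp]:
  "carrier (bimod_of M) = carrier M" "zero (bimod_of M) = zero M" "add (bimod_of M) = add M"
  "smult (bimod_of M) = smult M" "rsmult (bimod_of M) = (\<lambda>x r. r \<odot>\<^bsub>M\<^esub> x)"
  by (simp_all add: bimod_of_def)

lemma regular_sel [simp]:
  "carrier (regular R) = carrier R" "zero (regular R) = zero R" "add (regular R) = add R"
  "smult (regular R) = mult R"
  by (simp_all add: regular_def)

lemma lrestr_sel [simp]:
  "carrier (lrestr f M) = carrier M" "zero (lrestr f M) = zero M" "add (lrestr f M) = add M"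
  "smult (lrestr f M) = (\<lambda>q x. f q \<odot>\<^bsub>M\<^esub> x)" "rsmult (lrestr f M) = rsmult M"
  by (simp_all add: lrestr_def)

lemma rrestr_sel [simp]:
  "carrier (rrestr f M) = carrier M" "zero (rrestr f M) = zero M" "add (rrestr f M) = add M"
  "smult (rrestr f M) = smult M" "rsmult (rrestr f M) = (\<lambda>x q. rsmult M x (f q))"
  by (simp_all add: rrestr_def)

lemma lk_sel [simp]:
  "carrier (lk H M) = carrier M" "zero (lk H M) = zero M" "add (lk H M) = add M"
  "smult (lk H M) = (\<lambda>a x. unit_map H a \<odot>\<^bsub>M\<^esub> x)" "rsmult (lk H M) = rsmult M"
  by (simp_all add: lk_def)

lemma rk_sel [simp]:
  "carrier (rk H M) = carrier M" "zero (rk H M) = zero M" "add (rk H M) = add M"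
  "smult (rk H M) = smult M" "rsmult (rk H M) = (\<lambda>x a. rsmult M x (unit_map H a))"
  by (simp_all add: rk_def)

lemma kk_sel [simp]:
  "carrier (kk H M) = carrier M" "zero (kk H M) = zero M" "add (kk H M) = add M"
  "smult (kk H M) = (\<lambda>a x. unit_map H a \<odot>\<^bsub>M\<^esub> x)" "rsmult (kk H M) = (\<lambda>x a. rsmult M x (unit_map H a))"
  by (simp_all add: kk_def)

lemma bimodule_eqI:
  fixes M N :: "('r, 's, 'a) bimodule"
  assumes "carrier M = carrier N" "mult M = mult N" "one M = one N" "zero M = zero N" "add M = add N"
    "smult M = smult N" "rsmult M = rsmult N"
  shows "M = N"
  using assms by (cases M, cases N) simp

lemma bimodule_bimod_of:
  assumes "module R M" shows "is_bimodule R R (bimod_of M)"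
proof -
  interpret module R M by fact
  have ab: "abelian_group (bimod_of M)"
    by (rule abelian_group_cong[OF abelian_group_axioms]) simp_all
  show ?thesis
    by (rule is_bimoduleI)
      (auto simp: additive_def ab smult_r_distr smult_l_distr smult_assoc1[symmetric] R.m_comm R.is_cring)
qed

lemma bimodule_lrestr:
  assumes M: "is_bimodule R S M" and f: "f \<in> ring_hom Q R" and Q: "cring Q"
  shows "is_bimodule Q S (lrestr f M)"
proof -
  note L = is_bimodule_laws[OF M]
  note fc = ring_hom_closed[OF f]
  have ab: "abelian_group (lrestr f M)" by (rule abelian_group_cong[OF L(3)]) simp_all
  have a: "additive (lrestr f M) (lrestr f M) g" if "additive M M g" for g
    by (rule additive_cong_ring[THEN iffD1, OF _ _ _ _ _ _ that]) simp_all
  show ?thesis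
  proof (rule is_bimoduleI)
    show "additive (lrestr f M) (lrestr f M) ((\<odot>\<^bsub>lrestr f M\<^esub>) r)" if "r \<in> carrier Q" for r
      using a[OF L(6)[OF fc[OF that]]] by simp
    show "additive (lrestr f M) (lrestr f M) (\<lambda>x. rsmult (lrestr f M) x s)" if "s \<in> carrier S" for s
      using a[OF L(7)[OF that]] by simp
  qed (fact ab | fact Q | fact L(2) |
      simp only: lrestr_sel ring_hom_add[OF f] ring_hom_mult[OF f] ring_hom_one[OF f] fc L(8-14))+
qed

lemma bimodule_rrestr:
  assumes M: "is_bimodule R S M" and f: "f \<in> ring_hom Q S" and Q: "cring Q"
  shows "is_bimodule R Q (rrestr f M)"
proof -
  note L = is_bimodule_laws[OF M]
  note fc = ring_hom_closed[OF f]
  have ab: "abelian_group (rrestr f M)" by (rule abelian_group_cong[OF L(3)]) simp_all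
  have a: "additive (rrestr f M) (rrestr f M) g" if "additive M M g" for g
    by (rule additive_cong_ring[THEN iffD1, OF _ _ _ _ _ _ that]) simp_all
  show ?thesis
  proof (rule is_bimoduleI)
    show "additive (rrestr f M) (rrestr f M) ((\<odot>\<^bsub>rrestr f M\<^esub>) r)" if "r \<in> carrier R" for r
      using a[OF L(6)[OF that]] by simp
    show "additive (rrestr f M) (rrestr f M) (\<lambda>x. rsmult (rrestr f M) x s)" if "s \<in> carrier Q" for s
      using a[OF L(7)[OF fc[OF that]]] by simp
  qed (fact ab | fact Q | fact L(1) |
      simp only: rrestr_sel ring_hom_add[OF f] ring_hom_mult[OF f] ring_hom_one[OF f] fc L(8-14))+
qed

lemma kmod_bimod_of: "module k M \<Longrightarrow> kmod k (bimod_of M)"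
  by (simp add: kmod_def bimodule_bimod_of)

lemma module_regular: "cring R \<Longrightarrow> module R (regular R)"
proof -
  assume "cring R" then interpret cring R .
  have "abelian_group (regular R)" by (rule abelian_group_cong[OF abelian_group_axioms]) simp_all
  then show ?thesis by (intro moduleI) (simp_all add: is_cring l_distr r_distr m_assoc)
qed

text \<open>\<open>tmap2\<close> of two coproducts is how \<Delta>(gh), \<Delta>(ch) and the
  coproduct of C \<otimes>_H D are written; this rule dissolves it into one Sweedler sum for each
  factor.\<close>

lemma tlift_tmap2:
  assumes F: "kbil k P Q A F"
    and t: "t \<in> carrier (M \<boxtimes>\<^bsub>k\<^esub> M')" and s: "s \<in> carrier (N \<boxtimes>\<^bsub>k\<^esub> N')"
    and f: "kbil k M N P f" and g: "kbil k M' N' Q g"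
  shows "tlift A F (tmap2 (P \<boxtimes>\<^bsub>k\<^esub> Q) f g t s) =
    tlift A (\<lambda>x x'. tlift A (\<lambda>y y'. F (f x y) (g x' y')) s) t"
proof -
  note km [kl] = kbil_laws(1-3)[OF F] kbil_laws(1,2)[OF f] kbil_laws(1,2)[OF g]
  note fl = klin_comp[OF kbil_laws(4)[OF F]] klin_comp[OF kbil_laws(5)[OF F]]
    klin_etens_l[OF kbil_laws(4)[OF f]] klin_etens_l[OF kbil_laws(5)[OF f]]
    klin_etens_r[OF kbil_laws(4)[OF g]] klin_etens_r[OF kbil_laws(5)[OF g]]
    kbil_laws(4,5)[OF f] kbil_laws(4,5)[OF g] kbil_laws(6)[OF f] kbil_laws(6)[OF g]
  have b1: "kbil k N N' (P \<boxtimes>\<^bsub>k\<^esub> Q) (\<lambda>y y'. etens (P \<boxtimes>\<^bsub>k\<^esub> Q) (f x y) (g x' y'))"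
    if "x \<in> carrier M" "x' \<in> carrier M'" for x x'
    by (assumption | rule kl fl that)+
  have b2: "kbil k M M' (P \<boxtimes>\<^bsub>k\<^esub> Q) (\<lambda>x x'. tlift (P \<boxtimes>\<^bsub>k\<^esub> Q) (\<lambda>y y'. etens (P \<boxtimes>\<^bsub>k\<^esub> Q) (f x y) (g x' y')) s)"
    by (assumption | rule kl fl s)+
  have b3: "kbil k M M' A (\<lambda>x x'. tlift A (\<lambda>y y'. F (f x y) (g x' y')) s)"
    by (assumption | rule kl fl s)+
  have b4: "kbil k N N' A (\<lambda>y y'. F (f x y) (g x' y'))"
    if "x \<in> carrier M" "x' \<in> carrier M'" for x x'
    by (assumption | rule kl fl that)+
  have "tlift A F (tmap2 (P \<boxtimes>\<^bsub>k\<^esub> Q) f g t s) =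
      tlift A (\<lambda>x x'. tlift A F (tlift (P \<boxtimes>\<^bsub>k\<^esub> Q) (\<lambda>y y'. etens (P \<boxtimes>\<^bsub>k\<^esub> Q) (f x y) (g x' y')) s)) t"
    unfolding tmap2_def by (rule tlift_fusion[OF klin_tlift0[OF F] b2 t])
  also have "\<dots> = tlift A (\<lambda>x x'. tlift A (\<lambda>y y'. F (f x y) (g x' y')) s) t"
  proof (rule tlift_cong[OF b3 _ t, symmetric])
    fix x x' assume x: "x \<in> carrier M" "x' \<in> carrier M'"
    have "tlift A F (tlift (P \<boxtimes>\<^bsub>k\<^esub> Q) (\<lambda>y y'. etens (P \<boxtimes>\<^bsub>k\<^esub> Q) (f x y) (g x' y')) s) =
      tlift A (\<lambda>y y'. tlift A F (etens (P \<boxtimes>\<^bsub>k\<^esub> Q) (f x y) (g x' y'))) s"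
      by (rule tlift_fusion[OF klin_tlift0[OF F] b1[OF x] s])
    also have "\<dots> = tlift A (\<lambda>y y'. F (f x y) (g x' y')) s"
      by (rule tlift_cong[OF b4[OF x] _ s, symmetric])
        (simp add: tlift_etens[OF F] x kbil_laws(6)[OF f] kbil_laws(6)[OF g])
    finally show "tlift A (\<lambda>y y'. F (f x y) (g x' y')) s =
      tlift A F (tlift (P \<boxtimes>\<^bsub>k\<^esub> Q) (\<lambda>y y'. etens (P \<boxtimes>\<^bsub>k\<^esub> Q) (f x y) (g x' y')) s)" by simp
  qed
  finally show ?thesis .
qed

lemma kbil_tmap2:
  assumes f: "kbil k M N P f" and g: "kbil k M' N' Q g"
  shows "kbil k (M \<boxtimes>\<^bsub>k\<^esub> M') (N \<boxtimes>\<^bsub>k\<^esub> N') (P \<boxtimes>\<^bsub>k\<^esub> Q) (tmap2 (P \<boxtimes>\<^bsub>k\<^esub> Q) f g)"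
    and "x \<in> carrier M \<Longrightarrow> x' \<in> carrier M' \<Longrightarrow> y \<in> carrier N \<Longrightarrow> y' \<in> carrier N' \<Longrightarrow>
      tmap2 (P \<boxtimes>\<^bsub>k\<^esub> Q) f g (etens (M \<boxtimes>\<^bsub>k\<^esub> M') x x') (etens (N \<boxtimes>\<^bsub>k\<^esub> N') y y') =
      etens (P \<boxtimes>\<^bsub>k\<^esub> Q) (f x y) (g x' y')"
proof -
  note km [kl] = kbil_laws(1-3)[OF f] kbil_laws(1-3)[OF g]
  note fl = klin_etens_l[OF kbil_laws(4)[OF f]] klin_etens_l[OF kbil_laws(5)[OF f]]
    klin_etens_r[OF kbil_laws(4)[OF g]] klin_etens_r[OF kbil_laws(5)[OF g]]
    kbil_laws(6)[OF f] kbil_laws(6)[OF g]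
  show "kbil k (M \<boxtimes>\<^bsub>k\<^esub> M') (N \<boxtimes>\<^bsub>k\<^esub> N') (P \<boxtimes>\<^bsub>k\<^esub> Q) (tmap2 (P \<boxtimes>\<^bsub>k\<^esub> Q) f g)"
    unfolding tmap2_def by (assumption | rule kl fl)+
  assume a: "x \<in> carrier M" "x' \<in> carrier M'" "y \<in> carrier N" "y' \<in> carrier N'"
  have e: "etens (N \<boxtimes>\<^bsub>k\<^esub> N') y y' \<in> carrier (N \<boxtimes>\<^bsub>k\<^esub> N')" by (assumption | rule kl a)+
  have b: "kbil k M M' (P \<boxtimes>\<^bsub>k\<^esub> Q) (\<lambda>x x'. tlift (P \<boxtimes>\<^bsub>k\<^esub> Q) (\<lambda>y y'. etens (P \<boxtimes>\<^bsub>k\<^esub> Q) (f x y) (g x' y')) (etens (N \<boxtimes>\<^bsub>k\<^esub> N') y y'))"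
    by (assumption | rule kl fl e)+
  have b': "kbil k N N' (P \<boxtimes>\<^bsub>k\<^esub> Q) (\<lambda>y y'. etens (P \<boxtimes>\<^bsub>k\<^esub> Q) (f x y) (g x' y'))"
    by (assumption | rule kl fl a)+
  show "tmap2 (P \<boxtimes>\<^bsub>k\<^esub> Q) f g (etens (M \<boxtimes>\<^bsub>k\<^esub> M') x x') (etens (N \<boxtimes>\<^bsub>k\<^esub> N') y y') =
      etens (P \<boxtimes>\<^bsub>k\<^esub> Q) (f x y) (g x' y')"
    unfolding tmap2_def using a by (simp add: tlift_etens[OF b] tlift_etens[OF b'])
qed

lemma cring_laws:
  assumes "cring R"
  shows "x \<in> carrier R \<Longrightarrow> y \<in> carrier R \<Longrightarrow> z \<in> carrier R \<Longrightarrow>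
      (x \<oplus>\<^bsub>R\<^esub> y) \<otimes>\<^bsub>R\<^esub> z = x \<otimes>\<^bsub>R\<^esub> z \<oplus>\<^bsub>R\<^esub> y \<otimes>\<^bsub>R\<^esub> z"
    "x \<in> carrier R \<Longrightarrow> y \<in> carrier R \<Longrightarrow> z \<in> carrier R \<Longrightarrow>
      (x \<otimes>\<^bsub>R\<^esub> y) \<otimes>\<^bsub>R\<^esub> z = x \<otimes>\<^bsub>R\<^esub> (y \<otimes>\<^bsub>R\<^esub> z)"
    "x \<in> carrier R \<Longrightarrow> y \<in> carrier R \<Longrightarrow> x \<otimes>\<^bsub>R\<^esub> y = y \<otimes>\<^bsub>R\<^esub> x"
proof -
  interpret cring R by fact
  show "x \<in> carrier R \<Longrightarrow> y \<in> carrier R \<Longrightarrow> z \<in> carrier R \<Longrightarrow>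
      (x \<oplus>\<^bsub>R\<^esub> y) \<otimes>\<^bsub>R\<^esub> z = x \<otimes>\<^bsub>R\<^esub> z \<oplus>\<^bsub>R\<^esub> y \<otimes>\<^bsub>R\<^esub> z"
    "x \<in> carrier R \<Longrightarrow> y \<in> carrier R \<Longrightarrow> z \<in> carrier R \<Longrightarrow>
      (x \<otimes>\<^bsub>R\<^esub> y) \<otimes>\<^bsub>R\<^esub> z = x \<otimes>\<^bsub>R\<^esub> (y \<otimes>\<^bsub>R\<^esub> z)"
    "x \<in> carrier R \<Longrightarrow> y \<in> carrier R \<Longrightarrow> x \<otimes>\<^bsub>R\<^esub> y = y \<otimes>\<^bsub>R\<^esub> x"
    by (rule l_distr m_assoc m_comm; assumption)+
qed

locale comm_hopf =
  fixes k :: "('k, 'x) ring_scheme" and H :: "('k, 'h, 'z) hopf_scheme"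
  assumes cring_k: "cring k" and hopf: "commutative_hopf_algebra k H"
begin

abbreviation Hk where "Hk \<equiv> bimod_of H"
abbreviation hmult (infixl "\<cdot>" 70) where "g \<cdot> h \<equiv> g \<otimes>\<^bsub>H\<^esub> h"
abbreviation Rk where "Rk \<equiv> bimod_of (regular k)"
abbreviation S where "S \<equiv> antipode H"

lemma algebra_H: "algebra k H" using hopf by (simp add: commutative_hopf_algebra_def Let_def)

sublocale A: algebra k H by (rule algebra_H)
lemma cring_H: "cring H" by (rule A.M_cring)
lemmas H_l_distr = cring_laws(1)[OF cring_H]
lemmas H_m_assoc = cring_laws(2)[OF cring_H]
lemmas H_m_comm = cring_laws(3)[OF cring_H]

lemma kmod_Hk [kl]: "kmod k Hk" by (rule kmod_bimod_of) (rule A.module)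
lemma kmod_Rk [kl]: "kmod k Rk" by (rule kmod_bimod_of[OF module_regular[OF cring_k]])

sublocale Hc: coalg k Hk "hcomult H" "hcounit H"
  by unfold_locales (use hopf kmod_Hk kmod_Rk in \<open>simp_all add: commutative_hopf_algebra_def Let_def\<close>)

lemma tlift_H: "tlift H = tlift Hk" by (rule tlift_cong_ring) simp_all
lemma tlift_k: "tlift k = tlift Rk" by (rule tlift_cong_ring) simp_all

lemma mult_lin [kl]:
  "klin k P Hk f \<Longrightarrow> h \<in> carrier Hk \<Longrightarrow> klin k P Hk (\<lambda>z. f z \<cdot> h)"
  "klin k P Hk f \<Longrightarrow> h \<in> carrier Hk \<Longrightarrow> klin k P Hk (\<lambda>z. h \<cdot> f z)"
proof -
  assume f: "klin k P Hk f" and h: "h \<in> carrier Hk"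
  have "klin k Hk Hk (\<lambda>z. z \<cdot> h)"
    by (rule klinI[OF kmod_Hk kmod_Hk]) (use h in \<open>simp_all add: H_l_distr A.smult_assoc2\<close>)
  then show *: "klin k P Hk (\<lambda>z. f z \<cdot> h)" using f by (rule klin_comp)
  show "klin k P Hk (\<lambda>z. h \<cdot> f z)"
    by (rule klin_cong[OF *]) (use h klin_laws(4)[OF f] in \<open>simp add: H_m_comm\<close>)
qed

lemma mult_closed [kl]: "g \<in> carrier Hk \<Longrightarrow> h \<in> carrier Hk \<Longrightarrow> g \<cdot> h \<in> carrier Hk"
  by simp

lemma kmult_lin [kl]:
  "klin k P Rk f \<Longrightarrow> a \<in> carrier Rk \<Longrightarrow> klin k P Rk (\<lambda>z. f z \<otimes>\<^bsub>k\<^esub> a)"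
  "klin k P Rk f \<Longrightarrow> a \<in> carrier Rk \<Longrightarrow> klin k P Rk (\<lambda>z. a \<otimes>\<^bsub>k\<^esub> f z)"
proof -
  assume f: "klin k P Rk f" and a: "a \<in> carrier Rk"
  have "klin k Rk Rk (\<lambda>z. z \<otimes>\<^bsub>k\<^esub> a)"
    by (rule klinI[OF kmod_Rk kmod_Rk]) (use a in \<open>simp_all add: A.R.l_distr A.R.m_assoc\<close>)
  then show *: "klin k P Rk (\<lambda>z. f z \<otimes>\<^bsub>k\<^esub> a)" using f by (rule klin_comp)
  show "klin k P Rk (\<lambda>z. a \<otimes>\<^bsub>k\<^esub> f z)"
    by (rule klin_cong[OF *]) (use a klin_laws(4)[OF f] in \<open>simp add: A.R.m_comm\<close>)
qed

lemma antipode_klin: "klin k Hk Hk S"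
  using hopf kmod_Hk by (intro bihom_klin) (simp_all add: commutative_hopf_algebra_def Let_def)

lemma antipode_lin [kl]: "klin k P Hk f \<Longrightarrow> klin k P Hk (\<lambda>z. S (f z))"
  by (rule klin_comp[OF antipode_klin])

lemma antipode_closed [kl]: "h \<in> carrier Hk \<Longrightarrow> S h \<in> carrier Hk"
  by (rule klin_laws(4)[OF antipode_klin])

lemma antipode_carrier [simp]: "h \<in> carrier H \<Longrightarrow> S h \<in> carrier H"
  using antipode_closed by simp

lemma hcounit_carrier [simp]: "h \<in> carrier H \<Longrightarrow> hcounit H h \<in> carrier k"
  using Hc.counit_closed by simp

lemma hcounit_hom: "hcounit H \<in> ring_hom H k"
  using hopf by (simp add: commutative_hopf_algebra_def Let_def)

lemma kmod_smult_lin [kl]: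
  assumes f: "klin k P Rk f" and y: "y \<in> carrier M" and M: "kmod k M"
  shows "klin k P M (\<lambda>z. f z \<odot>\<^bsub>M\<^esub> y)"
proof -
  have "klin k Rk M (\<lambda>a. a \<odot>\<^bsub>M\<^esub> y)"
    by (rule klinI) (use kmod_Rk M y kmod_laws[OF M] in auto)
  then show ?thesis using f by (rule klin_comp)
qed

lemma hcomult_mult:
  "g \<in> carrier H \<Longrightarrow> h \<in> carrier H \<Longrightarrow>
    hcomult H (g \<cdot> h) = tmap2 (Hk \<boxtimes>\<^bsub>k\<^esub> Hk) (mult H) (mult H) (hcomult H g) (hcomult H h)"
  "hcomult H \<one>\<^bsub>H\<^esub> = etens (Hk \<boxtimes>\<^bsub>k\<^esub> Hk) \<one>\<^bsub>H\<^esub> \<one>\<^bsub>H\<^esub>"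
  using hopf by (simp_all add: commutative_hopf_algebra_def Let_def)

lemma kbil_mult: "kbil k Hk Hk Hk (mult H)"
  by (assumption | rule kl)+

text \<open>As with the counit, the axiom is given with an arbitrary linear \<open>g\<close> around
  it, so that S(h1) h2 can be contracted inside a product.\<close>

lemma antipode_l:
  assumes g: "klin k Hk M g" and h: "h \<in> carrier Hk"
  shows "tlift M (\<lambda>u v. g (S u \<cdot> v)) (hcomult H h) = hcounit H h \<odot>\<^bsub>M\<^esub> g \<one>\<^bsub>H\<^esub>"
proof -
  have b: "kbil k Hk Hk Hk (\<lambda>u v. S u \<cdot> v)" by (assumption | rule kl)+
  have "tlift M (\<lambda>u v. g (S u \<cdot> v)) (hcomult H h) = g (tlift Hk (\<lambda>u v. S u \<cdot> v) (hcomult H h))"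
    by (rule tlift_fusion[OF g b, symmetric]) (use h Hc.comult_closed in simp)
  also have "tlift Hk (\<lambda>u v. S u \<cdot> v) (hcomult H h) = hcounit H h \<odot>\<^bsub>H\<^esub> \<one>\<^bsub>H\<^esub>"
    using hopf h by (simp add: commutative_hopf_algebra_def Let_def tlift_H)
  also have "g \<dots> = hcounit H h \<odot>\<^bsub>M\<^esub> g \<one>\<^bsub>H\<^esub>"
    using klin_laws(6)[OF g, of "hcounit H h" "\<one>\<^bsub>H\<^esub>"] h by simp
  finally show ?thesis .
qed

lemma antipode_r:
  assumes g: "klin k Hk M g" and h: "h \<in> carrier Hk"
  shows "tlift M (\<lambda>u v. g (u \<cdot> S v)) (hcomult H h) = hcounit H h \<odot>\<^bsub>M\<^esub> g \<one>\<^bsub>H\<^esub>"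
proof -
  have b: "kbil k Hk Hk Hk (\<lambda>u v. u \<cdot> S v)" by (assumption | rule kl)+
  have "tlift M (\<lambda>u v. g (u \<cdot> S v)) (hcomult H h) = g (tlift Hk (\<lambda>u v. u \<cdot> S v) (hcomult H h))"
    by (rule tlift_fusion[OF g b, symmetric]) (use h Hc.comult_closed in simp)
  also have "tlift Hk (\<lambda>u v. u \<cdot> S v) (hcomult H h) = hcounit H h \<odot>\<^bsub>H\<^esub> \<one>\<^bsub>H\<^esub>"
    using hopf h by (simp add: commutative_hopf_algebra_def Let_def tlift_H)
  also have "g \<dots> = hcounit H h \<odot>\<^bsub>M\<^esub> g \<one>\<^bsub>H\<^esub>"
    using klin_laws(6)[OF g, of "hcounit H h" "\<one>\<^bsub>H\<^esub>"] h by simp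
  finally show ?thesis .
qed

text \<open>The antipode axiom at 1, whose coproduct is 1 \<otimes> 1.\<close>

lemma antipode_one: "S \<one>\<^bsub>H\<^esub> = \<one>\<^bsub>H\<^esub>"
proof -
  have b: "kbil k Hk Hk Hk (\<lambda>u v. S u \<cdot> v)" by (assumption | rule kl)+
  have "S \<one>\<^bsub>H\<^esub> \<cdot> \<one>\<^bsub>H\<^esub> = tlift Hk (\<lambda>u v. S u \<cdot> v) (hcomult H \<one>\<^bsub>H\<^esub>)"
    unfolding hcomult_mult(2) by (rule tlift_etens[OF b, symmetric]) simp_all
  also have "\<dots> = hcounit H \<one>\<^bsub>H\<^esub> \<odot>\<^bsub>Hk\<^esub> \<one>\<^bsub>H\<^esub>"
    by (rule antipode_l[of Hk "\<lambda>h. h"]) (simp_all add: klin_id kmod_Hk)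
  also have "\<dots> = \<one>\<^bsub>H\<^esub>" using ring_hom_one[OF hcounit_hom] by simp
  finally show ?thesis by simp
qed

text \<open>The identity \<open>\<Sum> S(g\<^sub>1h)g\<^sub>2 = \<epsilon>(g)S(h)\<close> is obtained by inserting \<open>h\<^sub>2S(h\<^sub>3)\<close>.\<close>

lemma antipode_mult_aux:
  assumes g: "g \<in> carrier H" and h: "h \<in> carrier H"
  shows "tlift Hk (\<lambda>u v. S (u \<cdot> h) \<cdot> v) (hcomult H g) = hcounit H g \<odot>\<^bsub>H\<^esub> S h"
proof -
  have g': "g \<in> carrier Hk" and h': "h \<in> carrier Hk" using g h by simp_all
  have dg: "hcomult H g \<in> carrier (Hk \<boxtimes>\<^bsub>k\<^esub> Hk)" by (rule Hc.comult_closed[OF g'])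
  have "tlift Hk (\<lambda>u v. S (u \<cdot> h) \<cdot> v) (hcomult H g) =
    tlift Hk (\<lambda>a h''. hcounit H h'' \<odot>\<^bsub>Hk\<^esub>
       tlift Hk (\<lambda>u v. S (u \<cdot> a) \<cdot> v) (hcomult H g)) (hcomult H h)"
    by (rule Hc.counit_r[OF _ h', symmetric]) (assumption | rule kl dg)+
  also have "\<dots> = tlift Hk (\<lambda>a h''. tlift Hk (\<lambda>b c.
       tlift Hk (\<lambda>u v. S (u \<cdot> a) \<cdot> v) (hcomult H g) \<cdot> (b \<cdot> S c)) (hcomult H h'')) (hcomult H h)"
  proof (rule tlift_cong[OF _ _ Hc.comult_closed[OF h']])
    show "kbil k Hk Hk Hk (\<lambda>a h''. hcounit H h'' \<odot>\<^bsub>Hk\<^esub>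
       tlift Hk (\<lambda>u v. S (u \<cdot> a) \<cdot> v) (hcomult H g))"
      by (assumption | rule kl dg)+
    fix a h'' assume ah: "a \<in> carrier Hk" "h'' \<in> carrier Hk"
    let ?X = "tlift Hk (\<lambda>u v. S (u \<cdot> a) \<cdot> v) (hcomult H g)"
    have X: "?X \<in> carrier Hk" by (assumption | rule kl ah dg)+
    have "tlift Hk (\<lambda>b c. ?X \<cdot> (b \<cdot> S c)) (hcomult H h'') = hcounit H h'' \<odot>\<^bsub>Hk\<^esub> (?X \<cdot> \<one>\<^bsub>H\<^esub>)"
      by (rule antipode_r) (assumption | rule kl ah X | simp add: ah X)+
    then show "hcounit H h'' \<odot>\<^bsub>Hk\<^esub> ?X = tlift Hk (\<lambda>b c. ?X \<cdot> (b \<cdot> S c)) (hcomult H h'')"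
      using X by simp
  qed
  also have "\<dots> = tlift Hk (\<lambda>h'' c. tlift Hk (\<lambda>a b.
       tlift Hk (\<lambda>u v. S (u \<cdot> a) \<cdot> v) (hcomult H g) \<cdot> (b \<cdot> S c)) (hcomult H h'')) (hcomult H h)"
    by (rule Hc.coassoc[OF _ h', symmetric]) (assumption | rule kl dg)+
  also have "\<dots> = tlift Hk (\<lambda>h'' c. hcounit H h'' \<odot>\<^bsub>Hk\<^esub> (hcounit H g \<odot>\<^bsub>Hk\<^esub> S c)) (hcomult H h)"
  proof (rule tlift_cong[OF _ _ Hc.comult_closed[OF h']])
    show "kbil k Hk Hk Hk (\<lambda>h'' c. tlift Hk (\<lambda>a b.
       tlift Hk (\<lambda>u v. S (u \<cdot> a) \<cdot> v) (hcomult H g) \<cdot> (b \<cdot> S c)) (hcomult H h''))"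
      by (assumption | rule kl dg)+
    fix h'' c assume hc: "h'' \<in> carrier Hk" "c \<in> carrier Hk"
    have dh: "hcomult H h'' \<in> carrier (Hk \<boxtimes>\<^bsub>k\<^esub> Hk)" by (rule Hc.comult_closed[OF hc(1)])
    have "tlift Hk (\<lambda>a b. tlift Hk (\<lambda>u v. S (u \<cdot> a) \<cdot> v) (hcomult H g) \<cdot> (b \<cdot> S c)) (hcomult H h'')
      = tlift Hk (\<lambda>a b. tlift Hk (\<lambda>u v. S (u \<cdot> a) \<cdot> (v \<cdot> b) \<cdot> S c) (hcomult H g)) (hcomult H h'')"
    proof (rule tlift_cong[OF _ _ dh])
      show "kbil k Hk Hk Hk (\<lambda>a b. tlift Hk (\<lambda>u v. S (u \<cdot> a) \<cdot> v) (hcomult H g) \<cdot> (b \<cdot> S c))"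
        by (assumption | rule kl dg hc)+
      fix a b assume ab: "a \<in> carrier Hk" "b \<in> carrier Hk"
      have "tlift Hk (\<lambda>u v. S (u \<cdot> a) \<cdot> v) (hcomult H g) \<cdot> (b \<cdot> S c) =
        tlift Hk (\<lambda>u v. S (u \<cdot> a) \<cdot> v \<cdot> (b \<cdot> S c)) (hcomult H g)"
        by (rule tlift_fusion[OF _ _ dg]) (assumption | rule kl ab hc)+
      also have "\<dots> = tlift Hk (\<lambda>u v. S (u \<cdot> a) \<cdot> (v \<cdot> b) \<cdot> S c) (hcomult H g)"
      proof (rule tlift_cong[OF _ _ dg])
        show "kbil k Hk Hk Hk (\<lambda>u v. S (u \<cdot> a) \<cdot> v \<cdot> (b \<cdot> S c))"
          by (assumption | rule kl ab hc)+
      qed (use ab hc in \<open>simp add: H_m_assoc\<close>)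
      finally show "tlift Hk (\<lambda>u v. S (u \<cdot> a) \<cdot> v) (hcomult H g) \<cdot> (b \<cdot> S c) =
        tlift Hk (\<lambda>u v. S (u \<cdot> a) \<cdot> (v \<cdot> b) \<cdot> S c) (hcomult H g)" .
    qed
    also have "\<dots> = tlift Hk (\<lambda>u v. tlift Hk (\<lambda>a b. S (u \<cdot> a) \<cdot> (v \<cdot> b) \<cdot> S c) (hcomult H h'')) (hcomult H g)"
      by (rule tlift_swap[OF dh dg]) (assumption | rule kl hc)+
    \<comment> \<open>The products \<open>u \<cdot> a\<close> and \<open>v \<cdot> b\<close> are the
      legs of the coproduct of \<open>g \<cdot> h''\<close>, so the antipode axiom for that element
      contracts the sum.\<close>
    also have "\<dots> = tlift Hk (\<lambda>x y. S x \<cdot> y \<cdot> S c) (hcomult H (g \<cdot> h''))"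
      using hc g by (subst hcomult_mult(1))
        (simp_all, rule tlift_tmap2[OF _ dg dh kbil_mult kbil_mult, symmetric], (assumption | rule kl | simp)+)
    also have "\<dots> = hcounit H (g \<cdot> h'') \<odot>\<^bsub>Hk\<^esub> (\<one>\<^bsub>H\<^esub> \<cdot> S c)"
      by (rule antipode_l) (assumption | rule kl hc g' hc[simplified] g | simp)+
    also have "\<dots> = hcounit H h'' \<odot>\<^bsub>Hk\<^esub> (hcounit H g \<odot>\<^bsub>Hk\<^esub> S c)"
      using hc g ring_hom_mult[OF hcounit_hom] by (simp add: A.smult_assoc1[symmetric] A.R.m_comm)
    finally show "tlift Hk (\<lambda>a b. tlift Hk (\<lambda>u v. S (u \<cdot> a) \<cdot> v) (hcomult H g) \<cdot> (b \<cdot> S c)) (hcomult H h'')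
      = hcounit H h'' \<odot>\<^bsub>Hk\<^esub> (hcounit H g \<odot>\<^bsub>Hk\<^esub> S c)" .
  qed
  also have "\<dots> = hcounit H g \<odot>\<^bsub>Hk\<^esub> S h"
    by (rule Hc.counit_l[OF _ h']) (assumption | rule kl g | simp add: g)+
  finally show ?thesis by simp
qed

text \<open>S(gh) = S(g1 h) g2 S(g3), and \<open>antipode_mult_aux\<close> contracts the first two
  factors to \<epsilon>(g1) S(h). The order of the factors comes out reversed, as in any Hopf
  algebra; commutativity restores it.\<close>

lemma antipode_mult:
  assumes g: "g \<in> carrier H" and h: "h \<in> carrier H"
  shows "S (g \<cdot> h) = S g \<cdot> S h"
proof -
  have g': "g \<in> carrier Hk" and h': "h \<in> carrier Hk" using g h by simp_all
  have "S (g \<cdot> h) = tlift Hk (\<lambda>a b. hcounit H b \<odot>\<^bsub>Hk\<^esub> S (a \<cdot> h)) (hcomult H g)"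
    by (rule Hc.counit_r[OF _ g', symmetric]) (assumption | rule kl h')+
  also have "\<dots> = tlift Hk (\<lambda>a b. tlift Hk (\<lambda>u v. S (a \<cdot> h) \<cdot> (u \<cdot> S v)) (hcomult H b)) (hcomult H g)"
  proof (rule tlift_cong[OF _ _ Hc.comult_closed[OF g']])
    show "kbil k Hk Hk Hk (\<lambda>a b. hcounit H b \<odot>\<^bsub>Hk\<^esub> S (a \<cdot> h))" by (assumption | rule kl h')+
    fix a b assume ab: "a \<in> carrier Hk" "b \<in> carrier Hk"
    have "tlift Hk (\<lambda>u v. S (a \<cdot> h) \<cdot> (u \<cdot> S v)) (hcomult H b) = hcounit H b \<odot>\<^bsub>Hk\<^esub> (S (a \<cdot> h) \<cdot> \<one>\<^bsub>H\<^esub>)"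
      by (rule antipode_r) (assumption | rule kl ab h' | simp add: ab h')+
    then show "hcounit H b \<odot>\<^bsub>Hk\<^esub> S (a \<cdot> h) = tlift Hk (\<lambda>u v. S (a \<cdot> h) \<cdot> (u \<cdot> S v)) (hcomult H b)"
      using ab h by simp
  qed
  also have "\<dots> = tlift Hk (\<lambda>b v. tlift Hk (\<lambda>a u. S (a \<cdot> h) \<cdot> (u \<cdot> S v)) (hcomult H b)) (hcomult H g)"
    by (rule Hc.coassoc[OF _ g', symmetric]) (assumption | rule kl h')+
  also have "\<dots> = tlift Hk (\<lambda>b v. hcounit H b \<odot>\<^bsub>Hk\<^esub> (S h \<cdot> S v)) (hcomult H g)"
  proof (rule tlift_cong[OF _ _ Hc.comult_closed[OF g']])
    show "kbil k Hk Hk Hk (\<lambda>b v. tlift Hk (\<lambda>a u. S (a \<cdot> h) \<cdot> (u \<cdot> S v)) (hcomult H b))"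
      by (assumption | rule kl h')+
    fix b v assume bv: "b \<in> carrier Hk" "v \<in> carrier Hk"
    have db: "hcomult H b \<in> carrier (Hk \<boxtimes>\<^bsub>k\<^esub> Hk)" by (rule Hc.comult_closed[OF bv(1)])
    have "tlift Hk (\<lambda>a u. S (a \<cdot> h) \<cdot> (u \<cdot> S v)) (hcomult H b) =
      tlift Hk (\<lambda>a u. S (a \<cdot> h) \<cdot> u \<cdot> S v) (hcomult H b)"
    proof (rule tlift_cong[OF _ _ db])
      show "kbil k Hk Hk Hk (\<lambda>a u. S (a \<cdot> h) \<cdot> (u \<cdot> S v))"
        by (assumption | rule kl h' bv)+
    qed (use h bv in \<open>simp add: H_m_assoc\<close>)
    also have "\<dots> = tlift Hk (\<lambda>a u. S (a \<cdot> h) \<cdot> u) (hcomult H b) \<cdot> S v"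
      by (rule tlift_fusion[OF _ _ db, symmetric]) (assumption | rule kl h' bv)+
    also have "\<dots> = hcounit H b \<odot>\<^bsub>Hk\<^esub> (S h \<cdot> S v)"
      using bv h by (simp add: antipode_mult_aux A.smult_assoc2)
    finally show "tlift Hk (\<lambda>a u. S (a \<cdot> h) \<cdot> (u \<cdot> S v)) (hcomult H b) =
      hcounit H b \<odot>\<^bsub>Hk\<^esub> (S h \<cdot> S v)" .
  qed
  also have "\<dots> = S h \<cdot> S g"
    by (rule Hc.counit_l[OF _ g']) (assumption | rule kl h')+
  finally show ?thesis using g h by (simp add: H_m_comm)
qed

text \<open>Inserting S(h2) h3 gives S(S(h1)) S(h2) h3. By multiplicativity the first two factors
  are S(S(h1) h2), which the antipode axiom contracts to \<epsilon>(h1).\<close>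

lemma antipode_antipode:
  assumes h: "h \<in> carrier H" shows "S (S h) = h"
proof -
  have h': "h \<in> carrier Hk" using h by simp
  have "S (S h) = tlift Hk (\<lambda>a b. hcounit H b \<odot>\<^bsub>Hk\<^esub> S (S a)) (hcomult H h)"
    by (rule Hc.counit_r[OF _ h', symmetric]) (assumption | rule kl)+
  also have "\<dots> = tlift Hk (\<lambda>a b. tlift Hk (\<lambda>u v. S (S a) \<cdot> (S u \<cdot> v)) (hcomult H b)) (hcomult H h)"
  proof (rule tlift_cong[OF _ _ Hc.comult_closed[OF h']])
    show "kbil k Hk Hk Hk (\<lambda>a b. hcounit H b \<odot>\<^bsub>Hk\<^esub> S (S a))" by (assumption | rule kl)+
    fix a b assume ab: "a \<in> carrier Hk" "b \<in> carrier Hk"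
    have "tlift Hk (\<lambda>u v. S (S a) \<cdot> (S u \<cdot> v)) (hcomult H b) = hcounit H b \<odot>\<^bsub>Hk\<^esub> (S (S a) \<cdot> \<one>\<^bsub>H\<^esub>)"
      by (rule antipode_l) (assumption | rule kl ab | simp add: ab)+
    then show "hcounit H b \<odot>\<^bsub>Hk\<^esub> S (S a) = tlift Hk (\<lambda>u v. S (S a) \<cdot> (S u \<cdot> v)) (hcomult H b)"
      using ab by simp
  qed
  also have "\<dots> = tlift Hk (\<lambda>b v. tlift Hk (\<lambda>a u. S (S a) \<cdot> (S u \<cdot> v)) (hcomult H b)) (hcomult H h)"
    by (rule Hc.coassoc[OF _ h', symmetric]) (assumption | rule kl)+
  also have "\<dots> = tlift Hk (\<lambda>b v. hcounit H b \<odot>\<^bsub>Hk\<^esub> v) (hcomult H h)"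
  proof (rule tlift_cong[OF _ _ Hc.comult_closed[OF h']])
    show "kbil k Hk Hk Hk (\<lambda>b v. tlift Hk (\<lambda>a u. S (S a) \<cdot> (S u \<cdot> v)) (hcomult H b))"
      by (assumption | rule kl)+
    fix b v assume bv: "b \<in> carrier Hk" "v \<in> carrier Hk"
    have db: "hcomult H b \<in> carrier (Hk \<boxtimes>\<^bsub>k\<^esub> Hk)" by (rule Hc.comult_closed[OF bv(1)])
    have "tlift Hk (\<lambda>a u. S (S a) \<cdot> (S u \<cdot> v)) (hcomult H b) =
      tlift Hk (\<lambda>a u. S (S a \<cdot> u) \<cdot> v) (hcomult H b)"
    proof (rule tlift_cong[OF _ _ db])
      show "kbil k Hk Hk Hk (\<lambda>a u. S (S a) \<cdot> (S u \<cdot> v))"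
        by (assumption | rule kl bv)+
    qed (use bv in \<open>simp add: H_m_assoc antipode_mult\<close>)
    also have "\<dots> = hcounit H b \<odot>\<^bsub>Hk\<^esub> (S \<one>\<^bsub>H\<^esub> \<cdot> v)"
      by (rule antipode_l) (assumption | rule kl bv | simp add: bv)+
    finally show "tlift Hk (\<lambda>a u. S (S a) \<cdot> (S u \<cdot> v)) (hcomult H b) = hcounit H b \<odot>\<^bsub>Hk\<^esub> v"
      using bv by (simp add: antipode_one)
  qed
  also have "\<dots> = h" by (rule Hc.counit_l[OF _ h']) (assumption | rule kl)+
  finally show ?thesis .
qed

text \<open>Since S is an involution, the S^-1 in the actions on the pen may be read as S.\<close>

lemma antipode_inv [simp]: "h \<in> carrier H \<Longrightarrow> antipode_inv H h = S h"
proof -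
  assume h: "h \<in> carrier H"
  have "inj_on S (carrier H)" by (metis antipode_antipode inj_onI)
  then have "inv_into (carrier H) S (S (S h)) = S h" using h by (simp add: inv_into_f_f)
  then show ?thesis by (simp add: antipode_inv_def antipode_antipode h)
qed

lemma antipode_ring_hom: "S \<in> ring_hom H H"
  by (rule ring_hom_memI)
    (use klin_laws(5)[OF antipode_klin] in \<open>simp_all add: antipode_mult antipode_one\<close>)

lemma antipode_inv_ring_hom: "antipode_inv H \<in> ring_hom H H"
  by (rule ring_hom_memI)
    (use ring_hom_add[OF antipode_ring_hom] in \<open>simp_all add: antipode_mult antipode_one\<close>)

end

text \<open>\<open>tlift_fusion\<close> and \<open>tlift_cong\<close> in one: the pushed summand has
  to be computed on elements of the factors only.\<close>

lemma tlift_push: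
  assumes g: "klin k A B g" and f: "kbil k M N A f" and t: "t \<in> carrier (M \<boxtimes>\<^bsub>k\<^esub> N)"
    and eq: "\<And>x y. x \<in> carrier M \<Longrightarrow> y \<in> carrier N \<Longrightarrow> g (f x y) = h x y"
  shows "g (tlift A f t) = tlift B h t"
proof -
  have "kbil k M N B (\<lambda>x y. g (f x y))"
    by (rule kbil_intro[OF kbil_laws(1,2)[OF f]]) (auto intro!: klin_comp[OF g] kbil_laws[OF f])
  then show ?thesis using tlift_fusion[OF g f t] tlift_cong[OF _ eq t] by simp
qed

subsection \<open>Bimodules over the Hopf algebra\<close>

context comm_hopf
begin

lemma unit_map_closed [simp]: "a \<in> carrier k \<Longrightarrow> unit_map H a \<in> carrier H"
  by (simp add: unit_map_def)

lemma unit_map_mult: "a \<in> carrier k \<Longrightarrow> h \<in> carrier H \<Longrightarrow> unit_map H a \<otimes>\<^bsub>H\<^esub> h = a \<odot>\<^bsub>H\<^esub> h"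
  by (simp add: unit_map_def A.smult_assoc2)

lemma unit_map_ring_hom: "unit_map H \<in> ring_hom k H"
  by (rule ring_hom_memI)
    (simp_all add: unit_map_mult, simp_all add: unit_map_def A.smult_l_distr A.smult_assoc1)

definition hbimod where
  "hbimod M \<longleftrightarrow> is_bimodule H H M \<and> k_central k H M"

lemma hbimod_bimodule: "hbimod M \<Longrightarrow> is_bimodule H H M" by (simp add: hbimod_def)

lemma hbimod_restr:
  assumes "hbimod M"
  shows "is_bimodule k H (lk H M)" "is_bimodule H k (rk H M)" "is_bimodule k k (kk H M)"
  using assms unit_map_ring_hom cring_k unfolding lk_def rk_def kk_def hbimod_def
  by (auto intro!: bimodule_lrestr bimodule_rrestr)

lemma hbimod_central:
  "hbimod M \<Longrightarrow> a \<in> carrier k \<Longrightarrow> x \<in> carrier M \<Longrightarrow> rsmult M x (unit_map H a) = unit_map H a \<odot>\<^bsub>M\<^esub> x"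
  by (simp add: hbimod_def k_central_def)

lemma kmod_kk: "hbimod M \<Longrightarrow> kmod k (kk H M)"
  by (simp add: kmod_def hbimod_restr hbimod_central)

text \<open>The relations over \<open>k\<close> involve the inner actions only, so restricting the
  outer H-actions afterwards or beforehand gives the same record. Calculations with H-bimodules over
  \<open>k\<close> thereby become calculations with k-modules.\<close>

lemma kk_ktensor: "kk H (rk H M \<boxtimes>\<^bsub>k\<^esub> lk H N) = kk H M \<boxtimes>\<^bsub>k\<^esub> kk H N"
proof -
  have T: "tensor_group k (rk H M) (lk H N) = tensor_group k (kk H M) (kk H N)"
    by (simp add: tensor_group_def tensor_relations_def)
  show ?thesis
    by (rule bimodule_eqI) (simp_all add: kk_def lk_def rk_def lrestr_def rrestr_def tensor_def Let_def
        T[unfolded kk_def lk_def rk_def lrestr_def rrestr_def, simplified])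
qed

lemma ktensor_zero:
  "zero (rk H M \<boxtimes>\<^bsub>k\<^esub> lk H N) = zero (kk H M \<boxtimes>\<^bsub>k\<^esub> kk H N)"
  "carrier (rk H M \<boxtimes>\<^bsub>k\<^esub> lk H N) = carrier (kk H M \<boxtimes>\<^bsub>k\<^esub> kk H N)"
  "add (rk H M \<boxtimes>\<^bsub>k\<^esub> lk H N) = add (kk H M \<boxtimes>\<^bsub>k\<^esub> kk H N)"
  using kk_ktensor[of M N] kk_sel(1-3)[of H "rk H M \<boxtimes>\<^bsub>k\<^esub> lk H N"] by simp_all

lemma etens_ktensor: "etens (rk H M \<boxtimes>\<^bsub>k\<^esub> lk H N) = etens (kk H M \<boxtimes>\<^bsub>k\<^esub> kk H N)"
  by (rule etens_cong_ring, rule ktensor_zero)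

lemma tlift_ktensor: "tlift (rk H M \<boxtimes>\<^bsub>k\<^esub> lk H N) = tlift (kk H M \<boxtimes>\<^bsub>k\<^esub> kk H N)"
  by (rule tlift_cong_ring; rule ktensor_zero)

lemma tlift_kk: "tlift (kk H M) = tlift M" by (rule tlift_cong_ring) simp_all

lemma hbimod_ktensor:
  assumes M: "hbimod M" and N: "hbimod N" shows "hbimod (rk H M \<boxtimes>\<^bsub>k\<^esub> lk H N)"
proof -
  have "kmod k (kk H (rk H M \<boxtimes>\<^bsub>k\<^esub> lk H N))"
    unfolding kk_ktensor by (intro kmod_tensor kmod_kk M N)
  then have "rsmult (rk H M \<boxtimes>\<^bsub>k\<^esub> lk H N) x (unit_map H a) = unit_map H a \<odot>\<^bsub>rk H M \<boxtimes>\<^bsub>k\<^esub> lk H N\<^esub> x"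
    if "a \<in> carrier k" "x \<in> carrier (rk H M \<boxtimes>\<^bsub>k\<^esub> lk H N)" for a x
    using kmod_laws(5)[of k "kk H (rk H M \<boxtimes>\<^bsub>k\<^esub> lk H N)" a x] that by (simp del: tensor_sel)
  then show ?thesis
    using tensor_bimodule(1)[OF hbimod_restr(2)[OF M] hbimod_restr(1)[OF N]]
    by (simp add: hbimod_def k_central_def del: tensor_sel)
qed

lemma hbimod_tensor:
  assumes M: "hbimod M" and N: "hbimod N" shows "hbimod (M \<boxtimes>\<^bsub>H\<^esub> N)"
proof -
  note T = tensor_bimodule[OF hbimod_bimodule[OF M] hbimod_bimodule[OF N]]
  note e = etens_rules[OF hbimod_bimodule[OF M] hbimod_bimodule[OF N]]
  note L = is_bimodule_laws[OF T(1)]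
  have "unit_map H a \<odot>\<^bsub>M \<boxtimes>\<^bsub>H\<^esub> N\<^esub> t = rsmult (M \<boxtimes>\<^bsub>H\<^esub> N) t (unit_map H a)"
    if a: "a \<in> carrier k" and t: "t \<in> carrier (M \<boxtimes>\<^bsub>H\<^esub> N)" for a t
    using bimodule_tensorable[OF hbimod_bimodule[OF M] hbimod_bimodule[OF N]]
      L(6)[OF unit_map_closed[OF a]] L(7)[OF unit_map_closed[OF a]] _ t
  proof (rule tensor_ext_gen)
    fix x y assume "x \<in> carrier M" "y \<in> carrier N"
    then show "unit_map H a \<odot>\<^bsub>M \<boxtimes>\<^bsub>H\<^esub> N\<^esub> etens (M \<boxtimes>\<^bsub>H\<^esub> N) x y =
        rsmult (M \<boxtimes>\<^bsub>H\<^esub> N) (etens (M \<boxtimes>\<^bsub>H\<^esub> N) x y) (unit_map H a)"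
      using a e(4)[of x "unit_map H a" y] by (simp add: T(2,3) hbimod_central[OF M] hbimod_central[OF N] del: tensor_sel)
  qed
  with T(1) show ?thesis by (simp add: hbimod_def k_central_def)
qed

lemma hbimod_bimod_of: "module H M \<Longrightarrow> hbimod (bimod_of M)"
  by (simp add: hbimod_def bimodule_bimod_of k_central_def)

definition pen_of :: "('h, 'h, 'a) bimodule \<Rightarrow> ('h, 'h, 'a) bimodule" where
  "pen_of M = lrestr (antipode_inv H) (rrestr (antipode_inv H) M)"

lemma pen_of_sel [simp]:
  "carrier (pen_of M) = carrier M" "zero (pen_of M) = zero M" "add (pen_of M) = add M"
  "smult (pen_of M) = (\<lambda>h x. antipode_inv H h \<odot>\<^bsub>M\<^esub> x)" "rsmult (pen_of M) = (\<lambda>x h. rsmult M x (antipode_inv H h))"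
  by (simp_all add: pen_of_def)

lemma antipode_unit_map: "a \<in> carrier k \<Longrightarrow> S (unit_map H a) = unit_map H a"
  using klin_laws(6)[OF antipode_klin, of a "\<one>\<^bsub>H\<^esub>"] by (simp add: unit_map_def antipode_one)

lemma hbimod_pen_of:
  assumes "hbimod M" shows "hbimod (pen_of M)"
proof -
  have "is_bimodule H H (pen_of M)"
    unfolding pen_of_def
    by (rule bimodule_lrestr[OF bimodule_rrestr[OF hbimod_bimodule[OF assms] antipode_inv_ring_hom cring_H]
          antipode_inv_ring_hom cring_H])
  then show ?thesis
    using hbimod_central[OF assms] by (simp add: hbimod_def k_central_def antipode_unit_map)
qed

lemma hsmult_lin [kl]:
  assumes f: "klin k P (kk H M) f" and h: "h \<in> carrier Hk" and M: "hbimod M"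
  shows "klin k P (kk H M) (\<lambda>z. h \<odot>\<^bsub>M\<^esub> f z)" "klin k P (kk H M) (\<lambda>z. rsmult M (f z) h)"
proof -
  note L = is_bimodule_laws[OF hbimod_bimodule[OF M]]
  have h': "h \<in> carrier H" using h by simp
  have "klin k (kk H M) (kk H M) (\<lambda>z. h \<odot>\<^bsub>M\<^esub> z)"
  proof (rule klinI[OF kmod_kk[OF M] kmod_kk[OF M]])
    fix a x assume "a \<in> carrier k" "x \<in> carrier (kk H M)"
    then show "h \<odot>\<^bsub>M\<^esub> (a \<odot>\<^bsub>kk H M\<^esub> x) = a \<odot>\<^bsub>kk H M\<^esub> (h \<odot>\<^bsub>M\<^esub> x)"
      using h' by (simp add: L(10)[symmetric] H_m_comm[of h])
  qed (use h' L(4) additive_add[OF L(6)[OF h']] in simp_all)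
  then show "klin k P (kk H M) (\<lambda>z. h \<odot>\<^bsub>M\<^esub> f z)" using f by (rule klin_comp)
  have "klin k (kk H M) (kk H M) (\<lambda>z. rsmult M z h)"
    by (rule klinI[OF kmod_kk[OF M] kmod_kk[OF M]])
      (use h' L(5,14) additive_add[OF L(7)[OF h']] in simp_all)
  then show "klin k P (kk H M) (\<lambda>z. rsmult M (f z) h)" using f by (rule klin_comp)
qed

lemma hact_lin [kl]:
  assumes f: "klin k P Hk f" and x: "x \<in> carrier (kk H M)" and M: "hbimod M"
  shows "klin k P (kk H M) (\<lambda>z. f z \<odot>\<^bsub>M\<^esub> x)" "klin k P (kk H M) (\<lambda>z. rsmult M x (f z))"
proof -
  note L = is_bimodule_laws[OF hbimod_bimodule[OF M]]
  have x': "x \<in> carrier M" using x by simp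
  have "klin k Hk (kk H M) (\<lambda>z. z \<odot>\<^bsub>M\<^esub> x)"
    by (rule klinI[OF kmod_Hk kmod_kk[OF M]])
      (use x' L(4,8) in \<open>simp_all add: unit_map_mult[symmetric] L(10)\<close>)
  then show "klin k P (kk H M) (\<lambda>z. f z \<odot>\<^bsub>M\<^esub> x)" using f by (rule klin_comp)
  have "klin k Hk (kk H M) (\<lambda>z. rsmult M x z)"
  proof (rule klinI[OF kmod_Hk kmod_kk[OF M]])
    fix a h assume "a \<in> carrier k" "h \<in> carrier Hk"
    then show "rsmult M x (a \<odot>\<^bsub>Hk\<^esub> h) = a \<odot>\<^bsub>kk H M\<^esub> rsmult M x h"
      using x' by (simp add: unit_map_mult[symmetric] L(5,11) hbimod_central[OF M])
  qed (use x' L(5,9) in simp_all)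
  then show "klin k P (kk H M) (\<lambda>z. rsmult M x (f z))" using f by (rule klin_comp)
qed

lemma hact_closed [kl]:
  assumes "hbimod M" "x \<in> carrier (kk H M)" "h \<in> carrier Hk"
  shows "h \<odot>\<^bsub>M\<^esub> x \<in> carrier (kk H M)" "rsmult M x h \<in> carrier (kk H M)"
  using assms is_bimodule_laws(4,5)[OF hbimod_bimodule[OF assms(1)]] by simp_all

end

subsection \<open>Module coalgebras\<close>

locale mod_coalg = comm_hopf k H
  for k :: "('k, 'x) ring_scheme" and H :: "('k, 'h, 'z) hopf_scheme" +
  fixes C :: "('k, 'h, 'c, 'w) module_coalgebra_scheme"
  assumes mc: "is_module_coalgebra k H C"
begin

abbreviation Ck where "Ck \<equiv> kk H (bimod_of C)"
abbreviation CC where "CC \<equiv> Ck \<boxtimes>\<^bsub>k\<^esub> Ck"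
abbreviation CH where "CH \<equiv> Ck \<boxtimes>\<^bsub>k\<^esub> bimod_of H"
abbreviation act where "act \<equiv> \<lambda>c h. h \<odot>\<^bsub>C\<^esub> c"

lemma module_C: "module H C" using mc by (simp add: is_module_coalgebra_def Let_def)
sublocale C: module H C by (rule module_C)

lemma hbimod_C [kl]: "hbimod (bimod_of C)" by (rule hbimod_bimod_of[OF module_C])
lemma kmod_Ck [kl]: "kmod k Ck" by (rule kmod_kk[OF hbimod_C])

sublocale Cc: coalg k Ck "comult C" "counit C"
  by unfold_locales (use mc kmod_Ck kmod_Rk in \<open>simp_all add: is_module_coalgebra_def Let_def\<close>)

lemma act_lin [kl]:
  "klin k P Ck f \<Longrightarrow> h \<in> carrier Hk \<Longrightarrow> klin k P Ck (\<lambda>z. h \<odot>\<^bsub>C\<^esub> f z)"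
  "klin k P Hk g \<Longrightarrow> x \<in> carrier Ck \<Longrightarrow> klin k P Ck (\<lambda>z. g z \<odot>\<^bsub>C\<^esub> x)"
  using hsmult_lin(1)[OF _ _ hbimod_C] hact_lin(1)[OF _ _ hbimod_C] by simp_all

lemma act_closed [kl]: "x \<in> carrier Ck \<Longrightarrow> h \<in> carrier Hk \<Longrightarrow> h \<odot>\<^bsub>C\<^esub> x \<in> carrier Ck"
  by simp

lemma kbil_act: "kbil k Ck Hk Ck act"
  by (assumption | rule kl)+

lemma comult_act:
  "c \<in> carrier C \<Longrightarrow> h \<in> carrier H \<Longrightarrow> comult C (h \<odot>\<^bsub>C\<^esub> c) =
    tmap2 CC act act (comult C c) (hcomult H h)"
  "c \<in> carrier C \<Longrightarrow> h \<in> carrier H \<Longrightarrow> counit C (h \<odot>\<^bsub>C\<^esub> c) = counit C c \<otimes>\<^bsub>k\<^esub> hcounit H h"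
  using mc by (simp_all add: is_module_coalgebra_def Let_def)

lemma act_ksmult:
  "a \<in> carrier k \<Longrightarrow> h \<in> carrier H \<Longrightarrow> c \<in> carrier C \<Longrightarrow> (a \<odot>\<^bsub>H\<^esub> h) \<odot>\<^bsub>C\<^esub> c = a \<odot>\<^bsub>Ck\<^esub> (h \<odot>\<^bsub>C\<^esub> c)"
  by (simp add: unit_map_mult[symmetric] C.smult_assoc1)

text \<open>\<open>twist c h\<close> is \<open>c\<^sub>1 \<otimes> c\<^sub>2h\<close>, the value of the Galois map at \<open>c \<otimes> h\<close>.\<close>

definition twist where
  "twist c h = tlift CC (\<lambda>u v. etens CC u (h \<odot>\<^bsub>C\<^esub> v)) (comult C c)"

lemma twist_tmap: "twist c h = tmap CC (\<lambda>x. x) (\<lambda>y. h \<odot>\<^bsub>C\<^esub> y) (comult C c)"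
  by (simp add: twist_def tmap_def)

lemma kbil_twist: "kbil k Ck Hk CC twist"
  unfolding twist_def by (assumption | rule kl)+

lemma twist_lin [kl]:
  "klin k P Ck f \<Longrightarrow> h \<in> carrier Hk \<Longrightarrow> klin k P CC (\<lambda>z. twist (f z) h)"
  "klin k P Hk g \<Longrightarrow> x \<in> carrier Ck \<Longrightarrow> klin k P CC (\<lambda>z. twist x (g z))"
  using klin_comp[OF kbil_laws(4)[OF kbil_twist]] klin_comp[OF kbil_laws(5)[OF kbil_twist]] by blast+

lemma twist_closed [kl]: "c \<in> carrier Ck \<Longrightarrow> h \<in> carrier Hk \<Longrightarrow> twist c h \<in> carrier CC"
  by (rule kbil_laws(6)[OF kbil_twist])

lemma twist_one:
  assumes "c \<in> carrier C" shows "twist c \<one>\<^bsub>H\<^esub> = comult C c"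
proof -
  have "twist c \<one>\<^bsub>H\<^esub> = tlift CC (\<lambda>u v. etens CC u v) (comult C c)"
    unfolding twist_def by (rule tlift_cong[OF _ _ Cc.comult_closed]) (assumption | rule kl | simp add: assms)+
  then show ?thesis using tlift_id[OF kmod_Ck kmod_Ck Cc.comult_closed] assms by simp
qed

lemma galois_map_tlift: "galois_map k H C = tlift CC twist"
  by (simp add: galois_map_def Let_def twist_tmap[abs_def])

lemma galois_map_klin: "klin k CH CC (galois_map k H C)"
  unfolding galois_map_tlift by (rule klin_tlift0[OF kbil_twist])

lemma galois_map_etens: "c \<in> carrier C \<Longrightarrow> h \<in> carrier H \<Longrightarrow> galois_map k H C (etens CH c h) = twist c h"
  unfolding galois_map_tlift by (rule tlift_etens[OF kbil_twist]) simp_all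

lemma tlift_twist:
  assumes F: "kbil k Ck Ck A F" and c: "c \<in> carrier Ck" and h: "h \<in> carrier Hk"
  shows "tlift A F (twist c h) = tlift A (\<lambda>u v. F u (h \<odot>\<^bsub>C\<^esub> v)) (comult C c)"
  unfolding twist_def
proof (rule tlift_push[OF klin_tlift0[OF F] _ Cc.comult_closed[OF c]], (assumption | rule kl h)+)
  show "tlift A F (etens CC x (h \<odot>\<^bsub>C\<^esub> y)) = F x (h \<odot>\<^bsub>C\<^esub> y)"
    if "x \<in> carrier Ck" "y \<in> carrier Ck" for x y
    by (rule tlift_etens[OF F]) (rule kl h that)+
qed

text \<open>The inverse of \<delta> is x \<otimes> y \<mapsto> x1 \<otimes> E(x2 \<otimes> y).
  Applied after \<delta>, it gives c1 \<otimes> E(c2 \<otimes> c3 h), which \<open>E1\<close>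
  contracts to c \<otimes> h; applied before \<delta>, it gives x1 \<otimes> x2 E(x3 \<otimes> y),
  which \<open>E2\<close> contracts to x \<otimes> y. Applying \<epsilon> to the first factor of the
  inverse returns E.\<close>

lemma galois_criterion:
  assumes E: "klin k CC Hk E"
    and E1: "\<And>c h. c \<in> carrier C \<Longrightarrow> h \<in> carrier H \<Longrightarrow> E (twist c h) = counit C c \<odot>\<^bsub>H\<^esub> h"
    and E2: "\<And>x y. x \<in> carrier C \<Longrightarrow> y \<in> carrier C \<Longrightarrow>
      tlift Ck (\<lambda>u v. E (etens CC v y) \<odot>\<^bsub>C\<^esub> u) (comult C x) = counit C x \<odot>\<^bsub>Ck\<^esub> y"
  shows "bij_betw (galois_map k H C) (carrier CH) (carrier CC)"
    and "t \<in> carrier CC \<Longrightarrow> galois_ev k H C t = E t"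
proof -
  note El = klin_comp[OF E] klin_laws(4)[OF E]
  \<comment> \<open>This form is forced: \<delta> is left C-colinear, so an inverse must send x
    \<otimes> y to x1 \<otimes> (\<epsilon> \<otimes> H) \<delta>^-1(x2 \<otimes> y).\<close>
  define \<kappa>0 where "\<kappa>0 x y = tlift CH (\<lambda>u v. etens CH u (E (etens CC v y))) (comult C x)" for x y
  define \<kappa> where "\<kappa> = tlift CH \<kappa>0"
  have k0: "kbil k Ck Ck CH \<kappa>0" unfolding \<kappa>0_def by (assumption | rule kl El)+
  have kpl: "klin k CC CH \<kappa>" unfolding \<kappa>_def by (rule klin_tlift0[OF k0])
  have ke: "\<kappa> (etens CC x y) = \<kappa>0 x y" if "x \<in> carrier Ck" "y \<in> carrier Ck" for x y
    unfolding \<kappa>_def by (rule tlift_etens[OF k0 that])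
  let ?\<delta> = "galois_map k H C"
  have inv1: "\<kappa> (?\<delta> s) = s" if s: "s \<in> carrier CH" for s
  proof (rule tensor_ext[OF klin_comp[OF kpl galois_map_klin] klin_id kmod_Ck kmod_Hk _ s])
    fix c h assume ch: "c \<in> carrier Ck" "h \<in> carrier Hk"
    have "\<kappa> (?\<delta> (etens CH c h)) = tlift CH \<kappa>0 (twist c h)"
      using ch by (simp add: galois_map_etens \<kappa>_def)
    also have "\<dots> = tlift CH (\<lambda>u v. \<kappa>0 u (h \<odot>\<^bsub>C\<^esub> v)) (comult C c)"
      by (rule tlift_twist[OF k0 ch])
    also have "\<dots> = tlift CH (\<lambda>x w. tlift CH (\<lambda>u v. etens CH x (E (etens CC u (h \<odot>\<^bsub>C\<^esub> v)))) (comult C w)) (comult C c)"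
      unfolding \<kappa>0_def by (rule Cc.coassoc[OF _ ch(1)]) (assumption | rule kl ch El)+
    also have "\<dots> = tlift CH (\<lambda>x w. counit C w \<odot>\<^bsub>CH\<^esub> etens CH x h) (comult C c)"
    proof (rule tlift_cong[OF _ _ Cc.comult_closed[OF ch(1)], symmetric], (assumption | rule kl ch)+)
      fix x w assume xw: "x \<in> carrier Ck" "w \<in> carrier Ck"
      have l: "klin k CC CH (\<lambda>t. etens CH x (E t))" by (assumption | rule kl xw El)+
      have "tlift CH (\<lambda>u v. etens CH x (E (etens CC u (h \<odot>\<^bsub>C\<^esub> v)))) (comult C w) = etens CH x (E (twist w h))"
        unfolding twist_def
        by (rule tlift_fusion[OF l _ Cc.comult_closed[OF xw(2)], symmetric]) (assumption | rule kl ch)+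
      also have "\<dots> = etens CH x (counit C w \<odot>\<^bsub>Hk\<^esub> h)" using E1[of w h] xw ch by simp
      also have "\<dots> = counit C w \<odot>\<^bsub>CH\<^esub> etens CH x h"
        by (rule klin_laws(6)[OF kbil_laws(5)[OF kbil_etens]]) (rule kl xw ch Cc.counit_closed)+
      finally show "counit C w \<odot>\<^bsub>CH\<^esub> etens CH x h =
        tlift CH (\<lambda>u v. etens CH x (E (etens CC u (h \<odot>\<^bsub>C\<^esub> v)))) (comult C w)" by simp
    qed
    also have "\<dots> = etens CH c h"
      by (rule Cc.counit_r[OF _ ch(1)]) (assumption | rule kl ch)+
    finally show "\<kappa> (?\<delta> (etens CH c h)) = etens CH c h" .
  qed (assumption | rule kl)+
  have inv2: "?\<delta> (\<kappa> t) = t" if t: "t \<in> carrier CC" for t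
  proof (rule tensor_ext[OF klin_comp[OF galois_map_klin kpl] klin_id kmod_Ck kmod_Ck _ t])
    fix x y assume xy: "x \<in> carrier Ck" "y \<in> carrier Ck"
    have "?\<delta> (\<kappa> (etens CC x y)) = tlift CC (\<lambda>u v. twist u (E (etens CC v y))) (comult C x)"
      unfolding ke[OF xy] \<kappa>0_def
    proof (rule tlift_push[OF galois_map_klin _ Cc.comult_closed[OF xy(1)]])
      fix u v assume uv: "u \<in> carrier Ck" "v \<in> carrier Ck"
      have "E (etens CC v y) \<in> carrier Hk" by (rule kl El xy uv)+
      with uv show "?\<delta> (etens CH u (E (etens CC v y))) = twist u (E (etens CC v y))"
        by (simp add: galois_map_etens)
    qed (assumption | rule kl xy El)+
    also have "\<dots> = tlift CC (\<lambda>z w. tlift CC (\<lambda>u v. etens CC z (E (etens CC v y) \<odot>\<^bsub>C\<^esub> u)) (comult C w)) (comult C x)"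
      unfolding twist_def by (rule Cc.coassoc[OF _ xy(1)]) (assumption | rule kl xy El)+
    also have "\<dots> = tlift CC (\<lambda>z w. counit C w \<odot>\<^bsub>CC\<^esub> etens CC z y) (comult C x)"
    proof (rule tlift_cong[OF _ _ Cc.comult_closed[OF xy(1)], symmetric], (assumption | rule kl xy)+)
      fix z w assume zw: "z \<in> carrier Ck" "w \<in> carrier Ck"
      have l: "klin k Ck CC (\<lambda>t. etens CC z t)" by (assumption | rule kl zw)+
      have "tlift CC (\<lambda>u v. etens CC z (E (etens CC v y) \<odot>\<^bsub>C\<^esub> u)) (comult C w) =
          etens CC z (tlift Ck (\<lambda>u v. E (etens CC v y) \<odot>\<^bsub>C\<^esub> u) (comult C w))"
        by (rule tlift_fusion[OF l _ Cc.comult_closed[OF zw(2)], symmetric]) (assumption | rule kl xy El)+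
      also have "\<dots> = etens CC z (counit C w \<odot>\<^bsub>Ck\<^esub> y)" using E2[of w y] zw xy by simp
      also have "\<dots> = counit C w \<odot>\<^bsub>CC\<^esub> etens CC z y"
        by (rule klin_laws(6)[OF kbil_laws(5)[OF kbil_etens]]) (rule kl zw xy Cc.counit_closed)+
      finally show "counit C w \<odot>\<^bsub>CC\<^esub> etens CC z y =
        tlift CC (\<lambda>u v. etens CC z (E (etens CC v y) \<odot>\<^bsub>C\<^esub> u)) (comult C w)" by simp
    qed
    also have "\<dots> = etens CC x y"
      by (rule Cc.counit_r[OF _ xy(1)]) (assumption | rule kl xy)+
    finally show "?\<delta> (\<kappa> (etens CC x y)) = etens CC x y" .
  qed (assumption | rule kl)+
  show bij: "bij_betw ?\<delta> (carrier CH) (carrier CC)"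
    by (rule bij_betw_byWitness[where f' = \<kappa>])
      (use inv1 inv2 klin_laws(4)[OF kpl] klin_laws(4)[OF galois_map_klin] in \<open>auto simp del: tensor_sel\<close>)
  assume t: "t \<in> carrier CC"
  have "inv_into (carrier CH) ?\<delta> t = \<kappa> t"
    using inv_into_f_f[OF bij_betw_imp_inj_on[OF bij] klin_laws(4)[OF kpl t]] inv2[OF t] by simp
  then have "galois_ev k H C t = tlift Hk (\<lambda>c h. counit C c \<odot>\<^bsub>Hk\<^esub> h) (\<kappa> t)"
    by (simp add: galois_ev_def tlift_H)
  also have "\<dots> = E t"
  proof (rule tensor_ext[OF klin_comp[OF klin_tlift0 kpl] E kmod_Ck kmod_Ck _ t])
    show b: "kbil k Ck Hk Hk (\<lambda>c h. counit C c \<odot>\<^bsub>Hk\<^esub> h)" by (assumption | rule kl)+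
    fix x y assume xy: "x \<in> carrier Ck" "y \<in> carrier Ck"
    have "tlift Hk (\<lambda>c h. counit C c \<odot>\<^bsub>Hk\<^esub> h) (\<kappa> (etens CC x y)) =
        tlift Hk (\<lambda>u v. counit C u \<odot>\<^bsub>Hk\<^esub> E (etens CC v y)) (comult C x)"
      unfolding ke[OF xy] \<kappa>0_def
      by (rule tlift_push[OF klin_tlift0[OF b] _ Cc.comult_closed[OF xy(1)]])
        (assumption | rule kl xy El tlift_etens[OF b])+
    also have "\<dots> = E (etens CC x y)"
      by (rule Cc.counit_l[OF _ xy(1)]) (assumption | rule kl xy El)+
    finally show "tlift Hk (\<lambda>c h. counit C c \<odot>\<^bsub>Hk\<^esub> h) (\<kappa> (etens CC x y)) = E (etens CC x y)" .
  qed
  finally show "galois_ev k H C t = E t" .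
qed

end

subsection \<open>Records that agree as modules over the base ring\<close>

text \<open>Restrictions, pens and iterated tensor products yield different records for one and the
  same k-module. Equal additive groups and equal scalars on the carriers are stable under tensor
  products and enough to exchange \<open>etens\<close>, \<open>tlift\<close> and
  \<open>tmap\<close>.\<close>

definition keqv where
  "keqv k M N \<longleftrightarrow> kmod k M \<and> kmod k N \<and> carrier M = carrier N \<and> add M = add N \<and> zero M = zero N \<and>
     (\<forall>a\<in>carrier k. \<forall>x\<in>carrier M. a \<odot>\<^bsub>M\<^esub> x = a \<odot>\<^bsub>N\<^esub> x)"

lemma keqv_refl: "kmod k M \<Longrightarrow> keqv k M M" by (simp add: keqv_def)

lemma keqv_sym: "keqv k M N \<Longrightarrow> keqv k N M" by (simp add: keqv_def)

lemma keqv_klin: "keqv k M M' \<Longrightarrow> keqv k N N' \<Longrightarrow> klin k M N f \<Longrightarrow> klin k M' N' f"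
proof (rule klinI)
  assume M: "keqv k M M'" and N: "keqv k N N'" and f: "klin k M N f"
  note L = klin_laws(4-6)[OF f]
  show "f (a \<odot>\<^bsub>M'\<^esub> x) = a \<odot>\<^bsub>N'\<^esub> f x" if "a \<in> carrier k" "x \<in> carrier M'" for a x
  proof -
    have "x \<in> carrier M" using M that by (simp add: keqv_def)
    then have "f (a \<odot>\<^bsub>M\<^esub> x) = a \<odot>\<^bsub>N\<^esub> f x" "f x \<in> carrier N" using L that by auto
    then show ?thesis using M N that by (simp add: keqv_def)
  qed
  show "f x \<in> carrier N'" if "x \<in> carrier M'" for x using L(1)[of x] M N that by (simp add: keqv_def)
  show "f (x \<oplus>\<^bsub>M'\<^esub> y) = f x \<oplus>\<^bsub>N'\<^esub> f y" if "x \<in> carrier M'" "y \<in> carrier M'" for x y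
    using L(2)[of x y] M N that by (simp add: keqv_def)
qed (auto simp: keqv_def)

lemma keqv_tensor_group:
  assumes "keqv k M M'" "keqv k N N'"
  shows "tensor_group k M N = tensor_group k M' N'"
  by (rule tensor_group_cong) (use assms in \<open>auto simp: keqv_def kmod_def\<close>)

lemma keqv_tensor:
  assumes M: "keqv k M M'" and N: "keqv k N N'"
  shows "keqv k (M \<boxtimes>\<^bsub>k\<^esub> N) (M' \<boxtimes>\<^bsub>k\<^esub> N')"
proof -
  note T = keqv_tensor_group[OF M N]
  have km: "kmod k M" "kmod k M'" "kmod k N" "kmod k N'" using M N by (auto simp: keqv_def)
  note b = kmod_tensor[OF km(1,3)] kmod_tensor[OF km(2,4)]
  have e: "etens (M \<boxtimes>\<^bsub>k\<^esub> N) = etens (M' \<boxtimes>\<^bsub>k\<^esub> N')" by (rule etens_cong_ring) (simp add: T)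
  have "a \<odot>\<^bsub>M \<boxtimes>\<^bsub>k\<^esub> N\<^esub> t = a \<odot>\<^bsub>M' \<boxtimes>\<^bsub>k\<^esub> N'\<^esub> t" if a: "a \<in> carrier k" and t: "t \<in> carrier (M \<boxtimes>\<^bsub>k\<^esub> N)" for a t
    using kmod_tensorable[OF km(1,3)] kmod_laws(8)[OF b(1) a] _ _ t
  proof (rule tensor_ext_gen)
    have "additive (M' \<boxtimes>\<^bsub>k\<^esub> N') (M' \<boxtimes>\<^bsub>k\<^esub> N') ((\<odot>\<^bsub>M' \<boxtimes>\<^bsub>k\<^esub> N'\<^esub>) a) =
        additive (M \<boxtimes>\<^bsub>k\<^esub> N) (M \<boxtimes>\<^bsub>k\<^esub> N) ((\<odot>\<^bsub>M' \<boxtimes>\<^bsub>k\<^esub> N'\<^esub>) a)"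
      by (rule additive_cong_ring) (simp_all add: T)
    then show "additive (M \<boxtimes>\<^bsub>k\<^esub> N) (M \<boxtimes>\<^bsub>k\<^esub> N) ((\<odot>\<^bsub>M' \<boxtimes>\<^bsub>k\<^esub> N'\<^esub>) a)"
      using kmod_laws(8)[OF b(2) a] by blast
    fix x y assume xy: "x \<in> carrier M" "y \<in> carrier N"
    then have xy': "x \<in> carrier M'" "y \<in> carrier N'" using M N by (auto simp: keqv_def)
    have "a \<odot>\<^bsub>M' \<boxtimes>\<^bsub>k\<^esub> N'\<^esub> etens (M' \<boxtimes>\<^bsub>k\<^esub> N') x y = etens (M' \<boxtimes>\<^bsub>k\<^esub> N') (a \<odot>\<^bsub>M'\<^esub> x) y"
      by (rule tensor_bimodule(2)[OF kmod_laws(3)[OF km(2)] kmod_laws(3)[OF km(4)] a xy'])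
    moreover have "a \<odot>\<^bsub>M \<boxtimes>\<^bsub>k\<^esub> N\<^esub> etens (M \<boxtimes>\<^bsub>k\<^esub> N) x y = etens (M \<boxtimes>\<^bsub>k\<^esub> N) (a \<odot>\<^bsub>M\<^esub> x) y"
      by (rule tensor_bimodule(2)[OF kmod_laws(3)[OF km(1)] kmod_laws(3)[OF km(3)] a xy])
    moreover have "a \<odot>\<^bsub>M\<^esub> x = a \<odot>\<^bsub>M'\<^esub> x" using M xy a by (auto simp: keqv_def)
    ultimately show "a \<odot>\<^bsub>M \<boxtimes>\<^bsub>k\<^esub> N\<^esub> etens (M \<boxtimes>\<^bsub>k\<^esub> N) x y = a \<odot>\<^bsub>M' \<boxtimes>\<^bsub>k\<^esub> N'\<^esub> etens (M \<boxtimes>\<^bsub>k\<^esub> N) x y"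
      by (simp add: e)
  qed
  then show ?thesis using b by (simp add: keqv_def T)
qed

lemma keqv_sel: "keqv k M N \<Longrightarrow> carrier M = carrier N" "keqv k M N \<Longrightarrow> add M = add N"
  "keqv k M N \<Longrightarrow> zero M = zero N"
  "keqv k M N \<Longrightarrow> a \<in> carrier k \<Longrightarrow> x \<in> carrier N \<Longrightarrow> a \<odot>\<^bsub>M\<^esub> x = a \<odot>\<^bsub>N\<^esub> x"
  by (simp_all add: keqv_def)

lemma klin_bihom:
  assumes "klin k M N f" shows "f \<in> bihom k k M N"
  using assms klin_laws[OF assms] kmod_laws(5)[of k M] kmod_laws(5)[of k N]
  by (auto simp: bihom_def hom_def)

context comm_hopf
begin

lemma keqv_ops:
  fixes T :: "('h, 'h, ('a, 'b) tens) bimodule" and U :: "('h, 'h, 'd) bimodule"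
  shows "keqv k (kk H T) N \<Longrightarrow> etens T = etens N"
    "keqv k (kk H T) N \<Longrightarrow> (tmap T :: ('e \<Rightarrow> 'a) \<Rightarrow> ('f \<Rightarrow> 'b) \<Rightarrow> _) = tmap N"
    "keqv k (kk H U) N' \<Longrightarrow> (tlift U :: ('e \<Rightarrow> 'f \<Rightarrow> 'd) \<Rightarrow> _) = tlift N'"
proof -
  show "keqv k (kk H T) N \<Longrightarrow> etens T = etens N"
    by (rule etens_cong_ring) (simp add: keqv_def)
  show "keqv k (kk H T) N \<Longrightarrow> (tmap T :: ('e \<Rightarrow> 'a) \<Rightarrow> ('f \<Rightarrow> 'b) \<Rightarrow> _) = tmap N"
    by (rule tmap_cong_ring) (simp_all add: keqv_def)
  show "keqv k (kk H U) N' \<Longrightarrow> (tlift U :: ('e \<Rightarrow> 'f \<Rightarrow> 'd) \<Rightarrow> _) = tlift N'"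
    by (rule tlift_cong_ring) (simp_all add: keqv_def)
qed

lemma keqv_pen: "hbimod M \<Longrightarrow> keqv k (kk H (pen_of M)) (kk H M)"
  using hbimod_pen_of[of M] by (simp add: keqv_def kmod_kk antipode_unit_map)

lemma module_regular_H: "hbimod (bimod_of (regular H))"
  by (rule hbimod_bimod_of[OF module_regular[OF cring_H]])

lemma keqv_H: "keqv k (kk H (bimod_of (regular H))) Hk"
  using kmod_kk[OF module_regular_H] kmod_Hk by (simp add: keqv_def unit_map_mult)

text \<open>The outer actions touch one factor each, and both sides of an H-linearity law are
  k-linear, so elementary tensors decide. The right-hand law is stated with \<open>h\<close> in
  front, which commutativity of \<open>H\<close> permits.\<close>

lemma bihom_pairing:
  assumes M: "hbimod M" and N: "hbimod N" and E: "klin k (kk H M \<boxtimes>\<^bsub>k\<^esub> kk H N) Hk E"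
    and l: "\<And>h x y. h \<in> carrier H \<Longrightarrow> x \<in> carrier M \<Longrightarrow> y \<in> carrier N \<Longrightarrow>
      E (etens (kk H M \<boxtimes>\<^bsub>k\<^esub> kk H N) (h \<odot>\<^bsub>M\<^esub> x) y) = h \<otimes>\<^bsub>H\<^esub> E (etens (kk H M \<boxtimes>\<^bsub>k\<^esub> kk H N) x y)"
    and r: "\<And>h x y. h \<in> carrier H \<Longrightarrow> x \<in> carrier M \<Longrightarrow> y \<in> carrier N \<Longrightarrow>
      E (etens (kk H M \<boxtimes>\<^bsub>k\<^esub> kk H N) x (rsmult N y h)) = h \<otimes>\<^bsub>H\<^esub> E (etens (kk H M \<boxtimes>\<^bsub>k\<^esub> kk H N) x y)"
  shows "E \<in> bihom H H (rk H M \<boxtimes>\<^bsub>k\<^esub> lk H N) (bimod_of (regular H))"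
proof -
  let ?T = "rk H M \<boxtimes>\<^bsub>k\<^esub> lk H N" and ?K = "kk H M \<boxtimes>\<^bsub>k\<^esub> kk H N"
  note hT = hbimod_ktensor[OF M N]
  have kT: "kk H ?T = ?K" by (rule kk_ktensor)
  note TB = tensor_bimodule[OF hbimod_restr(2)[OF M] hbimod_restr(1)[OF N]]
  note c = ktensor_zero[of M N]
  have km: "kmod k (kk H M)" "kmod k (kk H N)" by (rule kmod_kk[OF M], rule kmod_kk[OF N])
  have L: "E (h \<odot>\<^bsub>?T\<^esub> t) = h \<otimes>\<^bsub>H\<^esub> E t" if h: "h \<in> carrier H" and t: "t \<in> carrier ?K" for h t
  proof (rule tensor_ext[OF _ _ km _ t])
    have "klin k ?K ?K (\<lambda>t. h \<odot>\<^bsub>?T\<^esub> t)"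
      using hsmult_lin(1)[OF klin_id[OF kmod_kk[OF hT]] _ hT, of h] h unfolding kT by simp
    then show "klin k ?K Hk (\<lambda>t. E (h \<odot>\<^bsub>?T\<^esub> t))" by (rule klin_comp[OF E])
    show "klin k ?K Hk (\<lambda>t. h \<otimes>\<^bsub>H\<^esub> E t)" by (rule mult_lin(2)[OF E]) (simp add: h)
    fix x y assume "x \<in> carrier (kk H M)" "y \<in> carrier (kk H N)"
    then show "E (h \<odot>\<^bsub>?T\<^esub> etens ?K x y) = h \<otimes>\<^bsub>H\<^esub> E (etens ?K x y)"
      using TB(2)[of h x y] h l[of h x y] by (simp add: etens_ktensor)
  qed
  have R: "E (rsmult ?T t h) = E t \<otimes>\<^bsub>H\<^esub> h" if h: "h \<in> carrier H" and t: "t \<in> carrier ?K" for h t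
  proof (rule tensor_ext[OF _ _ km _ t])
    have "klin k ?K ?K (\<lambda>t. rsmult ?T t h)"
      using hsmult_lin(2)[OF klin_id[OF kmod_kk[OF hT]] _ hT, of h] h unfolding kT by simp
    then show "klin k ?K Hk (\<lambda>t. E (rsmult ?T t h))" by (rule klin_comp[OF E])
    show "klin k ?K Hk (\<lambda>t. E t \<otimes>\<^bsub>H\<^esub> h)" by (rule mult_lin(1)[OF E]) (simp add: h)
    fix x y assume xy: "x \<in> carrier (kk H M)" "y \<in> carrier (kk H N)"
    then have "E (etens ?K x y) \<in> carrier H"
      using klin_laws(4)[OF E etens_closed[OF xy km]] by simp
    with xy show "E (rsmult ?T (etens ?K x y) h) = E (etens ?K x y) \<otimes>\<^bsub>H\<^esub> h"
      using TB(3)[of h x y] h r[of h x y] by (simp add: etens_ktensor H_m_comm)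
  qed
  show ?thesis
    using klin_laws(4,5)[OF E] L R
    by (auto simp: bihom_def hom_def c H_m_comm simp del: tensor_sel)
qed

end

subsection \<open>Bijectivity of the Galois map\<close>

locale galois = mod_coalg k H C
  for k :: "('k, 'x) ring_scheme" and H :: "('k, 'h, 'z) hopf_scheme"
    and C :: "('k, 'h, 'c, 'w) module_coalgebra_scheme" +
  assumes bij: "bij_betw (galois_map k H C) (carrier CH) (carrier CC)"
begin

abbreviation E0 where "E0 \<equiv> galois_ev k H C"

text \<open>Every element of C \<otimes> C is a value of \<delta>, and on the source C \<otimes> H
  elementary tensors decide. The laws of the evaluation are obtained by testing them on c1 \<otimes>
  c2 h.\<close>

lemma delta_ext:
  assumes f: "klin k CC A f" and g: "klin k CC A g" and t: "t \<in> carrier CC"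
    and eq: "\<And>c h. c \<in> carrier Ck \<Longrightarrow> h \<in> carrier Hk \<Longrightarrow> f (twist c h) = g (twist c h)"
  shows "f t = g t"
proof -
  obtain s where s: "s \<in> carrier CH" "t = galois_map k H C s"
    using bij t by (auto simp: bij_betw_def)
  show ?thesis
    unfolding s(2)
    by (rule tensor_ext[OF klin_comp[OF f galois_map_klin] klin_comp[OF g galois_map_klin] kmod_Ck kmod_Hk _ s(1)])
      (simp add: galois_map_etens eq)
qed

lemma ev_klin: "klin k CC Hk E0"
proof -
  let ?\<delta> = "galois_map k H C" and ?i = "inv_into (carrier CH) (galois_map k H C)"
  have i: "?i t \<in> carrier CH" "?\<delta> (?i t) = t" if "t \<in> carrier CC" for t
    using bij that inv_into_into[of t ?\<delta> "carrier CH"] f_inv_into_f[of t ?\<delta> "carrier CH"]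
    by (auto simp: bij_betw_def simp del: tensor_sel)
  have u: "?i (?\<delta> s) = s" if "s \<in> carrier CH" for s
    using bij that by (simp add: bij_betw_def inv_into_f_f)
  note dl = klin_laws[OF galois_map_klin]
  have "klin k CC CH ?i"
  proof (rule klinI)
    fix s t assume st: "s \<in> carrier CC" "t \<in> carrier CC"
    have cl: "?i s \<oplus>\<^bsub>CH\<^esub> ?i t \<in> carrier CH"
      by (rule abelian_monoid.a_closed[OF abelian_group.axioms(1)[OF kmod_laws(2)[OF dl(1)]]]; rule i(1); fact st)
    have "?\<delta> (?i s \<oplus>\<^bsub>CH\<^esub> ?i t) = s \<oplus>\<^bsub>CC\<^esub> t"
      using dl(5)[OF i(1)[OF st(1)] i(1)[OF st(2)]] i(2) st by simp
    then show "?i (s \<oplus>\<^bsub>CC\<^esub> t) = ?i s \<oplus>\<^bsub>CH\<^esub> ?i t" using u[OF cl] by simp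
  next
    fix a t assume at: "a \<in> carrier k" "t \<in> carrier CC"
    have "?\<delta> (a \<odot>\<^bsub>CH\<^esub> ?i t) = a \<odot>\<^bsub>CC\<^esub> t" using dl(6)[OF at(1) i(1)[OF at(2)]] i(2)[OF at(2)] by simp
    then show "?i (a \<odot>\<^bsub>CC\<^esub> t) = a \<odot>\<^bsub>CH\<^esub> ?i t"
      using u[OF kmod_laws(4)[OF dl(1) at(1) i(1)[OF at(2)]]] by simp
  qed (use i(1) dl(1,2) in simp_all)
  moreover have "kbil k Ck Hk Hk (\<lambda>c h. counit C c \<odot>\<^bsub>Hk\<^esub> h)" by (assumption | rule kl)+
  ultimately have "klin k CC Hk (\<lambda>t. tlift Hk (\<lambda>c h. counit C c \<odot>\<^bsub>Hk\<^esub> h) (?i t))"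
    by (rule klin_tlift)
  then show ?thesis by (rule klin_cong) (simp add: galois_ev_def tlift_H)
qed

lemma ev_lin [kl]: "klin k P CC f \<Longrightarrow> klin k P Hk (\<lambda>z. E0 (f z))"
  by (rule klin_comp[OF ev_klin])

lemma ev_closed [kl]: "t \<in> carrier CC \<Longrightarrow> E0 t \<in> carrier Hk"
  by (rule klin_laws(4)[OF ev_klin])

lemma ev_etens_closed [simp]: "x \<in> carrier C \<Longrightarrow> y \<in> carrier C \<Longrightarrow> E0 (etens CC x y) \<in> carrier H"
  using ev_closed[OF etens_closed[OF _ _ kmod_Ck kmod_Ck], of x y] by simp

lemma ev_twist:
  assumes "c \<in> carrier C" "h \<in> carrier H"
  shows "E0 (twist c h) = counit C c \<odot>\<^bsub>H\<^esub> h"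
proof -
  have b: "kbil k Ck Hk Hk (\<lambda>c h. counit C c \<odot>\<^bsub>Hk\<^esub> h)" by (assumption | rule kl)+
  have "inv_into (carrier CH) (galois_map k H C) (galois_map k H C (etens CH c h)) = etens CH c h"
    by (rule inv_into_f_f[OF bij_betw_imp_inj_on[OF bij]]) (rule etens_closed; simp add: assms kmod_Ck kmod_Hk)
  then show ?thesis
    using tlift_etens[OF b, of c h] assms by (simp add: galois_ev_def galois_map_etens tlift_H)
qed

lemma ev_comult: "c \<in> carrier C \<Longrightarrow> E0 (comult C c) = counit C c \<odot>\<^bsub>H\<^esub> \<one>\<^bsub>H\<^esub>"
  using ev_twist[of c "\<one>\<^bsub>H\<^esub>"] by (simp add: twist_one)

text \<open>\<delta> is linear for the actions on the second factors of C \<otimes> H and C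
  \<otimes> C, and so is its inverse.\<close>

lemma ev_act_r:
  assumes x: "x \<in> carrier C" and y: "y \<in> carrier C" and h: "h \<in> carrier H"
  shows "E0 (etens CC x (h \<odot>\<^bsub>C\<^esub> y)) = h \<otimes>\<^bsub>H\<^esub> E0 (etens CC x y)"
proof -
  have xy': "x \<in> carrier Ck" "y \<in> carrier Ck" and h': "h \<in> carrier Hk" using x y h by simp_all
  have b: "kbil k Ck Ck Hk (\<lambda>x y. E0 (etens CC x (h \<odot>\<^bsub>C\<^esub> y)))" by (assumption | rule kl h')+
  have b': "kbil k Ck Ck CC (\<lambda>u v. etens CC u (g \<odot>\<^bsub>C\<^esub> v))" if g: "g \<in> carrier Hk" for g
    by (assumption | rule kl g)+
  have "tlift Hk (\<lambda>x y. E0 (etens CC x (h \<odot>\<^bsub>C\<^esub> y))) (etens CC x y) = h \<otimes>\<^bsub>H\<^esub> E0 (etens CC x y)"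
  proof (rule delta_ext[OF klin_tlift0[OF b] mult_lin(2)[OF ev_klin h'] etens_closed[OF xy' kmod_Ck kmod_Ck]])
    fix c g assume cg: "c \<in> carrier Ck" "g \<in> carrier Hk"
    have "tlift Hk (\<lambda>x y. E0 (etens CC x (h \<odot>\<^bsub>C\<^esub> y))) (twist c g) =
        tlift Hk (\<lambda>x y. E0 (etens CC x (h \<odot>\<^bsub>C\<^esub> (g \<odot>\<^bsub>C\<^esub> y)))) (comult C c)"
      by (rule tlift_twist[OF b cg])
    also have "\<dots> = E0 (twist c (h \<otimes>\<^bsub>H\<^esub> g))"
      unfolding twist_def
    proof (rule tlift_push[OF ev_klin b' Cc.comult_closed[OF cg(1)], symmetric])
      show "h \<otimes>\<^bsub>H\<^esub> g \<in> carrier Hk" using cg h by simp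
    qed (use cg h in \<open>simp add: C.smult_assoc1\<close>)
    also have "\<dots> = h \<otimes>\<^bsub>H\<^esub> E0 (twist c g)"
      using cg h Cc.counit_closed[OF cg(1)] klin_laws(6)[OF mult_lin(2)[OF klin_id[OF kmod_Hk] h'], of "counit C c" g]
      by (simp add: ev_twist)
    finally show "tlift Hk (\<lambda>x y. E0 (etens CC x (h \<odot>\<^bsub>C\<^esub> y))) (twist c g) = h \<otimes>\<^bsub>H\<^esub> E0 (twist c g)" .
  qed
  then show ?thesis by (simp add: tlift_etens[OF b xy'])
qed

text \<open>The identity \<open>c\<^sub>1g \<otimes> c\<^sub>2h = \<delta>(cg\<^sub>1 \<otimes> S(g\<^sub>2)h)\<close>.\<close>

lemma twist_antipode:
  assumes c: "c \<in> carrier Ck" and g: "g \<in> carrier Hk" and h: "h \<in> carrier Hk"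
  shows "tlift CC (\<lambda>u v. twist (u \<odot>\<^bsub>C\<^esub> c) (h \<otimes>\<^bsub>H\<^esub> S v)) (hcomult H g) =
    tlift CC (\<lambda>u v. etens CC (g \<odot>\<^bsub>C\<^esub> u) (h \<odot>\<^bsub>C\<^esub> v)) (comult C c)"
proof -
  note cd = Cc.comult_closed[OF c]
  have "tlift CC (\<lambda>u v. twist (u \<odot>\<^bsub>C\<^esub> c) (h \<otimes>\<^bsub>H\<^esub> S v)) (hcomult H g) =
    tlift CC (\<lambda>u v. tlift CC (\<lambda>a b. tlift CC (\<lambda>x y.
       etens CC (a \<odot>\<^bsub>C\<^esub> x) ((h \<otimes>\<^bsub>H\<^esub> S v) \<odot>\<^bsub>C\<^esub> (b \<odot>\<^bsub>C\<^esub> y))) (comult C c)) (hcomult H u)) (hcomult H g)"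
  proof (rule tlift_cong[OF _ _ Hc.comult_closed[OF g]])
    show "kbil k Hk Hk CC (\<lambda>u v. twist (u \<odot>\<^bsub>C\<^esub> c) (h \<otimes>\<^bsub>H\<^esub> S v))" by (assumption | rule kl c h)+
    fix u v assume uv: "u \<in> carrier Hk" "v \<in> carrier Hk"
    let ?F = "\<lambda>x y. etens CC x ((h \<otimes>\<^bsub>H\<^esub> S v) \<odot>\<^bsub>C\<^esub> y)"
    have "twist (u \<odot>\<^bsub>C\<^esub> c) (h \<otimes>\<^bsub>H\<^esub> S v) =
        tlift CC ?F (tmap2 CC act act (comult C c) (hcomult H u))"
      using c uv by (simp add: twist_def comult_act)
    also have "\<dots> = tlift CC (\<lambda>x y. tlift CC (\<lambda>a b. ?F (a \<odot>\<^bsub>C\<^esub> x) (b \<odot>\<^bsub>C\<^esub> y)) (hcomult H u)) (comult C c)"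
      by (rule tlift_tmap2[OF _ cd Hc.comult_closed[OF uv(1)] kbil_act kbil_act]) (assumption | rule kl h uv)+
    also have "\<dots> = tlift CC (\<lambda>a b. tlift CC (\<lambda>x y. ?F (a \<odot>\<^bsub>C\<^esub> x) (b \<odot>\<^bsub>C\<^esub> y)) (comult C c)) (hcomult H u)"
      by (rule tlift_swap[OF cd Hc.comult_closed[OF uv(1)]]) (assumption | rule kl h uv)+
    finally show "twist (u \<odot>\<^bsub>C\<^esub> c) (h \<otimes>\<^bsub>H\<^esub> S v) =
      tlift CC (\<lambda>a b. tlift CC (\<lambda>x y. ?F (a \<odot>\<^bsub>C\<^esub> x) (b \<odot>\<^bsub>C\<^esub> y)) (comult C c)) (hcomult H u)" .
  qed
  also have "\<dots> = tlift CC (\<lambda>a u. tlift CC (\<lambda>b v. tlift CC (\<lambda>x y.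
       etens CC (a \<odot>\<^bsub>C\<^esub> x) ((h \<otimes>\<^bsub>H\<^esub> S v) \<odot>\<^bsub>C\<^esub> (b \<odot>\<^bsub>C\<^esub> y))) (comult C c)) (hcomult H u)) (hcomult H g)"
    by (rule Hc.coassoc[OF _ g]) (assumption | rule kl cd h)+
  also have "\<dots> = tlift CC (\<lambda>a u. hcounit H u \<odot>\<^bsub>CC\<^esub>
      tlift CC (\<lambda>x y. etens CC (a \<odot>\<^bsub>C\<^esub> x) (h \<odot>\<^bsub>C\<^esub> y)) (comult C c)) (hcomult H g)"
  proof (rule tlift_cong[OF _ _ Hc.comult_closed[OF g], symmetric])
    show "kbil k Hk Hk CC (\<lambda>a u. hcounit H u \<odot>\<^bsub>CC\<^esub>
      tlift CC (\<lambda>x y. etens CC (a \<odot>\<^bsub>C\<^esub> x) (h \<odot>\<^bsub>C\<^esub> y)) (comult C c))"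
      by (assumption | rule kl cd h)+
    fix a u assume au: "a \<in> carrier Hk" "u \<in> carrier Hk"
    let ?G = "\<lambda>s. tlift CC (\<lambda>x y. etens CC (a \<odot>\<^bsub>C\<^esub> x) ((h \<otimes>\<^bsub>H\<^esub> s) \<odot>\<^bsub>C\<^esub> y)) (comult C c)"
    have "tlift CC (\<lambda>b v. tlift CC (\<lambda>x y. etens CC (a \<odot>\<^bsub>C\<^esub> x) ((h \<otimes>\<^bsub>H\<^esub> S v) \<odot>\<^bsub>C\<^esub> (b \<odot>\<^bsub>C\<^esub> y))) (comult C c)) (hcomult H u)
      = tlift CC (\<lambda>b v. ?G (b \<otimes>\<^bsub>H\<^esub> S v)) (hcomult H u)"
    proof (rule tlift_cong[OF _ _ Hc.comult_closed[OF au(2)]])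
      show "kbil k Hk Hk CC (\<lambda>b v. tlift CC (\<lambda>x y. etens CC (a \<odot>\<^bsub>C\<^esub> x) ((h \<otimes>\<^bsub>H\<^esub> S v) \<odot>\<^bsub>C\<^esub> (b \<odot>\<^bsub>C\<^esub> y))) (comult C c))"
        by (assumption | rule kl cd h au)+
      fix b v assume bv: "b \<in> carrier Hk" "v \<in> carrier Hk"
      show "tlift CC (\<lambda>x y. etens CC (a \<odot>\<^bsub>C\<^esub> x) ((h \<otimes>\<^bsub>H\<^esub> S v) \<odot>\<^bsub>C\<^esub> (b \<odot>\<^bsub>C\<^esub> y))) (comult C c) = ?G (b \<otimes>\<^bsub>H\<^esub> S v)"
      proof (rule tlift_cong[OF _ _ cd])
        show "kbil k Ck Ck CC (\<lambda>x y. etens CC (a \<odot>\<^bsub>C\<^esub> x) ((h \<otimes>\<^bsub>H\<^esub> S v) \<odot>\<^bsub>C\<^esub> (b \<odot>\<^bsub>C\<^esub> y)))"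
          by (assumption | rule kl h au bv)+
        fix x y assume "x \<in> carrier Ck" "y \<in> carrier Ck"
        \<comment> \<open>Commutativity of \<open>H\<close> brings \<open>b\<close> next to
          \<open>S v\<close>, where the antipode axiom can contract them.\<close>
        moreover have "h \<otimes>\<^bsub>H\<^esub> (b \<otimes>\<^bsub>H\<^esub> S v) = (h \<otimes>\<^bsub>H\<^esub> S v) \<otimes>\<^bsub>H\<^esub> b"
          using h bv H_m_comm[of b "S v"] by (simp add: H_m_assoc)
        ultimately show "etens CC (a \<odot>\<^bsub>C\<^esub> x) ((h \<otimes>\<^bsub>H\<^esub> S v) \<odot>\<^bsub>C\<^esub> (b \<odot>\<^bsub>C\<^esub> y)) =
            etens CC (a \<odot>\<^bsub>C\<^esub> x) ((h \<otimes>\<^bsub>H\<^esub> (b \<otimes>\<^bsub>H\<^esub> S v)) \<odot>\<^bsub>C\<^esub> y)"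
          using h bv by (simp add: C.smult_assoc1)
      qed
    qed
    also have "\<dots> = hcounit H u \<odot>\<^bsub>CC\<^esub> ?G \<one>\<^bsub>H\<^esub>"
      by (rule antipode_r) (assumption | rule kl cd h au)+
    finally show "hcounit H u \<odot>\<^bsub>CC\<^esub> tlift CC (\<lambda>x y. etens CC (a \<odot>\<^bsub>C\<^esub> x) (h \<odot>\<^bsub>C\<^esub> y)) (comult C c) =
      tlift CC (\<lambda>b v. tlift CC (\<lambda>x y. etens CC (a \<odot>\<^bsub>C\<^esub> x) ((h \<otimes>\<^bsub>H\<^esub> S v) \<odot>\<^bsub>C\<^esub> (b \<odot>\<^bsub>C\<^esub> y))) (comult C c)) (hcomult H u)"
      using h by simp
  qed
  also have "\<dots> = tlift CC (\<lambda>x y. etens CC (g \<odot>\<^bsub>C\<^esub> x) (h \<odot>\<^bsub>C\<^esub> y)) (comult C c)"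
    by (rule Hc.counit_r[OF _ g]) (assumption | rule kl cd h)+
  finally show ?thesis .
qed

text \<open>By \<open>twist_antipode\<close>, c1 g \<otimes> c2 h is a sum of values \<delta>(c g1
  \<otimes> S(g2) h), whose evaluation is \<epsilon>(c) \<epsilon>(g1) S(g2) h = \<epsilon>(c) S(g)
  h. The S appearing here is the reason for the twisted actions on the pen.\<close>

lemma ev_act_l:
  assumes x: "x \<in> carrier C" and y: "y \<in> carrier C" and g: "g \<in> carrier H"
  shows "E0 (etens CC (g \<odot>\<^bsub>C\<^esub> x) y) = S g \<otimes>\<^bsub>H\<^esub> E0 (etens CC x y)"
proof -
  have xy': "x \<in> carrier Ck" "y \<in> carrier Ck" and g': "g \<in> carrier Hk" using x y g by simp_all
  have Sg: "S g \<in> carrier Hk" using g by simp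
  have b: "kbil k Ck Ck Hk (\<lambda>x y. E0 (etens CC (g \<odot>\<^bsub>C\<^esub> x) y))" by (assumption | rule kl g')+
  have "tlift Hk (\<lambda>x y. E0 (etens CC (g \<odot>\<^bsub>C\<^esub> x) y)) (etens CC x y) = S g \<otimes>\<^bsub>H\<^esub> E0 (etens CC x y)"
  proof (rule delta_ext[OF klin_tlift0[OF b] mult_lin(2)[OF ev_klin Sg] etens_closed[OF xy' kmod_Ck kmod_Ck]])
    fix c h assume ch: "c \<in> carrier Ck" "h \<in> carrier Hk"
    have "tlift Hk (\<lambda>x y. E0 (etens CC (g \<odot>\<^bsub>C\<^esub> x) y)) (twist c h) =
        tlift Hk (\<lambda>x y. E0 (etens CC (g \<odot>\<^bsub>C\<^esub> x) (h \<odot>\<^bsub>C\<^esub> y))) (comult C c)"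
      by (rule tlift_twist[OF b ch])
    also have "\<dots> = E0 (tlift CC (\<lambda>u v. etens CC (g \<odot>\<^bsub>C\<^esub> u) (h \<odot>\<^bsub>C\<^esub> v)) (comult C c))"
      by (rule tlift_fusion[OF ev_klin _ Cc.comult_closed[OF ch(1)], symmetric]) (assumption | rule kl g' ch)+
    also have "\<dots> = E0 (tlift CC (\<lambda>u v. twist (u \<odot>\<^bsub>C\<^esub> c) (h \<otimes>\<^bsub>H\<^esub> S v)) (hcomult H g))"
      by (simp only: twist_antipode[OF ch(1) g' ch(2)])
    also have "\<dots> = tlift Hk (\<lambda>u v. hcounit H u \<odot>\<^bsub>Hk\<^esub> (counit C c \<odot>\<^bsub>Hk\<^esub> (h \<otimes>\<^bsub>H\<^esub> S v))) (hcomult H g)"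
    proof (rule tlift_push[OF ev_klin _ Hc.comult_closed[OF g']])
      show "kbil k Hk Hk CC (\<lambda>u v. twist (u \<odot>\<^bsub>C\<^esub> c) (h \<otimes>\<^bsub>H\<^esub> S v))" by (assumption | rule kl ch)+
      fix u v assume uv: "u \<in> carrier Hk" "v \<in> carrier Hk"
      have "counit C c \<in> carrier k" using Cc.counit_closed[OF ch(1)] .
      then show "E0 (twist (u \<odot>\<^bsub>C\<^esub> c) (h \<otimes>\<^bsub>H\<^esub> S v)) =
          hcounit H u \<odot>\<^bsub>Hk\<^esub> (counit C c \<odot>\<^bsub>Hk\<^esub> (h \<otimes>\<^bsub>H\<^esub> S v))"
        using uv ch by (simp add: ev_twist comult_act A.smult_assoc1[symmetric] A.R.m_comm)
    qed
    also have "\<dots> = counit C c \<odot>\<^bsub>Hk\<^esub> (h \<otimes>\<^bsub>H\<^esub> S g)"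
      by (rule Hc.counit_l[OF _ g']) (assumption | rule kl ch Cc.counit_closed)+
    also have "\<dots> = S g \<otimes>\<^bsub>H\<^esub> E0 (twist c h)"
      using ch g Cc.counit_closed[OF ch(1)] by (simp add: ev_twist H_m_comm[of "S g"] A.smult_assoc2)
    finally show "tlift Hk (\<lambda>x y. E0 (etens CC (g \<odot>\<^bsub>C\<^esub> x) y)) (twist c h) = S g \<otimes>\<^bsub>H\<^esub> E0 (twist c h)" .
  qed
  then show ?thesis by (simp add: tlift_etens[OF b xy'])
qed

text \<open>Tested on c1 \<otimes> c2 h: the left side is c1 ev(c2 \<otimes> c3 h) = c h, the right
  side \<epsilon>(c1) c2 h = c h. This is the second equation in
  \<open>galois_criterion\<close>.\<close>

lemma ev_counit:
  assumes x: "x \<in> carrier C" and y: "y \<in> carrier C"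
  shows "tlift Ck (\<lambda>u v. E0 (etens CC v y) \<odot>\<^bsub>C\<^esub> u) (comult C x) = counit C x \<odot>\<^bsub>Ck\<^esub> y"
proof -
  have xy': "x \<in> carrier Ck" "y \<in> carrier Ck" using x y by simp_all
  have b1: "kbil k Ck Ck Ck (\<lambda>x y. tlift Ck (\<lambda>u v. E0 (etens CC v y) \<odot>\<^bsub>C\<^esub> u) (comult C x))"
    by (assumption | rule kl)+
  have b2: "kbil k Ck Ck Ck (\<lambda>x y. counit C x \<odot>\<^bsub>Ck\<^esub> y)" by (assumption | rule kl)+
  have "tlift Ck (\<lambda>x y. tlift Ck (\<lambda>u v. E0 (etens CC v y) \<odot>\<^bsub>C\<^esub> u) (comult C x)) (etens CC x y) =
    tlift Ck (\<lambda>x y. counit C x \<odot>\<^bsub>Ck\<^esub> y) (etens CC x y)"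
  proof (rule delta_ext[OF klin_tlift0[OF b1] klin_tlift0[OF b2] etens_closed[OF xy' kmod_Ck kmod_Ck]])
    fix c h assume ch: "c \<in> carrier Ck" "h \<in> carrier Hk"
    have "tlift Ck (\<lambda>x y. tlift Ck (\<lambda>u v. E0 (etens CC v y) \<odot>\<^bsub>C\<^esub> u) (comult C x)) (twist c h) =
      tlift Ck (\<lambda>x y. tlift Ck (\<lambda>u v. E0 (etens CC v (h \<odot>\<^bsub>C\<^esub> y)) \<odot>\<^bsub>C\<^esub> u) (comult C x)) (comult C c)"
      by (rule tlift_twist[OF b1 ch])
    also have "\<dots> = tlift Ck (\<lambda>u w. tlift Ck (\<lambda>v y. E0 (etens CC v (h \<odot>\<^bsub>C\<^esub> y)) \<odot>\<^bsub>C\<^esub> u) (comult C w)) (comult C c)"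
      by (rule Cc.coassoc[OF _ ch(1)]) (assumption | rule kl ch)+
    also have "\<dots> = tlift Ck (\<lambda>u w. counit C w \<odot>\<^bsub>Ck\<^esub> (h \<odot>\<^bsub>C\<^esub> u)) (comult C c)"
    proof (rule tlift_cong[OF _ _ Cc.comult_closed[OF ch(1)], symmetric])
      show "kbil k Ck Ck Ck (\<lambda>u w. counit C w \<odot>\<^bsub>Ck\<^esub> (h \<odot>\<^bsub>C\<^esub> u))" by (assumption | rule kl ch)+
      fix u w assume uw: "u \<in> carrier Ck" "w \<in> carrier Ck"
      have l: "klin k CC Ck (\<lambda>t. E0 t \<odot>\<^bsub>C\<^esub> u)" by (assumption | rule kl uw)+
      have "tlift Ck (\<lambda>v y. E0 (etens CC v (h \<odot>\<^bsub>C\<^esub> y)) \<odot>\<^bsub>C\<^esub> u) (comult C w) = E0 (twist w h) \<odot>\<^bsub>C\<^esub> u"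
        unfolding twist_def
        by (rule tlift_fusion[OF l _ Cc.comult_closed[OF uw(2)], symmetric]) (assumption | rule kl ch)+
      also have "\<dots> = counit C w \<odot>\<^bsub>Ck\<^esub> (h \<odot>\<^bsub>C\<^esub> u)"
        using uw ch Cc.counit_closed[OF uw(2)] by (simp add: ev_twist act_ksmult)
      finally show "counit C w \<odot>\<^bsub>Ck\<^esub> (h \<odot>\<^bsub>C\<^esub> u) =
        tlift Ck (\<lambda>v y. E0 (etens CC v (h \<odot>\<^bsub>C\<^esub> y)) \<odot>\<^bsub>C\<^esub> u) (comult C w)" by simp
    qed
    also have "\<dots> = h \<odot>\<^bsub>C\<^esub> c"
      by (rule Cc.counit_r[OF _ ch(1)]) (assumption | rule kl ch)+
    also have "\<dots> = tlift Ck (\<lambda>x y. counit C x \<odot>\<^bsub>Ck\<^esub> (h \<odot>\<^bsub>C\<^esub> y)) (comult C c)"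
      by (rule Cc.counit_l[OF _ ch(1), symmetric]) (assumption | rule kl ch)+
    also have "\<dots> = tlift Ck (\<lambda>x y. counit C x \<odot>\<^bsub>Ck\<^esub> y) (twist c h)"
      by (rule tlift_twist[OF b2 ch, symmetric])
    finally show "tlift Ck (\<lambda>x y. tlift Ck (\<lambda>u v. E0 (etens CC v y) \<odot>\<^bsub>C\<^esub> u) (comult C x)) (twist c h) =
      tlift Ck (\<lambda>x y. counit C x \<odot>\<^bsub>Ck\<^esub> y) (twist c h)" .
  qed
  then show ?thesis unfolding tlift_etens[OF b1 xy'] tlift_etens[OF b2 xy'] .
qed

text \<open>Tested on c1 \<otimes> c2 h: by \<open>ev_act_l\<close> the right side is S(h) c1 ev(c2
  \<otimes> y), and \<open>ev_counit\<close> contracts it to \<epsilon>(c) S(h) y, which is the left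
  side since ev(c1 \<otimes> c2 h) = \<epsilon>(c) h. Both compatibility axioms of a formal dual
  come from this identity.\<close>

lemma ev_dual:
  assumes x: "x \<in> carrier C" and p: "p \<in> carrier C" and y: "y \<in> carrier C"
  shows "S (E0 (etens CC x p)) \<odot>\<^bsub>C\<^esub> y = E0 (etens CC p y) \<odot>\<^bsub>C\<^esub> x"
proof -
  have c': "x \<in> carrier Ck" "p \<in> carrier Ck" "y \<in> carrier Ck" using x y p by simp_all
  have l: "klin k CC Ck (\<lambda>t. S (E0 t) \<odot>\<^bsub>C\<^esub> y)" by (assumption | rule kl c')+
  have b: "kbil k Ck Ck Ck (\<lambda>x p. E0 (etens CC p y) \<odot>\<^bsub>C\<^esub> x)" by (assumption | rule kl c')+
  have "S (E0 (etens CC x p)) \<odot>\<^bsub>C\<^esub> y = tlift Ck (\<lambda>x p. E0 (etens CC p y) \<odot>\<^bsub>C\<^esub> x) (etens CC x p)"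
  proof (rule delta_ext[OF l klin_tlift0[OF b] etens_closed[OF c'(1,2) kmod_Ck kmod_Ck]])
    fix c h assume ch: "c \<in> carrier Ck" "h \<in> carrier Hk"
    have Sh: "S h \<in> carrier Hk" using ch by simp
    have ec: "counit C c \<in> carrier k" using Cc.counit_closed[OF ch(1)] .
    have l': "klin k Ck Ck (\<lambda>t. S h \<odot>\<^bsub>C\<^esub> t)" by (assumption | rule kl Sh)+
    have "tlift Ck (\<lambda>x p. E0 (etens CC p y) \<odot>\<^bsub>C\<^esub> x) (twist c h) =
        tlift Ck (\<lambda>x p. E0 (etens CC (h \<odot>\<^bsub>C\<^esub> p) y) \<odot>\<^bsub>C\<^esub> x) (comult C c)"
      by (rule tlift_twist[OF b ch])
    also have "\<dots> = S h \<odot>\<^bsub>C\<^esub> tlift Ck (\<lambda>x p. E0 (etens CC p y) \<odot>\<^bsub>C\<^esub> x) (comult C c)"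
      by (rule tlift_push[OF l' b Cc.comult_closed[OF ch(1)], symmetric])
        (use ch y in \<open>simp add: ev_act_l C.smult_assoc1\<close>)
    also have "\<dots> = S h \<odot>\<^bsub>C\<^esub> (counit C c \<odot>\<^bsub>Ck\<^esub> y)"
      using ev_counit[of c y] ch y by simp
    also have "\<dots> = counit C c \<odot>\<^bsub>Ck\<^esub> (S h \<odot>\<^bsub>C\<^esub> y)"
      using klin_laws(6)[OF l' ec] y by simp
    also have "\<dots> = S (E0 (twist c h)) \<odot>\<^bsub>C\<^esub> y"
      using ch y ec klin_laws(6)[OF antipode_klin, of "counit C c" h]
      by (simp only: ev_twist kk_sel bimod_of_sel) (simp add: act_ksmult)
    finally show "S (E0 (twist c h)) \<odot>\<^bsub>C\<^esub> y = tlift Ck (\<lambda>x p. E0 (etens CC p y) \<odot>\<^bsub>C\<^esub> x) (twist c h)" by simp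
  qed
  then show ?thesis unfolding tlift_etens[OF b c'(1,2)] .
qed

end

subsection \<open>The herd of a Galois co-object\<close>

context galois
begin

abbreviation X where "X \<equiv> galois_herd k H C"
abbreviation Pen where "Pen \<equiv> pen_of (bimod_of C)"
abbreviation N3 where "N3 \<equiv> CC \<boxtimes>\<^bsub>k\<^esub> Ck"
abbreviation N4 where "N4 \<equiv> N3 \<boxtimes>\<^bsub>k\<^esub> Ck"
abbreviation N5 where "N5 \<equiv> N4 \<boxtimes>\<^bsub>k\<^esub> Ck"

definition shep where "shep c = tlift N3 (\<lambda>a z. etens N3 (comult C a) z) (comult C c)"

lemma herd_sel:
  "bimod X = bimod_of C" "pen X = Pen" "ev X = E0" "evh X = (\<lambda>t. S (E0 t))" "shepherd X = shep"
  by (simp_all add: galois_herd_def Let_def pen_of_def shep_def[abs_def] tmap_def)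

lemma hbimod_Pen [kl]: "hbimod Pen" by (rule hbimod_pen_of[OF hbimod_C])

lemma keqv_Pen: "keqv k (kk H Pen) Ck" by (rule keqv_pen[OF hbimod_C])
lemma keqv_Ck: "keqv k Ck Ck" by (rule keqv_refl[OF kmod_Ck])

lemma keqv_TP: "keqv k (kk H (TP k H X)) CC"
  unfolding TP_def herd_sel kk_ktensor by (rule keqv_tensor[OF keqv_Ck keqv_Pen])

lemma keqv_PT: "keqv k (kk H (PT k H X)) CC"
  unfolding PT_def herd_sel kk_ktensor by (rule keqv_tensor[OF keqv_Pen keqv_Ck])

lemma keqv_TPT: "keqv k (kk H (TPT k H X)) N3"
  unfolding TPT_def kk_ktensor herd_sel by (rule keqv_tensor[OF keqv_TP keqv_Ck])

lemma keqv_T4: "keqv k (kk H (rk H (TPT k H X) \<boxtimes>\<^bsub>k\<^esub> lk H Pen)) N4"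
  unfolding kk_ktensor by (rule keqv_tensor[OF keqv_TPT keqv_Pen])

lemma keqv_T5: "keqv k (kk H (rk H (rk H (TPT k H X) \<boxtimes>\<^bsub>k\<^esub> lk H Pen) \<boxtimes>\<^bsub>k\<^esub> lk H (bimod_of C))) N5"
  unfolding kk_ktensor[of "rk H (TPT k H X) \<boxtimes>\<^bsub>k\<^esub> lk H Pen"] by (rule keqv_tensor[OF keqv_T4 keqv_Ck])

lemma kbil_shep: "kbil k Ck Ck N3 (\<lambda>a z. etens N3 (comult C a) z)"
  by (assumption | rule kl)+

lemma shep_lin [kl]: "klin k P Ck f \<Longrightarrow> klin k P N3 (\<lambda>z. shep (f z))"
  unfolding shep_def by (rule klin_comp[OF klin_tlift0[OF kbil_shep]]) (rule kl)

lemma shep_closed [kl]: "x \<in> carrier Ck \<Longrightarrow> shep x \<in> carrier N3"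
  by (rule klin_laws(4)[OF shep_lin[OF klin_id[OF kmod_Ck]]])

lemma tlift_shep:
  assumes F: "kbil k CC Ck A F" and c: "c \<in> carrier Ck"
  shows "tlift A F (shep c) = tlift A (\<lambda>a z. F (comult C a) z) (comult C c)"
  unfolding shep_def
  by (rule tlift_push[OF klin_tlift0[OF F] kbil_shep Cc.comult_closed[OF c]])
    (rule tlift_etens[OF F]; (assumption | rule kl))

text \<open>Both sides are the iterated coproduct with five legs. Coassociativity is applied twice:
  to the legs hidden in the first factor, then to \<open>x\<close> itself.\<close>

lemma shep_coassoc:
  assumes x: "x \<in> carrier Ck"
  shows "tlift N5 (\<lambda>t z. etens N5 (tlift N4 (\<lambda>t p. etens N4 (shep t) p) t) z) (shep x) =
    tlift N5 (\<lambda>t y. tlift N5 (\<lambda>u z. tlift N5 (\<lambda>w p. etens N5 (etens N4 (etens N3 t w) p) z) u) (shep y)) (shep x)"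
proof -
  let ?K = "\<lambda>a w p z. etens N5 (etens N4 (etens N3 (comult C a) w) p) z"
  note dx = Cc.comult_closed[OF x]
  have "tlift N5 (\<lambda>t z. etens N5 (tlift N4 (\<lambda>t p. etens N4 (shep t) p) t) z) (shep x) =
    tlift N5 (\<lambda>a z. etens N5 (tlift N4 (\<lambda>t p. etens N4 (shep t) p) (comult C a)) z) (comult C x)"
    by (rule tlift_shep[OF _ x]) (assumption | rule kl)+
  also have "\<dots> = tlift N5 (\<lambda>a z. tlift N5 (\<lambda>w b. tlift N5 (\<lambda>u v. ?K w u v z) (comult C b)) (comult C a)) (comult C x)"
  proof (rule tlift_cong[OF _ _ dx], (assumption | rule kl)+)
    fix a z assume az: "a \<in> carrier Ck" "z \<in> carrier Ck"
    note da = Cc.comult_closed[OF az(1)]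
    have l: "klin k N4 N5 (\<lambda>t. etens N5 t z)" by (assumption | rule kl az)+
    have "etens N5 (tlift N4 (\<lambda>t p. etens N4 (shep t) p) (comult C a)) z =
       tlift N5 (\<lambda>u v. tlift N5 (\<lambda>w w'. ?K w w' v z) (comult C u)) (comult C a)"
    proof (rule tlift_push[OF l _ da], (assumption | rule kl)+)
      fix u v assume uv: "u \<in> carrier Ck" "v \<in> carrier Ck"
      have l': "klin k N3 N5 (\<lambda>t. etens N5 (etens N4 t v) z)" by (assumption | rule kl az uv)+
      show "etens N5 (etens N4 (shep u) v) z = tlift N5 (\<lambda>w w'. ?K w w' v z) (comult C u)"
        unfolding shep_def by (rule tlift_fusion[OF l' kbil_shep Cc.comult_closed[OF uv(1)]])
    qed
    also have "\<dots> = tlift N5 (\<lambda>w b. tlift N5 (\<lambda>u v. ?K w u v z) (comult C b)) (comult C a)"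
      by (rule Cc.coassoc[OF _ az(1)]) (assumption | rule kl az)+
    finally show "etens N5 (tlift N4 (\<lambda>t p. etens N4 (shep t) p) (comult C a)) z =
      tlift N5 (\<lambda>w b. tlift N5 (\<lambda>u v. ?K w u v z) (comult C b)) (comult C a)" .
  qed
  also have "\<dots> = tlift N5 (\<lambda>w y. tlift N5 (\<lambda>b z. tlift N5 (\<lambda>u v. ?K w u v z) (comult C b)) (comult C y)) (comult C x)"
    by (rule Cc.coassoc[OF _ x]) (assumption | rule kl)+
  also have "\<dots> = tlift N5 (\<lambda>a y. tlift N5 (\<lambda>u z. tlift N5 (\<lambda>w p. ?K a w p z) u) (shep y)) (comult C x)"
  proof (rule tlift_cong[OF _ _ dx, symmetric], (assumption | rule kl)+)
    show "tlift N5 (\<lambda>u z. tlift N5 (\<lambda>w p. ?K a w p z) u) (shep y) =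
      tlift N5 (\<lambda>b z. tlift N5 (\<lambda>u v. ?K a u v z) (comult C b)) (comult C y)"
      if "a \<in> carrier Ck" "y \<in> carrier Ck" for a y
      by (rule tlift_shep) (assumption | rule kl that)+
  qed
  also have "\<dots> = tlift N5 (\<lambda>t y. tlift N5 (\<lambda>u z. tlift N5 (\<lambda>w p. etens N5 (etens N4 (etens N3 t w) p) z) u) (shep y)) (shep x)"
    by (rule tlift_shep[OF _ x, symmetric]) (assumption | rule kl)+
  finally show ?thesis .
qed

lemma ev_shep_left:
  assumes x: "x \<in> carrier Ck"
  shows "tlift (Hk \<boxtimes>\<^bsub>k\<^esub> Ck) (\<lambda>t z. etens (Hk \<boxtimes>\<^bsub>k\<^esub> Ck) (S (E0 t)) z) (shep x) = etens (Hk \<boxtimes>\<^bsub>k\<^esub> Ck) \<one>\<^bsub>H\<^esub> x"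
proof -
  let ?T = "Hk \<boxtimes>\<^bsub>k\<^esub> Ck"
  have one: "\<one>\<^bsub>H\<^esub> \<in> carrier Hk" by simp
  have "tlift ?T (\<lambda>t z. etens ?T (S (E0 t)) z) (shep x) = tlift ?T (\<lambda>a z. etens ?T (S (E0 (comult C a))) z) (comult C x)"
    by (rule tlift_shep[OF _ x]) (assumption | rule kl)+
  also have "\<dots> = tlift ?T (\<lambda>a z. counit C a \<odot>\<^bsub>?T\<^esub> etens ?T \<one>\<^bsub>H\<^esub> z) (comult C x)"
  proof (rule tlift_cong[OF _ _ Cc.comult_closed[OF x]], (assumption | rule kl)+)
    fix a z assume az: "a \<in> carrier Ck" "z \<in> carrier Ck"
    have ea: "counit C a \<in> carrier k" by (rule Cc.counit_closed[OF az(1)])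
    have l: "klin k Hk ?T (\<lambda>h. etens ?T (S h) z)" by (assumption | rule kl az)+
    show "etens ?T (S (E0 (comult C a))) z = counit C a \<odot>\<^bsub>?T\<^esub> etens ?T \<one>\<^bsub>H\<^esub> z"
      using klin_laws(6)[OF l ea one] az by (simp add: ev_comult antipode_one)
  qed
  also have "\<dots> = etens ?T \<one>\<^bsub>H\<^esub> x"
    by (rule Cc.counit_l[OF _ x]) (assumption | rule kl one)+
  finally show ?thesis .
qed

text \<open>The evaluation pairs the last two legs, which the left bracketing of \<open>shep\<close>
  separates. After one rebracketing they form the coproduct of a single element, and ev(\<Delta>(a))
  = \<epsilon>(a) 1.\<close>

lemma ev_shep_right:
  assumes x: "x \<in> carrier Ck"
  shows "tlift (Ck \<boxtimes>\<^bsub>k\<^esub> Hk) (\<lambda>t z. tlift (Ck \<boxtimes>\<^bsub>k\<^esub> Hk) (\<lambda>y p. etens (Ck \<boxtimes>\<^bsub>k\<^esub> Hk) y (E0 (etens CC p z))) t) (shep x) =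
    etens (Ck \<boxtimes>\<^bsub>k\<^esub> Hk) x \<one>\<^bsub>H\<^esub>"
proof -
  let ?T = "Ck \<boxtimes>\<^bsub>k\<^esub> Hk"
  have one: "\<one>\<^bsub>H\<^esub> \<in> carrier Hk" by simp
  have "tlift ?T (\<lambda>t z. tlift ?T (\<lambda>y p. etens ?T y (E0 (etens CC p z))) t) (shep x) =
     tlift ?T (\<lambda>a z. tlift ?T (\<lambda>y p. etens ?T y (E0 (etens CC p z))) (comult C a)) (comult C x)"
    by (rule tlift_shep[OF _ x]) (assumption | rule kl)+
  also have "\<dots> = tlift ?T (\<lambda>y a. tlift ?T (\<lambda>p z. etens ?T y (E0 (etens CC p z))) (comult C a)) (comult C x)"
    by (rule Cc.coassoc[OF _ x]) (assumption | rule kl)+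
  also have "\<dots> = tlift ?T (\<lambda>y a. counit C a \<odot>\<^bsub>?T\<^esub> etens ?T y \<one>\<^bsub>H\<^esub>) (comult C x)"
  proof (rule tlift_cong[OF _ _ Cc.comult_closed[OF x]], (assumption | rule kl)+)
    fix y a assume az: "y \<in> carrier Ck" "a \<in> carrier Ck"
    have ea: "counit C a \<in> carrier k" by (rule Cc.counit_closed[OF az(2)])
    have l0: "klin k CC ?T (\<lambda>t. etens ?T y (E0 t))" by (assumption | rule kl az)+
    have l: "klin k Hk ?T (\<lambda>h. etens ?T y h)" by (assumption | rule kl az)+
    have "tlift ?T (\<lambda>p z. etens ?T y (E0 (etens CC p z))) (comult C a) =
        etens ?T y (E0 (tlift CC (etens CC) (comult C a)))"
      by (rule tlift_fusion[OF l0 kbil_etens Cc.comult_closed[OF az(2)], symmetric]) (rule kl)+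
    also have "tlift CC (etens CC) (comult C a) = comult C a"
      by (rule tlift_id[OF kmod_Ck kmod_Ck Cc.comult_closed[OF az(2)]])
    also have "etens ?T y (E0 (comult C a)) = counit C a \<odot>\<^bsub>?T\<^esub> etens ?T y \<one>\<^bsub>H\<^esub>"
      using klin_laws(6)[OF l ea one] az by (simp add: ev_comult)
    finally show "tlift ?T (\<lambda>p z. etens ?T y (E0 (etens CC p z))) (comult C a) =
      counit C a \<odot>\<^bsub>?T\<^esub> etens ?T y \<one>\<^bsub>H\<^esub>" .
  qed
  also have "\<dots> = etens ?T x \<one>\<^bsub>H\<^esub>"
    by (rule Cc.counit_r[OF _ x]) (assumption | rule kl one)+
  finally show ?thesis .
qed

text \<open>On the pen \<open>h\<close> acts as \<open>S h\<close>, and \<open>ev_act_l\<close> adds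
  a second S; as S S = id, the evaluation becomes H-linear on both sides. In the second evaluation
  the outer S plays the same part for the exchanged factors.\<close>

lemma formal_dual: "formal_dual k H X"
proof -
  have PTe: "etens (PT k H X) = etens CC" and TPe: "etens (TP k H X) = etens CC"
    by (rule keqv_ops(1)[OF keqv_PT], rule keqv_ops(1)[OF keqv_TP])
  have hb: "is_bimodule H H (bimod_of C)" "k_central k H (bimod_of C)" "is_bimodule H H Pen" "k_central k H Pen"
    using hbimod_C hbimod_Pen by (simp_all add: hbimod_def)
  have kP: "etens (kk H Pen \<boxtimes>\<^bsub>k\<^esub> Ck) = etens CC" "etens (Ck \<boxtimes>\<^bsub>k\<^esub> kk H Pen) = etens CC"
    by (rule etens_cong_ring, rule keqv_sel(3), rule keqv_tensor, rule keqv_Pen keqv_Ck, rule keqv_Ck keqv_Pen)+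
  have ev: "E0 \<in> bihom H H (PT k H X) (bimod_of (regular H))"
    unfolding PT_def herd_sel
  proof (rule bihom_pairing[OF hbimod_Pen hbimod_C])
    show "klin k (kk H Pen \<boxtimes>\<^bsub>k\<^esub> Ck) Hk E0"
      by (rule keqv_klin[OF _ keqv_refl[OF kmod_Hk] ev_klin]) (rule keqv_sym, rule keqv_tensor[OF keqv_Pen keqv_Ck])
  qed (simp_all add: kP ev_act_l ev_act_r antipode_antipode)
  have evh: "(\<lambda>t. S (E0 t)) \<in> bihom H H (TP k H X) (bimod_of (regular H))"
    unfolding TP_def herd_sel
  proof (rule bihom_pairing[OF hbimod_C hbimod_Pen])
    show "klin k (Ck \<boxtimes>\<^bsub>k\<^esub> kk H Pen) Hk (\<lambda>t. S (E0 t))"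
      by (rule keqv_klin[OF _ keqv_refl[OF kmod_Hk] antipode_lin[OF ev_klin]])
        (rule keqv_sym, rule keqv_tensor[OF keqv_Ck keqv_Pen])
  qed (simp_all add: kP ev_act_l ev_act_r antipode_antipode antipode_mult)
  show ?thesis
    unfolding formal_dual_def Let_def herd_sel PTe TPe
  proof (intro conjI ballI)
    fix p x q assume "p \<in> carrier Pen" "x \<in> carrier (bimod_of C)" "q \<in> carrier Pen"
    then show "rsmult Pen p (S (E0 (etens CC x q))) = E0 (etens CC p x) \<odot>\<^bsub>Pen\<^esub> q"
      using ev_dual[of p x q] by (simp add: antipode_antipode)
  qed (use hb ev evh ev_dual in simp_all)
qed

theorem herd: "is_herd k H X"
proof -
  let ?T3 = "TPT k H X" and ?T4 = "rk H (TPT k H X) \<boxtimes>\<^bsub>k\<^esub> lk H Pen"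
  let ?T5 = "rk H (rk H (TPT k H X) \<boxtimes>\<^bsub>k\<^esub> lk H Pen) \<boxtimes>\<^bsub>k\<^esub> lk H (bimod_of C)"
  have e: "etens (PT k H X) = etens CC" "etens ?T3 = etens N3" "etens ?T4 = etens N4" "etens ?T5 = etens N5"
    by (rule keqv_ops(1), rule keqv_PT keqv_TPT keqv_T4 keqv_T5)+
  have t: "tlift ?T5 = tlift N5" "tlift ?T5 = tlift N5" "tmap ?T4 = tmap N4" "tmap ?T5 = tmap N5"
    by (rule keqv_ops(3)[OF keqv_T5] keqv_ops(2)[OF keqv_T4] keqv_ops(2)[OF keqv_T5])+
  have g1: "tensor_group k Hk (lk H (bimod_of C)) = tensor_group k Hk Ck"
    by (simp add: tensor_group_def tensor_relations_def)
  have g2: "tensor_group k (rk H (bimod_of C)) Hk = tensor_group k Ck Hk"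
    by (simp add: tensor_group_def tensor_relations_def)
  have h: "tmap (Hk \<boxtimes>\<^bsub>k\<^esub> lk H (bimod_of C)) = tmap (Hk \<boxtimes>\<^bsub>k\<^esub> Ck)"
    "etens (Hk \<boxtimes>\<^bsub>k\<^esub> lk H (bimod_of C)) = etens (Hk \<boxtimes>\<^bsub>k\<^esub> Ck)"
    "tlift (rk H (bimod_of C) \<boxtimes>\<^bsub>k\<^esub> Hk) = tlift (Ck \<boxtimes>\<^bsub>k\<^esub> Hk)"
    "tlift (rk H (bimod_of C) \<boxtimes>\<^bsub>k\<^esub> Hk) = tlift (Ck \<boxtimes>\<^bsub>k\<^esub> Hk)"
    "etens (rk H (bimod_of C) \<boxtimes>\<^bsub>k\<^esub> Hk) = etens (Ck \<boxtimes>\<^bsub>k\<^esub> Hk)"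
    unfolding tensor_record_ops g1 g2 by (rule refl)+
  have sh: "shep \<in> bihom k k Ck (kk H ?T3)"
    by (rule klin_bihom, rule keqv_klin[OF keqv_Ck keqv_sym[OF keqv_TPT] shep_lin[OF klin_id[OF kmod_Ck]]])
  show ?thesis
    unfolding is_herd_def Let_def herd_sel e t h
    unfolding tmap_def
    using formal_dual sh by (auto simp: ev_shep_left ev_shep_right shep_coassoc)
qed

end

subsection \<open>Tensor products over the Hopf algebra\<close>

context comm_hopf
begin

lemmas hbimod_kl [kl] = hbimod_tensor hbimod_ktensor hbimod_pen_of
lemmas kmod_kk_kl [kl] = kmod_kk

text \<open>Balanced over \<open>H\<close>, but with values in a mere k-module: most maps out of
  tensor products over \<open>H\<close> end in tensor products over \<open>k\<close>, and linearity
  over \<open>H\<close> is treated separately.\<close>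

definition hbal where
  "hbal M N A f \<longleftrightarrow> hbimod M \<and> hbimod N \<and> kbil k (kk H M) (kk H N) A f \<and>
     (\<forall>x\<in>carrier M. \<forall>h\<in>carrier H. \<forall>y\<in>carrier N. f (rsmult M x h) y = f x (h \<odot>\<^bsub>N\<^esub> y))"

lemma hbal_laws:
  assumes "hbal M N A f"
  shows "hbimod M" "hbimod N" "kbil k (kk H M) (kk H N) A f" "kmod k A"
    "x \<in> carrier M \<Longrightarrow> h \<in> carrier H \<Longrightarrow> y \<in> carrier N \<Longrightarrow> f (rsmult M x h) y = f x (h \<odot>\<^bsub>N\<^esub> y)"
  using assms kbil_laws(3) by (auto simp: hbal_def)

lemma hbalI:
  assumes "hbimod M" "hbimod N" "kbil k (kk H M) (kk H N) A f"
    "\<And>x h y. x \<in> carrier M \<Longrightarrow> h \<in> carrier H \<Longrightarrow> y \<in> carrier N \<Longrightarrow> f (rsmult M x h) y = f x (h \<odot>\<^bsub>N\<^esub> y)"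
  shows "hbal M N A f"
  using assms by (simp add: hbal_def)

lemma additive_kk_l: "additive (kk H M) A f = additive M A f"
  by (rule additive_cong_ring) simp_all

lemma additive_kk_r: "additive A (kk H M) f = additive A M f"
  by (rule additive_cong_ring) simp_all

lemmas additive_kk = additive_kk_l additive_kk_r

lemma hbal_balanced: "hbal M N A f \<Longrightarrow> balanced H M N A f"
proof (rule balancedI)
  assume f: "hbal M N A f"
  note b = kbil_laws(4,5)[OF hbal_laws(3)[OF f]]
  show "additive M A (\<lambda>x. f x y)" if "y \<in> carrier N" for y
    using klin_laws(3)[OF b(1), of y] that by (simp add: additive_kk)
  show "additive N A (\<lambda>y. f x y)" if "x \<in> carrier M" for x
    using klin_laws(3)[OF b(2), of x] that by (simp add: additive_kk)
qed (rule hbal_laws(5))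

lemma htensorable: "hbimod M \<Longrightarrow> hbimod N \<Longrightarrow> tensorable H M N"
  by (rule bimodule_tensorable[OF hbimod_bimodule hbimod_bimodule])

lemma htlift_etens:
  assumes f: "hbal M N A f" and xy: "x \<in> carrier (kk H M)" "y \<in> carrier (kk H N)"
  shows "tlift A f (etens (M \<boxtimes>\<^bsub>H\<^esub> N) x y) = f x y"
  by (rule tlift_etens_gen[OF htensorable[OF hbal_laws(1,2)[OF f]] kmod_laws(2)[OF hbal_laws(4)[OF f]]
        hbal_balanced[OF f]]) (rule xy[unfolded kk_sel])+

lemma hetens_bal:
  assumes "hbimod M" "hbimod N" "x \<in> carrier M" "h \<in> carrier H" "y \<in> carrier N"
  shows "etens (M \<boxtimes>\<^bsub>H\<^esub> N) (rsmult M x h) y = etens (M \<boxtimes>\<^bsub>H\<^esub> N) x (h \<odot>\<^bsub>N\<^esub> y)"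
  by (rule etens_rules(4)[OF assms(1,2)[THEN hbimod_bimodule] assms(3-5)])

lemma hetens_smult:
  assumes "hbimod M" "hbimod N" "x \<in> carrier M" "h \<in> carrier H" "y \<in> carrier N"
  shows "h \<odot>\<^bsub>M \<boxtimes>\<^bsub>H\<^esub> N\<^esub> etens (M \<boxtimes>\<^bsub>H\<^esub> N) x y = etens (M \<boxtimes>\<^bsub>H\<^esub> N) (h \<odot>\<^bsub>M\<^esub> x) y"
    "rsmult (M \<boxtimes>\<^bsub>H\<^esub> N) (etens (M \<boxtimes>\<^bsub>H\<^esub> N) x y) h = etens (M \<boxtimes>\<^bsub>H\<^esub> N) x (rsmult N y h)"
  by (rule tensor_bimodule(2,3)[OF assms(1,2)[THEN hbimod_bimodule] assms(4,3,5)])+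

lemma hetens_closed [kl]:
  assumes "x \<in> carrier (kk H M)" "y \<in> carrier (kk H N)" "hbimod M" "hbimod N"
  shows "etens (M \<boxtimes>\<^bsub>H\<^esub> N) x y \<in> carrier (kk H (M \<boxtimes>\<^bsub>H\<^esub> N))"
  unfolding kk_sel by (rule etens_rules(1)[OF assms(3,4)[THEN hbimod_bimodule] assms(1,2)[unfolded kk_sel]])

lemma hbal_etens:
  assumes M: "hbimod M" and N: "hbimod N"
  shows "hbal M N (kk H (M \<boxtimes>\<^bsub>H\<^esub> N)) (etens (M \<boxtimes>\<^bsub>H\<^esub> N))"
proof (rule hbalI[OF M N])
  note e = etens_rules[OF hbimod_bimodule[OF M] hbimod_bimodule[OF N]]
  have um: "unit_map H a \<in> carrier H" if "a \<in> carrier k" for a using that by simp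
  note km = kmod_kk[OF M] kmod_kk[OF N] kmod_kk[OF hbimod_tensor[OF M N]]
  show "kbil k (kk H M) (kk H N) (kk H (M \<boxtimes>\<^bsub>H\<^esub> N)) (etens (M \<boxtimes>\<^bsub>H\<^esub> N))"
  proof (rule kbil_intro[OF km(1,2)])
    fix y assume y: "y \<in> carrier (kk H N)"
    then have y': "y \<in> carrier N" by simp
    have "etens (M \<boxtimes>\<^bsub>H\<^esub> N) (a \<odot>\<^bsub>kk H M\<^esub> x) y = a \<odot>\<^bsub>kk H (M \<boxtimes>\<^bsub>H\<^esub> N)\<^esub> etens (M \<boxtimes>\<^bsub>H\<^esub> N) x y"
      if "a \<in> carrier k" "x \<in> carrier (kk H M)" for a x
      using that hetens_smult(1)[OF M N _ um y', of x a] by simp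
    then show "klin k (kk H M) (kk H (M \<boxtimes>\<^bsub>H\<^esub> N)) (\<lambda>x. etens (M \<boxtimes>\<^bsub>H\<^esub> N) x y)"
      unfolding klin_def additive_kk using km(1,3) e(2)[OF y'] by blast
  next
    fix x assume x: "x \<in> carrier (kk H M)"
    then have x': "x \<in> carrier M" by simp
    have "etens (M \<boxtimes>\<^bsub>H\<^esub> N) x (a \<odot>\<^bsub>kk H N\<^esub> y) = a \<odot>\<^bsub>kk H (M \<boxtimes>\<^bsub>H\<^esub> N)\<^esub> etens (M \<boxtimes>\<^bsub>H\<^esub> N) x y"
      if a: "a \<in> carrier k" and y: "y \<in> carrier (kk H N)" for a y
    proof -
      have y': "y \<in> carrier N" using y by simp
      show ?thesis
        using hetens_smult(1)[OF M N x' um[OF a] y'] hetens_bal[OF M N x' um[OF a] y'] hbimod_central[OF M a x']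
        by simp
    qed
    then show "klin k (kk H N) (kk H (M \<boxtimes>\<^bsub>H\<^esub> N)) (\<lambda>y. etens (M \<boxtimes>\<^bsub>H\<^esub> N) x y)"
      unfolding klin_def additive_kk using km(2,3) e(3)[OF x'] by blast
  qed
qed (rule hetens_bal[OF M N])

lemma klin_hetens_l [kl]:
  "klin k P (kk H M) f \<Longrightarrow> y \<in> carrier (kk H N) \<Longrightarrow> hbimod M \<Longrightarrow> hbimod N \<Longrightarrow>
    klin k P (kk H (M \<boxtimes>\<^bsub>H\<^esub> N)) (\<lambda>z. etens (M \<boxtimes>\<^bsub>H\<^esub> N) (f z) y)"
  by (rule klin_comp[OF kbil_laws(4)[OF hbal_laws(3)[OF hbal_etens]]])

lemma klin_hetens_r [kl]:
  "klin k P (kk H N) f \<Longrightarrow> x \<in> carrier (kk H M) \<Longrightarrow> hbimod M \<Longrightarrow> hbimod N \<Longrightarrow>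
    klin k P (kk H (M \<boxtimes>\<^bsub>H\<^esub> N)) (\<lambda>z. etens (M \<boxtimes>\<^bsub>H\<^esub> N) x (f z))"
  by (rule klin_comp[OF kbil_laws(5)[OF hbal_laws(3)[OF hbal_etens]]])

lemma hext_additive:
  assumes "hbimod M" "hbimod N" "additive (M \<boxtimes>\<^bsub>H\<^esub> N) A f" "additive (M \<boxtimes>\<^bsub>H\<^esub> N) A g"
    "\<And>x y. x \<in> carrier (kk H M) \<Longrightarrow> y \<in> carrier (kk H N) \<Longrightarrow>
      f (etens (M \<boxtimes>\<^bsub>H\<^esub> N) x y) = g (etens (M \<boxtimes>\<^bsub>H\<^esub> N) x y)"
    "t \<in> carrier (M \<boxtimes>\<^bsub>H\<^esub> N)"
  shows "f t = g t"
  by (rule tensor_ext_gen[OF htensorable[OF assms(1,2)] assms(3,4) _ assms(6)]) (rule assms(5); simp)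

text \<open>A scalar acts on the first factor of an elementary tensor, where \<open>f\<close> is
  linear. The rule is kept out of \<open>kl\<close>, because balance over \<open>H\<close> cannot be
  read off the syntax of an expression and is calculated in each case.\<close>

lemma klin_htlift:
  assumes f: "hbal M N A f" shows "klin k (kk H (M \<boxtimes>\<^bsub>H\<^esub> N)) A (tlift A f)"
proof -
  note L = hbal_laws[OF f]
  note ta = additive_tlift[OF htensorable[OF L(1,2)] kmod_laws(2)[OF L(4)] hbal_balanced[OF f]]
  have km: "kmod k (kk H (M \<boxtimes>\<^bsub>H\<^esub> N))" by (rule kmod_kk[OF hbimod_tensor[OF L(1,2)]])
  have "tlift A f (a \<odot>\<^bsub>kk H (M \<boxtimes>\<^bsub>H\<^esub> N)\<^esub> t) = a \<odot>\<^bsub>A\<^esub> tlift A f t"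
    if a: "a \<in> carrier k" and t: "t \<in> carrier (M \<boxtimes>\<^bsub>H\<^esub> N)" for a t
  proof (rule hext_additive[OF L(1,2) _ _ _ t])
    show "additive (M \<boxtimes>\<^bsub>H\<^esub> N) A (\<lambda>t. tlift A f (a \<odot>\<^bsub>kk H (M \<boxtimes>\<^bsub>H\<^esub> N)\<^esub> t))"
      by (rule additive_comp[OF ta kmod_laws(8)[OF km a, unfolded additive_kk]])
    show "additive (M \<boxtimes>\<^bsub>H\<^esub> N) A (\<lambda>t. a \<odot>\<^bsub>A\<^esub> tlift A f t)"
      by (rule additive_comp[OF kmod_laws(8)[OF L(4) a] ta])
    fix x y assume xy: "x \<in> carrier (kk H M)" "y \<in> carrier (kk H N)"
    have "a \<odot>\<^bsub>kk H (M \<boxtimes>\<^bsub>H\<^esub> N)\<^esub> etens (M \<boxtimes>\<^bsub>H\<^esub> N) x y = etens (M \<boxtimes>\<^bsub>H\<^esub> N) (a \<odot>\<^bsub>kk H M\<^esub> x) y"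
      using hetens_smult(1)[OF L(1,2)] xy a by simp
    moreover have "a \<odot>\<^bsub>kk H M\<^esub> x \<in> carrier (kk H M)" by (rule kmod_laws(4)[OF kmod_kk[OF L(1)] a xy(1)])
    ultimately show "tlift A f (a \<odot>\<^bsub>kk H (M \<boxtimes>\<^bsub>H\<^esub> N)\<^esub> etens (M \<boxtimes>\<^bsub>H\<^esub> N) x y) =
        a \<odot>\<^bsub>A\<^esub> tlift A f (etens (M \<boxtimes>\<^bsub>H\<^esub> N) x y)"
      using klin_laws(6)[OF kbil_laws(4)[OF L(3) xy(2)] a xy(1)]
      by (simp only: htlift_etens[OF f _ xy(2)] xy(1))
  qed
  then show ?thesis using ta km L(4) by (simp add: klin_def additive_kk)
qed

lemma htlift_closed: "hbal M N A f \<Longrightarrow> t \<in> carrier (kk H (M \<boxtimes>\<^bsub>H\<^esub> N)) \<Longrightarrow> tlift A f t \<in> carrier A"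
  by (rule klin_laws(4)[OF klin_htlift])

lemma hext:
  assumes f: "klin k (kk H (M \<boxtimes>\<^bsub>H\<^esub> N)) A f" and g: "klin k (kk H (M \<boxtimes>\<^bsub>H\<^esub> N)) A g"
    and M: "hbimod M" and N: "hbimod N"
    and eq: "\<And>x y. x \<in> carrier (kk H M) \<Longrightarrow> y \<in> carrier (kk H N) \<Longrightarrow>
      f (etens (M \<boxtimes>\<^bsub>H\<^esub> N) x y) = g (etens (M \<boxtimes>\<^bsub>H\<^esub> N) x y)"
    and t: "t \<in> carrier (kk H (M \<boxtimes>\<^bsub>H\<^esub> N))"
  shows "f t = g t"
  by (rule hext_additive[OF M N klin_laws(3)[OF f, unfolded additive_kk] klin_laws(3)[OF g, unfolded additive_kk] eq
        t[unfolded kk_sel]])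

text \<open>The second conclusion transfers balance from a map for which it is clear to a
  complicated one with the same values; the composed shepherd is handled in this way.\<close>

lemma htlift_cong:
  assumes f: "hbal M N A f" and eq: "\<And>x y. x \<in> carrier (kk H M) \<Longrightarrow> y \<in> carrier (kk H N) \<Longrightarrow> f x y = g x y"
    and t: "t \<in> carrier (kk H (M \<boxtimes>\<^bsub>H\<^esub> N))"
  shows "tlift A f t = tlift A g t" "hbal M N A g"
proof -
  note L = hbal_laws[OF f]
  have cl: "rsmult M x h \<in> carrier M" "h \<odot>\<^bsub>N\<^esub> y \<in> carrier N"
    if "x \<in> carrier M" "h \<in> carrier H" "y \<in> carrier N" for x y h
    by (rule is_bimodule_laws(5)[OF hbimod_bimodule[OF L(1)]] is_bimodule_laws(4)[OF hbimod_bimodule[OF L(2)]];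
        rule that)+
  show g: "hbal M N A g"
  proof (rule hbalI[OF L(1,2) kbil_cong[OF L(3) eq]])
    fix x h y assume a: "x \<in> carrier M" "h \<in> carrier H" "y \<in> carrier N"
    show "g (rsmult M x h) y = g x (h \<odot>\<^bsub>N\<^esub> y)"
      using eq[of "rsmult M x h" y] eq[of x "h \<odot>\<^bsub>N\<^esub> y"] L(5)[OF a] cl[OF a] a by simp
  qed
  show "tlift A f t = tlift A g t"
    by (rule hext[OF klin_htlift[OF f] klin_htlift[OF g] L(1,2) _ t])
      (simp only: htlift_etens[OF f] htlift_etens[OF g] eq)
qed

lemma htlift_param:
  assumes t: "t \<in> carrier (kk H (M \<boxtimes>\<^bsub>H\<^esub> N))" and P: "kmod k P"
    and f: "\<And>z. z \<in> carrier P \<Longrightarrow> hbal M N A (f z)"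
    and fl: "\<And>x y. x \<in> carrier (kk H M) \<Longrightarrow> y \<in> carrier (kk H N) \<Longrightarrow> klin k P A (\<lambda>z. f z x y)"
  shows "klin k P A (\<lambda>z. tlift A (f z) t)"
proof -
  have MN: "hbimod M" "hbimod N" and A: "kmod k A"
    using hbal_laws(1,2,4)[OF f[OF kmod_laws(10)[OF P]]] by auto
  show ?thesis
  proof (rule klinI)
    show "tlift A (f z) t \<in> carrier A" if "z \<in> carrier P" for z
      by (rule htlift_closed[OF f[OF that] t])
    fix z w assume zw: "z \<in> carrier P" "w \<in> carrier P"
    have zw': "z \<oplus>\<^bsub>P\<^esub> w \<in> carrier P"
      using zw kmod_laws(2)[OF P] by (simp add: abelian_group.axioms abelian_monoid.a_closed)
    show "tlift A (f (z \<oplus>\<^bsub>P\<^esub> w)) t = tlift A (f z) t \<oplus>\<^bsub>A\<^esub> tlift A (f w) t"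
      by (rule hext[OF klin_htlift[OF f[OF zw']] klin_add[OF klin_htlift[OF f[OF zw(1)]] klin_htlift[OF f[OF zw(2)]]]
            MN _ t])
        (simp only: htlift_etens[OF f] zw zw' klin_laws(5)[OF fl])
  next
    fix a z assume az: "a \<in> carrier k" "z \<in> carrier P"
    have az': "a \<odot>\<^bsub>P\<^esub> z \<in> carrier P" using kmod_laws(4)[OF P] az by blast
    show "tlift A (f (a \<odot>\<^bsub>P\<^esub> z)) t = a \<odot>\<^bsub>A\<^esub> tlift A (f z) t"
      by (rule hext[OF klin_htlift[OF f[OF az']] klin_smult[OF klin_htlift[OF f[OF az(2)]] az(1)] MN _ t])
        (simp only: htlift_etens[OF f] az az' klin_laws(6)[OF fl])
  qed (use P A in simp_all)
qed

end

subsection \<open>Pushing a coproduct forward along a bilinear map\<close>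

text \<open>Everything happens leg by leg, so f(x, b h) = f(x, b) h and its analogue for
  \<open>g\<close> give the law on elementary tensors. It yields the compatibility of coactions and
  coproducts with the diagonal H-action.\<close>

lemma tmap2_act:
  assumes f: "kbil k A B M f" and g: "kbil k A' B' N g"
    and bB: "kbil k B C B bB" and bB': "kbil k B' C' B' bB'"
    and bM: "kbil k M C M bM" and bN: "kbil k N C' N bN"
    and fe: "\<And>x b h. x \<in> carrier A \<Longrightarrow> b \<in> carrier B \<Longrightarrow> h \<in> carrier C \<Longrightarrow> f x (bB b h) = bM (f x b) h"
    and ge: "\<And>x b h. x \<in> carrier A' \<Longrightarrow> b \<in> carrier B' \<Longrightarrow> h \<in> carrier C' \<Longrightarrow> g x (bB' b h) = bN (g x b) h"
    and s: "s \<in> carrier (A \<boxtimes>\<^bsub>k\<^esub> A')" and t: "t \<in> carrier (B \<boxtimes>\<^bsub>k\<^esub> B')" and u: "u \<in> carrier (C \<boxtimes>\<^bsub>k\<^esub> C')"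
  shows "tmap2 (M \<boxtimes>\<^bsub>k\<^esub> N) f g s (tmap2 (B \<boxtimes>\<^bsub>k\<^esub> B') bB bB' t u) =
    tmap2 (M \<boxtimes>\<^bsub>k\<^esub> N) bM bN (tmap2 (M \<boxtimes>\<^bsub>k\<^esub> N) f g s t) u"
proof -
  note T = kbil_tmap2(1)[OF f g] kbil_tmap2(1)[OF bB bB'] kbil_tmap2(1)[OF bM bN]
  note lin = klin_comp[OF kbil_laws(4)[OF T(1)]] klin_comp[OF kbil_laws(5)[OF T(1)]]
    klin_comp[OF kbil_laws(4)[OF T(2)]] klin_comp[OF kbil_laws(5)[OF T(2)]]
    klin_comp[OF kbil_laws(4)[OF T(3)]] klin_comp[OF kbil_laws(5)[OF T(3)]]
    kbil_laws(6)[OF T(1)] kbil_laws(6)[OF T(2)] kbil_laws(6)[OF T(3)]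
  note km [kl] = kbil_laws(1-3)[OF f] kbil_laws(1-3)[OF g] kbil_laws(1-3)[OF bB] kbil_laws(1-3)[OF bB']
  show ?thesis
  proof (rule tensor_ext2[where f = "\<lambda>s t. tmap2 (M \<boxtimes>\<^bsub>k\<^esub> N) f g s (tmap2 (B \<boxtimes>\<^bsub>k\<^esub> B') bB bB' t u)"
        and g = "\<lambda>s t. tmap2 (M \<boxtimes>\<^bsub>k\<^esub> N) bM bN (tmap2 (M \<boxtimes>\<^bsub>k\<^esub> N) f g s t) u", OF _ _ _ _ _ _ _ s t])
    fix x x' b b' assume a: "x \<in> carrier A" "x' \<in> carrier A'" "b \<in> carrier B" "b' \<in> carrier B'"
    have e: "etens (A \<boxtimes>\<^bsub>k\<^esub> A') x x' \<in> carrier (A \<boxtimes>\<^bsub>k\<^esub> A')" "etens (B \<boxtimes>\<^bsub>k\<^esub> B') b b' \<in> carrier (B \<boxtimes>\<^bsub>k\<^esub> B')"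
      by (rule kl a)+
    have cl: "f x b \<in> carrier M" "g x' b' \<in> carrier N" using kbil_laws(6)[OF f] kbil_laws(6)[OF g] a by auto
    show "tmap2 (M \<boxtimes>\<^bsub>k\<^esub> N) f g (etens (A \<boxtimes>\<^bsub>k\<^esub> A') x x') (tmap2 (B \<boxtimes>\<^bsub>k\<^esub> B') bB bB' (etens (B \<boxtimes>\<^bsub>k\<^esub> B') b b') u) =
      tmap2 (M \<boxtimes>\<^bsub>k\<^esub> N) bM bN (tmap2 (M \<boxtimes>\<^bsub>k\<^esub> N) f g (etens (A \<boxtimes>\<^bsub>k\<^esub> A') x x') (etens (B \<boxtimes>\<^bsub>k\<^esub> B') b b')) u"
    proof (rule tensor_ext[OF _ _ kbil_laws(2)[OF bB] kbil_laws(2)[OF bB'] _ u])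
      fix h h' assume h: "h \<in> carrier C" "h' \<in> carrier C'"
      have c2: "bB b h \<in> carrier B" "bB' b' h' \<in> carrier B'"
        using kbil_laws(6)[OF bB] kbil_laws(6)[OF bB'] a h by auto
      show "tmap2 (M \<boxtimes>\<^bsub>k\<^esub> N) f g (etens (A \<boxtimes>\<^bsub>k\<^esub> A') x x')
          (tmap2 (B \<boxtimes>\<^bsub>k\<^esub> B') bB bB' (etens (B \<boxtimes>\<^bsub>k\<^esub> B') b b') (etens (C \<boxtimes>\<^bsub>k\<^esub> C') h h')) =
        tmap2 (M \<boxtimes>\<^bsub>k\<^esub> N) bM bN (tmap2 (M \<boxtimes>\<^bsub>k\<^esub> N) f g (etens (A \<boxtimes>\<^bsub>k\<^esub> A') x x') (etens (B \<boxtimes>\<^bsub>k\<^esub> B') b b'))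
          (etens (C \<boxtimes>\<^bsub>k\<^esub> C') h h')"
        by (simp only: kbil_tmap2(2)[OF bB bB' a(3,4) h] kbil_tmap2(2)[OF f g a(1,2) c2]
            kbil_tmap2(2)[OF f g a] kbil_tmap2(2)[OF bM bN cl h] fe[OF a(1,3) h(1)] ge[OF a(2,4) h(2)])
    qed (assumption | rule kl lin e kbil_laws(2)[OF bB] kbil_laws(2)[OF bB'])+
  qed (assumption | rule kl lin u)+
qed

text \<open>Covers two situations at once: the Hopf module C \<otimes> H (A = C, B = H, N = C, with
  \<open>\<psi>\<close> the action) and the coalgebra C \<otimes>_H D (A = C, B = D, M = N). In
  both, the structure on the elements \<open>\<Phi> x b\<close> and \<open>\<psi> x b\<close> is
  that of A and B leg by leg, so coassociativity and the counit laws are inherited.\<close>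

locale push_coalg = A: coalg k A \<Delta>A \<epsilon>A + B: coalg k B \<Delta>B \<epsilon>B
  for k :: "('k, 'x) ring_scheme" and A :: "('k, 'k, 'a) bimodule" and \<Delta>A \<epsilon>A
    and B :: "('k, 'k, 'b) bimodule" and \<Delta>B \<epsilon>B +
  fixes M :: "('k, 'k, 'm) bimodule" and N :: "('k, 'k, 'n) bimodule" and \<Phi> \<psi> \<rho> \<Delta>N and \<epsilon>N :: "'n \<Rightarrow> 'k"
  assumes Phi: "kbil k A B M \<Phi>" and psi: "kbil k A B N \<psi>"
    and rho: "klin k M (M \<boxtimes>\<^bsub>k\<^esub> N) \<rho>" and DN: "klin k N (N \<boxtimes>\<^bsub>k\<^esub> N) \<Delta>N"
    and eN: "klin k N (bimod_of (regular k)) \<epsilon>N"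
    and rho_Phi: "\<And>x b. x \<in> carrier A \<Longrightarrow> b \<in> carrier B \<Longrightarrow>
      \<rho> (\<Phi> x b) = tmap2 (M \<boxtimes>\<^bsub>k\<^esub> N) \<Phi> \<psi> (\<Delta>A x) (\<Delta>B b)"
    and DN_psi: "\<And>x b. x \<in> carrier A \<Longrightarrow> b \<in> carrier B \<Longrightarrow>
      \<Delta>N (\<psi> x b) = tmap2 (N \<boxtimes>\<^bsub>k\<^esub> N) \<psi> \<psi> (\<Delta>A x) (\<Delta>B b)"
    and eN_psi: "\<And>x b. x \<in> carrier A \<Longrightarrow> b \<in> carrier B \<Longrightarrow> \<epsilon>N (\<psi> x b) = \<epsilon>A x \<otimes>\<^bsub>k\<^esub> \<epsilon>B b"
begin

abbreviation "MN \<equiv> M \<boxtimes>\<^bsub>k\<^esub> N"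
abbreviation "MNN \<equiv> (M \<boxtimes>\<^bsub>k\<^esub> N) \<boxtimes>\<^bsub>k\<^esub> N"

lemmas push_kl [kl] = kbil_laws(3)[OF Phi] kbil_laws(3)[OF psi]
  klin_comp[OF kbil_laws(4)[OF Phi]] klin_comp[OF kbil_laws(5)[OF Phi]] kbil_laws(6)[OF Phi]
  klin_comp[OF kbil_laws(4)[OF psi]] klin_comp[OF kbil_laws(5)[OF psi]] kbil_laws(6)[OF psi]
  klin_comp[OF rho] klin_laws(4)[OF rho] klin_comp[OF DN] klin_laws(4)[OF DN]

text \<open>The Sweedler sums over \<open>x\<close> and over \<open>b\<close> are independent. They
  are separated by \<open>tlift_swap\<close>, each is rebracketed by coassociativity of its own
  coalgebra, and then they are merged again.\<close>

lemma coassoc_push: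
  assumes x: "x \<in> carrier A" and b: "b \<in> carrier B"
  shows "tmap MNN \<rho> (\<lambda>c. c) (\<rho> (\<Phi> x b)) =
    tlift MNN (\<lambda>n c. tlift MNN (\<lambda>d e. etens MNN (etens MN n d) e) (\<Delta>N c)) (\<rho> (\<Phi> x b))"
proof -
  let ?J = "\<lambda>p q u r s v. etens MNN (etens MN (\<Phi> p r) (\<psi> q s)) (\<psi> u v)"
  note dx = A.comult_closed[OF x] and db = B.comult_closed[OF b]
  have "tmap MNN \<rho> (\<lambda>c. c) (\<rho> (\<Phi> x b)) =
      tlift MNN (\<lambda>p u. tlift MNN (\<lambda>r v. etens MNN (\<rho> (\<Phi> p r)) (\<psi> u v)) (\<Delta>B b)) (\<Delta>A x)"
    unfolding tmap_def rho_Phi[OF x b]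
    by (rule tlift_tmap2[OF _ dx db Phi psi]) (assumption | rule kl)+
  also have "\<dots> = tlift MNN (\<lambda>x1 u. tlift MNN (\<lambda>p q. tlift MNN (\<lambda>b1 v. tlift MNN (\<lambda>r s.
       ?J p q u r s v) (\<Delta>B b1)) (\<Delta>B b)) (\<Delta>A x1)) (\<Delta>A x)"
  proof (rule tlift_cong[OF _ _ dx], (assumption | rule db kl)+)
    fix x1 u assume xu: "x1 \<in> carrier A" "u \<in> carrier A"
    note dx1 = A.comult_closed[OF xu(1)]
    have "tlift MNN (\<lambda>b1 v. etens MNN (\<rho> (\<Phi> x1 b1)) (\<psi> u v)) (\<Delta>B b) =
      tlift MNN (\<lambda>b1 v. tlift MNN (\<lambda>p q. tlift MNN (\<lambda>r s. ?J p q u r s v) (\<Delta>B b1)) (\<Delta>A x1)) (\<Delta>B b)"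
    proof (rule tlift_cong[OF _ _ db], (assumption | rule xu kl)+)
      fix b1 v assume bv: "b1 \<in> carrier B" "v \<in> carrier B"
      have l: "klin k MN MNN (\<lambda>t. etens MNN t (\<psi> u v))" by (assumption | rule kl xu bv)+
      have "etens MNN (\<rho> (\<Phi> x1 b1)) (\<psi> u v) =
        tlift MNN (\<lambda>m n. etens MNN (etens MN m n) (\<psi> u v)) (tmap2 MN \<Phi> \<psi> (\<Delta>A x1) (\<Delta>B b1))"
      proof -
        have t: "tmap2 MN \<Phi> \<psi> (\<Delta>A x1) (\<Delta>B b1) \<in> carrier MN"
          using rho_Phi[OF xu(1) bv(1)] klin_laws(4)[OF rho] kbil_laws(6)[OF Phi xu(1) bv(1)] by metis
        have "etens MNN (tlift MN (etens MN) (tmap2 MN \<Phi> \<psi> (\<Delta>A x1) (\<Delta>B b1))) (\<psi> u v) =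
          tlift MNN (\<lambda>m n. etens MNN (etens MN m n) (\<psi> u v)) (tmap2 MN \<Phi> \<psi> (\<Delta>A x1) (\<Delta>B b1))"
          by (rule tlift_fusion[OF l kbil_etens t]) (rule kl)+
        then show ?thesis using rho_Phi[OF xu(1) bv(1)] tlift_id[OF kbil_laws(3)[OF Phi] kbil_laws(3)[OF psi] t] by simp
      qed
      also have "\<dots> = tlift MNN (\<lambda>p q. tlift MNN (\<lambda>r s. ?J p q u r s v) (\<Delta>B b1)) (\<Delta>A x1)"
        by (rule tlift_tmap2[OF _ dx1 B.comult_closed[OF bv(1)] Phi psi]) (assumption | rule kl xu bv)+
      finally show "etens MNN (\<rho> (\<Phi> x1 b1)) (\<psi> u v) =
        tlift MNN (\<lambda>p q. tlift MNN (\<lambda>r s. ?J p q u r s v) (\<Delta>B b1)) (\<Delta>A x1)" .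
    qed
    also have "\<dots> = tlift MNN (\<lambda>p q. tlift MNN (\<lambda>b1 v. tlift MNN (\<lambda>r s. ?J p q u r s v) (\<Delta>B b1)) (\<Delta>B b)) (\<Delta>A x1)"
      by (rule tlift_swap[OF db dx1]) (assumption | rule kl xu)+
    finally show "tlift MNN (\<lambda>b1 v. etens MNN (\<rho> (\<Phi> x1 b1)) (\<psi> u v)) (\<Delta>B b) =
      tlift MNN (\<lambda>p q. tlift MNN (\<lambda>b1 v. tlift MNN (\<lambda>r s. ?J p q u r s v) (\<Delta>B b1)) (\<Delta>B b)) (\<Delta>A x1)" .
  qed
  also have "\<dots> = tlift MNN (\<lambda>p y. tlift MNN (\<lambda>q u. tlift MNN (\<lambda>b1 v. tlift MNN (\<lambda>r s.
       ?J p q u r s v) (\<Delta>B b1)) (\<Delta>B b)) (\<Delta>A y)) (\<Delta>A x)"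
    by (rule A.coassoc[OF _ x]) (assumption | rule kl db)+
  also have "\<dots> = tlift MNN (\<lambda>p y. tlift MNN (\<lambda>r c. tlift MNN (\<lambda>q u. tlift MNN (\<lambda>s v.
       ?J p q u r s v) (\<Delta>B c)) (\<Delta>A y)) (\<Delta>B b)) (\<Delta>A x)"
  proof (rule tlift_cong[OF _ _ dx], (assumption | rule db kl)+)
    fix p y assume py: "p \<in> carrier A" "y \<in> carrier A"
    note dy = A.comult_closed[OF py(2)]
    have "tlift MNN (\<lambda>q u. tlift MNN (\<lambda>b1 v. tlift MNN (\<lambda>r s. ?J p q u r s v) (\<Delta>B b1)) (\<Delta>B b)) (\<Delta>A y) =
      tlift MNN (\<lambda>q u. tlift MNN (\<lambda>r c. tlift MNN (\<lambda>s v. ?J p q u r s v) (\<Delta>B c)) (\<Delta>B b)) (\<Delta>A y)"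
    proof (rule tlift_cong[OF _ _ dy], (assumption | rule db py kl)+)
      show "tlift MNN (\<lambda>b1 v. tlift MNN (\<lambda>r s. ?J p q u r s v) (\<Delta>B b1)) (\<Delta>B b) =
          tlift MNN (\<lambda>r c. tlift MNN (\<lambda>s v. ?J p q u r s v) (\<Delta>B c)) (\<Delta>B b)"
        if "q \<in> carrier A" "u \<in> carrier A" for q u
        by (rule B.coassoc[OF _ b]) (assumption | rule kl py that)+
    qed
    also have "\<dots> = tlift MNN (\<lambda>r c. tlift MNN (\<lambda>q u. tlift MNN (\<lambda>s v. ?J p q u r s v) (\<Delta>B c)) (\<Delta>A y)) (\<Delta>B b)"
      by (rule tlift_swap[OF dy db]) (assumption | rule kl py)+
    finally show "tlift MNN (\<lambda>q u. tlift MNN (\<lambda>b1 v. tlift MNN (\<lambda>r s. ?J p q u r s v) (\<Delta>B b1)) (\<Delta>B b)) (\<Delta>A y) =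
      tlift MNN (\<lambda>r c. tlift MNN (\<lambda>q u. tlift MNN (\<lambda>s v. ?J p q u r s v) (\<Delta>B c)) (\<Delta>A y)) (\<Delta>B b)" .
  qed
  also have "\<dots> = tlift MNN (\<lambda>p y. tlift MNN (\<lambda>r c. tlift MNN (\<lambda>d e. etens MNN (etens MN (\<Phi> p r) d) e) (\<Delta>N (\<psi> y c))) (\<Delta>B b)) (\<Delta>A x)"
  proof (rule tlift_cong[OF _ _ dx, symmetric], (assumption | rule db kl)+)
    fix p y assume py: "p \<in> carrier A" "y \<in> carrier A"
    show "tlift MNN (\<lambda>r c. tlift MNN (\<lambda>d e. etens MNN (etens MN (\<Phi> p r) d) e) (\<Delta>N (\<psi> y c))) (\<Delta>B b) =
      tlift MNN (\<lambda>r c. tlift MNN (\<lambda>q u. tlift MNN (\<lambda>s v. ?J p q u r s v) (\<Delta>B c)) (\<Delta>A y)) (\<Delta>B b)"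
    proof (rule tlift_cong[OF _ _ db], (assumption | rule py kl)+)
      fix r c assume rc: "r \<in> carrier B" "c \<in> carrier B"
      show "tlift MNN (\<lambda>d e. etens MNN (etens MN (\<Phi> p r) d) e) (\<Delta>N (\<psi> y c)) =
        tlift MNN (\<lambda>q u. tlift MNN (\<lambda>s v. ?J p q u r s v) (\<Delta>B c)) (\<Delta>A y)"
        unfolding DN_psi[OF py(2) rc(2)]
        by (rule tlift_tmap2[OF _ A.comult_closed[OF py(2)] B.comult_closed[OF rc(2)] psi psi]) (assumption | rule kl py rc)+
    qed
  qed
  also have "\<dots> = tlift MNN (\<lambda>n c. tlift MNN (\<lambda>d e. etens MNN (etens MN n d) e) (\<Delta>N c)) (\<rho> (\<Phi> x b))"
    unfolding rho_Phi[OF x b]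
    by (rule tlift_tmap2[OF _ dx db Phi psi, symmetric]) (assumption | rule kl)+
  finally show ?thesis .
qed

text \<open>\<open>\<epsilon>N\<close> is a product of two counits here, so the sum over
  \<open>b\<close> collapses first and the one over \<open>x\<close> after it.\<close>

lemma counit_push_gen:
  assumes g: "kbil k A B L g" and x: "x \<in> carrier A" and b: "b \<in> carrier B"
  shows "tlift L (\<lambda>p y. tlift L (\<lambda>r c. \<epsilon>N (\<psi> y c) \<odot>\<^bsub>L\<^esub> g p r) (\<Delta>B b)) (\<Delta>A x) = g x b"
    "tlift L (\<lambda>p y. tlift L (\<lambda>r c. \<epsilon>N (\<psi> p r) \<odot>\<^bsub>L\<^esub> g y c) (\<Delta>B b)) (\<Delta>A x) = g x b"
proof -
  note dx = A.comult_closed[OF x] and db = B.comult_closed[OF b]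
  note [kl] = kbil_laws(3)[OF g] klin_comp[OF kbil_laws(4)[OF g]] klin_comp[OF kbil_laws(5)[OF g]] kbil_laws(6)[OF g]
  have sm: "\<epsilon>N (\<psi> y c) \<odot>\<^bsub>L\<^esub> m = \<epsilon>A y \<odot>\<^bsub>L\<^esub> (\<epsilon>B c \<odot>\<^bsub>L\<^esub> m)"
    if "y \<in> carrier A" "c \<in> carrier B" "m \<in> carrier L" for y c m
    using kmod_laws(6)[OF kbil_laws(3)[OF g]] that by (simp add: eN_psi A.counit_closed B.counit_closed)
  have s1: "kbil k A A L (\<lambda>p y. \<epsilon>A y \<odot>\<^bsub>L\<^esub> g p b)" "kbil k A A L (\<lambda>p y. \<epsilon>A p \<odot>\<^bsub>L\<^esub> g y b)"
    by (assumption | rule kl b)+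
  have "tlift L (\<lambda>r c. \<epsilon>N (\<psi> y c) \<odot>\<^bsub>L\<^esub> g p r) (\<Delta>B b) = \<epsilon>A y \<odot>\<^bsub>L\<^esub> g p b"
    if py: "p \<in> carrier A" "y \<in> carrier A" for p y
  proof -
    have l: "klin k L L (\<lambda>m. \<epsilon>A y \<odot>\<^bsub>L\<^esub> m)" by (assumption | rule kl py A.counit_closed)+
    have "\<epsilon>A y \<odot>\<^bsub>L\<^esub> tlift L (\<lambda>r c. \<epsilon>B c \<odot>\<^bsub>L\<^esub> g p r) (\<Delta>B b) = tlift L (\<lambda>r c. \<epsilon>N (\<psi> y c) \<odot>\<^bsub>L\<^esub> g p r) (\<Delta>B b)"
      by (rule tlift_push[OF l _ db]) (assumption | rule kl py sm[symmetric])+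
    then show ?thesis using B.counit_r[OF kbil_laws(5)[OF g py(1)] b] by simp
  qed
  then have "tlift L (\<lambda>p y. tlift L (\<lambda>r c. \<epsilon>N (\<psi> y c) \<odot>\<^bsub>L\<^esub> g p r) (\<Delta>B b)) (\<Delta>A x) = tlift L (\<lambda>p y. \<epsilon>A y \<odot>\<^bsub>L\<^esub> g p b) (\<Delta>A x)"
    by (intro tlift_cong[OF s1(1) _ dx, symmetric]) simp
  then show "tlift L (\<lambda>p y. tlift L (\<lambda>r c. \<epsilon>N (\<psi> y c) \<odot>\<^bsub>L\<^esub> g p r) (\<Delta>B b)) (\<Delta>A x) = g x b"
    using A.counit_r[OF kbil_laws(4)[OF g b] x] by simp
  have "tlift L (\<lambda>r c. \<epsilon>N (\<psi> p r) \<odot>\<^bsub>L\<^esub> g y c) (\<Delta>B b) = \<epsilon>A p \<odot>\<^bsub>L\<^esub> g y b"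
    if py: "p \<in> carrier A" "y \<in> carrier A" for p y
  proof -
    have l: "klin k L L (\<lambda>m. \<epsilon>A p \<odot>\<^bsub>L\<^esub> m)" by (assumption | rule kl py A.counit_closed)+
    have "\<epsilon>A p \<odot>\<^bsub>L\<^esub> tlift L (\<lambda>r c. \<epsilon>B r \<odot>\<^bsub>L\<^esub> g y c) (\<Delta>B b) = tlift L (\<lambda>r c. \<epsilon>N (\<psi> p r) \<odot>\<^bsub>L\<^esub> g y c) (\<Delta>B b)"
      by (rule tlift_push[OF l _ db]) (assumption | rule kl py sm[symmetric])+
    then show ?thesis using B.counit_l[OF kbil_laws(5)[OF g py(2)] b] by simp
  qed
  then have "tlift L (\<lambda>p y. tlift L (\<lambda>r c. \<epsilon>N (\<psi> p r) \<odot>\<^bsub>L\<^esub> g y c) (\<Delta>B b)) (\<Delta>A x) = tlift L (\<lambda>p y. \<epsilon>A p \<odot>\<^bsub>L\<^esub> g y b) (\<Delta>A x)"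
    by (intro tlift_cong[OF s1(2) _ dx, symmetric]) simp
  then show "tlift L (\<lambda>p y. tlift L (\<lambda>r c. \<epsilon>N (\<psi> p r) \<odot>\<^bsub>L\<^esub> g y c) (\<Delta>B b)) (\<Delta>A x) = g x b"
    using A.counit_l[OF kbil_laws(4)[OF g b] x] by simp
qed

lemma counit_smult_lin:
  assumes f: "klin k P N f" and y: "y \<in> carrier L" and L: "kmod k L"
  shows "klin k P L (\<lambda>z. \<epsilon>N (f z) \<odot>\<^bsub>L\<^esub> y)"
proof -
  have "klin k (bimod_of (regular k)) L (\<lambda>a. a \<odot>\<^bsub>L\<^esub> y)"
    by (rule klinI) (use A.kmod_k L y kmod_laws[OF L] in \<open>auto simp: bimod_of_def regular_def\<close>)
  then show ?thesis by (rule klin_comp) (rule klin_comp[OF eN f])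
qed

lemma eN_closed: "n \<in> carrier N \<Longrightarrow> \<epsilon>N n \<in> carrier k"
  using klin_laws(4)[OF eN, of n] by (simp add: bimod_of_def regular_def)

lemma counit_push:
  assumes x: "x \<in> carrier A" and b: "b \<in> carrier B"
  shows "tlift M (\<lambda>n c. \<epsilon>N c \<odot>\<^bsub>M\<^esub> n) (\<rho> (\<Phi> x b)) = \<Phi> x b"
    "tlift N (\<lambda>n c. \<epsilon>N n \<odot>\<^bsub>N\<^esub> c) (\<Delta>N (\<psi> x b)) = \<psi> x b"
proof -
  note dx = A.comult_closed[OF x] and db = B.comult_closed[OF b]
  have "tlift M (\<lambda>n c. \<epsilon>N c \<odot>\<^bsub>M\<^esub> n) (\<rho> (\<Phi> x b)) =
      tlift M (\<lambda>p y. tlift M (\<lambda>r c. \<epsilon>N (\<psi> y c) \<odot>\<^bsub>M\<^esub> \<Phi> p r) (\<Delta>B b)) (\<Delta>A x)"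
    unfolding rho_Phi[OF x b]
    by (rule tlift_tmap2[OF _ dx db Phi psi]) (assumption | rule kl counit_smult_lin eN_closed)+
  then show "tlift M (\<lambda>n c. \<epsilon>N c \<odot>\<^bsub>M\<^esub> n) (\<rho> (\<Phi> x b)) = \<Phi> x b"
    using counit_push_gen(1)[OF Phi x b] by simp
  have "tlift N (\<lambda>n c. \<epsilon>N n \<odot>\<^bsub>N\<^esub> c) (\<Delta>N (\<psi> x b)) =
      tlift N (\<lambda>p y. tlift N (\<lambda>r c. \<epsilon>N (\<psi> p r) \<odot>\<^bsub>N\<^esub> \<psi> y c) (\<Delta>B b)) (\<Delta>A x)"
    unfolding DN_psi[OF x b]
    by (rule tlift_tmap2[OF _ dx db psi psi]) (assumption | rule kl counit_smult_lin eN_closed)+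
  then show "tlift N (\<lambda>n c. \<epsilon>N n \<odot>\<^bsub>N\<^esub> c) (\<Delta>N (\<psi> x b)) = \<psi> x b"
    using counit_push_gen(2)[OF psi x b] by simp
qed

end

subsection \<open>From the equivalence of categories to the Galois map\<close>

lemma infinite_times_lepoll:
  assumes u: "infinite (UNIV :: 'u set)" and A: "A \<lesssim> (UNIV :: 'u set)" and B: "B \<lesssim> (UNIV :: 'u set)"
  shows "A \<times> B \<lesssim> (UNIV :: 'u set)"
proof -
  have "A \<times> B \<lesssim> (UNIV :: 'u set) \<times> (UNIV :: 'u set)" using A B by (rule times_lepoll_mono)
  moreover have "(UNIV :: 'u set) \<times> (UNIV :: 'u set) \<approx> (UNIV :: 'u set)"
    unfolding eqpoll_iff_card_of_ordIso using u by (rule card_of_Times_same_infinite)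
  ultimately show ?thesis by (rule lepoll_trans2)
qed

text \<open>Formal sums are finitely supported functions into the integers, hence no more numerous
  than the finite subsets of A \<times> int, and an infinite set has as many finite subsets as
  elements.\<close>

lemma free_Abelian_group_lepoll:
  assumes u: "infinite (UNIV :: 'u set)" and A: "A \<lesssim> (UNIV :: 'u set)" and ne: "A \<noteq> {}"
  shows "carrier (free_Abelian_group A) \<lesssim> (UNIV :: 'u set)"
proof -
  \<comment> \<open>The factor \<open>int\<close> makes the product infinite even for finite
    \<open>A\<close>, provided that \<open>A\<close> is nonempty.\<close>
  have inf: "infinite (A \<times> (UNIV :: int set))"
    using ne by (auto simp: finite_cartesian_product_iff infinite_UNIV_int)
  have "carrier (free_Abelian_group A) \<lesssim>
      {f. f ` A \<subseteq> (UNIV :: int set) \<and> {x. f x \<noteq> 0} \<subseteq> A \<and> finite {x. f x \<noteq> 0}}"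
    unfolding lepoll_def
    by (rule exI[of _ Poly_Mapping.lookup]) (auto simp: poly_mapping_eqI lookup_not_eq_zero_eq_in_keys inj_onI)
  also have "\<dots> \<lesssim> Fpow (A \<times> (UNIV :: int set))" by (rule lepoll_restricted_funspace)
  also have "\<dots> \<approx> A \<times> (UNIV :: int set)" using inf by (rule eqpoll_Fpow)
  also have "\<dots> \<lesssim> (UNIV :: 'u set)"
  proof (rule infinite_times_lepoll[OF u A])
    have "(UNIV :: int set) \<lesssim> (UNIV :: nat set)"
      unfolding lepoll_def by (metis inj_to_nat subset_UNIV)
    then show "(UNIV :: int set) \<lesssim> (UNIV :: 'u set)"
      using u unfolding infinite_le_lepoll by (rule lepoll_trans)
  qed
  finally show ?thesis .
qed

text \<open>A tensor product is a quotient of the free abelian group on a product of two sets that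
  embed in \<open>'u\<close>, so its cardinality does not exceed that of the infinite
  universe.\<close>

lemma tensor_embedding:
  fixes f :: "'a \<Rightarrow> 'u" and g :: "'b \<Rightarrow> 'u"
  assumes T: "tensorable S M N" and u: "infinite (UNIV :: 'u set)"
    and f: "inj_on f (carrier M)" and g: "inj_on g (carrier N)"
  shows "\<exists>e :: _ \<Rightarrow> 'u. inj_on e (carrier (M \<boxtimes>\<^bsub>S\<^esub> N))"
proof -
  interpret M: abelian_group M using T by (simp add: tensorable_def)
  interpret N: abelian_group N using T by (simp add: tensorable_def)
  have "carrier M \<lesssim> (UNIV :: 'u set)" "carrier N \<lesssim> (UNIV :: 'u set)"
    using f g by (auto simp: lepoll_def)
  then have "carrier M \<times> carrier N \<lesssim> (UNIV :: 'u set)" by (rule infinite_times_lepoll[OF u])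
  moreover have "carrier M \<times> carrier N \<noteq> {}" using M.zero_closed N.zero_closed by blast
  ultimately have F: "carrier (free_Abelian_group (carrier M \<times> carrier N)) \<lesssim> (UNIV :: 'u set)"
    by (rule free_Abelian_group_lepoll[OF u])
  have "carrier (M \<boxtimes>\<^bsub>S\<^esub> N) \<lesssim> carrier (free_Abelian_group (carrier M \<times> carrier N))"
    unfolding tensor_sel carrier_tensor_group_coset[OF T] by (rule image_lepoll)
  then have "carrier (M \<boxtimes>\<^bsub>S\<^esub> N) \<lesssim> (UNIV :: 'u set)" using F by (rule lepoll_trans)
  then show ?thesis by (auto simp: lepoll_def)
qed

text \<open>\<open>galois_coobject\<close> speaks of modules with carrier in \<open>'u\<close> only,
  so a module of another type takes part through a copy. The values of the operations off the image
  of \<open>e\<close> carry no meaning.\<close>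

definition transport :: "('a \<Rightarrow> 'u) \<Rightarrow> ('r, 'a, 'z) module_scheme \<Rightarrow> ('r, 'u) module" where
  "transport e W = \<lparr>carrier = e ` carrier W, mult = (\<lambda>_ _. undefined), one = undefined, zero = e \<zero>\<^bsub>W\<^esub>,
     add = (\<lambda>x y. e (inv_into (carrier W) e x \<oplus>\<^bsub>W\<^esub> inv_into (carrier W) e y)),
     smult = (\<lambda>r x. e (r \<odot>\<^bsub>W\<^esub> inv_into (carrier W) e x))\<rparr>"

lemma module_transport:
  assumes W: "module R W" and e: "inj_on e (carrier W)"
  shows "module R (transport e W)"
proof -
  interpret W: module R W by fact
  note i [simp] = inv_into_f_f[OF e]
  show ?thesis
  proof (rule moduleI[OF W.is_cring])
    show "abelian_group (transport e W)"
    proof (rule abelian_groupI)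
      fix x assume "x \<in> carrier (transport e W)"
      then obtain w where w: "w \<in> carrier W" "x = e w" by (auto simp: transport_def)
      then show "\<exists>y\<in>carrier (transport e W). y \<oplus>\<^bsub>transport e W\<^esub> x = \<zero>\<^bsub>transport e W\<^esub>"
        by (intro bexI[of _ "e (\<ominus>\<^bsub>W\<^esub> w)"]) (auto simp: transport_def W.l_neg)
    qed (auto simp: transport_def W.a_ac)
  qed (auto simp: transport_def W.smult_l_distr W.smult_r_distr W.smult_assoc1)
qed

section \<open>The Hopf module C \<otimes> H and its coaction\<close>

context mod_coalg
begin

context
  fixes e :: "('c, 'h) tens \<Rightarrow> 'u"
  assumes einj: "inj_on e (carrier CH)"
begin

text \<open>C \<otimes> H with both outer actions; of these, the right one, multiplication on the
  factor H, is passed on to \<open>M\<close>.\<close>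

definition W where "W = rk H (bimod_of C) \<boxtimes>\<^bsub>k\<^esub> lk H (bimod_of (regular H))"
definition M where "M = transport e (right_module W)"
abbreviation Mk where "Mk \<equiv> kk H (bimod_of M)"
abbreviation inve where "inve \<equiv> inv_into (carrier CH) e"
definition Phi where "Phi c h = e (etens CH c h)"

lemma hbimod_W: "hbimod W"
  unfolding W_def by (rule hbimod_ktensor[OF hbimod_C module_regular_H])

lemma keqv_W: "keqv k (kk H W) CH"
  unfolding W_def kk_ktensor by (rule keqv_tensor[OF keqv_refl[OF kmod_Ck] keqv_H])

lemma W_sel: "carrier W = carrier CH" "add W = add CH" "zero W = zero CH"
  using keqv_sel(1-3)[OF keqv_W] by (simp_all only: kk_sel)

lemma module_M: "module H M"
  unfolding M_def
proof (rule module_transport)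
  show "module H (right_module W)" using hbimod_bimodule[OF hbimod_W] by (simp add: is_bimodule_def)
  show "inj_on e (carrier (right_module W))" using einj by (simp add: right_module_def W_sel del: tensor_sel)
qed

lemma hbimod_M [kl]: "hbimod (bimod_of M)" by (rule hbimod_bimod_of[OF module_M])

lemma M_sel:
  "carrier M = e ` carrier CH"
  "add M = (\<lambda>x y. e (inve x \<oplus>\<^bsub>CH\<^esub> inve y))"
  "smult M = (\<lambda>h x. e (rsmult W (inve x) h))"
  by (simp_all add: M_def transport_def right_module_def W_sel del: tensor_sel)

lemma inve [simp]: "t \<in> carrier CH \<Longrightarrow> inve (e t) = t"
  by (rule inv_into_f_f[OF einj])

lemma CH_closed:
  "s \<in> carrier CH \<Longrightarrow> t \<in> carrier CH \<Longrightarrow> s \<oplus>\<^bsub>CH\<^esub> t \<in> carrier CH"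
  "h \<in> carrier H \<Longrightarrow> t \<in> carrier CH \<Longrightarrow> rsmult W t h \<in> carrier CH"
proof -
  have "abelian_group CH" by (rule kmod_laws(2)[OF kmod_tensor[OF kmod_Ck kmod_Hk]])
  then show "s \<in> carrier CH \<Longrightarrow> t \<in> carrier CH \<Longrightarrow> s \<oplus>\<^bsub>CH\<^esub> t \<in> carrier CH"
    by (rule abelian_monoid.a_closed[OF abelian_group.axioms(1)])
  show "h \<in> carrier H \<Longrightarrow> t \<in> carrier CH \<Longrightarrow> rsmult W t h \<in> carrier CH"
    using is_bimodule_laws(5)[OF hbimod_bimodule[OF hbimod_W], of h t] unfolding W_sel .
qed

lemma rsmult_W_unit: "a \<in> carrier k \<Longrightarrow> t \<in> carrier CH \<Longrightarrow> rsmult W t (unit_map H a) = a \<odot>\<^bsub>CH\<^esub> t"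
  using hbimod_central[OF hbimod_W, of a t] keqv_sel(4)[OF keqv_W, of a t] by (simp add: W_sel del: tensor_sel)

lemma e_klin: "klin k CH Mk e"
proof (rule klinI)
  show "kmod k CH" by (rule kmod_tensor[OF kmod_Ck kmod_Hk])
  show "kmod k Mk" by (rule kmod_kk[OF hbimod_M])
qed (simp_all add: M_sel rsmult_W_unit del: tensor_sel)

lemma inve_klin: "klin k Mk CH inve"
proof (rule klinI)
  show "kmod k CH" by (rule kmod_tensor[OF kmod_Ck kmod_Hk])
  show "kmod k Mk" by (rule kmod_kk[OF hbimod_M])
  show "inve (a \<odot>\<^bsub>Mk\<^esub> x) = a \<odot>\<^bsub>CH\<^esub> inve x" if "a \<in> carrier k" "x \<in> carrier Mk" for a x
  proof -
    have "x \<in> e ` carrier CH" using that(2) by (simp only: kk_sel bimod_of_sel M_sel(1))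
    then obtain t where t: "t \<in> carrier CH" "x = e t" by blast
    then show ?thesis
      using that CH_closed(2)[of "unit_map H a" t] by (simp add: M_sel rsmult_W_unit del: tensor_sel)
  qed
qed (auto simp: M_sel CH_closed simp del: tensor_sel)

lemma kbil_Phi: "kbil k Ck Hk Mk Phi"
proof -
  note [kl] = klin_comp[OF e_klin]
  show ?thesis unfolding Phi_def by (assumption | rule kl)+
qed

lemmas Phi_kl [kl] = klin_comp[OF kbil_laws(4)[OF kbil_Phi]] klin_comp[OF kbil_laws(5)[OF kbil_Phi]]
  kbil_laws(6)[OF kbil_Phi] kbil_laws(3)[OF kbil_Phi]

lemma M_ext:
  assumes f: "klin k Mk A f" and g: "klin k Mk A g"
    and eq: "\<And>c h. c \<in> carrier Ck \<Longrightarrow> h \<in> carrier Hk \<Longrightarrow> f (Phi c h) = g (Phi c h)" and m: "m \<in> carrier Mk"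
  shows "f m = g m"
proof -
  obtain t where t: "t \<in> carrier CH" "m = e t" using m by (auto simp: M_sel simp del: tensor_sel)
  show ?thesis unfolding t(2)
    by (rule tensor_ext[OF klin_comp[OF f e_klin] klin_comp[OF g e_klin] kmod_Ck kmod_Hk _ t(1)])
      (use eq in \<open>simp add: Phi_def\<close>)
qed

lemma tlift_inve_Phi:
  assumes F: "kbil k Ck Hk A F" and ch: "c \<in> carrier Ck" "h \<in> carrier Hk"
  shows "tlift A F (inve (Phi c h)) = F c h"
  unfolding Phi_def inve[OF etens_closed[OF ch kmod_Ck kmod_Hk]] by (rule tlift_etens[OF F ch])

lemma Phi_act:
  assumes "c \<in> carrier C" "g \<in> carrier H" "h \<in> carrier H"
  shows "h \<odot>\<^bsub>M\<^esub> Phi c g = Phi c (g \<otimes>\<^bsub>H\<^esub> h)"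
proof -
  have t: "etens CH c g \<in> carrier CH" by (rule etens_closed) (simp_all add: assms kmod_Ck kmod_Hk)
  have "etens W = etens CH" by (rule etens_cong_ring) (rule W_sel)
  then have "rsmult W (etens CH c g) h = etens CH c (g \<otimes>\<^bsub>H\<^esub> h)"
    using tensor_bimodule(3)[OF hbimod_restr(2)[OF hbimod_C] hbimod_restr(1)[OF module_regular_H], of h c g] assms
    by (simp add: W_def H_m_comm)
  then show ?thesis unfolding Phi_def M_sel inve[OF t] by simp
qed

abbreviation MC where "MC \<equiv> kk H (bimod_of M) \<boxtimes>\<^bsub>k\<^esub> kk H (bimod_of C)"

text \<open>The codiagonal coaction c \<otimes> h \<mapsto> (c1 \<otimes> h1) \<otimes> c2 h2, read
  on the copy through \<open>inve\<close>. With it the unit of the adjunction turns into the Galois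
  map, as \<open>unit_e\<close> shows.\<close>

definition rho where
  "rho m = tlift MC (\<lambda>c h. tmap2 MC Phi act (comult C c) (hcomult H h)) (inve m)"

lemma kbil_rho0: "kbil k Ck Hk MC (\<lambda>c h. tmap2 MC Phi act (comult C c) (hcomult H h))"
proof -
  note b = kbil_tmap2(1)[OF kbil_Phi kbil_act]
  note [kl] = klin_comp[OF kbil_laws(4)[OF b]] klin_comp[OF kbil_laws(5)[OF b]]
  show ?thesis by (assumption | rule kl)+
qed

lemma rho_klin: "klin k Mk MC rho"
  unfolding rho_def by (rule klin_tlift[OF inve_klin kbil_rho0])

lemma rho_Phi:
  assumes "c \<in> carrier Ck" "h \<in> carrier Hk"
  shows "rho (Phi c h) = tmap2 MC Phi act (comult C c) (hcomult H h)"
  unfolding rho_def by (rule tlift_inve_Phi[OF kbil_rho0 assms])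

lemma push_rho: "push_coalg k Ck (comult C) (counit C) Hk (hcomult H) (hcounit H) Mk Ck Phi act rho (comult C) (counit C)"
  by unfold_locales
    (use kbil_Phi kbil_act rho_klin Cc.comult_klin Cc.counit_klin rho_Phi comult_act in simp_all)

lemma kbil_actM: "kbil k Mk Hk Mk (\<lambda>m h. h \<odot>\<^bsub>M\<^esub> m)"
  using hsmult_lin(1)[OF klin_id[OF kmod_kk[OF hbimod_M]] _ hbimod_M] hact_lin(1)[OF klin_id[OF kmod_Hk] _ hbimod_M]
  by (intro kbil_intro kmod_kk[OF hbimod_M] kmod_Hk) simp_all

text \<open>On \<open>Phi c g\<close> the action multiplies \<open>g\<close> by \<open>h\<close>,
  and \<Delta>(g h) = \<Delta>(g) \<Delta>(h) distributes it over the legs.\<close>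

lemma rho_act:
  assumes m: "m \<in> carrier M" and h: "h \<in> carrier H"
  shows "rho (h \<odot>\<^bsub>M\<^esub> m) = tmap2 MC (\<lambda>m h. h \<odot>\<^bsub>M\<^esub> m) act (rho m) (hcomult H h)"
proof -
  note b = kbil_tmap2(1)[OF kbil_actM kbil_act]
  have h': "h \<in> carrier Hk" using h by simp
  note dh = Hc.comult_closed[OF h']
  show ?thesis
  proof (rule M_ext[where A = MC and m = m])
    show "klin k Mk MC (\<lambda>m. rho (h \<odot>\<^bsub>M\<^esub> m))" by (rule klin_comp[OF rho_klin kbil_laws(4)[OF kbil_actM h']])
    show "klin k Mk MC (\<lambda>m. tmap2 MC (\<lambda>m h. h \<odot>\<^bsub>M\<^esub> m) act (rho m) (hcomult H h))"
      by (rule klin_comp[OF kbil_laws(4)[OF b dh] rho_klin])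
    fix c g assume cg: "c \<in> carrier Ck" "g \<in> carrier Hk"
    have gh: "g \<otimes>\<^bsub>H\<^esub> h \<in> carrier Hk" using cg h by simp
    have "rho (h \<odot>\<^bsub>M\<^esub> Phi c g) = tmap2 MC Phi act (comult C c)
        (tmap2 (Hk \<boxtimes>\<^bsub>k\<^esub> Hk) (mult H) (mult H) (hcomult H g) (hcomult H h))"
      using Phi_act[of c g h] rho_Phi[OF cg(1) gh] hcomult_mult(1)[of g h] cg h by simp
    also have "\<dots> = tmap2 MC (\<lambda>m h. h \<odot>\<^bsub>M\<^esub> m) act
        (tmap2 MC Phi act (comult C c) (hcomult H g)) (hcomult H h)"
      by (rule tmap2_act[OF kbil_Phi kbil_act kbil_mult kbil_mult kbil_actM kbil_act _ _
            Cc.comult_closed[OF cg(1)] Hc.comult_closed[OF cg(2)] dh])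
        (simp_all add: Phi_act, metis C.smult_assoc1 H_m_comm)
    finally show "rho (h \<odot>\<^bsub>M\<^esub> Phi c g) = tmap2 MC (\<lambda>m h. h \<odot>\<^bsub>M\<^esub> m) act (rho (Phi c g)) (hcomult H h)"
      by (simp only: rho_Phi[OF cg])
  qed (simp add: m)
qed

lemma hopf_module_M: "hopf_module k H C M rho"
proof -
  interpret P: push_coalg k Ck "comult C" "counit C" Hk "hcomult H" "hcounit H" Mk Ck Phi "\<lambda>c h. h \<odot>\<^bsub>C\<^esub> c" rho "comult C" "counit C"
    by (rule push_rho)
  let ?MCC = "MC \<boxtimes>\<^bsub>k\<^esub> Ck"
  note [kl] = klin_comp[OF rho_klin] klin_laws(4)[OF rho_klin]
  have co: "tmap ?MCC rho (\<lambda>c. c) (rho m) =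
      tlift ?MCC (\<lambda>n c. tlift ?MCC (\<lambda>d e. etens ?MCC (etens MC n d) e) (comult C c)) (rho m)"
    if "m \<in> carrier Mk" for m
  proof (rule M_ext[where f = "\<lambda>m. tmap ?MCC rho (\<lambda>c. c) (rho m)" and A = ?MCC, OF _ _ _ that])
    show "klin k Mk ?MCC (\<lambda>m. tmap ?MCC rho (\<lambda>c. c) (rho m))"
      unfolding tmap_def by (assumption | rule kl)+
    show "klin k Mk ?MCC (\<lambda>m. tlift ?MCC (\<lambda>n c. tlift ?MCC (\<lambda>d e. etens ?MCC (etens MC n d) e) (comult C c)) (rho m))"
      by (assumption | rule kl)+
  qed (rule P.coassoc_push)
  have cu: "tlift Mk (\<lambda>n c. counit C c \<odot>\<^bsub>Mk\<^esub> n) (rho m) = m" if "m \<in> carrier Mk" for m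
  proof (rule M_ext[where f = "\<lambda>m. tlift Mk (\<lambda>n c. counit C c \<odot>\<^bsub>Mk\<^esub> n) (rho m)" and A = Mk, OF _ _ _ that])
    show "klin k Mk Mk (\<lambda>m. tlift Mk (\<lambda>n c. counit C c \<odot>\<^bsub>Mk\<^esub> n) (rho m))" by (assumption | rule kl)+
    show "klin k Mk Mk (\<lambda>m. m)" by (rule kl)+
  qed (rule P.counit_push(1))
  have tM: "tlift M = tlift Mk" by (rule tlift_cong_ring) simp_all
  show ?thesis
    unfolding hopf_module_def Let_def tM
    using module_M klin_bihom[OF rho_klin] co cu rho_act by simp
qed

section \<open>Coinvariants of C \<otimes> H\<close>

definition Q where "Q = coinv k H (lk H (bimod_of M))"

lemma bimodule_triv: "is_bimodule H k (triv k H)"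
  unfolding triv_def by (rule bimodule_lrestr[OF kmod_laws(3)[OF kmod_Rk] hcounit_hom cring_H])

lemma bimodule_Q: "is_bimodule k k Q"
  unfolding Q_def coinv_def by (rule tensor_bimodule(1)[OF hbimod_restr(1)[OF hbimod_M] bimodule_triv])

lemmas Q_etens = etens_rules[OF hbimod_restr(1)[OF hbimod_M] bimodule_triv, folded coinv_def, folded Q_def]
lemmas Q_smult = tensor_bimodule(2,3)[OF hbimod_restr(1)[OF hbimod_M] bimodule_triv, folded coinv_def, folded Q_def]

lemma triv_sel [simp]: "carrier (triv k H) = carrier k" "h \<odot>\<^bsub>triv k H\<^esub> x = hcounit H h \<otimes>\<^bsub>k\<^esub> x"
  "rsmult (triv k H) x a = a \<otimes>\<^bsub>k\<^esub> x"
  by (simp_all add: triv_def)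

lemma tensorable_Q: "tensorable H (lk H (bimod_of M)) (triv k H)"
  by (rule bimodule_tensorable[OF hbimod_restr(1)[OF hbimod_M] bimodule_triv])

lemma Q_ext:
  assumes "additive Q A f" "additive Q A g"
    "\<And>m b. m \<in> carrier M \<Longrightarrow> b \<in> carrier k \<Longrightarrow> f (etens Q m b) = g (etens Q m b)" "t \<in> carrier Q"
  shows "f t = g t"
  using tensor_ext_gen[OF tensorable_Q, folded coinv_def, folded Q_def, OF assms(1,2) _ assms(4)] assms(3) by simp

lemma hcounit_unit_map: "a \<in> carrier k \<Longrightarrow> hcounit H (unit_map H a) = a"
  using klin_laws(6)[OF Hc.counit_klin, of a "\<one>\<^bsub>H\<^esub>"] ring_hom_one[OF hcounit_hom] by (simp add: unit_map_def)

lemma Q_move: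
  assumes "m \<in> carrier M" "h \<in> carrier H" "b \<in> carrier k"
  shows "etens Q (h \<odot>\<^bsub>M\<^esub> m) b = etens Q m (hcounit H h \<otimes>\<^bsub>k\<^esub> b)"
  using Q_etens(4)[of m h b] assms by simp

text \<open>A scalar crosses \<otimes>_H as its image in \<open>H\<close>, and \<epsilon>_H sends
  that image back to the scalar; so the action through the first factor and the one through
  \<open>k\<close> agree.\<close>

lemma kmod_Q [kl]: "kmod k Q"
proof -
  note L = is_bimodule_laws[OF bimodule_Q]
  have "rsmult Q t a = a \<odot>\<^bsub>Q\<^esub> t" if a: "a \<in> carrier k" and t: "t \<in> carrier Q" for a t
  proof (rule Q_ext[OF L(7)[OF a] L(6)[OF a] _ t])
    fix m b assume mb: "m \<in> carrier M" "b \<in> carrier k"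
    then show "rsmult Q (etens Q m b) a = a \<odot>\<^bsub>Q\<^esub> etens Q m b"
      using Q_smult(1)[of a m b] Q_smult(2)[of a m b] Q_move[OF mb(1) unit_map_closed[OF a] mb(2)] a
      by (simp add: hcounit_unit_map)
  qed
  then show ?thesis using bimodule_Q by (simp add: kmod_def)
qed

lemma Q_one_klin: "klin k Mk Q (\<lambda>m. etens Q m \<one>\<^bsub>k\<^esub>)"
proof (rule klinI[OF kmod_kk[OF hbimod_M] kmod_Q])
  fix x y assume xy: "x \<in> carrier Mk" "y \<in> carrier Mk"
  show "etens Q x \<one>\<^bsub>k\<^esub> \<in> carrier Q"
    unfolding Q_def coinv_def by (rule etens_rules(1)[OF hbimod_restr(1)[OF hbimod_M] bimodule_triv]) (use xy in simp_all)
  show "etens Q (x \<oplus>\<^bsub>Mk\<^esub> y) \<one>\<^bsub>k\<^esub> = etens Q x \<one>\<^bsub>k\<^esub> \<oplus>\<^bsub>Q\<^esub> etens Q y \<one>\<^bsub>k\<^esub>"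
    using additive_add[OF Q_etens(2), of "\<one>\<^bsub>k\<^esub>" x y] xy by simp
next
  fix a x assume "a \<in> carrier k" "x \<in> carrier Mk"
  then show "etens Q (a \<odot>\<^bsub>Mk\<^esub> x) \<one>\<^bsub>k\<^esub> = a \<odot>\<^bsub>Q\<^esub> etens Q x \<one>\<^bsub>k\<^esub>"
    using Q_smult(1)[of a x "\<one>\<^bsub>k\<^esub>"] by simp
qed

text \<open>The identification of C with the coinvariants of C \<otimes> H.\<close>

definition chi where "chi c = etens Q (Phi c \<one>\<^bsub>H\<^esub>) \<one>\<^bsub>k\<^esub>"

lemma chi_lin [kl]: "klin k P Ck f \<Longrightarrow> klin k P Q (\<lambda>z. chi (f z))"
  unfolding chi_def by (rule klin_comp[OF Q_one_klin], rule klin_comp[OF kbil_laws(4)[OF kbil_Phi]]) simp_all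

lemma chi_closed [kl]: "c \<in> carrier Ck \<Longrightarrow> chi c \<in> carrier Q"
  by (rule klin_laws(4)[OF chi_lin[OF klin_id[OF kmod_Ck]]])

lemma Q_Phi:
  assumes "c \<in> carrier C" "h \<in> carrier H"
  shows "etens Q (Phi c h) \<one>\<^bsub>k\<^esub> = hcounit H h \<odot>\<^bsub>Q\<^esub> chi c"
proof -
  have p: "Phi c \<one>\<^bsub>H\<^esub> \<in> carrier M" using kbil_laws(6)[OF kbil_Phi, of c "\<one>\<^bsub>H\<^esub>"] assms by simp
  have "etens Q (Phi c h) \<one>\<^bsub>k\<^esub> = etens Q (h \<odot>\<^bsub>M\<^esub> Phi c \<one>\<^bsub>H\<^esub>) \<one>\<^bsub>k\<^esub>"
    using Phi_act[of c "\<one>\<^bsub>H\<^esub>" h] assms by simp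
  also have "\<dots> = etens Q (Phi c \<one>\<^bsub>H\<^esub>) (hcounit H h \<otimes>\<^bsub>k\<^esub> \<one>\<^bsub>k\<^esub>)"
    by (rule Q_move[OF p assms(2)]) simp
  also have "\<dots> = rsmult Q (chi c) (hcounit H h)"
    using Q_smult(2)[of "hcounit H h" "Phi c \<one>\<^bsub>H\<^esub>" "\<one>\<^bsub>k\<^esub>"] p assms by (simp add: chi_def)
  also have "\<dots> = hcounit H h \<odot>\<^bsub>Q\<^esub> chi c"
    using kmod_laws(5)[OF kmod_Q, of "hcounit H h" "chi c"] chi_closed[of c] assms by simp
  finally show ?thesis .
qed

abbreviation QC where "QC \<equiv> Q \<boxtimes>\<^bsub>k\<^esub> kk H (bimod_of C)"

definition chiC where "chiC = tlift QC (\<lambda>x y. etens QC (chi x) y)"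

lemma kbil_chiC: "kbil k Ck Ck QC (\<lambda>x y. etens QC (chi x) y)" by (assumption | rule kl)+

lemma chiC_klin: "klin k CC QC chiC" unfolding chiC_def by (rule klin_tlift0[OF kbil_chiC])

lemma QC_eq: "tensor_group k Q (lk H (bimod_of C)) = tensor_group k Q Ck"
  by (simp add: tensor_group_def tensor_relations_def)

definition unit where "unit = tlift QC (\<lambda>m d. etens QC (etens Q m \<one>\<^bsub>k\<^esub>) d)"

lemma galois_unit_eq: "galois_unit k H C M rho m = unit (rho m)"
  by (simp add: galois_unit_def Let_def Q_def[symmetric] unit_def tmap_def tensor_record_ops QC_eq)

lemma kbil_unit: "kbil k Mk Ck QC (\<lambda>m d. etens QC (etens Q m \<one>\<^bsub>k\<^esub>) d)"
  by (assumption | rule kl klin_comp[OF Q_one_klin] klin_laws(4)[OF Q_one_klin])+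

text \<open>In (c1 \<otimes> h1) \<otimes>_H 1 the factor h1 crosses \<otimes>_H and becomes
  \<epsilon>(h1), which the counit law contracts against c2 h2. What is left is c1 \<otimes> c2 h,
  the Galois map up to the identification \<open>chi\<close>.\<close>

lemma unit_e:
  assumes s: "s \<in> carrier CH" shows "unit (rho (e s)) = chiC (galois_map k H C s)"
proof (rule tensor_ext[OF _ klin_comp[OF chiC_klin galois_map_klin] kmod_Ck kmod_Hk _ s])
  show "klin k CH QC (\<lambda>s. unit (rho (e s)))"
    unfolding unit_def by (rule klin_comp[OF klin_tlift0[OF kbil_unit] klin_comp[OF rho_klin e_klin]])
  fix c h assume ch: "c \<in> carrier Ck" "h \<in> carrier Hk"
  note dc = Cc.comult_closed[OF ch(1)] and dh = Hc.comult_closed[OF ch(2)]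
  have "unit (rho (e (etens CH c h))) =
      tlift QC (\<lambda>x y. tlift QC (\<lambda>a b. etens QC (etens Q (Phi x a) \<one>\<^bsub>k\<^esub>) (b \<odot>\<^bsub>C\<^esub> y)) (hcomult H h)) (comult C c)"
    unfolding unit_def Phi_def[symmetric] rho_Phi[OF ch]
    by (rule tlift_tmap2[OF kbil_unit dc dh kbil_Phi kbil_act])
  also have "\<dots> = tlift QC (\<lambda>x y. etens QC (chi x) (h \<odot>\<^bsub>C\<^esub> y)) (comult C c)"
  proof (rule tlift_cong[OF _ _ dc, symmetric])
    show "kbil k Ck Ck QC (\<lambda>x y. etens QC (chi x) (h \<odot>\<^bsub>C\<^esub> y))" by (assumption | rule kl ch)+
    fix x y assume xy: "x \<in> carrier Ck" "y \<in> carrier Ck"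
    have l: "klin k Hk QC (\<lambda>b. etens QC (chi x) (b \<odot>\<^bsub>C\<^esub> y))" by (assumption | rule kl xy)+
    have "tlift QC (\<lambda>a b. etens QC (etens Q (Phi x a) \<one>\<^bsub>k\<^esub>) (b \<odot>\<^bsub>C\<^esub> y)) (hcomult H h) =
      tlift QC (\<lambda>a b. hcounit H a \<odot>\<^bsub>QC\<^esub> etens QC (chi x) (b \<odot>\<^bsub>C\<^esub> y)) (hcomult H h)"
    proof (rule tlift_cong[OF _ _ dh, symmetric])
      show "kbil k Hk Hk QC (\<lambda>a b. hcounit H a \<odot>\<^bsub>QC\<^esub> etens QC (chi x) (b \<odot>\<^bsub>C\<^esub> y))"
        by (assumption | rule kl xy)+
      fix a b assume ab: "a \<in> carrier Hk" "b \<in> carrier Hk"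
      have l': "klin k Q QC (\<lambda>q. etens QC q (b \<odot>\<^bsub>C\<^esub> y))" by (assumption | rule kl xy ab)+
      show "hcounit H a \<odot>\<^bsub>QC\<^esub> etens QC (chi x) (b \<odot>\<^bsub>C\<^esub> y) = etens QC (etens Q (Phi x a) \<one>\<^bsub>k\<^esub>) (b \<odot>\<^bsub>C\<^esub> y)"
        using klin_laws(6)[OF l' Hc.counit_closed[OF ab(1)] chi_closed[OF xy(1)]] Q_Phi[of x a] xy ab by simp
    qed
    also have "\<dots> = etens QC (chi x) (h \<odot>\<^bsub>C\<^esub> y)" by (rule Hc.counit_l[OF l ch(2)])
    finally show "etens QC (chi x) (h \<odot>\<^bsub>C\<^esub> y) =
      tlift QC (\<lambda>a b. etens QC (etens Q (Phi x a) \<one>\<^bsub>k\<^esub>) (b \<odot>\<^bsub>C\<^esub> y)) (hcomult H h)" by simp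
  qed
  also have "\<dots> = chiC (twist c h)"
    unfolding chiC_def by (rule tlift_twist[OF kbil_chiC ch, symmetric])
  finally show "unit (rho (e (etens CH c h))) = chiC (galois_map k H C (etens CH c h))"
    using ch by (simp add: galois_map_etens)
qed

text \<open>A left inverse of \<open>chi\<close> is \<open>m \<otimes> b \<mapsto> b (C \<otimes> \<epsilon>)(m)\<close>.\<close>

definition coun where "coun m = tlift Ck (\<lambda>c h. hcounit H h \<odot>\<^bsub>Ck\<^esub> c) (inve m)"

lemma kbil_coun: "kbil k Ck Hk Ck (\<lambda>c h. hcounit H h \<odot>\<^bsub>Ck\<^esub> c)" by (assumption | rule kl)+

lemma coun_klin: "klin k Mk Ck coun" unfolding coun_def by (rule klin_tlift[OF inve_klin kbil_coun])

text \<open>Here C carries the trivial action through \<epsilon>_H, and multiplicativity of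
  \<epsilon>_H gives the law on \<open>Phi c g\<close>. It is the balance condition behind
  \<open>pi\<close>.\<close>

lemma coun_act:
  assumes m: "m \<in> carrier M" and h: "h \<in> carrier H"
  shows "coun (h \<odot>\<^bsub>M\<^esub> m) = hcounit H h \<odot>\<^bsub>Ck\<^esub> coun m"
proof (rule M_ext[where A = Ck and m = m])
  have h': "h \<in> carrier Hk" "hcounit H h \<in> carrier k" using h by simp_all
  show "klin k Mk Ck (\<lambda>m. coun (h \<odot>\<^bsub>M\<^esub> m))" by (rule klin_comp[OF coun_klin kbil_laws(4)[OF kbil_actM h'(1)]])
  show "klin k Mk Ck (\<lambda>m. hcounit H h \<odot>\<^bsub>Ck\<^esub> coun m)" by (rule klin_smult[OF coun_klin h'(2)])
  fix c g assume cg: "c \<in> carrier Ck" "g \<in> carrier Hk"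
  have gh: "g \<otimes>\<^bsub>H\<^esub> h \<in> carrier Hk" using cg h by simp
  have "coun (h \<odot>\<^bsub>M\<^esub> Phi c g) = hcounit H (g \<otimes>\<^bsub>H\<^esub> h) \<odot>\<^bsub>Ck\<^esub> c"
    using tlift_inve_Phi[OF kbil_coun cg(1) gh] Phi_act[of c g h] cg h by (simp add: coun_def)
  also have "hcounit H (g \<otimes>\<^bsub>H\<^esub> h) = hcounit H h \<otimes>\<^bsub>k\<^esub> hcounit H g"
    using ring_hom_mult[OF hcounit_hom, of g h] cg h by (simp add: A.R.m_comm)
  also have "\<dots> \<odot>\<^bsub>Ck\<^esub> c = hcounit H h \<odot>\<^bsub>Ck\<^esub> (hcounit H g \<odot>\<^bsub>Ck\<^esub> c)"
    by (rule kmod_laws(6)[OF kmod_Ck h'(2) _ cg(1)]) (use cg in simp)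
  also have "hcounit H g \<odot>\<^bsub>Ck\<^esub> c = coun (Phi c g)"
    unfolding coun_def by (rule tlift_inve_Phi[OF kbil_coun cg, symmetric])
  finally show "coun (h \<odot>\<^bsub>M\<^esub> Phi c g) = hcounit H h \<odot>\<^bsub>Ck\<^esub> coun (Phi c g)" .
qed (simp add: m)

definition pi where "pi = tlift Ck (\<lambda>m a. a \<odot>\<^bsub>Ck\<^esub> coun m)"

lemma balanced_pi: "balanced H (lk H (bimod_of M)) (triv k H) Ck (\<lambda>m a. a \<odot>\<^bsub>Ck\<^esub> coun m)"
proof (rule balancedI)
  note c = klin_laws(4,5)[OF coun_klin]
  have aR: "additive (triv k H) Rk f = additive Rk Rk f" for f
    by (rule additive_cong_ring) (simp_all add: triv_def)
  show "additive (lk H (bimod_of M)) Ck (\<lambda>m. a \<odot>\<^bsub>Ck\<^esub> coun m)" if "a \<in> carrier (triv k H)" for a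
  proof -
    have "additive Mk Ck (\<lambda>m. a \<odot>\<^bsub>Ck\<^esub> coun m)" by (rule klin_laws(3)[OF klin_smult[OF coun_klin]]) (use that in simp)
    moreover have "additive Mk Ck (\<lambda>m. a \<odot>\<^bsub>Ck\<^esub> coun m) = additive (lk H (bimod_of M)) Ck (\<lambda>m. a \<odot>\<^bsub>Ck\<^esub> coun m)"
      by (rule additive_cong_ring) simp_all
    ultimately show ?thesis by blast
  qed
  show "additive (triv k H) Ck (\<lambda>a. a \<odot>\<^bsub>Ck\<^esub> coun m)" if "m \<in> carrier (lk H (bimod_of M))" for m
  proof -
    have "coun m \<in> carrier Ck" using c(1)[of m] that by simp
    then have "additive Rk Ck (\<lambda>a. a \<odot>\<^bsub>Ck\<^esub> coun m)"
      by (rule klin_laws(3)[OF kmod_smult_lin[OF klin_id[OF kmod_Rk] _ kmod_Ck]])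
    moreover have "additive Rk Ck (\<lambda>a. a \<odot>\<^bsub>Ck\<^esub> coun m) = additive (triv k H) Ck (\<lambda>a. a \<odot>\<^bsub>Ck\<^esub> coun m)"
      by (rule additive_cong_ring) (simp_all add: triv_def)
    ultimately show ?thesis by blast
  qed
  show "a \<odot>\<^bsub>Ck\<^esub> coun (rsmult (lk H (bimod_of M)) m h) = (h \<odot>\<^bsub>triv k H\<^esub> a) \<odot>\<^bsub>Ck\<^esub> coun m"
    if "m \<in> carrier (lk H (bimod_of M))" "h \<in> carrier H" "a \<in> carrier (triv k H)" for m h a
  proof -
    have m: "m \<in> carrier M" "coun m \<in> carrier Ck" and a: "a \<in> carrier k" and e: "hcounit H h \<in> carrier k"
      using that c(1)[of m] by simp_all
    have "a \<odot>\<^bsub>Ck\<^esub> (hcounit H h \<odot>\<^bsub>Ck\<^esub> coun m) = (hcounit H h \<otimes>\<^bsub>k\<^esub> a) \<odot>\<^bsub>Ck\<^esub> coun m"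
      using kmod_laws(6)[OF kmod_Ck a e m(2)] A.R.m_comm[OF a e] by simp
    then show ?thesis using coun_act[OF m(1) that(2)] by simp
  qed
qed

lemma pi_etens: "m \<in> carrier M \<Longrightarrow> a \<in> carrier k \<Longrightarrow> pi (etens Q m a) = a \<odot>\<^bsub>Ck\<^esub> coun m"
  unfolding pi_def Q_def coinv_def
  by (rule tlift_etens_gen[OF tensorable_Q kmod_laws(2)[OF kmod_Ck] balanced_pi]) simp_all

lemma pi_additive: "additive Q Ck pi"
  unfolding pi_def Q_def coinv_def by (rule additive_tlift[OF tensorable_Q kmod_laws(2)[OF kmod_Ck] balanced_pi])

lemma pi_klin: "klin k Q Ck pi"
proof -
  have "pi (a \<odot>\<^bsub>Q\<^esub> t) = a \<odot>\<^bsub>Ck\<^esub> pi t" if a: "a \<in> carrier k" and t: "t \<in> carrier Q" for a t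
  proof (rule Q_ext[OF additive_comp[OF pi_additive kmod_laws(8)[OF kmod_Q a]]
        additive_comp[OF kmod_laws(8)[OF kmod_Ck a] pi_additive] _ t])
    fix m b assume mb: "m \<in> carrier M" "b \<in> carrier k"
    have cm: "coun m \<in> carrier Ck" using klin_laws(4)[OF coun_klin, of m] mb by simp
    have am: "a \<odot>\<^bsub>Mk\<^esub> m \<in> carrier M" using kmod_laws(4)[OF kmod_kk[OF hbimod_M] a, of m] mb by simp
    have "pi (a \<odot>\<^bsub>Q\<^esub> etens Q m b) = pi (etens Q (a \<odot>\<^bsub>Mk\<^esub> m) b)"
      using Q_smult(1)[of a m b] a mb by simp
    also have "\<dots> = b \<odot>\<^bsub>Ck\<^esub> coun (a \<odot>\<^bsub>Mk\<^esub> m)" by (rule pi_etens[OF am mb(2)])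
    also have "coun (a \<odot>\<^bsub>Mk\<^esub> m) = a \<odot>\<^bsub>Ck\<^esub> coun m" by (rule klin_laws(6)[OF coun_klin a]) (use mb in simp)
    also have "b \<odot>\<^bsub>Ck\<^esub> \<dots> = a \<odot>\<^bsub>Ck\<^esub> (b \<odot>\<^bsub>Ck\<^esub> coun m)"
      using kmod_laws(6)[OF kmod_Ck a mb(2) cm] kmod_laws(6)[OF kmod_Ck mb(2) a cm] A.R.m_comm[OF a mb(2)] by simp
    finally show "pi (a \<odot>\<^bsub>Q\<^esub> etens Q m b) = a \<odot>\<^bsub>Ck\<^esub> pi (etens Q m b)" by (simp only: pi_etens[OF mb])
  qed
  then show ?thesis using kmod_Q kmod_Ck pi_additive by (simp add: klin_def)
qed

lemma pi_chi: "c \<in> carrier C \<Longrightarrow> pi (chi c) = c"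
proof -
  assume c: "c \<in> carrier C"
  then have c': "c \<in> carrier Ck" and o: "\<one>\<^bsub>H\<^esub> \<in> carrier Hk" by simp_all
  have p: "Phi c \<one>\<^bsub>H\<^esub> \<in> carrier M" using kbil_laws(6)[OF kbil_Phi c' o] by simp
  have "coun (Phi c \<one>\<^bsub>H\<^esub>) = hcounit H \<one>\<^bsub>H\<^esub> \<odot>\<^bsub>Ck\<^esub> c"
    unfolding coun_def by (rule tlift_inve_Phi[OF kbil_coun c' o])
  then have "coun (Phi c \<one>\<^bsub>H\<^esub>) = c"
    using ring_hom_one[OF hcounit_hom] kmod_laws(9)[OF kmod_Ck c'] by simp
  then show ?thesis
    unfolding chi_def using pi_etens[OF p, of "\<one>\<^bsub>k\<^esub>"] kmod_laws(9)[OF kmod_Ck c'] by simp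
qed

text \<open>\<open>chi\<close> is split by the linear map \<open>pi\<close>, hence its tensor
  product with C is split as well; for an injective map without a splitting this conclusion fails in
  general.\<close>

lemma chiC_inj: "inj_on chiC (carrier CC)"
proof -
  let ?Z = "tlift CC (\<lambda>q y. etens CC (pi q) y)"
  have b: "kbil k Q Ck CC (\<lambda>q y. etens CC (pi q) y)"
    by (assumption | rule kl klin_comp[OF pi_klin] klin_laws(4)[OF pi_klin])+
  have "?Z (chiC t) = t" if t: "t \<in> carrier CC" for t
  proof (rule tensor_ext[OF klin_comp[OF klin_tlift0[OF b] chiC_klin] klin_id kmod_Ck kmod_Ck _ t])
    fix x y assume xy: "x \<in> carrier Ck" "y \<in> carrier Ck"
    show "?Z (chiC (etens CC x y)) = etens CC x y"
      unfolding chiC_def tlift_etens[OF kbil_chiC xy] tlift_etens[OF b chi_closed[OF xy(1)] xy(2)]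
      using pi_chi[of x] xy by simp
  qed (rule kl)+
  then show ?thesis by (rule inj_on_inverseI)
qed

text \<open>The unit after \<open>e\<close> is \<open>chiC\<close> after \<delta>. Injectivity of
  \<delta> follows from that of the unit and of \<open>e\<close>; surjectivity follows because every
  value of \<open>chiC\<close> is a value of the unit and \<open>chiC\<close> is injective.\<close>

lemma galois_map_bij:
  assumes "bij_betw (galois_unit k H C M rho) (carrier M)
    (carrier (coinv k H (lk H (bimod_of M)) \<boxtimes>\<^bsub>k\<^esub> lk H (bimod_of C)))"
  shows "bij_betw (galois_map k H C) (carrier CH) (carrier CC)"
proof -
  note bij = assms[folded Q_def]
  have car: "carrier (Q \<boxtimes>\<^bsub>k\<^esub> lk H (bimod_of C)) = carrier QC" by (simp add: QC_eq)
  let ?\<delta> = "galois_map k H C"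
  have im: "e s \<in> carrier M" if "s \<in> carrier CH" for s using that unfolding M_sel by blast
  have "inj_on ?\<delta> (carrier CH)"
  proof (rule inj_onI)
    fix s t assume st: "s \<in> carrier CH" "t \<in> carrier CH" "?\<delta> s = ?\<delta> t"
    then have "galois_unit k H C M rho (e s) = galois_unit k H C M rho (e t)"
      by (simp only: galois_unit_eq unit_e)
    then have "e s = e t" using bij_betw_imp_inj_on[OF bij] im[OF st(1)] im[OF st(2)] by (simp only: inj_on_def)
    then show "s = t" using einj st(1,2) by (simp only: inj_on_def)
  qed
  moreover have "?\<delta> ` carrier CH = carrier CC"
  proof
    show "?\<delta> ` carrier CH \<subseteq> carrier CC" using klin_laws(4)[OF galois_map_klin] by blast
    show "carrier CC \<subseteq> ?\<delta> ` carrier CH"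
    proof
      fix t assume t: "t \<in> carrier CC"
      then have "chiC t \<in> galois_unit k H C M rho ` carrier M"
        using klin_laws(4)[OF chiC_klin t] bij_betw_imp_surj_on[OF bij] unfolding car by blast
      then obtain s where s: "s \<in> carrier CH" "chiC t = galois_unit k H C M rho (e s)"
        unfolding M_sel by blast
      then have "chiC t = chiC (?\<delta> s)" by (simp only: galois_unit_eq unit_e)
      then have "t = ?\<delta> s" using chiC_inj t klin_laws(4)[OF galois_map_klin s(1)] by (simp only: inj_on_def)
      with s(1) show "t \<in> ?\<delta> ` carrier CH" by blast
    qed
  qed
  ultimately show ?thesis by (simp only: bij_betw_def)
qed

end

theorem galois_coobject_bij:
  fixes f :: "'c \<Rightarrow> 'u" and g :: "'h \<Rightarrow> 'u"
  assumes u: "infinite (UNIV :: 'u set)" and f: "inj_on f (carrier C)" and g: "inj_on g (carrier H)"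
    and gal: "galois_coobject TYPE('u) k H C"
  shows "bij_betw (galois_map k H C) (carrier CH) (carrier CC)"
proof -
  obtain e :: "('c, 'h) tens \<Rightarrow> 'u" where e: "inj_on e (carrier CH)"
    using tensor_embedding[OF kmod_tensorable[OF kmod_Ck kmod_Hk] u, of f g] f g by auto
  show ?thesis
  proof (rule galois_map_bij[OF e])
    show "bij_betw (galois_unit k H C (M e) (rho e)) (carrier (M e))
        (carrier (coinv k H (lk H (bimod_of (M e))) \<boxtimes>\<^bsub>k\<^esub> lk H (bimod_of C)))"
      using gal hopf_module_M[OF e] unfolding galois_coobject_def by blast
  qed
qed

end

section \<open>The composed Galois co-object\<close>

lemma tlift_klin_etens:
  assumes g: "klin k (M \<boxtimes>\<^bsub>k\<^esub> N) A g" and M: "kmod k M" and N: "kmod k N" and t: "t \<in> carrier (M \<boxtimes>\<^bsub>k\<^esub> N)"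
  shows "tlift A (\<lambda>x y. g (etens (M \<boxtimes>\<^bsub>k\<^esub> N) x y)) t = g t"
  using tlift_fusion[OF g kbil_etens[OF M N] t] tlift_id[OF M N t] by simp

lemma keqv_cong_ops:
  fixes M N :: "('k, 'k, 'd) bimodule"
  assumes "keqv k M N"
  shows "(tlift M :: ('e \<Rightarrow> 'f \<Rightarrow> 'd) \<Rightarrow> _) = tlift N"
  by (rule tlift_cong_ring) (use assms in \<open>simp_all add: keqv_def\<close>)

lemma keqv_cong_etens:
  assumes "keqv k M N" shows "etens M = etens N"
  by (rule etens_cong_ring) (use assms in \<open>simp add: keqv_def\<close>)

lemma keqv_cong_tmap:
  assumes "keqv k M N" shows "tmap M = tmap N"
  by (rule tmap_cong_ring) (use assms in \<open>simp_all add: keqv_def\<close>)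

locale galois_pair = C: galois k H C + D: galois k H D
  for k :: "('k, 'x) ring_scheme" and H :: "('k, 'h, 'z) hopf_scheme"
    and C :: "('k, 'h, 'c, 'w) module_coalgebra_scheme" and D :: "('k, 'h, 'd, 'v) module_coalgebra_scheme"
begin

abbreviation Ck where "Ck \<equiv> kk H (bimod_of C)"
abbreviation Dk where "Dk \<equiv> kk H (bimod_of D)"
abbreviation CC where "CC \<equiv> Ck \<boxtimes>\<^bsub>k\<^esub> Ck"
abbreviation DD where "DD \<equiv> Dk \<boxtimes>\<^bsub>k\<^esub> Dk"
abbreviation Eh where "Eh \<equiv> bimod_of C \<boxtimes>\<^bsub>H\<^esub> bimod_of D"
abbreviation Ek where "Ek \<equiv> kk H Eh"
abbreviation E2 where "E2 \<equiv> Ek \<boxtimes>\<^bsub>k\<^esub> Ek"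
abbreviation E3 where "E3 \<equiv> E2 \<boxtimes>\<^bsub>k\<^esub> Ek"
abbreviation EE where "EE \<equiv> compose_coobjects k H C D"
abbreviation Hk where "Hk \<equiv> bimod_of H"
abbreviation Rk where "Rk \<equiv> bimod_of (regular k)"
abbreviation S where "S \<equiv> antipode H"
abbreviation evC where "evC \<equiv> galois_ev k H C"
abbreviation evD where "evD \<equiv> galois_ev k H D"
abbreviation tens where "tens \<equiv> etens Eh"
abbreviation Eact where "Eact \<equiv> \<lambda>t h. h \<odot>\<^bsub>Eh\<^esub> t"

section \<open>The module coalgebra C \<otimes>_H D\<close>

lemma hbimod_E [kl]: "C.hbimod Eh" by (rule C.hbimod_tensor[OF C.hbimod_C D.hbimod_C])

lemma kmod_E [kl]: "kmod k Ek" by (rule C.kmod_kk[OF hbimod_E])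

lemma kbil_tens: "kbil k Ck Dk Ek tens"
  by (rule C.hbal_laws(3)[OF C.hbal_etens[OF C.hbimod_C D.hbimod_C]])

lemma tens_closed: "c \<in> carrier C \<Longrightarrow> d \<in> carrier D \<Longrightarrow> tens c d \<in> carrier Ek"
  using kbil_laws(6)[OF kbil_tens, of c d] by simp

lemma tens_bal:
  "c \<in> carrier C \<Longrightarrow> h \<in> carrier H \<Longrightarrow> d \<in> carrier D \<Longrightarrow> tens (h \<odot>\<^bsub>C\<^esub> c) d = tens c (h \<odot>\<^bsub>D\<^esub> d)"
  using C.hetens_bal[OF C.hbimod_C D.hbimod_C, of c h d] by simp

lemma tens_smult:
  assumes "c \<in> carrier C" "h \<in> carrier H" "d \<in> carrier D"
  shows "h \<odot>\<^bsub>Eh\<^esub> tens c d = tens (h \<odot>\<^bsub>C\<^esub> c) d"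
    "rsmult Eh (tens c d) h = tens c (h \<odot>\<^bsub>D\<^esub> d)"
  using C.hetens_smult[OF C.hbimod_C D.hbimod_C, of c h d] assms by simp_all

text \<open>The left action lives on C and the right one on D, and \<open>h\<close> crosses
  \<otimes>_H between them.\<close>

lemma E_rsmult:
  assumes h: "h \<in> carrier H" and t: "t \<in> carrier Eh" shows "rsmult Eh t h = h \<odot>\<^bsub>Eh\<^esub> t"
proof -
  note L = is_bimodule_laws[OF C.hbimod_bimodule[OF hbimod_E]]
  show ?thesis
    by (rule C.hext_additive[OF C.hbimod_C D.hbimod_C L(7)[OF h] L(6)[OF h] _ t])
      (use h in \<open>simp add: tens_smult tens_bal\<close>)
qed

lemma E_ext:
  assumes f: "klin k Ek A f" and g: "klin k Ek A g"
    and eq: "\<And>c d. c \<in> carrier C \<Longrightarrow> d \<in> carrier D \<Longrightarrow> f (tens c d) = g (tens c d)" and t: "t \<in> carrier Ek"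
  shows "f t = g t"
  by (rule C.hext[OF f g C.hbimod_C D.hbimod_C _ t]) (simp add: eq)

lemma EE_sel [simp]:
  "carrier EE = carrier Eh" "zero EE = zero Eh" "add EE = add Eh" "smult EE = smult Eh"
  "comult EE = tlift E2 (\<lambda>c d. tmap2 E2 tens tens (comult C c) (comult D d))"
  "counit EE = tlift k (\<lambda>c d. counit C c \<otimes>\<^bsub>k\<^esub> counit D d)"
  by (simp_all add: compose_coobjects_def Let_def)

lemmas kbil_tens2 = kbil_tmap2[OF kbil_tens kbil_tens]

text \<open>Both sides of the balance condition are the diagonal action of \<Delta>(h): h1 acts on
  the first copy of C \<otimes>_H D and h2 on the second.\<close>

lemma hbal_comult: "C.hbal (bimod_of C) (bimod_of D) E2 (\<lambda>c d. tmap2 E2 tens tens (comult C c) (comult D d))"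
proof (rule C.hbalI[OF C.hbimod_C D.hbimod_C])
  note [kl] = klin_comp[OF kbil_laws(4)[OF kbil_tens2(1)]] klin_comp[OF kbil_laws(5)[OF kbil_tens2(1)]]
  show "kbil k Ck Dk E2 (\<lambda>c d. tmap2 E2 tens tens (comult C c) (comult D d))"
    by (assumption | rule kl)+
  fix c h d assume a: "c \<in> carrier (bimod_of C)" "h \<in> carrier H" "d \<in> carrier (bimod_of D)"
  have a': "c \<in> carrier Ck" "h \<in> carrier Hk" "d \<in> carrier Dk" using a by simp_all
  note cl = C.Cc.comult_closed[OF a'(1)] C.Hc.comult_closed[OF a'(2)] D.Cc.comult_closed[OF a'(3)]
  have f: "kbil k Dk Ck Ek (\<lambda>d c. tens c d)"
    by (rule kbil_intro[OF D.kmod_Ck C.kmod_Ck kbil_laws(5,4)[OF kbil_tens]])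
  \<comment> \<open>\<open>tmap2_act\<close> handles an action on the second argument, but here
    \<Delta>(h) meets the first one, so the roles of C and D are exchanged.\<close>
  have e: "tmap2 E2 tens tens t s = tmap2 E2 (\<lambda>d c. tens c d) (\<lambda>d c. tens c d) s t"
    if "t \<in> carrier CC" "s \<in> carrier DD" for t s
  proof (rule tensor_ext2[OF kbil_tens2(1) _ C.kmod_Ck C.kmod_Ck D.kmod_Ck D.kmod_Ck _ that])
    note b = kbil_tmap2(1)[OF f f]
    show "kbil k CC DD E2 (\<lambda>t s. tmap2 E2 (\<lambda>d c. tens c d) (\<lambda>d c. tens c d) s t)"
      by (rule kbil_intro[OF kbil_laws(2,1)[OF b] kbil_laws(5,4)[OF b]])
    fix x y u v assume "x \<in> carrier Ck" "y \<in> carrier Ck" "u \<in> carrier Dk" "v \<in> carrier Dk"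
    then show "tmap2 E2 tens tens (etens CC x y) (etens DD u v) =
        tmap2 E2 (\<lambda>d c. tens c d) (\<lambda>d c. tens c d) (etens DD u v) (etens CC x y)"
      by (simp only: kbil_tmap2(2)[OF f f] kbil_tens2(2))
  qed
  have bS: "kbil k Ek Hk Ek Eact" by (assumption | rule kl)+
  have c': "tmap2 CC C.act C.act (comult C c) (hcomult H h) \<in> carrier CC"
    by (rule kbil_laws(6)[OF kbil_tmap2(1)[OF C.kbil_act C.kbil_act] cl(1,2)])
  have "tmap2 E2 tens tens (tmap2 CC C.act C.act (comult C c) (hcomult H h)) (comult D d) =
    tmap2 E2 Eact Eact (tmap2 E2 (\<lambda>d c. tens c d) (\<lambda>d c. tens c d) (comult D d) (comult C c)) (hcomult H h)"
    unfolding e[OF c' cl(3)]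
    by (rule tmap2_act[OF f f C.kbil_act C.kbil_act bS bS _ _ cl(3,1,2)]) (simp_all add: tens_smult)
  also have "tmap2 E2 (\<lambda>d c. tens c d) (\<lambda>d c. tens c d) (comult D d) (comult C c) = tmap2 E2 tens tens (comult C c) (comult D d)"
    by (rule e[OF cl(1,3), symmetric])
  also have "tmap2 E2 Eact Eact \<dots> (hcomult H h) =
    tmap2 E2 tens tens (comult C c) (tmap2 DD D.act D.act (comult D d) (hcomult H h))"
    by (rule tmap2_act[OF kbil_tens kbil_tens D.kbil_act D.kbil_act bS bS _ _ cl(1,3,2), symmetric])
      (simp_all add: tens_smult tens_bal)
  finally show "tmap2 E2 tens tens (comult C (rsmult (bimod_of C) c h)) (comult D d) =
    tmap2 E2 tens tens (comult C c) (comult D (h \<odot>\<^bsub>bimod_of D\<^esub> d))"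
    using a by (simp add: C.comult_act D.comult_act)
qed

lemma comult_E:
  assumes "c \<in> carrier C" "d \<in> carrier D"
  shows "comult EE (tens c d) = tmap2 E2 tens tens (comult C c) (comult D d)"
  unfolding EE_sel by (rule C.htlift_etens[OF hbal_comult]) (simp_all add: assms)

lemma comult_E_klin: "klin k Ek E2 (comult EE)"
  unfolding EE_sel by (rule C.klin_htlift[OF hbal_comult])

lemma hbal_counit: "C.hbal (bimod_of C) (bimod_of D) Rk (\<lambda>c d. counit C c \<otimes>\<^bsub>k\<^esub> counit D d)"
proof (rule C.hbalI[OF C.hbimod_C D.hbimod_C])
  have c: "counit C x \<in> carrier Rk" if "x \<in> carrier Ck" for x using C.Cc.counit_closed[OF that] by simp
  have d: "counit D x \<in> carrier Rk" if "x \<in> carrier Dk" for x using D.Cc.counit_closed[OF that] by simp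
  show "kbil k Ck Dk Rk (\<lambda>c d. counit C c \<otimes>\<^bsub>k\<^esub> counit D d)" by (assumption | rule kl c d)+
  fix c h d assume a: "c \<in> carrier (bimod_of C)" "h \<in> carrier H" "d \<in> carrier (bimod_of D)"
  have "counit C c \<in> carrier k" "counit D d \<in> carrier k" "hcounit H h \<in> carrier k"
    using C.Cc.counit_closed[of c] D.Cc.counit_closed[of d] a by simp_all
  then show "counit C (rsmult (bimod_of C) c h) \<otimes>\<^bsub>k\<^esub> counit D d = counit C c \<otimes>\<^bsub>k\<^esub> counit D (h \<odot>\<^bsub>bimod_of D\<^esub> d)"
    using a by (simp add: C.comult_act D.comult_act C.A.R.m_ac)
qed

lemma counit_EE: "counit EE = tlift Rk (\<lambda>c d. counit C c \<otimes>\<^bsub>k\<^esub> counit D d)"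
  unfolding EE_sel C.tlift_k ..

lemma counit_E:
  assumes "c \<in> carrier C" "d \<in> carrier D"
  shows "counit EE (tens c d) = counit C c \<otimes>\<^bsub>k\<^esub> counit D d"
  unfolding counit_EE by (rule C.htlift_etens[OF hbal_counit]) (simp_all add: assms)

lemma counit_E_klin: "klin k Ek Rk (counit EE)"
  unfolding counit_EE by (rule C.klin_htlift[OF hbal_counit])

lemma push_E: "push_coalg k Ck (comult C) (counit C) Dk (comult D) (counit D) Ek Ek tens tens (comult EE) (comult EE) (counit EE)"
  by unfold_locales
    (use kbil_tens comult_E_klin counit_E_klin comult_E counit_E in \<open>simp_all only: kk_sel bimod_of_sel\<close>)

lemma module_EE: "module H EE"
proof -
  note L = is_bimodule_laws[OF C.hbimod_bimodule[OF hbimod_E]]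
  show ?thesis
    by (rule moduleI[OF L(1)], rule abelian_group_cong[OF L(3)])
      (use L(4,8,10,12) additive_add[OF L(6)] in \<open>simp_all only: EE_sel\<close>)
qed

lemma keqv_EE: "keqv k (kk H (bimod_of EE)) Ek"
  using C.kmod_kk[OF C.hbimod_bimod_of[OF module_EE]] kmod_E by (simp add: keqv_def del: tensor_sel)

lemmas keqv_EE2 = keqv_tensor[OF keqv_EE keqv_EE]
lemmas keqv_EE3 = keqv_tensor[OF keqv_EE2 keqv_EE]

lemma coalgebra_EE: "coalgebra k (kk H (bimod_of EE)) (comult EE) (counit EE)"
proof -
  interpret P: push_coalg k Ck "comult C" "counit C" Dk "comult D" "counit D" Ek Ek tens tens "comult EE" "comult EE" "counit EE"
    by (rule push_E)
  have e: "etens (kk H (bimod_of EE) \<boxtimes>\<^bsub>k\<^esub> kk H (bimod_of EE)) = etens E2"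
    "etens ((kk H (bimod_of EE) \<boxtimes>\<^bsub>k\<^esub> kk H (bimod_of EE)) \<boxtimes>\<^bsub>k\<^esub> kk H (bimod_of EE)) = etens E3"
    by (rule keqv_cong_etens[OF keqv_EE2], rule keqv_cong_etens[OF keqv_EE3])
  have t: "tlift ((kk H (bimod_of EE) \<boxtimes>\<^bsub>k\<^esub> kk H (bimod_of EE)) \<boxtimes>\<^bsub>k\<^esub> kk H (bimod_of EE)) = tlift E3"
    "tlift (kk H (bimod_of EE)) = tlift Ek"
    by (rule keqv_cong_ops[OF keqv_EE3], rule keqv_cong_ops[OF keqv_EE])
  have tm: "tmap ((kk H (bimod_of EE) \<boxtimes>\<^bsub>k\<^esub> kk H (bimod_of EE)) \<boxtimes>\<^bsub>k\<^esub> kk H (bimod_of EE)) = tmap E3"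
    by (rule keqv_cong_tmap[OF keqv_EE3])
  note dl = klin_comp[OF comult_E_klin] klin_laws(4)[OF comult_E_klin]
  have 1: "tmap E3 (comult EE) (\<lambda>z. z) (comult EE x) =
      tlift E3 (\<lambda>u w. tlift E3 (\<lambda>v z. etens E3 (etens E2 u v) z) (comult EE w)) (comult EE x)"
    if x: "x \<in> carrier Ek" for x
  proof (rule E_ext[where f = "\<lambda>x. tmap E3 (comult EE) (\<lambda>z. z) (comult EE x)" and A = E3, OF _ _ _ x])
    show "klin k Ek E3 (\<lambda>x. tmap E3 (comult EE) (\<lambda>z. z) (comult EE x))"
      unfolding tmap_def by (assumption | rule kl dl)+
    show "klin k Ek E3 (\<lambda>x. tlift E3 (\<lambda>u w. tlift E3 (\<lambda>v z. etens E3 (etens E2 u v) z) (comult EE w)) (comult EE x))"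
      by (assumption | rule kl dl)+
    show "tmap E3 (comult EE) (\<lambda>z. z) (comult EE (tens c d)) =
      tlift E3 (\<lambda>u w. tlift E3 (\<lambda>v z. etens E3 (etens E2 u v) z) (comult EE w)) (comult EE (tens c d))"
      if "c \<in> carrier C" "d \<in> carrier D" for c d
      using P.coassoc_push[of c d] that by (simp only: kk_sel bimod_of_sel)
  qed
  note el = P.counit_smult_lin
  have 2: "tlift Ek (\<lambda>u v. counit EE u \<odot>\<^bsub>Ek\<^esub> v) (comult EE x) = x" if x: "x \<in> carrier Ek" for x
  proof (rule E_ext[where f = "\<lambda>x. tlift Ek (\<lambda>u v. counit EE u \<odot>\<^bsub>Ek\<^esub> v) (comult EE x)" and A = Ek, OF _ klin_id[OF kmod_E] _ x], (assumption | rule dl el P.eN_closed kl)+)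
    show "tlift Ek (\<lambda>u v. counit EE u \<odot>\<^bsub>Ek\<^esub> v) (comult EE (tens c d)) = tens c d"
      if "c \<in> carrier C" "d \<in> carrier D" for c d
      using P.counit_push(2)[of c d] that by (simp only: kk_sel bimod_of_sel)
  qed
  have 3: "tlift Ek (\<lambda>u v. counit EE v \<odot>\<^bsub>Ek\<^esub> u) (comult EE x) = x" if x: "x \<in> carrier Ek" for x
  proof (rule E_ext[where f = "\<lambda>x. tlift Ek (\<lambda>u v. counit EE v \<odot>\<^bsub>Ek\<^esub> u) (comult EE x)" and A = Ek, OF _ klin_id[OF kmod_E] _ x], (assumption | rule dl el P.eN_closed kl)+)
    show "tlift Ek (\<lambda>u v. counit EE v \<odot>\<^bsub>Ek\<^esub> u) (comult EE (tens c d)) = tens c d"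
      if "c \<in> carrier C" "d \<in> carrier D" for c d
      using P.counit_push(1)[of c d] that by (simp only: kk_sel bimod_of_sel)
  qed
  have 4: "comult EE \<in> bihom k k (kk H (bimod_of EE)) (kk H (bimod_of EE) \<boxtimes>\<^bsub>k\<^esub> kk H (bimod_of EE))"
    by (rule klin_bihom[OF keqv_klin[OF keqv_sym[OF keqv_EE] keqv_sym[OF keqv_EE2] comult_E_klin]])
  have 5: "counit EE \<in> bihom k k (kk H (bimod_of EE)) Rk"
    by (rule klin_bihom[OF keqv_klin[OF keqv_sym[OF keqv_EE] keqv_refl[OF C.kmod_Rk] counit_E_klin]])
  have car: "carrier (kk H (bimod_of EE)) = carrier Ek" by (rule keqv_sel(1)[OF keqv_EE])
  have s: "smult (kk H (bimod_of EE)) = smult Ek" "rsmult (kk H (bimod_of EE)) = (\<lambda>x a. a \<odot>\<^bsub>Ek\<^esub> x)"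
    by (simp_all only: kk_sel bimod_of_sel EE_sel)
  show ?thesis
    unfolding coalgebra_def Let_def e t tm car s
    using 1 2 3 4 5 by blast
qed

lemma comult_EE_act:
  assumes x: "x \<in> carrier Ek" and h: "h \<in> carrier Hk"
  shows "comult EE (h \<odot>\<^bsub>Eh\<^esub> x) = tmap2 E2 Eact Eact (comult EE x) (hcomult H h)"
    "counit EE (h \<odot>\<^bsub>Eh\<^esub> x) = counit EE x \<otimes>\<^bsub>k\<^esub> hcounit H h"
proof -
  have bS: "kbil k Ek Hk Ek Eact" by (assumption | rule kl)+
  note dh = C.Hc.comult_closed[OF h]
  note b = kbil_tmap2(1)[OF bS bS]
  show "comult EE (h \<odot>\<^bsub>Eh\<^esub> x) = tmap2 E2 Eact Eact (comult EE x) (hcomult H h)"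
  proof (rule E_ext[where f = "\<lambda>x. comult EE (h \<odot>\<^bsub>Eh\<^esub> x)" and A = E2, OF _ _ _ x])
    show "klin k Ek E2 (\<lambda>x. comult EE (h \<odot>\<^bsub>Eh\<^esub> x))" by (rule klin_comp[OF comult_E_klin kbil_laws(4)[OF bS h]])
    show "klin k Ek E2 (\<lambda>x. tmap2 E2 Eact Eact (comult EE x) (hcomult H h))"
      by (rule klin_comp[OF kbil_laws(4)[OF b dh] comult_E_klin])
    fix c d assume cd: "c \<in> carrier C" "d \<in> carrier D"
    have cd': "c \<in> carrier Ck" "d \<in> carrier Dk" "h \<in> carrier H" "h \<odot>\<^bsub>D\<^esub> d \<in> carrier D" using cd h by simp_all
    have "comult EE (h \<odot>\<^bsub>Eh\<^esub> tens c d) = tmap2 E2 tens tens (comult C c) (comult D (h \<odot>\<^bsub>D\<^esub> d))"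
      by (simp only: tens_smult(1)[OF cd(1) cd'(3) cd(2)] tens_bal[OF cd(1) cd'(3) cd(2)] comult_E[OF cd(1) cd'(4)])
    also have "\<dots> = tmap2 E2 tens tens (comult C c) (tmap2 DD D.act D.act (comult D d) (hcomult H h))"
      by (simp only: D.comult_act(1)[OF cd(2) cd'(3)])
    also have "\<dots> = tmap2 E2 Eact Eact (tmap2 E2 tens tens (comult C c) (comult D d)) (hcomult H h)"
      by (rule tmap2_act[OF kbil_tens kbil_tens D.kbil_act D.kbil_act bS bS _ _
            C.Cc.comult_closed[OF cd'(1)] D.Cc.comult_closed[OF cd'(2)] dh])
        (simp_all add: tens_smult tens_bal)
    finally show "comult EE (h \<odot>\<^bsub>Eh\<^esub> tens c d) =
        tmap2 E2 Eact Eact (comult EE (tens c d)) (hcomult H h)"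
      by (simp only: comult_E[OF cd])
  qed
  have eh: "hcounit H h \<in> carrier Rk" using h by simp
  show "counit EE (h \<odot>\<^bsub>Eh\<^esub> x) = counit EE x \<otimes>\<^bsub>k\<^esub> hcounit H h"
  proof (rule E_ext[where f = "\<lambda>x. counit EE (h \<odot>\<^bsub>Eh\<^esub> x)" and A = Rk, OF _ _ _ x])
    show "klin k Ek Rk (\<lambda>x. counit EE (h \<odot>\<^bsub>Eh\<^esub> x))" by (rule klin_comp[OF counit_E_klin kbil_laws(4)[OF bS h]])
    show "klin k Ek Rk (\<lambda>x. counit EE x \<otimes>\<^bsub>k\<^esub> hcounit H h)" by (rule C.kmult_lin(1)[OF counit_E_klin eh])
    fix c d assume cd: "c \<in> carrier C" "d \<in> carrier D"
    have cd': "h \<in> carrier H" "h \<odot>\<^bsub>D\<^esub> d \<in> carrier D" "counit C c \<in> carrier k" "counit D d \<in> carrier k"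
      using cd h C.Cc.counit_closed[of c] D.Cc.counit_closed[of d] by simp_all
    show "counit EE (h \<odot>\<^bsub>Eh\<^esub> tens c d) = counit EE (tens c d) \<otimes>\<^bsub>k\<^esub> hcounit H h"
      unfolding tens_smult(1)[OF cd(1) cd'(1) cd(2)] tens_bal[OF cd(1) cd'(1) cd(2)] counit_E[OF cd(1) cd'(2)] counit_E[OF cd]
      using cd' eh by (simp add: D.comult_act(2)[OF cd(2) cd'(1)] C.A.R.m_assoc)
  qed
qed

lemma mod_coalg_EE: "mod_coalg k H EE"
proof
  have t: "tmap2 (kk H (bimod_of EE) \<boxtimes>\<^bsub>k\<^esub> kk H (bimod_of EE)) f g = tmap2 E2 f g" for f g :: "('c, 'd) tens \<Rightarrow> 'h \<Rightarrow> ('c, 'd) tens"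
    by (intro ext) (simp only: tmap2_def keqv_cong_ops[OF keqv_EE2] keqv_cong_etens[OF keqv_EE2])
  have car: "carrier EE = carrier Ek" "carrier H = carrier Hk" by simp_all
  show "is_module_coalgebra k H EE"
    unfolding is_module_coalgebra_def Let_def t EE_sel(4) car
    using module_EE coalgebra_EE comult_EE_act by blast
qed

section \<open>The evaluation of C \<otimes>_H D\<close>

definition tau where
  "tau e f = tlift Hk (\<lambda>c d. tlift Hk (\<lambda>c' d'. evC (etens CC c c') \<otimes>\<^bsub>H\<^esub> evD (etens DD d d')) f) e"

lemma hbal_tau1:
  assumes "c \<in> carrier Ck" "d \<in> carrier Dk"
  shows "C.hbal (bimod_of C) (bimod_of D) Hk (\<lambda>c' d'. evC (etens CC c c') \<otimes>\<^bsub>H\<^esub> evD (etens DD d d'))"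
proof (rule C.hbalI[OF C.hbimod_C D.hbimod_C], (assumption | rule assms kl)+)
  show "evC (etens CC c (rsmult (bimod_of C) x h)) \<otimes>\<^bsub>H\<^esub> evD (etens DD d y) =
      evC (etens CC c x) \<otimes>\<^bsub>H\<^esub> evD (etens DD d (h \<odot>\<^bsub>bimod_of D\<^esub> y))"
    if "x \<in> carrier (bimod_of C)" "h \<in> carrier H" "y \<in> carrier (bimod_of D)" for x h y
    using that assms C.H_m_comm[of h "evC (etens CC c x)"] by (simp add: C.ev_act_r D.ev_act_r C.H_m_assoc)
qed

text \<open>An \<open>h\<close> on the first argument of either evaluation comes out as the factor
  \<open>S h\<close>, so in the commutative \<open>H\<close> it does not matter which of the two
  carries it. The inner sums are compared termwise.\<close>

lemma hbal_tau2:
  assumes f: "f \<in> carrier Ek"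
  shows "C.hbal (bimod_of C) (bimod_of D) Hk (\<lambda>c d. tlift Hk (\<lambda>c' d'. evC (etens CC c c') \<otimes>\<^bsub>H\<^esub> evD (etens DD d d')) f)"
proof (rule C.hbalI[OF C.hbimod_C D.hbimod_C], (assumption | rule kbil_intro C.htlift_param[OF f] hbal_tau1 | rule kl)+)
  fix x h y assume a: "x \<in> carrier (bimod_of C)" "h \<in> carrier H" "y \<in> carrier (bimod_of D)"
  have a': "rsmult (bimod_of C) x h \<in> carrier Ck" "y \<in> carrier Dk" using a by simp_all
  show "tlift Hk (\<lambda>c' d'. evC (etens CC (rsmult (bimod_of C) x h) c') \<otimes>\<^bsub>H\<^esub> evD (etens DD y d')) f =
      tlift Hk (\<lambda>c' d'. evC (etens CC x c') \<otimes>\<^bsub>H\<^esub> evD (etens DD (h \<odot>\<^bsub>bimod_of D\<^esub> y) d')) f"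
  proof (rule C.htlift_cong(1)[OF hbal_tau1[OF a'] _ f])
    fix c' d' assume cd: "c' \<in> carrier Ck" "d' \<in> carrier Dk"
    then show "evC (etens CC (rsmult (bimod_of C) x h) c') \<otimes>\<^bsub>H\<^esub> evD (etens DD y d') =
        evC (etens CC x c') \<otimes>\<^bsub>H\<^esub> evD (etens DD (h \<odot>\<^bsub>bimod_of D\<^esub> y) d')"
      using a C.H_m_comm[of "S h" "evC (etens CC x c')"] by (simp add: C.ev_act_l D.ev_act_l C.H_m_assoc)
  qed
qed

lemma tau_tens:
  assumes "c \<in> carrier C" "d \<in> carrier D" "c' \<in> carrier C" "d' \<in> carrier D"
  shows "tau (tens c d) (tens c' d') = evC (etens CC c c') \<otimes>\<^bsub>H\<^esub> evD (etens DD d d')"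
proof -
  have a: "c \<in> carrier Ck" "d \<in> carrier Dk" "c' \<in> carrier Ck" "d' \<in> carrier Dk" using assms by simp_all
  show ?thesis
    unfolding tau_def C.htlift_etens[OF hbal_tau2[OF tens_closed[OF assms(3,4)]] a(1,2)]
    by (rule C.htlift_etens[OF hbal_tau1[OF a(1,2)] a(3,4)])
qed

lemma kbil_tau: "kbil k Ek Ek Hk tau"
proof (rule kbil_intro[OF kmod_E kmod_E])
  show "klin k Ek Hk (\<lambda>e. tau e f)" if "f \<in> carrier Ek" for f
    unfolding tau_def by (rule C.klin_htlift[OF hbal_tau2[OF that]])
  show "klin k Ek Hk (\<lambda>f. tau e f)" if "e \<in> carrier Ek" for e
    unfolding tau_def
    by (rule C.htlift_param[OF that kmod_E hbal_tau2]) (assumption | rule C.klin_htlift hbal_tau1)+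
qed

lemmas tau_kl [kl] = klin_comp[OF kbil_laws(4)[OF kbil_tau]] klin_comp[OF kbil_laws(5)[OF kbil_tau]]
  kbil_laws(6)[OF kbil_tau]

definition EV where "EV = tlift Hk tau"

lemma EV_klin: "klin k E2 Hk EV" unfolding EV_def by (rule klin_tlift0[OF kbil_tau])

lemma EV_etens: "e \<in> carrier Ek \<Longrightarrow> f \<in> carrier Ek \<Longrightarrow> EV (etens E2 e f) = tau e f"
  unfolding EV_def by (rule tlift_etens[OF kbil_tau])

lemma tau_act_r:
  assumes "c \<in> carrier C" "d \<in> carrier D" "c' \<in> carrier C" "d' \<in> carrier D" "h \<in> carrier H"
  shows "tau (tens c d) (h \<odot>\<^bsub>Eh\<^esub> tens c' d') = evC (etens CC c c') \<otimes>\<^bsub>H\<^esub> (h \<otimes>\<^bsub>H\<^esub> evD (etens DD d d'))"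
  unfolding tens_smult(1)[OF assms(3,5,4)] tens_bal[OF assms(3,5,4)]
  using assms by (simp add: tau_tens D.ev_act_r)

text \<open>The sums over c and d decouple: the value is ev(\<Delta>(c)) h ev(\<Delta>(d)) =
  \<epsilon>(c) \<epsilon>(d) h. This is the first equation of the Galois criterion, for C
  \<otimes>_H D.\<close>

lemma EV_twist:
  assumes e: "e \<in> carrier Ek" and h: "h \<in> carrier Hk"
  shows "EV (tlift E2 (\<lambda>u v. etens E2 u (h \<odot>\<^bsub>Eh\<^esub> v)) (comult EE e)) = counit EE e \<odot>\<^bsub>Hk\<^esub> h"
proof (rule E_ext[where f = "\<lambda>e. EV (tlift E2 (\<lambda>u v. etens E2 u (h \<odot>\<^bsub>Eh\<^esub> v)) (comult EE e))" and A = Hk, OF _ _ _ e])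
  note dl = klin_comp[OF comult_E_klin] klin_comp[OF EV_klin] klin_comp[OF counit_E_klin]
  show "klin k Ek Hk (\<lambda>e. EV (tlift E2 (\<lambda>u v. etens E2 u (h \<odot>\<^bsub>Eh\<^esub> v)) (comult EE e)))"
    by (assumption | rule kl dl h)+
  show "klin k Ek Hk (\<lambda>e. counit EE e \<odot>\<^bsub>Hk\<^esub> h)" by (assumption | rule kl dl h)+
  fix c d assume cd: "c \<in> carrier C" "d \<in> carrier D"
  have cd': "c \<in> carrier Ck" "d \<in> carrier Dk" using cd by simp_all
  note dc = C.Cc.comult_closed[OF cd'(1)] and dd = D.Cc.comult_closed[OF cd'(2)]
  have b: "kbil k Ek Ek E2 (\<lambda>u v. etens E2 u (h \<odot>\<^bsub>Eh\<^esub> v))" by (assumption | rule kl h)+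
  have t: "tmap2 E2 tens tens (comult C c) (comult D d) \<in> carrier E2" by (rule kbil_laws(6)[OF kbil_tens2(1) dc dd])
  have "EV (tlift E2 (\<lambda>u v. etens E2 u (h \<odot>\<^bsub>Eh\<^esub> v)) (comult EE (tens c d))) =
      tlift Hk (\<lambda>u v. tau u (h \<odot>\<^bsub>Eh\<^esub> v)) (tmap2 E2 tens tens (comult C c) (comult D d))"
    unfolding comult_E[OF cd]
  proof (rule tlift_push[OF EV_klin b t])
    show "EV (etens E2 x (h \<odot>\<^bsub>Eh\<^esub> y)) = tau x (h \<odot>\<^bsub>Eh\<^esub> y)" if "x \<in> carrier Ek" "y \<in> carrier Ek" for x y
      by (rule EV_etens[OF that(1)]) (rule kl that h)+
  qed
  also have "\<dots> = tlift Hk (\<lambda>x x'. tlift Hk (\<lambda>y y'. tau (tens x y) (h \<odot>\<^bsub>Eh\<^esub> tens x' y')) (comult D d)) (comult C c)"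
    by (rule tlift_tmap2[OF _ dc dd kbil_tens kbil_tens]) (assumption | rule kl h)+
  also have "\<dots> = tlift Hk (\<lambda>x x'. evC (etens CC x x') \<otimes>\<^bsub>H\<^esub> (h \<otimes>\<^bsub>H\<^esub> evD (comult D d))) (comult C c)"
  proof (rule tlift_cong[OF _ _ dc, symmetric], (assumption | rule h cd' kl)+)
    fix x x' assume x: "x \<in> carrier Ck" "x' \<in> carrier Ck"
    let ?g = "\<lambda>s. evC (etens CC x x') \<otimes>\<^bsub>H\<^esub> (h \<otimes>\<^bsub>H\<^esub> evD s)"
    have g: "klin k DD Hk ?g" by (assumption | rule kl h x)+
    have "?g (comult D d) = tlift Hk (\<lambda>y y'. ?g (etens DD y y')) (comult D d)"
      by (rule tlift_klin_etens[OF g D.kmod_Ck D.kmod_Ck dd, symmetric])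
    also have "\<dots> = tlift Hk (\<lambda>y y'. tau (tens x y) (h \<odot>\<^bsub>Eh\<^esub> tens x' y')) (comult D d)"
    proof (rule tlift_cong[OF _ _ dd])
      show "kbil k Dk Dk Hk (\<lambda>y y'. ?g (etens DD y y'))" by (assumption | rule kl h x)+
    qed (use x h in \<open>simp add: tau_act_r\<close>)
    finally show "?g (comult D d) = tlift Hk (\<lambda>y y'. tau (tens x y) (h \<odot>\<^bsub>Eh\<^esub> tens x' y')) (comult D d)" .
  qed
  also have "\<dots> = evC (comult C c) \<otimes>\<^bsub>H\<^esub> (h \<otimes>\<^bsub>H\<^esub> evD (comult D d))"
  proof -
    have g: "klin k CC Hk (\<lambda>s. evC s \<otimes>\<^bsub>H\<^esub> (h \<otimes>\<^bsub>H\<^esub> evD (comult D d)))" by (assumption | rule kl h cd')+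
    show ?thesis by (rule tlift_klin_etens[OF g C.kmod_Ck C.kmod_Ck dc])
  qed
  also have "\<dots> = counit EE (tens c d) \<odot>\<^bsub>Hk\<^esub> h"
  proof -
    have e: "counit C c \<in> carrier k" "counit D d \<in> carrier k" and h': "h \<in> carrier H"
      using C.Cc.counit_closed[OF cd'(1)] D.Cc.counit_closed[OF cd'(2)] h by simp_all
    have "h \<otimes>\<^bsub>H\<^esub> (counit D d \<odot>\<^bsub>H\<^esub> \<one>\<^bsub>H\<^esub>) = counit D d \<odot>\<^bsub>H\<^esub> h"
      using klin_laws(6)[OF C.mult_lin(2)[OF klin_id[OF C.kmod_Hk] h] e(2), of "\<one>\<^bsub>H\<^esub>"] h' by simp
    then show ?thesis
      using e h' by (simp only: C.ev_comult[OF cd(1)] D.ev_comult[OF cd(2)] counit_E[OF cd])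
        (simp add: C.A.smult_assoc2 C.A.smult_assoc1)
  qed
  finally show "EV (tlift E2 (\<lambda>u v. etens E2 u (h \<odot>\<^bsub>Eh\<^esub> v)) (comult EE (tens c d))) = counit EE (tens c d) \<odot>\<^bsub>Hk\<^esub> h" .
qed

text \<open>The action on C \<otimes>_H D may be placed on either factor, so a product in
  \<open>H\<close> can act with one factor on each side; this separates the contributions of C and D
  to \<open>tau\<close>.\<close>

lemma E_smult_split:
  assumes "p \<in> carrier C" "r \<in> carrier D" "a \<in> carrier H" "b \<in> carrier H"
  shows "(a \<otimes>\<^bsub>H\<^esub> b) \<odot>\<^bsub>Eh\<^esub> tens p r = tens (a \<odot>\<^bsub>C\<^esub> p) (b \<odot>\<^bsub>D\<^esub> r)"
proof -
  have "(a \<otimes>\<^bsub>H\<^esub> b) \<odot>\<^bsub>Eh\<^esub> tens p r = tens (b \<odot>\<^bsub>C\<^esub> (a \<odot>\<^bsub>C\<^esub> p)) r"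
    using assms tens_smult(1)[of p "a \<otimes>\<^bsub>H\<^esub> b" r] C.H_m_comm[of a b] by (simp add: C.C.smult_assoc1)
  then show ?thesis using tens_bal[of "a \<odot>\<^bsub>C\<^esub> p" b r] assms by simp
qed

text \<open>By \<open>E_smult_split\<close> the value ev_C ev_D acts with its first factor on C and
  with its second on D, so \<open>ev_counit\<close> applies to each of them. The reduction to
  elementary tensors is made first in \<open>y\<close>, then in \<open>x\<close>.\<close>

lemma EV_counit:
  assumes x: "x \<in> carrier Ek" and y: "y \<in> carrier Ek"
  shows "tlift Ek (\<lambda>u v. tau v y \<odot>\<^bsub>Eh\<^esub> u) (comult EE x) = counit EE x \<odot>\<^bsub>Ek\<^esub> y"
proof -
  note dl = klin_comp[OF comult_E_klin] klin_comp[OF counit_E_klin] klin_laws(4)[OF comult_E_klin]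
  have ec: "counit EE e \<in> carrier k" if "e \<in> carrier Ek" for e using klin_laws(4)[OF counit_E_klin that] by simp
  have main: "tlift Ek (\<lambda>u v. tau v (tens c' d') \<odot>\<^bsub>Eh\<^esub> u) (comult EE (tens c d)) = counit EE (tens c d) \<odot>\<^bsub>Ek\<^esub> tens c' d'"
    if cd: "c \<in> carrier C" "d \<in> carrier D" and cd2: "c' \<in> carrier C" "d' \<in> carrier D" for c d c' d'
  proof -
    have cd': "c \<in> carrier Ck" "d \<in> carrier Dk" "c' \<in> carrier Ck" "d' \<in> carrier Dk" using cd cd2 by simp_all
    note dc = C.Cc.comult_closed[OF cd'(1)] and dd = D.Cc.comult_closed[OF cd'(2)] and y' = tens_closed[OF cd2]
    have e: "counit C c \<in> carrier k" "counit D d \<in> carrier k"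
      using C.Cc.counit_closed[OF cd'(1)] D.Cc.counit_closed[OF cd'(2)] by simp_all
    have "tlift Ek (\<lambda>u v. tau v (tens c' d') \<odot>\<^bsub>Eh\<^esub> u) (comult EE (tens c d)) =
       tlift Ek (\<lambda>p q. tlift Ek (\<lambda>r s. tau (tens q s) (tens c' d') \<odot>\<^bsub>Eh\<^esub> tens p r) (comult D d)) (comult C c)"
      unfolding comult_E[OF cd] by (rule tlift_tmap2[OF _ dc dd kbil_tens kbil_tens]) (assumption | rule kl y')+
    also have "\<dots> = tlift Ek (\<lambda>p q. tens (evC (etens CC q c') \<odot>\<^bsub>C\<^esub> p) (counit D d \<odot>\<^bsub>Dk\<^esub> d')) (comult C c)"
    proof (rule tlift_cong[OF _ _ dc, symmetric])
      have kd: "counit D d \<odot>\<^bsub>Dk\<^esub> d' \<in> carrier Dk" by (rule kmod_laws(4)[OF D.kmod_Ck e(2) cd'(4)])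
      show "kbil k Ck Ck Ek (\<lambda>p q. tens (evC (etens CC q c') \<odot>\<^bsub>C\<^esub> p) (counit D d \<odot>\<^bsub>Dk\<^esub> d'))"
        by (assumption | rule kl kd cd')+
      fix p q assume pq: "p \<in> carrier Ck" "q \<in> carrier Ck"
      let ?m = "evC (etens CC q c') \<odot>\<^bsub>C\<^esub> p"
      have l: "klin k Dk Ek (\<lambda>r. tens ?m r)" by (assumption | rule kl pq cd')+
      have "tens ?m (tlift Dk (\<lambda>r s. evD (etens DD s d') \<odot>\<^bsub>D\<^esub> r) (comult D d)) =
          tlift Ek (\<lambda>r s. tau (tens q s) (tens c' d') \<odot>\<^bsub>Eh\<^esub> tens p r) (comult D d)"
      proof (rule tlift_push[OF l _ dd], (assumption | rule cd' kl)+)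
        show "tens ?m (evD (etens DD s d') \<odot>\<^bsub>D\<^esub> r) = tau (tens q s) (tens c' d') \<odot>\<^bsub>Eh\<^esub> tens p r"
          if "r \<in> carrier Dk" "s \<in> carrier Dk" for r s
          using that pq cd2 by (simp add: tau_tens E_smult_split)
      qed
      then show "tens ?m (counit D d \<odot>\<^bsub>Dk\<^esub> d') =
          tlift Ek (\<lambda>r s. tau (tens q s) (tens c' d') \<odot>\<^bsub>Eh\<^esub> tens p r) (comult D d)"
        by (simp only: D.ev_counit[OF cd(2) cd2(2)])
    qed
    also have "\<dots> = tens (counit C c \<odot>\<^bsub>Ck\<^esub> c') (counit D d \<odot>\<^bsub>Dk\<^esub> d')"
    proof -
      have kd: "counit D d \<odot>\<^bsub>Dk\<^esub> d' \<in> carrier Dk" by (rule kmod_laws(4)[OF D.kmod_Ck e(2) cd'(4)])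
      have l: "klin k Ck Ek (\<lambda>p. tens p (counit D d \<odot>\<^bsub>Dk\<^esub> d'))" by (assumption | rule kl kd)+
      have "tens (tlift Ck (\<lambda>p q. evC (etens CC q c') \<odot>\<^bsub>C\<^esub> p) (comult C c)) (counit D d \<odot>\<^bsub>Dk\<^esub> d') =
          tlift Ek (\<lambda>p q. tens (evC (etens CC q c') \<odot>\<^bsub>C\<^esub> p) (counit D d \<odot>\<^bsub>Dk\<^esub> d')) (comult C c)"
        by (rule tlift_fusion[OF l _ dc]) (assumption | rule kl cd')+
      then show ?thesis by (simp only: C.ev_counit[OF cd(1) cd2(1)])
    qed
    also have "\<dots> = counit EE (tens c d) \<odot>\<^bsub>Ek\<^esub> tens c' d'"
    proof -
      have kd: "counit D d \<odot>\<^bsub>Dk\<^esub> d' \<in> carrier Dk" by (rule kmod_laws(4)[OF D.kmod_Ck e(2) cd'(4)])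
      show ?thesis
        unfolding klin_laws(6)[OF kbil_laws(4)[OF kbil_tens kd] e(1) cd'(3)] klin_laws(6)[OF kbil_laws(5)[OF kbil_tens cd'(3)] e(2) cd'(4)]
          counit_E[OF cd]
        by (rule kmod_laws(6)[OF kmod_E e y', symmetric])
    qed
    finally show ?thesis .
  qed
  have step: "tlift Ek (\<lambda>u v. tau v y \<odot>\<^bsub>Eh\<^esub> u) (comult EE (tens c d)) = counit EE (tens c d) \<odot>\<^bsub>Ek\<^esub> y"
    if cd: "c \<in> carrier C" "d \<in> carrier D" for c d
    by (rule E_ext[where f = "\<lambda>y. tlift Ek (\<lambda>u v. tau v y \<odot>\<^bsub>Eh\<^esub> u) (comult EE (tens c d))" and A = Ek, OF _ _ main[OF cd] y], (assumption | rule ec[OF tens_closed[OF cd]] dl tens_closed[OF cd] kl)+)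
  show ?thesis
  proof (rule E_ext[where f = "\<lambda>x. tlift Ek (\<lambda>u v. tau v y \<odot>\<^bsub>Eh\<^esub> u) (comult EE x)" and A = Ek, OF _ _ step x])
    show "klin k Ek Ek (\<lambda>x. tlift Ek (\<lambda>u v. tau v y \<odot>\<^bsub>Eh\<^esub> u) (comult EE x))" by (assumption | rule kl dl y)+
    show "klin k Ek Ek (\<lambda>x. counit EE x \<odot>\<^bsub>Ek\<^esub> y)" by (assumption | rule kl dl y)+
  qed
qed

sublocale E: mod_coalg k H EE by (rule mod_coalg_EE)

text \<open>\<open>EV_twist\<close> and \<open>EV_counit\<close> are the two equations of
  \<open>galois_criterion\<close>, which yields bijectivity of the Galois map and its evaluation
  together.\<close>

lemma galois_EE: "galois k H EE" and ev_EE: "t \<in> carrier E2 \<Longrightarrow> galois_ev k H EE t = EV t"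
proof -
  let ?F = "kk H (bimod_of EE)"
  have e: "etens (?F \<boxtimes>\<^bsub>k\<^esub> ?F) = etens E2" "tlift (?F \<boxtimes>\<^bsub>k\<^esub> ?F) = tlift E2" "tlift ?F = tlift Ek"
    "carrier (?F \<boxtimes>\<^bsub>k\<^esub> ?F) = carrier E2"
    by (rule keqv_cong_etens[OF keqv_EE2], rule keqv_cong_ops[OF keqv_EE2], rule keqv_cong_ops[OF keqv_EE],
        rule keqv_sel(1)[OF keqv_EE2])
  have k: "klin k (?F \<boxtimes>\<^bsub>k\<^esub> ?F) Hk EV"
    by (rule keqv_klin[OF keqv_sym[OF keqv_EE2] keqv_refl[OF C.kmod_Hk] EV_klin])
  have 1: "EV (E.twist c h) = counit EE c \<odot>\<^bsub>H\<^esub> h" if "c \<in> carrier EE" "h \<in> carrier H" for c h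
    unfolding E.twist_def e EE_sel(4) using EV_twist[of c h] that by (simp only: kk_sel bimod_of_sel EE_sel(1))
  have 2: "tlift ?F (\<lambda>u v. EV (etens (?F \<boxtimes>\<^bsub>k\<^esub> ?F) v y) \<odot>\<^bsub>EE\<^esub> u) (comult EE x) = counit EE x \<odot>\<^bsub>?F\<^esub> y"
    if x: "x \<in> carrier EE" and y: "y \<in> carrier EE" for x y
  proof -
    have xy: "x \<in> carrier Ek" "y \<in> carrier Ek" using x y by (simp_all only: kk_sel EE_sel)
    have "tlift Ek (\<lambda>u v. tau v y \<odot>\<^bsub>Eh\<^esub> u) (comult EE x) = tlift Ek (\<lambda>u v. EV (etens E2 v y) \<odot>\<^bsub>Eh\<^esub> u) (comult EE x)"
      by (rule tlift_cong[OF _ _ klin_laws(4)[OF comult_E_klin xy(1)]])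
        (assumption | rule kl xy | simp only: EV_etens xy)+
    then show ?thesis
      unfolding e EE_sel(4) using EV_counit[OF xy] by (simp only: kk_sel bimod_of_sel EE_sel(4))
  qed
  show "galois k H EE"
    by unfold_locales (rule E.galois_criterion(1)[OF k 1 2])
  show "galois_ev k H EE t = EV t" if "t \<in> carrier E2"
    by (rule E.galois_criterion(2)[OF k 1 2]) (simp_all only: e that)
qed

end

section \<open>The smash map\<close>

context galois_pair
begin

abbreviation hatC where "hatC \<equiv> comm_hopf.pen_of H (bimod_of C)"
abbreviation hatD where "hatD \<equiv> comm_hopf.pen_of H (bimod_of D)"
abbreviation CCh where "CCh \<equiv> PT k H (galois_herd k H C)"
abbreviation DDh where "DDh \<equiv> TP k H (galois_herd k H D)"
abbreviation Ah where "Ah \<equiv> CCh \<boxtimes>\<^bsub>H\<^esub> DDh"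
abbreviation Bh where "Bh \<equiv> DDh \<boxtimes>\<^bsub>H\<^esub> CCh"
abbreviation Bk where "Bk \<equiv> kk H Bh"

lemma CCh_def: "CCh = rk H hatC \<boxtimes>\<^bsub>k\<^esub> lk H (bimod_of C)"
  by (simp only: PT_def C.herd_sel)

lemma DDh_def: "DDh = rk H (bimod_of D) \<boxtimes>\<^bsub>k\<^esub> lk H hatD"
  by (simp only: TP_def D.herd_sel)

lemma hbimod_CCh [kl]: "C.hbimod CCh"
  unfolding CCh_def by (rule C.hbimod_ktensor[OF C.hbimod_Pen C.hbimod_C])

lemma hbimod_DDh [kl]: "C.hbimod DDh"
  unfolding DDh_def by (rule C.hbimod_ktensor[OF D.hbimod_C D.hbimod_Pen])

lemma hbimod_B [kl]: "C.hbimod Bh" by (rule C.hbimod_tensor[OF hbimod_DDh hbimod_CCh])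
lemma hbimod_A [kl]: "C.hbimod Ah" by (rule C.hbimod_tensor[OF hbimod_CCh hbimod_DDh])

lemma kmod_B [kl]: "kmod k Bk" by (rule C.kmod_kk[OF hbimod_B])

lemma CCh_ops: "etens CCh = etens CC" "tmap CCh = tmap CC" "carrier CCh = carrier CC"
  by (rule C.keqv_ops(1)[OF C.keqv_PT], rule C.keqv_ops(2)[OF C.keqv_PT], rule keqv_sel(1)[OF C.keqv_PT, unfolded kk_sel])

lemma DDh_ops: "etens DDh = etens DD" "tmap DDh = tmap DD" "carrier DDh = carrier DD"
  by (rule C.keqv_ops(1)[OF D.keqv_TP], rule C.keqv_ops(2)[OF D.keqv_TP], rule keqv_sel(1)[OF D.keqv_TP, unfolded kk_sel])

lemma CCh_lin [kl]: "klin k P CC f \<Longrightarrow> klin k P (kk H CCh) f"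
  using keqv_klin[OF _ keqv_sym[OF C.keqv_PT], OF keqv_refl] klin_laws(1) by blast

lemma DDh_lin [kl]: "klin k P DD f \<Longrightarrow> klin k P (kk H DDh) f"
  using keqv_klin[OF _ keqv_sym[OF D.keqv_TP], OF keqv_refl] klin_laws(1) by blast

lemma CCh_closed [kl]: "t \<in> carrier CC \<Longrightarrow> t \<in> carrier (kk H CCh)"
  by (simp only: kk_sel CCh_ops)

lemma DDh_closed [kl]: "t \<in> carrier DD \<Longrightarrow> t \<in> carrier (kk H DDh)"
  by (simp only: kk_sel DDh_ops)

lemma CCh_src: "klin k CC A f \<Longrightarrow> klin k (kk H CCh) A f"
  using keqv_klin[OF keqv_sym[OF C.keqv_PT], OF keqv_refl] klin_laws(2) by blast

lemma DDh_src: "klin k DD A f \<Longrightarrow> klin k (kk H DDh) A f"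
  using keqv_klin[OF keqv_sym[OF D.keqv_TP], OF keqv_refl] klin_laws(2) by blast

lemma CCh_smult:
  assumes "p \<in> carrier C" "x \<in> carrier C" "h \<in> carrier H"
  shows "h \<odot>\<^bsub>CCh\<^esub> etens CC p x = etens CC (S h \<odot>\<^bsub>C\<^esub> p) x"
    "rsmult CCh (etens CC p x) h = etens CC p (h \<odot>\<^bsub>C\<^esub> x)"
proof -
  note T = tensor_bimodule(2,3)[OF C.hbimod_restr(2)[OF C.hbimod_Pen] C.hbimod_restr(1)[OF C.hbimod_C],
      folded CCh_def, unfolded CCh_ops, of h p x]
  show "h \<odot>\<^bsub>CCh\<^esub> etens CC p x = etens CC (S h \<odot>\<^bsub>C\<^esub> p) x"
    "rsmult CCh (etens CC p x) h = etens CC p (h \<odot>\<^bsub>C\<^esub> x)"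
    using T assms by simp_all
qed

lemma DDh_smult:
  assumes "y \<in> carrier D" "q \<in> carrier D" "h \<in> carrier H"
  shows "h \<odot>\<^bsub>DDh\<^esub> etens DD y q = etens DD (h \<odot>\<^bsub>D\<^esub> y) q"
    "rsmult DDh (etens DD y q) h = etens DD y (S h \<odot>\<^bsub>D\<^esub> q)"
proof -
  note T = tensor_bimodule(2,3)[OF C.hbimod_restr(2)[OF D.hbimod_C] C.hbimod_restr(1)[OF D.hbimod_Pen],
      folded DDh_def, unfolded DDh_ops, of h y q]
  show "h \<odot>\<^bsub>DDh\<^esub> etens DD y q = etens DD (h \<odot>\<^bsub>D\<^esub> y) q"
    "rsmult DDh (etens DD y q) h = etens DD y (S h \<odot>\<^bsub>D\<^esub> q)"
    using T assms by simp_all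
qed

lemma hB_lin [kl]:
  "klin k P Bk f \<Longrightarrow> h \<in> carrier Hk \<Longrightarrow> klin k P Bk (\<lambda>z. h \<odot>\<^bsub>Bh\<^esub> f z)"
  "klin k P Bk f \<Longrightarrow> h \<in> carrier Hk \<Longrightarrow> klin k P Bk (\<lambda>z. rsmult Bh (f z) h)"
  by (rule C.hsmult_lin[OF _ _ hbimod_B]; assumption)+

lemma hCC_lin:
  "klin k P (kk H CCh) f \<Longrightarrow> h \<in> carrier Hk \<Longrightarrow> klin k P (kk H CCh) (\<lambda>z. h \<odot>\<^bsub>CCh\<^esub> f z)"
  "klin k P (kk H CCh) f \<Longrightarrow> h \<in> carrier Hk \<Longrightarrow> klin k P (kk H CCh) (\<lambda>z. rsmult CCh (f z) h)"
  "klin k P Hk g \<Longrightarrow> x \<in> carrier (kk H CCh) \<Longrightarrow> klin k P (kk H CCh) (\<lambda>z. g z \<odot>\<^bsub>CCh\<^esub> x)"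
  "klin k P Hk g \<Longrightarrow> x \<in> carrier (kk H CCh) \<Longrightarrow> klin k P (kk H CCh) (\<lambda>z. rsmult CCh x (g z))"
  by (rule C.hsmult_lin[OF _ _ hbimod_CCh] C.hact_lin[OF _ _ hbimod_CCh]; assumption)+

lemma hDD_lin:
  "klin k P (kk H DDh) f \<Longrightarrow> h \<in> carrier Hk \<Longrightarrow> klin k P (kk H DDh) (\<lambda>z. h \<odot>\<^bsub>DDh\<^esub> f z)"
  "klin k P (kk H DDh) f \<Longrightarrow> h \<in> carrier Hk \<Longrightarrow> klin k P (kk H DDh) (\<lambda>z. rsmult DDh (f z) h)"
  "klin k P Hk g \<Longrightarrow> x \<in> carrier (kk H DDh) \<Longrightarrow> klin k P (kk H DDh) (\<lambda>z. g z \<odot>\<^bsub>DDh\<^esub> x)"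
  by (rule C.hsmult_lin[OF _ _ hbimod_DDh] C.hact_lin[OF _ _ hbimod_DDh]; assumption)+

lemmas B_laws = is_bimodule_laws[OF C.hbimod_bimodule[OF hbimod_B]]

text \<open>The value that \<sigma> must take at \<Delta>(y) \<otimes>_H \<Delta>(v); the general
  formula is assembled from these elements.\<close>

definition K where "K v y = etens Bh (comult D v) (comult C y)"

lemma kbil_K: "kbil k Dk Ck Bk K"
  unfolding K_def by (assumption | rule kl)+

lemmas K_kl [kl] = klin_comp[OF kbil_laws(4)[OF kbil_K]] klin_comp[OF kbil_laws(5)[OF kbil_K]]
  kbil_laws(6)[OF kbil_K]

text \<open>The two sides below are \<open>\<Sum> (h\<^sub>1d \<otimes> d') \<otimes>\<^sub>H (h\<^sub>2c \<otimes> h\<^sub>3c')\<close> and \<open>\<Sum> (h\<^sub>1d \<otimes> h\<^sub>2d') \<otimes>\<^sub>H (c \<otimes> h\<^sub>3c')\<close>,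
  and \<open>h\<^sub>2\<close> can be moved across \<open>\<otimes>\<^sub>H\<close>.\<close>

lemma K_balance_aux:
  assumes t: "t \<in> carrier DD" and s: "s \<in> carrier CC" and h: "h \<in> carrier Hk"
  shows "tlift Bk (\<lambda>a b. a \<odot>\<^bsub>Bh\<^esub> etens Bh t (tmap2 CC C.act C.act s (hcomult H b))) (hcomult H h) =
    tlift Bk (\<lambda>a b. rsmult Bh (etens Bh (tmap2 DD D.act D.act t (hcomult H a)) s) b) (hcomult H h)"
proof -
  note bC = kbil_tmap2[OF C.kbil_act C.kbil_act] and bD = kbil_tmap2[OF D.kbil_act D.kbil_act]
  note tl = klin_comp[OF kbil_laws(4)[OF bC(1)]] klin_comp[OF kbil_laws(5)[OF bC(1)]] kbil_laws(6)[OF bC(1)]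
    klin_comp[OF kbil_laws(4)[OF bD(1)]] klin_comp[OF kbil_laws(5)[OF bD(1)]] kbil_laws(6)[OF bD(1)]
  let ?F = "\<lambda>t s. tlift Bk (\<lambda>a b. a \<odot>\<^bsub>Bh\<^esub> etens Bh t (tmap2 CC C.act C.act s (hcomult H b))) (hcomult H h)"
  let ?G = "\<lambda>t s. tlift Bk (\<lambda>a b. rsmult Bh (etens Bh (tmap2 DD D.act D.act t (hcomult H a)) s) b) (hcomult H h)"
  show ?thesis
  proof (rule tensor_ext2[where f = ?F and g = ?G, OF _ _ D.kmod_Ck D.kmod_Ck C.kmod_Ck C.kmod_Ck _ t s], (assumption | rule tl h kl)+)
    fix d d' c c' assume a: "d \<in> carrier Dk" "d' \<in> carrier Dk" "c \<in> carrier Ck" "c' \<in> carrier Ck"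
    have e: "etens DD d d' \<in> carrier DD" "etens CC c c' \<in> carrier CC" by (rule kl a)+
    note dh = C.Hc.comult_closed[OF h]
    let ?J = "\<lambda>u v w. etens Bh (etens DD (u \<odot>\<^bsub>D\<^esub> d) (v \<odot>\<^bsub>D\<^esub> d')) (etens CC c (w \<odot>\<^bsub>C\<^esub> c'))"
    have "?F (etens DD d d') (etens CC c c') = tlift Bk (\<lambda>a b. tlift Bk (\<lambda>v w. ?J a v w) (hcomult H b)) (hcomult H h)"
    proof (rule tlift_cong[OF _ _ dh], (assumption | rule tl e kl)+)
      fix u b assume ub: "u \<in> carrier Hk" "b \<in> carrier Hk"
      note db = C.Hc.comult_closed[OF ub(2)]
      have lm: "klin k CC Bk (\<lambda>s. u \<odot>\<^bsub>Bh\<^esub> etens Bh (etens DD d d') s)"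
        by (assumption | rule kl e ub)+
      have "u \<odot>\<^bsub>Bh\<^esub> etens Bh (etens DD d d') (tmap2 CC C.act C.act (etens CC c c') (hcomult H b)) =
        u \<odot>\<^bsub>Bh\<^esub> etens Bh (etens DD d d') (tlift CC (\<lambda>v w. etens CC (v \<odot>\<^bsub>C\<^esub> c) (w \<odot>\<^bsub>C\<^esub> c')) (hcomult H b))"
      proof -
        have "tmap2 CC C.act C.act (etens CC c c') (hcomult H b) =
            tlift CC (\<lambda>v w. etens CC (v \<odot>\<^bsub>C\<^esub> c) (w \<odot>\<^bsub>C\<^esub> c')) (hcomult H b)"
          unfolding tmap2_def by (rule tlift_etens[OF _ a(3,4)]) (assumption | rule kl db)+
        then show ?thesis by simp
      qed
      also have "\<dots> = tlift Bk (\<lambda>v w. ?J u v w) (hcomult H b)"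
      proof (rule tlift_push[OF lm _ db], (assumption | rule a kl)+)
        fix v w assume vw: "v \<in> carrier Hk" "w \<in> carrier Hk"
        have g: "d \<in> carrier D" "d' \<in> carrier D" "c \<in> carrier C" "c' \<in> carrier C" "u \<in> carrier H" "v \<in> carrier H" "w \<in> carrier H"
          using a ub vw by simp_all
        have cl: "etens DD (u \<odot>\<^bsub>D\<^esub> d) d' \<in> carrier DDh" "etens CC c (w \<odot>\<^bsub>C\<^esub> c') \<in> carrier CCh"
          "etens DD d d' \<in> carrier DDh" "etens CC (v \<odot>\<^bsub>C\<^esub> c) (w \<odot>\<^bsub>C\<^esub> c') \<in> carrier CCh"
          unfolding CCh_ops DDh_ops by (rule kl a ub vw)+
        have "u \<odot>\<^bsub>Bh\<^esub> etens Bh (etens DD d d') (etens CC (v \<odot>\<^bsub>C\<^esub> c) (w \<odot>\<^bsub>C\<^esub> c')) =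
            etens Bh (etens DD (u \<odot>\<^bsub>D\<^esub> d) d') (etens CC (v \<odot>\<^bsub>C\<^esub> c) (w \<odot>\<^bsub>C\<^esub> c'))"
          using C.hetens_smult(1)[OF hbimod_DDh hbimod_CCh cl(3) g(5) cl(4)] DDh_smult(1)[OF g(1,2,5)] by simp
        \<comment> \<open>The left action on \<open>CCh\<close> is the pen action on its first leg,
          twisted by S; since S S = id, acting by \<open>v\<close> on that leg is the action of
          \<open>S v\<close>.\<close>
        also have "\<dots> = etens Bh (etens DD (u \<odot>\<^bsub>D\<^esub> d) d') (S v \<odot>\<^bsub>CCh\<^esub> etens CC c (w \<odot>\<^bsub>C\<^esub> c'))"
          using CCh_smult(1)[of c "w \<odot>\<^bsub>C\<^esub> c'" "S v"] g by (simp add: C.antipode_antipode)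
        also have "\<dots> = etens Bh (rsmult DDh (etens DD (u \<odot>\<^bsub>D\<^esub> d) d') (S v)) (etens CC c (w \<odot>\<^bsub>C\<^esub> c'))"
          by (rule C.hetens_bal[OF hbimod_DDh hbimod_CCh cl(1) _ cl(2), symmetric]) (use g in simp)
        also have "\<dots> = ?J u v w"
          using DDh_smult(2)[of "u \<odot>\<^bsub>D\<^esub> d" d' "S v"] g by (simp add: C.antipode_antipode)
        finally show "u \<odot>\<^bsub>Bh\<^esub> etens Bh (etens DD d d') (etens CC (v \<odot>\<^bsub>C\<^esub> c) (w \<odot>\<^bsub>C\<^esub> c')) = ?J u v w" .
      qed
      finally show "u \<odot>\<^bsub>Bh\<^esub> etens Bh (etens DD d d') (tmap2 CC C.act C.act (etens CC c c') (hcomult H b)) =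
        tlift Bk (\<lambda>v w. ?J u v w) (hcomult H b)" .
    qed
    also have "\<dots> = tlift Bk (\<lambda>b w. tlift Bk (\<lambda>u v. ?J u v w) (hcomult H b)) (hcomult H h)"
      by (rule C.Hc.coassoc[OF _ h, symmetric]) (assumption | rule kl a)+
    also have "\<dots> = ?G (etens DD d d') (etens CC c c')"
    proof (rule tlift_cong[OF _ _ dh], (assumption | rule a kl)+)
      fix b w assume bw: "b \<in> carrier Hk" "w \<in> carrier Hk"
      note db = C.Hc.comult_closed[OF bw(1)]
      have lm: "klin k DD Bk (\<lambda>t. rsmult Bh (etens Bh t (etens CC c c')) w)"
        by (assumption | rule kl e bw)+
      have t': "tmap2 DD D.act D.act (etens DD d d') (hcomult H b) =
          tlift DD (\<lambda>u v. etens DD (u \<odot>\<^bsub>D\<^esub> d) (v \<odot>\<^bsub>D\<^esub> d')) (hcomult H b)"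
        unfolding tmap2_def by (rule tlift_etens[OF _ a(1,2)]) (assumption | rule kl db)+
      show "tlift Bk (\<lambda>u v. ?J u v w) (hcomult H b) =
        rsmult Bh (etens Bh (tmap2 DD D.act D.act (etens DD d d') (hcomult H b)) (etens CC c c')) w"
        unfolding t'
      proof (rule tlift_push[OF lm _ db, symmetric], (assumption | rule a kl)+)
        fix u v assume uv: "u \<in> carrier Hk" "v \<in> carrier Hk"
        have cl: "etens DD (u \<odot>\<^bsub>D\<^esub> d) (v \<odot>\<^bsub>D\<^esub> d') \<in> carrier DDh" "etens CC c c' \<in> carrier CCh"
          unfolding CCh_ops DDh_ops by (rule kl a uv)+
        have w: "w \<in> carrier H" using bw by simp
        show "rsmult Bh (etens Bh (etens DD (u \<odot>\<^bsub>D\<^esub> d) (v \<odot>\<^bsub>D\<^esub> d')) (etens CC c c')) w = ?J u v w"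
          using C.hetens_smult(2)[OF hbimod_DDh hbimod_CCh cl(1) w cl(2)] CCh_smult(2)[of c c' w] a w by simp
      qed
    qed
    finally show "?F (etens DD d d') (etens CC c c') = ?G (etens DD d d') (etens CC c c')" .
  qed
qed

text \<open>\<open>K_balance_aux\<close> at coproducts, where the diagonal actions are absorbed into
  the coproducts of the translated elements.\<close>

lemma K_balance:
  assumes v: "v \<in> carrier Dk" and y: "y \<in> carrier Ck" and h: "h \<in> carrier Hk"
  shows "tlift Bk (\<lambda>a b. a \<odot>\<^bsub>Bh\<^esub> K v (b \<odot>\<^bsub>C\<^esub> y)) (hcomult H h) =
    tlift Bk (\<lambda>a b. rsmult Bh (K (a \<odot>\<^bsub>D\<^esub> v) y) b) (hcomult H h)"
proof -
  note dh = C.Hc.comult_closed[OF h]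
  have "tlift Bk (\<lambda>a b. a \<odot>\<^bsub>Bh\<^esub> K v (b \<odot>\<^bsub>C\<^esub> y)) (hcomult H h) =
    tlift Bk (\<lambda>a b. a \<odot>\<^bsub>Bh\<^esub> etens Bh (comult D v) (tmap2 CC C.act C.act (comult C y) (hcomult H b))) (hcomult H h)"
  proof (rule tlift_cong[OF _ _ dh])
    show "kbil k Hk Hk Bk (\<lambda>a b. a \<odot>\<^bsub>Bh\<^esub> K v (b \<odot>\<^bsub>C\<^esub> y))" by (assumption | rule kl v y)+
  qed (use y in \<open>simp add: K_def C.comult_act\<close>)
  also have "\<dots> = tlift Bk (\<lambda>a b. rsmult Bh (etens Bh (tmap2 DD D.act D.act (comult D v) (hcomult H a)) (comult C y)) b) (hcomult H h)"
    by (rule K_balance_aux[OF D.Cc.comult_closed[OF v] C.Cc.comult_closed[OF y] h])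
  also have "\<dots> = tlift Bk (\<lambda>a b. rsmult Bh (K (a \<odot>\<^bsub>D\<^esub> v) y) b) (hcomult H h)"
  proof (rule tlift_cong[OF _ _ dh, symmetric])
    show "kbil k Hk Hk Bk (\<lambda>a b. rsmult Bh (K (a \<odot>\<^bsub>D\<^esub> v) y) b)" by (assumption | rule kl v y)+
  qed (use v in \<open>simp add: K_def D.comult_act\<close>)
  finally show ?thesis .
qed

text \<open>From d \<otimes> d' = d1 \<otimes> d2 ev(d3 \<otimes> d') and the prescribed values of
  \<sigma>, this is the value that \<sigma> must take at \<Delta>(y) \<otimes>_H (d \<otimes>
  d').\<close>

definition Mid where
  "Mid d d' y = tlift Bk (\<lambda>v w. rsmult Bh (K v y) (S (evD (etens DD w d')))) (comult D d)"

lemma Mid_lin [kl]: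
  "klin k P Dk f \<Longrightarrow> d' \<in> carrier Dk \<Longrightarrow> y \<in> carrier Ck \<Longrightarrow> klin k P Bk (\<lambda>z. Mid (f z) d' y)"
  "klin k P Dk f \<Longrightarrow> d \<in> carrier Dk \<Longrightarrow> y \<in> carrier Ck \<Longrightarrow> klin k P Bk (\<lambda>z. Mid d (f z) y)"
  "klin k P Ck g \<Longrightarrow> d \<in> carrier Dk \<Longrightarrow> d' \<in> carrier Dk \<Longrightarrow> klin k P Bk (\<lambda>z. Mid d d' (g z))"
proof -
  show "klin k P Bk (\<lambda>z. Mid (f z) d' y)" if f: "klin k P Dk f" and "d' \<in> carrier Dk" "y \<in> carrier Ck"
    unfolding Mid_def by (assumption | rule kl that)+
  have "klin k Dk Bk (\<lambda>z. Mid d z y)" if "d \<in> carrier Dk" "y \<in> carrier Ck"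
    unfolding Mid_def by (assumption | rule kl that)+
  then show "klin k P Bk (\<lambda>z. Mid d (f z) y)" if "klin k P Dk f" "d \<in> carrier Dk" "y \<in> carrier Ck"
    using klin_comp[OF _ that(1)] that(2,3) by blast
  have "klin k Ck Bk (\<lambda>z. Mid d d' z)" if "d \<in> carrier Dk" "d' \<in> carrier Dk"
    unfolding Mid_def by (assumption | rule kl that)+
  then show "klin k P Bk (\<lambda>z. Mid d d' (g z))" if "klin k P Ck g" "d \<in> carrier Dk" "d' \<in> carrier Dk"
    using klin_comp[OF _ that(1)] that(2,3) by blast
qed

lemma Mid_closed [kl]: "d \<in> carrier Dk \<Longrightarrow> d' \<in> carrier Dk \<Longrightarrow> y \<in> carrier Ck \<Longrightarrow> Mid d d' y \<in> carrier Bk"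
  by (rule klin_laws(4)[OF Mid_lin(1)[OF klin_id[OF D.kmod_Ck]]])

text \<open>\<open>K_balance\<close> turns h1 K(d1, h2 y) into K(h1 d1, y) h2, and the right factor
  h2 is absorbed by the evaluation: S(ev(h2 d2 \<otimes> d')) = h2 S(ev(d2 \<otimes> d')) by
  \<open>ev_act_l\<close> and S S = id. The two legs of h then act on the two legs of d.\<close>

lemma Mid_balance:
  assumes d: "d \<in> carrier Dk" and d': "d' \<in> carrier Dk" and y: "y \<in> carrier Ck" and h: "h \<in> carrier Hk"
  shows "tlift Bk (\<lambda>a b. a \<odot>\<^bsub>Bh\<^esub> Mid d d' (b \<odot>\<^bsub>C\<^esub> y)) (hcomult H h) = Mid (h \<odot>\<^bsub>D\<^esub> d) d' y"
proof -
  note dh = C.Hc.comult_closed[OF h] and dd = D.Cc.comult_closed[OF d]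
  let ?g = "\<lambda>w. S (evD (etens DD w d'))"
  have "tlift Bk (\<lambda>a b. a \<odot>\<^bsub>Bh\<^esub> Mid d d' (b \<odot>\<^bsub>C\<^esub> y)) (hcomult H h) =
    tlift Bk (\<lambda>a b. tlift Bk (\<lambda>v w. rsmult Bh (a \<odot>\<^bsub>Bh\<^esub> K v (b \<odot>\<^bsub>C\<^esub> y)) (?g w)) (comult D d)) (hcomult H h)"
  proof (rule tlift_cong[OF _ _ dh], (assumption | rule d d' y kl)+)
    fix a b assume ab: "a \<in> carrier Hk" "b \<in> carrier Hk"
    have l: "klin k Bk Bk (\<lambda>z. a \<odot>\<^bsub>Bh\<^esub> z)" by (assumption | rule kl ab)+
    show "a \<odot>\<^bsub>Bh\<^esub> Mid d d' (b \<odot>\<^bsub>C\<^esub> y) = tlift Bk (\<lambda>v w. rsmult Bh (a \<odot>\<^bsub>Bh\<^esub> K v (b \<odot>\<^bsub>C\<^esub> y)) (?g w)) (comult D d)"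
      unfolding Mid_def
    proof (rule tlift_push[OF l _ dd], (assumption | rule d' y ab kl)+)
      fix v w assume vw: "v \<in> carrier Dk" "w \<in> carrier Dk"
      have "?g w \<in> carrier Hk" "K v (b \<odot>\<^bsub>C\<^esub> y) \<in> carrier Bk" by (rule kl vw d' y ab)+
      then show "a \<odot>\<^bsub>Bh\<^esub> rsmult Bh (K v (b \<odot>\<^bsub>C\<^esub> y)) (?g w) = rsmult Bh (a \<odot>\<^bsub>Bh\<^esub> K v (b \<odot>\<^bsub>C\<^esub> y)) (?g w)"
        using B_laws(14) ab by (simp only: kk_sel bimod_of_sel)
    qed
  qed
  also have "\<dots> = tlift Bk (\<lambda>v w. tlift Bk (\<lambda>a b. rsmult Bh (a \<odot>\<^bsub>Bh\<^esub> K v (b \<odot>\<^bsub>C\<^esub> y)) (?g w)) (hcomult H h)) (comult D d)"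
    by (rule tlift_swap[OF dh dd]) (assumption | rule kl d' y)+
  also have "\<dots> = tlift Bk (\<lambda>v w. tlift Bk (\<lambda>a b. rsmult Bh (K (a \<odot>\<^bsub>D\<^esub> v) y) (S (evD (etens DD (b \<odot>\<^bsub>D\<^esub> w) d')))) (hcomult H h)) (comult D d)"
  proof (rule tlift_cong[OF _ _ dd], (assumption | rule d' y dh kl)+)
    fix v w assume vw: "v \<in> carrier Dk" "w \<in> carrier Dk"
    have g: "?g w \<in> carrier Hk" by (rule kl vw d')+
    have l: "klin k Bk Bk (\<lambda>z. rsmult Bh z (?g w))" by (assumption | rule kl g)+
    have "tlift Bk (\<lambda>a b. rsmult Bh (a \<odot>\<^bsub>Bh\<^esub> K v (b \<odot>\<^bsub>C\<^esub> y)) (?g w)) (hcomult H h) =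
        rsmult Bh (tlift Bk (\<lambda>a b. a \<odot>\<^bsub>Bh\<^esub> K v (b \<odot>\<^bsub>C\<^esub> y)) (hcomult H h)) (?g w)"
      by (rule tlift_fusion[OF l _ dh, symmetric]) (assumption | rule kl vw y)+
    also have "\<dots> = rsmult Bh (tlift Bk (\<lambda>a b. rsmult Bh (K (a \<odot>\<^bsub>D\<^esub> v) y) b) (hcomult H h)) (?g w)"
      by (simp only: K_balance[OF vw(1) y h])
    also have "\<dots> = tlift Bk (\<lambda>a b. rsmult Bh (K (a \<odot>\<^bsub>D\<^esub> v) y) (S (evD (etens DD (b \<odot>\<^bsub>D\<^esub> w) d')))) (hcomult H h)"
    proof (rule tlift_push[OF l _ dh], (assumption | rule vw y kl)+)
      fix a b assume ab: "a \<in> carrier Hk" "b \<in> carrier Hk"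
      have Kc: "K (a \<odot>\<^bsub>D\<^esub> v) y \<in> carrier Bk" by (rule kl ab vw y)+
      have gb: "?g w \<in> carrier H" "b \<in> carrier H" using g ab by simp_all
      have "S (evD (etens DD (b \<odot>\<^bsub>D\<^esub> w) d')) = ?g w \<otimes>\<^bsub>H\<^esub> b"
        using vw d' gb C.H_m_comm[of b "?g w"] by (simp add: D.ev_act_l C.antipode_mult C.antipode_antipode)
      then show "rsmult Bh (rsmult Bh (K (a \<odot>\<^bsub>D\<^esub> v) y) b) (?g w) = rsmult Bh (K (a \<odot>\<^bsub>D\<^esub> v) y) (S (evD (etens DD (b \<odot>\<^bsub>D\<^esub> w) d')))"
        using B_laws(11)[OF gb Kc[unfolded kk_sel]] by simp
    qed
    finally show "tlift Bk (\<lambda>a b. rsmult Bh (a \<odot>\<^bsub>Bh\<^esub> K v (b \<odot>\<^bsub>C\<^esub> y)) (?g w)) (hcomult H h) =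
      tlift Bk (\<lambda>a b. rsmult Bh (K (a \<odot>\<^bsub>D\<^esub> v) y) (S (evD (etens DD (b \<odot>\<^bsub>D\<^esub> w) d')))) (hcomult H h)" .
  qed
  also have "\<dots> = tlift Bk (\<lambda>v w. rsmult Bh (K v y) (?g w)) (tmap2 DD D.act D.act (comult D d) (hcomult H h))"
    by (rule tlift_tmap2[OF _ dd dh D.kbil_act D.kbil_act, symmetric]) (assumption | rule kl d' y)+
  also have "\<dots> = Mid (h \<odot>\<^bsub>D\<^esub> d) d' y"
    using d h by (simp add: Mid_def D.comult_act)
  finally show ?thesis .
qed

text \<open>In the left H-module \<open>CCh\<close> one has c \<otimes> c' = ev(c \<otimes> c'1)
  \<Delta>(c'2), because S(ev(c \<otimes> c'1)) c'2 = \<epsilon>(c'1) c by \<open>ev_dual\<close>.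
  Left H-linearity of \<sigma> therefore leaves no other value at (c \<otimes> c') \<otimes>_H (d
  \<otimes> d').\<close>

definition Rr where
  "Rr c c' d d' = tlift Bk (\<lambda>x y. evC (etens CC c x) \<odot>\<^bsub>Bh\<^esub> Mid d d' y) (comult C c')"

lemma Rr_lin [kl]:
  "d \<in> carrier Dk \<Longrightarrow> d' \<in> carrier Dk \<Longrightarrow> c' \<in> carrier Ck \<Longrightarrow> klin k P Ck f \<Longrightarrow> klin k P Bk (\<lambda>z. Rr (f z) c' d d')"
  "d \<in> carrier Dk \<Longrightarrow> d' \<in> carrier Dk \<Longrightarrow> c \<in> carrier Ck \<Longrightarrow> klin k P Ck f \<Longrightarrow> klin k P Bk (\<lambda>z. Rr c (f z) d d')"
  "c \<in> carrier Ck \<Longrightarrow> c' \<in> carrier Ck \<Longrightarrow> d' \<in> carrier Dk \<Longrightarrow> klin k P Dk g \<Longrightarrow> klin k P Bk (\<lambda>z. Rr c c' (g z) d')"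
  "c \<in> carrier Ck \<Longrightarrow> c' \<in> carrier Ck \<Longrightarrow> d \<in> carrier Dk \<Longrightarrow> klin k P Dk g \<Longrightarrow> klin k P Bk (\<lambda>z. Rr c c' d (g z))"
proof -
  have "klin k Ck Bk (\<lambda>z. Rr z c' d d')" if "d \<in> carrier Dk" "d' \<in> carrier Dk" "c' \<in> carrier Ck" for c' d d'
    unfolding Rr_def by (assumption | rule kl that)+
  then show "d \<in> carrier Dk \<Longrightarrow> d' \<in> carrier Dk \<Longrightarrow> c' \<in> carrier Ck \<Longrightarrow> klin k P Ck f \<Longrightarrow> klin k P Bk (\<lambda>z. Rr (f z) c' d d')"
    by (rule klin_comp)
  have "klin k Ck Bk (\<lambda>z. Rr c z d d')" if "d \<in> carrier Dk" "d' \<in> carrier Dk" "c \<in> carrier Ck" for c d d'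
    unfolding Rr_def by (assumption | rule kl that)+
  then show "d \<in> carrier Dk \<Longrightarrow> d' \<in> carrier Dk \<Longrightarrow> c \<in> carrier Ck \<Longrightarrow> klin k P Ck f \<Longrightarrow> klin k P Bk (\<lambda>z. Rr c (f z) d d')"
    by (rule klin_comp)
  have "klin k Dk Bk (\<lambda>z. Rr c c' z d')" if "c \<in> carrier Ck" "c' \<in> carrier Ck" "d' \<in> carrier Dk" for c c' d'
    unfolding Rr_def by (assumption | rule kl that)+
  then show "c \<in> carrier Ck \<Longrightarrow> c' \<in> carrier Ck \<Longrightarrow> d' \<in> carrier Dk \<Longrightarrow> klin k P Dk g \<Longrightarrow> klin k P Bk (\<lambda>z. Rr c c' (g z) d')"
    by (rule klin_comp)
  have "klin k Dk Bk (\<lambda>z. Rr c c' d z)" if "c \<in> carrier Ck" "c' \<in> carrier Ck" "d \<in> carrier Dk" for c c' d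
    unfolding Rr_def by (assumption | rule kl that)+
  then show "c \<in> carrier Ck \<Longrightarrow> c' \<in> carrier Ck \<Longrightarrow> d \<in> carrier Dk \<Longrightarrow> klin k P Dk g \<Longrightarrow> klin k P Bk (\<lambda>z. Rr c c' d (g z))"
    by (rule klin_comp)
qed

text \<open>\<Delta>(h c') = h1 c'1 \<otimes> h2 c'2; the evaluation releases h1 on the left, and
  \<open>Mid_balance\<close> passes both legs of h on to d.\<close>

lemma Rr_balance:
  assumes a: "c \<in> carrier Ck" "c' \<in> carrier Ck" "d \<in> carrier Dk" "d' \<in> carrier Dk" and h: "h \<in> carrier Hk"
  shows "Rr c (h \<odot>\<^bsub>C\<^esub> c') d d' = Rr c c' (h \<odot>\<^bsub>D\<^esub> d) d'"
proof -
  note dh = C.Hc.comult_closed[OF h] and dc = C.Cc.comult_closed[OF a(2)]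
  have "Rr c (h \<odot>\<^bsub>C\<^esub> c') d d' = tlift Bk (\<lambda>x y. evC (etens CC c x) \<odot>\<^bsub>Bh\<^esub> Mid d d' y)
      (tmap2 CC C.act C.act (comult C c') (hcomult H h))"
    using a h by (simp add: Rr_def C.comult_act)
  also have "\<dots> = tlift Bk (\<lambda>x y. tlift Bk (\<lambda>u v. evC (etens CC c (u \<odot>\<^bsub>C\<^esub> x)) \<odot>\<^bsub>Bh\<^esub> Mid d d' (v \<odot>\<^bsub>C\<^esub> y)) (hcomult H h)) (comult C c')"
    by (rule tlift_tmap2[OF _ dc dh C.kbil_act C.kbil_act]) (assumption | rule kl a)+
  also have "\<dots> = tlift Bk (\<lambda>x y. evC (etens CC c x) \<odot>\<^bsub>Bh\<^esub> Mid (h \<odot>\<^bsub>D\<^esub> d) d' y) (comult C c')"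
  proof (rule tlift_cong[OF _ _ dc, symmetric], (assumption | rule a h kl)+)
    fix x y assume xy: "x \<in> carrier Ck" "y \<in> carrier Ck"
    let ?e = "evC (etens CC c x)"
    have e: "?e \<in> carrier Hk" by (rule kl a xy)+
    have l: "klin k Bk Bk (\<lambda>z. ?e \<odot>\<^bsub>Bh\<^esub> z)" by (assumption | rule kl e)+
    have "?e \<odot>\<^bsub>Bh\<^esub> tlift Bk (\<lambda>u v. u \<odot>\<^bsub>Bh\<^esub> Mid d d' (v \<odot>\<^bsub>C\<^esub> y)) (hcomult H h) =
      tlift Bk (\<lambda>u v. evC (etens CC c (u \<odot>\<^bsub>C\<^esub> x)) \<odot>\<^bsub>Bh\<^esub> Mid d d' (v \<odot>\<^bsub>C\<^esub> y)) (hcomult H h)"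
    proof (rule tlift_push[OF l _ dh], (assumption | rule a xy kl)+)
      fix u v assume uv: "u \<in> carrier Hk" "v \<in> carrier Hk"
      have m: "Mid d d' (v \<odot>\<^bsub>C\<^esub> y) \<in> carrier Bk" by (rule kl a xy uv)+
      have eu: "?e \<in> carrier H" "u \<in> carrier H" using e uv by simp_all
      have "evC (etens CC c (u \<odot>\<^bsub>C\<^esub> x)) = ?e \<otimes>\<^bsub>H\<^esub> u"
        using a xy eu C.H_m_comm[of u ?e] by (simp add: C.ev_act_r)
      then show "?e \<odot>\<^bsub>Bh\<^esub> (u \<odot>\<^bsub>Bh\<^esub> Mid d d' (v \<odot>\<^bsub>C\<^esub> y)) = evC (etens CC c (u \<odot>\<^bsub>C\<^esub> x)) \<odot>\<^bsub>Bh\<^esub> Mid d d' (v \<odot>\<^bsub>C\<^esub> y)"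
        using B_laws(10)[OF eu m[unfolded kk_sel]] by simp
    qed
    then show "?e \<odot>\<^bsub>Bh\<^esub> Mid (h \<odot>\<^bsub>D\<^esub> d) d' y =
      tlift Bk (\<lambda>u v. evC (etens CC c (u \<odot>\<^bsub>C\<^esub> x)) \<odot>\<^bsub>Bh\<^esub> Mid d d' (v \<odot>\<^bsub>C\<^esub> y)) (hcomult H h)"
      by (simp only: Mid_balance[OF a(3,4) xy(2) h])
  qed
  also have "\<dots> = Rr c c' (h \<odot>\<^bsub>D\<^esub> d) d'" by (simp only: Rr_def)
  finally show ?thesis .
qed

lemma Rr_smult_l:
  assumes a: "c \<in> carrier Ck" "c' \<in> carrier Ck" "d \<in> carrier Dk" "d' \<in> carrier Dk" and h: "h \<in> carrier Hk"
  shows "Rr (S h \<odot>\<^bsub>C\<^esub> c) c' d d' = h \<odot>\<^bsub>Bh\<^esub> Rr c c' d d'"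
  unfolding Rr_def
proof (rule tlift_push[OF _ _ C.Cc.comult_closed[OF a(2)], symmetric], (assumption | rule h a kl)+)
  fix x y assume xy: "x \<in> carrier Ck" "y \<in> carrier Ck"
  have m: "Mid d d' y \<in> carrier Bk" "evC (etens CC c x) \<in> carrier Hk" by (rule kl a xy)+
  then show "h \<odot>\<^bsub>Bh\<^esub> (evC (etens CC c x) \<odot>\<^bsub>Bh\<^esub> Mid d d' y) = evC (etens CC (S h \<odot>\<^bsub>C\<^esub> c) x) \<odot>\<^bsub>Bh\<^esub> Mid d d' y"
    using B_laws(10)[of h "evC (etens CC c x)" "Mid d d' y"] a xy h
    by (simp add: C.ev_act_l C.antipode_antipode del: tensor_sel)
qed

lemma Mid_smult_r:
  assumes a: "y \<in> carrier Ck" "d \<in> carrier Dk" "d' \<in> carrier Dk" and h: "h \<in> carrier Hk"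
  shows "Mid d (S h \<odot>\<^bsub>D\<^esub> d') y = rsmult Bh (Mid d d' y) h"
  unfolding Mid_def
proof (rule tlift_push[OF _ _ D.Cc.comult_closed[OF a(2)], symmetric], (assumption | rule h a kl)+)
  fix v w assume vw: "v \<in> carrier Dk" "w \<in> carrier Dk"
  have m: "K v y \<in> carrier Bk" "S (evD (etens DD w d')) \<in> carrier Hk" by (rule kl a vw)+
  then show "rsmult Bh (rsmult Bh (K v y) (S (evD (etens DD w d')))) h = rsmult Bh (K v y) (S (evD (etens DD w (S h \<odot>\<^bsub>D\<^esub> d'))))"
    using B_laws(11)[of h "S (evD (etens DD w d'))" "K v y"] a vw h
    by (simp add: D.ev_act_r C.antipode_mult C.antipode_antipode del: tensor_sel)
qed

lemma Rr_smult_r: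
  assumes a: "c \<in> carrier Ck" "c' \<in> carrier Ck" "d \<in> carrier Dk" "d' \<in> carrier Dk" and h: "h \<in> carrier Hk"
  shows "Rr c c' d (S h \<odot>\<^bsub>D\<^esub> d') = rsmult Bh (Rr c c' d d') h"
  unfolding Rr_def
proof (rule tlift_push[OF _ _ C.Cc.comult_closed[OF a(2)], symmetric], (assumption | rule h a kl)+)
  fix x y assume xy: "x \<in> carrier Ck" "y \<in> carrier Ck"
  have m: "Mid d d' y \<in> carrier Bk" "evC (etens CC c x) \<in> carrier Hk" by (rule kl a xy)+
  then show "rsmult Bh (evC (etens CC c x) \<odot>\<^bsub>Bh\<^esub> Mid d d' y) h = evC (etens CC c x) \<odot>\<^bsub>Bh\<^esub> Mid d (S h \<odot>\<^bsub>D\<^esub> d') y"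
    using B_laws(14)[of "evC (etens CC c x)" h "Mid d d' y"] Mid_smult_r[OF xy(2) a(3,4) h] h
    by (simp del: tensor_sel)
qed

section \<open>The resulting bimodule map and its defining equation\<close>

definition Theta where
  "Theta t u = tlift Bk (\<lambda>d d'. tlift Bk (\<lambda>c c'. Rr c c' d d') t) u"

lemma kbil_Rr1: "d \<in> carrier Dk \<Longrightarrow> d' \<in> carrier Dk \<Longrightarrow> kbil k Ck Ck Bk (\<lambda>c c'. Rr c c' d d')"
  by (assumption | rule kl)+

lemma kbil_Rr2: "t \<in> carrier CC \<Longrightarrow> kbil k Dk Dk Bk (\<lambda>d d'. tlift Bk (\<lambda>c c'. Rr c c' d d') t)"
  by (assumption | rule kl)+

lemma kbil_Theta0: "kbil k CC DD Bk Theta"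
  unfolding Theta_def by (assumption | rule kl)+

lemma Theta_etens:
  assumes "c \<in> carrier Ck" "c' \<in> carrier Ck" "d \<in> carrier Dk" "d' \<in> carrier Dk"
  shows "Theta (etens CC c c') (etens DD d d') = Rr c c' d d'"
proof -
  have e: "etens CC c c' \<in> carrier CC" by (rule kl assms)+
  show ?thesis
    unfolding Theta_def tlift_etens[OF kbil_Rr2[OF e] assms(3,4)] by (rule tlift_etens[OF kbil_Rr1[OF assms(3,4)] assms(1,2)])
qed

lemma kbil_Theta: "kbil k (kk H CCh) (kk H DDh) Bk Theta"
  by (rule kbil_intro[OF C.kmod_kk[OF hbimod_CCh] C.kmod_kk[OF hbimod_DDh]])
    (simp_all only: kk_sel CCh_ops DDh_ops CCh_src DDh_src kbil_laws(4,5)[OF kbil_Theta0])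

lemmas Theta_kl = klin_comp[OF kbil_laws(4)[OF kbil_Theta]] klin_comp[OF kbil_laws(5)[OF kbil_Theta]]

lemma CC_self [kl]: "klin k CC (kk H CCh) (\<lambda>z. z)" "klin k DD (kk H DDh) (\<lambda>z. z)"
  by (rule CCh_lin, rule klin_id, rule kl, rule kl, rule kl) (rule DDh_lin, rule klin_id, rule kl, rule kl, rule kl)

lemma Theta_ext:
  assumes f: "kbil k CC DD A f" and g: "kbil k CC DD A g"
    and eq: "\<And>c c' d d'. c \<in> carrier Ck \<Longrightarrow> c' \<in> carrier Ck \<Longrightarrow> d \<in> carrier Dk \<Longrightarrow> d' \<in> carrier Dk \<Longrightarrow>
      f (etens CC c c') (etens DD d d') = g (etens CC c c') (etens DD d d')"
    and t: "t \<in> carrier CCh" and u: "u \<in> carrier DDh"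
  shows "f t u = g t u"
  by (rule tensor_ext2[OF f g C.kmod_Ck C.kmod_Ck D.kmod_Ck D.kmod_Ck eq t[unfolded CCh_ops] u[unfolded DDh_ops]])

lemma kmod_CC [kl]: "kmod k CC" "kmod k DD" by (rule kl)+

lemma Theta_bal:
  assumes t: "t \<in> carrier CCh" and u: "u \<in> carrier DDh" and h: "h \<in> carrier H"
  shows "Theta (rsmult CCh t h) u = Theta t (h \<odot>\<^bsub>DDh\<^esub> u)"
    "Theta (h \<odot>\<^bsub>CCh\<^esub> t) u = h \<odot>\<^bsub>Bh\<^esub> Theta t u"
    "Theta t (rsmult DDh u h) = rsmult Bh (Theta t u) h"
proof -
  have h': "h \<in> carrier Hk" using h by simp
  note T = kbil_laws[OF kbil_Theta, unfolded kk_sel CCh_ops DDh_ops]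
  note T0 = kbil_laws[OF kbil_Theta0]
  note cl = is_bimodule_laws(4,5)[OF C.hbimod_bimodule[OF hbimod_CCh] h, unfolded CCh_ops]
  note cl' = is_bimodule_laws(4,5)[OF C.hbimod_bimodule[OF hbimod_DDh] h, unfolded DDh_ops]
  note lc = hCC_lin(1,2)[OF CC_self(1) h'] hDD_lin(1,2)[OF CC_self(2) h']
  have b1: "kbil k CC DD Bk (\<lambda>t u. Theta (rsmult CCh t h) u)" "kbil k CC DD Bk (\<lambda>t u. Theta (h \<odot>\<^bsub>CCh\<^esub> t) u)"
    by (rule kbil_intro[OF kmod_CC]; (rule Theta_kl(1)[OF _ lc(2)] Theta_kl(1)[OF _ lc(1)] T0(5); simp only: kk_sel DDh_ops cl))+
  have b2: "kbil k CC DD Bk (\<lambda>t u. Theta t (h \<odot>\<^bsub>DDh\<^esub> u))" "kbil k CC DD Bk (\<lambda>t u. Theta t (rsmult DDh u h))"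
    by (rule kbil_intro[OF kmod_CC]; (rule Theta_kl(2)[OF _ lc(3)] Theta_kl(2)[OF _ lc(4)] T0(4); simp only: kk_sel CCh_ops cl'))+
  have b3: "kbil k CC DD Bk (\<lambda>t u. h \<odot>\<^bsub>Bh\<^esub> Theta t u)" "kbil k CC DD Bk (\<lambda>t u. rsmult Bh (Theta t u) h)"
    by (rule kbil_intro[OF kmod_CC]; rule hB_lin[OF _ h']; rule T0(4,5); assumption)+
  show "Theta (rsmult CCh t h) u = Theta t (h \<odot>\<^bsub>DDh\<^esub> u)"
  proof (rule Theta_ext[OF b1(1) b2(1) _ t u])
    fix c c' d d' assume a: "c \<in> carrier Ck" "c' \<in> carrier Ck" "d \<in> carrier Dk" "d' \<in> carrier Dk"
    show "Theta (rsmult CCh (etens CC c c') h) (etens DD d d') = Theta (etens CC c c') (h \<odot>\<^bsub>DDh\<^esub> etens DD d d')"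
      using Rr_balance[OF a h'] a h CCh_smult(2)[of c c' h] DDh_smult(1)[of d d' h]
        Theta_etens[of c "h \<odot>\<^bsub>C\<^esub> c'" d d'] Theta_etens[of c c' "h \<odot>\<^bsub>D\<^esub> d" d'] by simp
  qed
  show "Theta (h \<odot>\<^bsub>CCh\<^esub> t) u = h \<odot>\<^bsub>Bh\<^esub> Theta t u"
  proof (rule Theta_ext[OF b1(2) b3(1) _ t u])
    fix c c' d d' assume a: "c \<in> carrier Ck" "c' \<in> carrier Ck" "d \<in> carrier Dk" "d' \<in> carrier Dk"
    show "Theta (h \<odot>\<^bsub>CCh\<^esub> etens CC c c') (etens DD d d') = h \<odot>\<^bsub>Bh\<^esub> Theta (etens CC c c') (etens DD d d')"
      using Rr_smult_l[OF a h'] a h CCh_smult(1)[of c c' h]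
        Theta_etens[of "S h \<odot>\<^bsub>C\<^esub> c" c' d d'] Theta_etens[OF a] by simp
  qed
  show "Theta t (rsmult DDh u h) = rsmult Bh (Theta t u) h"
  proof (rule Theta_ext[OF b2(2) b3(2) _ t u])
    fix c c' d d' assume a: "c \<in> carrier Ck" "c' \<in> carrier Ck" "d \<in> carrier Dk" "d' \<in> carrier Dk"
    show "Theta (etens CC c c') (rsmult DDh (etens DD d d') h) = rsmult Bh (Theta (etens CC c c') (etens DD d d')) h"
      using Rr_smult_r[OF a h'] a h DDh_smult(2)[of d d' h]
        Theta_etens[of c c' d "S h \<odot>\<^bsub>D\<^esub> d'"] Theta_etens[OF a] by simp
  qed
qed

lemma hbal_Theta: "C.hbal CCh DDh Bk Theta"
  by (rule C.hbalI[OF hbimod_CCh hbimod_DDh kbil_Theta]) (rule Theta_bal(1))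

text \<open>Two contractions: at \<Delta>(c) the sum over c collapses to \<open>Mid\<close> by
  ev(\<Delta>(c1)) = \<epsilon>(c1) 1, and at d1 \<otimes> d2 h the sum in \<open>Mid\<close>
  collapses by ev(d2 \<otimes> d3 h) = \<epsilon>(d2) h.\<close>

lemma Theta_spec:
  assumes c: "c \<in> carrier C" and d: "d \<in> carrier D" and h: "h \<in> carrier H"
  shows "Theta (comult C c) (D.twist d h) = rsmult Bh (K d c) (S h)"
proof -
  have c': "c \<in> carrier Ck" and d': "d \<in> carrier Dk" and h': "h \<in> carrier Hk" using c d h by simp_all
  note dc = C.Cc.comult_closed[OF c'] and dd = D.Cc.comult_closed[OF d']
  have 1: "tlift Bk (\<lambda>x y. Rr x y a b) (comult C c) = Mid a b c" if ab: "a \<in> carrier Dk" "b \<in> carrier Dk" for a b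
  proof -
    have "tlift Bk (\<lambda>x y. Rr x y a b) (comult C c) =
      tlift Bk (\<lambda>w y. tlift Bk (\<lambda>x z. evC (etens CC x z) \<odot>\<^bsub>Bh\<^esub> Mid a b y) (comult C w)) (comult C c)"
      unfolding Rr_def by (rule C.Cc.coassoc[OF _ c', symmetric]) (assumption | rule kl ab)+
    also have "\<dots> = tlift Bk (\<lambda>w y. counit C w \<odot>\<^bsub>Bk\<^esub> Mid a b y) (comult C c)"
    proof (rule tlift_cong[OF _ _ dc, symmetric], (assumption | rule ab kl)+)
      fix w y assume wy: "w \<in> carrier Ck" "y \<in> carrier Ck"
      have m: "Mid a b y \<in> carrier Bk" by (rule kl ab wy)+
      have g: "klin k CC Bk (\<lambda>t. evC t \<odot>\<^bsub>Bh\<^esub> Mid a b y)" by (assumption | rule kl m)+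
      have l: "klin k Hk Bk (\<lambda>s. s \<odot>\<^bsub>Bh\<^esub> Mid a b y)" by (assumption | rule kl m)+
      have o: "\<one>\<^bsub>H\<^esub> \<in> carrier Hk" by simp
      have "tlift Bk (\<lambda>x z. evC (etens CC x z) \<odot>\<^bsub>Bh\<^esub> Mid a b y) (comult C w) = evC (comult C w) \<odot>\<^bsub>Bh\<^esub> Mid a b y"
        by (rule tlift_klin_etens[OF g C.kmod_Ck C.kmod_Ck C.Cc.comult_closed[OF wy(1)]])
      also have "\<dots> = counit C w \<odot>\<^bsub>Bk\<^esub> Mid a b y"
        using klin_laws(6)[OF l C.Cc.counit_closed[OF wy(1)] o] wy B_laws(12)[OF m[unfolded kk_sel]] by (simp add: C.ev_comult)
      finally show "counit C w \<odot>\<^bsub>Bk\<^esub> Mid a b y = tlift Bk (\<lambda>x z. evC (etens CC x z) \<odot>\<^bsub>Bh\<^esub> Mid a b y) (comult C w)" by simp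
    qed
    also have "\<dots> = Mid a b c" by (rule C.Cc.counit_l[OF _ c']) (assumption | rule kl ab)+
    finally show ?thesis .
  qed
  have "Theta (comult C c) (D.twist d h) = tlift Bk (\<lambda>a b. tlift Bk (\<lambda>x y. Rr x y a (h \<odot>\<^bsub>D\<^esub> b)) (comult C c)) (comult D d)"
    unfolding Theta_def by (rule D.tlift_twist[OF kbil_Rr2[OF dc] d' h'])
  also have "\<dots> = tlift Bk (\<lambda>a b. Mid a (h \<odot>\<^bsub>D\<^esub> b) c) (comult D d)"
  proof (rule tlift_cong[OF _ _ dd, symmetric], (assumption | rule c' h' kl)+)
    show "Mid a (h \<odot>\<^bsub>D\<^esub> b) c = tlift Bk (\<lambda>x y. Rr x y a (h \<odot>\<^bsub>D\<^esub> b)) (comult C c)"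
      if "a \<in> carrier Dk" "b \<in> carrier Dk" for a b
      by (rule 1[symmetric]) (rule kl that h')+
  qed
  also have "\<dots> = tlift Bk (\<lambda>v w. tlift Bk (\<lambda>a b. rsmult Bh (K v c) (S (evD (etens DD a (h \<odot>\<^bsub>D\<^esub> b))))) (comult D w)) (comult D d)"
    unfolding Mid_def by (rule D.Cc.coassoc[OF _ d']) (assumption | rule kl c' h')+
  also have "\<dots> = tlift Bk (\<lambda>v w. counit D w \<odot>\<^bsub>Bk\<^esub> rsmult Bh (K v c) (S h)) (comult D d)"
  proof (rule tlift_cong[OF _ _ dd, symmetric])
    have Sh: "S h \<in> carrier Hk" using h by simp
    show "kbil k Dk Dk Bk (\<lambda>v w. counit D w \<odot>\<^bsub>Bk\<^esub> rsmult Bh (K v c) (S h))" by (assumption | rule kl c' Sh)+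
    fix v w assume vw: "v \<in> carrier Dk" "w \<in> carrier Dk"
    have g: "klin k DD Bk (\<lambda>t. rsmult Bh (K v c) (S (evD t)))" by (assumption | rule kl vw c')+
    have l: "klin k Hk Bk (\<lambda>s. rsmult Bh (K v c) (S s))" by (assumption | rule kl vw c')+
    have "tlift Bk (\<lambda>a b. rsmult Bh (K v c) (S (evD (etens DD a (h \<odot>\<^bsub>D\<^esub> b))))) (comult D w) =
        rsmult Bh (K v c) (S (evD (D.twist w h)))"
      unfolding D.twist_def by (rule tlift_fusion[OF g _ D.Cc.comult_closed[OF vw(2)], symmetric]) (assumption | rule kl h')+
    also have "\<dots> = counit D w \<odot>\<^bsub>Bk\<^esub> rsmult Bh (K v c) (S h)"
      using klin_laws(6)[OF l D.Cc.counit_closed[OF vw(2)] h'] vw h by (simp add: D.ev_twist)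
    finally show "counit D w \<odot>\<^bsub>Bk\<^esub> rsmult Bh (K v c) (S h) =
      tlift Bk (\<lambda>a b. rsmult Bh (K v c) (S (evD (etens DD a (h \<odot>\<^bsub>D\<^esub> b))))) (comult D w)" by simp
  qed
  also have "\<dots> = rsmult Bh (K d c) (S h)"
    by (rule D.Cc.counit_r[OF _ d']) (assumption | rule kl c' h')+
  finally show ?thesis .
qed

lemma is_sigma_Theta: "is_sigma k H C D (tlift Bk Theta)"
proof -
  let ?\<sigma> = "tlift Bk Theta"
  have l: "klin k (kk H Ah) Bk ?\<sigma>" by (rule C.klin_htlift[OF hbal_Theta])
  note AL = is_bimodule_laws[OF C.hbimod_bimodule[OF hbimod_A]]
  have add: "additive Ah Bh ?\<sigma>" using klin_laws(3)[OF l] by (simp only: C.additive_kk)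
  have e: "?\<sigma> (etens Ah t u) = Theta t u" if "t \<in> carrier CCh" "u \<in> carrier DDh" for t u
    by (rule C.htlift_etens[OF hbal_Theta]) (simp_all only: kk_sel that)
  have hl: "?\<sigma> (h \<odot>\<^bsub>Ah\<^esub> t) = h \<odot>\<^bsub>Bh\<^esub> ?\<sigma> t" if h: "h \<in> carrier H" and t: "t \<in> carrier Ah" for h t
  proof (rule C.hext_additive[OF hbimod_CCh hbimod_DDh additive_comp[OF add AL(6)[OF h]] additive_comp[OF B_laws(6)[OF h] add] _ t])
    fix x y assume "x \<in> carrier (kk H CCh)" "y \<in> carrier (kk H DDh)"
    then have xy: "x \<in> carrier CCh" "y \<in> carrier DDh" by (simp_all only: kk_sel)
    have hx: "h \<odot>\<^bsub>CCh\<^esub> x \<in> carrier CCh" by (rule is_bimodule_laws(4)[OF C.hbimod_bimodule[OF hbimod_CCh] h xy(1)])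
    show "?\<sigma> (h \<odot>\<^bsub>Ah\<^esub> etens Ah x y) = h \<odot>\<^bsub>Bh\<^esub> ?\<sigma> (etens Ah x y)"
      by (simp only: C.hetens_smult(1)[OF hbimod_CCh hbimod_DDh xy(1) h xy(2)] e[OF hx xy(2)] e[OF xy] Theta_bal(2)[OF xy h])
  qed
  have hr: "?\<sigma> (rsmult Ah t h) = rsmult Bh (?\<sigma> t) h" if h: "h \<in> carrier H" and t: "t \<in> carrier Ah" for h t
  proof (rule C.hext_additive[OF hbimod_CCh hbimod_DDh additive_comp[OF add AL(7)[OF h]] additive_comp[OF B_laws(7)[OF h] add] _ t])
    fix x y assume "x \<in> carrier (kk H CCh)" "y \<in> carrier (kk H DDh)"
    then have xy: "x \<in> carrier CCh" "y \<in> carrier DDh" by (simp_all only: kk_sel)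
    have hy: "rsmult DDh y h \<in> carrier DDh" by (rule is_bimodule_laws(5)[OF C.hbimod_bimodule[OF hbimod_DDh] h xy(2)])
    show "?\<sigma> (rsmult Ah (etens Ah x y) h) = rsmult Bh (?\<sigma> (etens Ah x y)) h"
      by (simp only: C.hetens_smult(2)[OF hbimod_CCh hbimod_DDh xy(1) h xy(2)] e[OF xy(1) hy] e[OF xy] Theta_bal(3)[OF xy h])
  qed
  have bih: "?\<sigma> \<in> bihom H H Ah Bh"
    unfolding bihom_def using additive_hom[OF add] hl hr by blast
  have spec: "?\<sigma> (etens Ah (comult C c) (tmap DDh (\<lambda>x. x) (\<lambda>y. h \<odot>\<^bsub>D\<^esub> y) (comult D d))) =
      etens Bh (comult D d) (tmap CCh (\<lambda>x. x) (\<lambda>y. S h \<odot>\<^bsub>C\<^esub> y) (comult C c))"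
    if c: "c \<in> carrier C" and d: "d \<in> carrier D" and h: "h \<in> carrier H" for c d h
  proof -
    have cl: "comult C c \<in> carrier CCh" "D.twist d h \<in> carrier DDh" "comult D d \<in> carrier DDh"
      unfolding CCh_ops DDh_ops using C.Cc.comult_closed[of c] D.Cc.comult_closed[of d] D.twist_closed[of d h] c d h
      by (simp_all only: kk_sel bimod_of_sel)
    have Sh: "S h \<in> carrier H" using h by simp
    have "?\<sigma> (etens Ah (comult C c) (D.twist d h)) = rsmult Bh (K d c) (S h)"
      by (simp only: e[OF cl(1,2)] Theta_spec[OF c d h])
    also have "\<dots> = etens Bh (comult D d) (rsmult CCh (comult C c) (S h))"
      unfolding K_def by (rule C.hetens_smult(2)[OF hbimod_DDh hbimod_CCh cl(3) Sh cl(1)])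
    also have "rsmult CCh (comult C c) (S h) = tmap CCh (\<lambda>x. x) (\<lambda>y. S h \<odot>\<^bsub>C\<^esub> y) (comult C c)"
      unfolding CCh_def tensor_smult by (simp only: lk_sel bimod_of_sel)
    finally show ?thesis unfolding DDh_ops D.twist_tmap .
  qed
  show ?thesis unfolding is_sigma_def Let_def using bih spec by blast
qed

text \<open>\<open>sigma\<close> is chosen among the maps with the defining property, and
  \<open>Theta\<close> shows that there is one. From here on exactly this property is available:
  H-linearity on both sides and the prescribed values.\<close>

lemma is_sigma_sigma: "is_sigma k H C D (sigma k H C D)"
  unfolding sigma_def by (rule someI[of "is_sigma k H C D", OF is_sigma_Theta])

end

section \<open>The composed herd\<close>

context comm_hopf
begin

lemma hbal_comp:
  assumes "hbal M N A f" "klin k A B g" shows "hbal M N B (\<lambda>x y. g (f x y))"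
proof (rule hbalI[OF hbal_laws(1,2)[OF assms(1)]])
  note kb = hbal_laws(3)[OF assms(1)]
  show "kbil k (kk H M) (kk H N) B (\<lambda>x y. g (f x y))"
    by (rule kbil_intro[OF kbil_laws(1,2)[OF kb]]; rule klin_comp[OF assms(2)]; rule kbil_laws(4,5)[OF kb]; assumption)
qed (simp add: hbal_laws(5)[OF assms(1)])

lemma htlift_fusion:
  assumes f: "hbal M N A f" and g: "klin k A B g" and t: "t \<in> carrier (kk H (M \<boxtimes>\<^bsub>H\<^esub> N))"
  shows "g (tlift A f t) = tlift B (\<lambda>x y. g (f x y)) t"
proof (rule hext[OF klin_comp[OF g klin_htlift[OF f]] klin_htlift[OF hbal_comp[OF f g]] hbal_laws(1,2)[OF f] _ t])
  fix x y assume "x \<in> carrier (kk H M)" "y \<in> carrier (kk H N)"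
  then show "g (tlift A f (etens (M \<boxtimes>\<^bsub>H\<^esub> N) x y)) = tlift B (\<lambda>x y. g (f x y)) (etens (M \<boxtimes>\<^bsub>H\<^esub> N) x y)"
    by (simp only: htlift_etens[OF f] htlift_etens[OF hbal_comp[OF f g]])
qed

end

section \<open>The pen of the composite and the flip\<close>

context galois_pair
begin

abbreviation Ph where "Ph \<equiv> hatD \<boxtimes>\<^bsub>H\<^esub> hatC"
abbreviation Pk where "Pk \<equiv> kk H Ph"
abbreviation ptens where "ptens \<equiv> etens Ph"
abbreviation Y where
  "Y \<equiv> compose_herds k H (galois_herd k H C) (galois_herd k H D) (sigma k H C D)"
abbreviation \<sigma> where "\<sigma> \<equiv> sigma k H C D"

lemma hbimod_P [kl]: "C.hbimod Ph" by (rule C.hbimod_tensor[OF D.hbimod_Pen C.hbimod_Pen])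
lemma kmod_P [kl]: "kmod k Pk" by (rule C.kmod_kk[OF hbimod_P])

text \<open>Both pen actions are twisted by the automorphism S, so balance for the pens is balance
  for C and D with \<open>h\<close> replaced by \<open>S h\<close>; exchanging the arguments matches
  the reversed order of the factors in the pen.\<close>

lemma hbal_pen:
  assumes "C.hbal (bimod_of C) (bimod_of D) A f" shows "C.hbal hatD hatC A (\<lambda>d c. f c d)"
proof (rule C.hbalI[OF D.hbimod_Pen C.hbimod_Pen])
  note kb = C.hbal_laws(3)[OF assms]
  have s: "klin k M A g \<Longrightarrow> keqv k M' M \<Longrightarrow> klin k M' A g" for M M' g
    by (rule keqv_klin[OF keqv_sym keqv_refl]) (assumption | rule klin_laws(2))+
  have cr: "carrier (kk H hatD) = carrier Dk" "carrier (kk H hatC) = carrier Ck"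
    by (rule keqv_sel(1)[OF D.keqv_Pen], rule keqv_sel(1)[OF C.keqv_Pen])
  show "kbil k (kk H hatD) (kk H hatC) A (\<lambda>d c. f c d)"
    by (rule kbil_intro[OF C.kmod_kk[OF D.hbimod_Pen] C.kmod_kk[OF C.hbimod_Pen]])
      (simp_all only: cr s[OF kbil_laws(5)[OF kb] D.keqv_Pen] s[OF kbil_laws(4)[OF kb] C.keqv_Pen])
  fix x h y assume "x \<in> carrier hatD" "h \<in> carrier H" "y \<in> carrier hatC"
  then show "f y (rsmult hatD x h) = f (h \<odot>\<^bsub>hatC\<^esub> y) x"
    using C.hbal_laws(5)[OF assms, of y "S h" x] by simp
qed

lemma hbal_unpen:
  assumes "C.hbal hatD hatC A f" shows "C.hbal (bimod_of C) (bimod_of D) A (\<lambda>c d. f d c)"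
proof (rule C.hbalI[OF C.hbimod_C D.hbimod_C])
  note kb = C.hbal_laws(3)[OF assms]
  have s: "klin k M A g \<Longrightarrow> keqv k M M' \<Longrightarrow> klin k M' A g" for M M' g
    by (rule keqv_klin[OF _ keqv_refl]) (assumption | rule klin_laws(2))+
  have cr: "carrier (kk H hatD) = carrier Dk" "carrier (kk H hatC) = carrier Ck"
    by (rule keqv_sel(1)[OF D.keqv_Pen], rule keqv_sel(1)[OF C.keqv_Pen])
  show "kbil k Ck Dk A (\<lambda>c d. f d c)"
    by (rule kbil_intro[OF C.kmod_Ck D.kmod_Ck])
      (simp_all only: cr[symmetric] s[OF kbil_laws(5)[OF kb] C.keqv_Pen] s[OF kbil_laws(4)[OF kb] D.keqv_Pen])
  fix x h y assume "x \<in> carrier (bimod_of C)" "h \<in> carrier H" "y \<in> carrier (bimod_of D)"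
  then show "f y (rsmult (bimod_of C) x h) = f (h \<odot>\<^bsub>bimod_of D\<^esub> y) x"
    using C.hbal_laws(5)[OF assms, of y "S h" x] by (simp add: C.antipode_antipode)
qed

definition theta where "theta = tlift Pk (\<lambda>c d. ptens d c)"
definition theta_inv where "theta_inv = tlift Ek (\<lambda>d c. tens c d)"

lemma flip_theta: "flip Ph = theta"
  unfolding flip_def theta_def C.tlift_kk ..

lemma hbal_theta: "C.hbal (bimod_of C) (bimod_of D) Pk (\<lambda>c d. ptens d c)"
  by (rule hbal_unpen[OF C.hbal_etens[OF D.hbimod_Pen C.hbimod_Pen]])

lemma hbal_theta_inv: "C.hbal hatD hatC Ek (\<lambda>d c. tens c d)"
  by (rule hbal_pen[OF C.hbal_etens[OF C.hbimod_C D.hbimod_C]])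

lemma theta_klin: "klin k Ek Pk theta"
  unfolding theta_def by (rule C.klin_htlift[OF hbal_theta])

lemma theta_inv_klin: "klin k Pk Ek theta_inv"
  unfolding theta_inv_def by (rule C.klin_htlift[OF hbal_theta_inv])

lemmas theta_kl [kl] = klin_comp[OF theta_klin] klin_laws(4)[OF theta_klin]
  klin_comp[OF theta_inv_klin] klin_laws(4)[OF theta_inv_klin]

lemma theta_tens: "c \<in> carrier C \<Longrightarrow> d \<in> carrier D \<Longrightarrow> theta (tens c d) = ptens d c"
  unfolding theta_def by (rule C.htlift_etens[OF hbal_theta]) simp_all

lemma theta_inv_ptens: "c \<in> carrier C \<Longrightarrow> d \<in> carrier D \<Longrightarrow> theta_inv (ptens d c) = tens c d"
  unfolding theta_inv_def by (rule C.htlift_etens[OF hbal_theta_inv]) simp_all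

lemma theta_inverse: "e \<in> carrier Ek \<Longrightarrow> theta_inv (theta e) = e"
  by (rule E_ext[OF klin_comp[OF theta_inv_klin theta_klin] klin_id[OF kmod_E]])
    (simp only: theta_tens theta_inv_ptens)

lemma theta_inv_inverse: "p \<in> carrier Pk \<Longrightarrow> theta (theta_inv p) = p"
  by (rule C.hext[OF klin_comp[OF theta_klin theta_inv_klin] klin_id[OF kmod_P] D.hbimod_Pen C.hbimod_Pen])
    (simp only: kk_sel C.pen_of_sel bimod_of_sel theta_tens theta_inv_ptens)

lemma theta_cases:
  assumes "p \<in> carrier Pk" obtains e where "e \<in> carrier Ek" "p = theta e"
  using that[OF klin_laws(4)[OF theta_inv_klin assms]] theta_inv_inverse[OF assms] by metis

lemma htlift_theta:
  assumes f: "C.hbal (bimod_of C) (bimod_of D) A f" and e: "e \<in> carrier Ek"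
  shows "tlift A (\<lambda>d c. f c d) (theta e) = tlift A f e"
proof (rule E_ext[OF klin_comp[OF C.klin_htlift[OF hbal_pen[OF f]] theta_klin] C.klin_htlift[OF f] _ e])
  fix c d assume cd: "c \<in> carrier C" "d \<in> carrier D"
  have cd': "c \<in> carrier Ck" "d \<in> carrier Dk" "c \<in> carrier (kk H hatC)" "d \<in> carrier (kk H hatD)"
    using cd by simp_all
  show "tlift A (\<lambda>d c. f c d) (theta (tens c d)) = tlift A f (tens c d)"
    unfolding theta_tens[OF cd] C.htlift_etens[OF hbal_pen[OF f] cd'(4,3)] C.htlift_etens[OF f cd'(1,2)] ..
qed

lemma theta_smult:
  assumes e: "e \<in> carrier Ek" and h: "h \<in> carrier H"
  shows "h \<odot>\<^bsub>Ph\<^esub> theta e = theta (S h \<odot>\<^bsub>Eh\<^esub> e)" "rsmult Ph (theta e) h = theta (S h \<odot>\<^bsub>Eh\<^esub> e)"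
proof -
  have h': "h \<in> carrier Hk" "S h \<in> carrier Hk" using h by simp_all
  have r: "klin k Ek Pk (\<lambda>e. theta (S h \<odot>\<^bsub>Eh\<^esub> e))" by (assumption | rule kl h')+
  have l: "klin k Ek Pk (\<lambda>e. h \<odot>\<^bsub>Ph\<^esub> theta e)" "klin k Ek Pk (\<lambda>e. rsmult Ph (theta e) h)"
    by (rule C.hsmult_lin[OF theta_klin h'(1) hbimod_P])+
  show "h \<odot>\<^bsub>Ph\<^esub> theta e = theta (S h \<odot>\<^bsub>Eh\<^esub> e)"
  proof (rule E_ext[OF l(1) r _ e])
    fix c d assume cd: "c \<in> carrier C" "d \<in> carrier D"
    have pc: "d \<in> carrier hatD" "c \<in> carrier hatC" using cd by simp_all
    show "h \<odot>\<^bsub>Ph\<^esub> theta (tens c d) = theta (S h \<odot>\<^bsub>Eh\<^esub> tens c d)"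
      using C.hetens_smult(1)[OF D.hbimod_Pen C.hbimod_Pen pc(1) h pc(2)] tens_smult(1)[of c "S h" d] tens_bal[of c "S h" d]
        theta_tens[of c d] theta_tens[of c "S h \<odot>\<^bsub>D\<^esub> d"] cd h by simp
  qed
  show "rsmult Ph (theta e) h = theta (S h \<odot>\<^bsub>Eh\<^esub> e)"
  proof (rule E_ext[OF l(2) r _ e])
    fix c d assume cd: "c \<in> carrier C" "d \<in> carrier D"
    have pc: "d \<in> carrier hatD" "c \<in> carrier hatC" using cd by simp_all
    show "rsmult Ph (theta (tens c d)) h = theta (S h \<odot>\<^bsub>Eh\<^esub> tens c d)"
      using C.hetens_smult(2)[OF D.hbimod_Pen C.hbimod_Pen pc(1) h pc(2)] tens_smult(1)[of c "S h" d]
        theta_tens[of c d] theta_tens[of "S h \<odot>\<^bsub>C\<^esub> c" d] cd h by simp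
  qed
qed

lemma Y_sel: "bimod Y = Eh" "pen Y = Ph"
  by (simp_all only: compose_herds_def Let_def herd.simps C.herd_sel D.herd_sel)

subsection \<open>The evaluation maps\<close>

abbreviation PE where "PE \<equiv> Pk \<boxtimes>\<^bsub>k\<^esub> Ek"
abbreviation EP where "EP \<equiv> Ek \<boxtimes>\<^bsub>k\<^esub> Pk"
abbreviation EPE where "EPE \<equiv> EP \<boxtimes>\<^bsub>k\<^esub> Ek"

definition nu where
  "nu p e = tlift Hk (\<lambda>d c. tlift Hk (\<lambda>c' d'. evD (etens DD d (evC (etens CC c c') \<odot>\<^bsub>D\<^esub> d'))) e) p"

definition mu where
  "mu e p = tlift Hk (\<lambda>c d. tlift Hk (\<lambda>d' c'. S (evC (etens CC (S (evD (etens DD d d')) \<odot>\<^bsub>C\<^esub> c) c'))) p) e"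

lemma ev_Y: "ev Y = tlift Hk nu" and evh_Y: "evh Y = tlift Hk mu"
proof -
  have e: "etens (PT k H (galois_herd k H D)) = etens DD" "etens (TP k H (galois_herd k H C)) = etens CC"
    by (rule C.keqv_ops(1)[OF D.keqv_PT], rule C.keqv_ops(1)[OF C.keqv_TP])
  show "ev Y = tlift Hk nu"
    unfolding nu_def[abs_def]
    by (simp only: compose_herds_def Let_def herd.simps C.herd_sel D.herd_sel C.tlift_H e CCh_ops bimod_of_sel)
  show "evh Y = tlift Hk mu"
    unfolding mu_def[abs_def]
    by (simp only: compose_herds_def Let_def herd.simps C.herd_sel D.herd_sel C.tlift_H e DDh_ops bimod_of_sel)
qed

definition T where "T e c d = tlift Hk (\<lambda>c' d'. evC (etens CC c c') \<otimes>\<^bsub>H\<^esub> evD (etens DD d d')) e"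

text \<open>The nested evaluation ev_D(d \<otimes> ev_C(c \<otimes> c') d') releases its inner value
  as a factor, since ev_D is H-linear in the second argument.\<close>

lemma nu_tau:
  assumes p: "p \<in> carrier Ek" and e: "e \<in> carrier Ek" shows "nu (theta p) e = tau p e"
proof -
  have hb: "C.hbal (bimod_of C) (bimod_of D) Hk (T e)"
    unfolding T_def[abs_def] by (rule hbal_tau2[OF e])
  have eq: "T e c d = tlift Hk (\<lambda>c' d'. evD (etens DD d (evC (etens CC c c') \<odot>\<^bsub>D\<^esub> d'))) e"
    if "d \<in> carrier (kk H hatD)" "c \<in> carrier (kk H hatC)" for c d
  proof -
    have a: "c \<in> carrier Ck" "d \<in> carrier Dk" using that by simp_all
    show ?thesis unfolding T_def
    proof (rule C.htlift_cong(1)[OF hbal_tau1[OF a] _ e])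
      show "evC (etens CC c c') \<otimes>\<^bsub>H\<^esub> evD (etens DD d d') = evD (etens DD d (evC (etens CC c c') \<odot>\<^bsub>D\<^esub> d'))"
        if "c' \<in> carrier Ck" "d' \<in> carrier Dk" for c' d'
        using a that D.ev_act_r[of d d' "evC (etens CC c c')"] by simp
    qed
  qed
  have "nu (theta p) e = tlift Hk (\<lambda>d c. T e c d) (theta p)"
    unfolding nu_def by (rule C.htlift_cong(1)[OF hbal_pen[OF hb] eq klin_laws(4)[OF theta_klin p], symmetric])
  also have "\<dots> = tlift Hk (T e) p" by (rule htlift_theta[OF hb p])
  also have "\<dots> = tau p e" unfolding tau_def T_def[abs_def] ..
  finally show ?thesis .
qed

text \<open>In the nested evaluation the inner value S(ev_D(d \<otimes> d')) acts on c, from where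
  \<open>ev_act_l\<close> takes it out with a second S, that is, as ev_D(d \<otimes> d').\<close>

lemma mu_tau:
  assumes p: "p \<in> carrier Ek" and e: "e \<in> carrier Ek" shows "mu e (theta p) = S (tau e p)"
proof -
  have hb: "C.hbal (bimod_of C) (bimod_of D) Hk (T p)"
    unfolding T_def[abs_def] by (rule hbal_tau2[OF p])
  have Sl: "klin k Hk Hk S" by (rule C.antipode_lin[OF klin_id[OF C.kmod_Hk]])
  note hS = C.hbal_comp[OF hb Sl]
  have eq: "S (T p c d) = tlift Hk (\<lambda>d' c'. S (evC (etens CC (S (evD (etens DD d d')) \<odot>\<^bsub>C\<^esub> c) c'))) (theta p)"
    if a: "c \<in> carrier Ck" "d \<in> carrier Dk" for c d
  proof -
    note h1 = C.hbal_comp[OF hbal_tau1[OF a] Sl]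
    have "S (T p c d) = tlift Hk (\<lambda>c' d'. S (evC (etens CC c c') \<otimes>\<^bsub>H\<^esub> evD (etens DD d d'))) p"
      unfolding T_def by (rule C.htlift_fusion[OF hbal_tau1[OF a] Sl p])
    also have "\<dots> = tlift Hk (\<lambda>d' c'. S (evC (etens CC c c') \<otimes>\<^bsub>H\<^esub> evD (etens DD d d'))) (theta p)"
      by (rule htlift_theta[OF h1 p, symmetric])
    also have "\<dots> = tlift Hk (\<lambda>d' c'. S (evC (etens CC (S (evD (etens DD d d')) \<odot>\<^bsub>C\<^esub> c) c'))) (theta p)"
    proof (rule C.htlift_cong(1)[OF hbal_pen[OF h1] _ klin_laws(4)[OF theta_klin p]])
      show "S (evC (etens CC c c') \<otimes>\<^bsub>H\<^esub> evD (etens DD d d')) = S (evC (etens CC (S (evD (etens DD d d')) \<odot>\<^bsub>C\<^esub> c) c'))"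
        if "d' \<in> carrier (kk H hatD)" "c' \<in> carrier (kk H hatC)" for d' c'
        using a that C.ev_act_l[of c c' "S (evD (etens DD d d'))"] C.H_m_comm[of "evC (etens CC c c')" "evD (etens DD d d')"]
        by (simp add: C.antipode_antipode)
    qed
    finally show ?thesis .
  qed
  have "mu e (theta p) = tlift Hk (\<lambda>c d. S (T p c d)) e"
    unfolding mu_def by (rule C.htlift_cong(1)[OF hS eq e, symmetric])
  also have "\<dots> = S (tlift Hk (T p) e)" by (rule C.htlift_fusion[OF hb Sl e, symmetric])
  also have "\<dots> = S (tau e p)" unfolding tau_def T_def[abs_def] ..
  finally show ?thesis .
qed

text \<open>Bilinearity is inherited from \<open>tau\<close> along the flip, which spares a direct
  check of balance on the pen side.\<close>

lemma kbil_nu: "kbil k Pk Ek Hk nu"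
proof (rule kbil_cong)
  show "kbil k Pk Ek Hk (\<lambda>p e. tau (theta_inv p) e)"
    by (assumption | rule kl theta_inv_klin)+
  show "tau (theta_inv p) e = nu p e" if "p \<in> carrier Pk" "e \<in> carrier Ek" for p e
    using nu_tau[OF klin_laws(4)[OF theta_inv_klin that(1)] that(2)] theta_inv_inverse[OF that(1)] by simp
qed

lemma kbil_mu: "kbil k Ek Pk Hk mu"
proof (rule kbil_cong)
  show "kbil k Ek Pk Hk (\<lambda>e p. S (tau e (theta_inv p)))"
    by (assumption | rule kl theta_inv_klin)+
  show "S (tau e (theta_inv p)) = mu e p" if "e \<in> carrier Ek" "p \<in> carrier Pk" for p e
    using mu_tau[OF klin_laws(4)[OF theta_inv_klin that(2)] that(1)] theta_inv_inverse[OF that(2)] by simp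
qed

lemma ev_Y_klin: "klin k PE Hk (ev Y)" unfolding ev_Y by (rule klin_tlift0[OF kbil_nu])
lemma evh_Y_klin: "klin k EP Hk (evh Y)" unfolding evh_Y by (rule klin_tlift0[OF kbil_mu])

lemma ev_Y_etens: "p \<in> carrier Ek \<Longrightarrow> e \<in> carrier Ek \<Longrightarrow> ev Y (etens PE (theta p) e) = tau p e"
  unfolding ev_Y by (simp only: tlift_etens[OF kbil_nu klin_laws(4)[OF theta_klin]] nu_tau)

lemma evh_Y_etens: "e \<in> carrier Ek \<Longrightarrow> p \<in> carrier Ek \<Longrightarrow> evh Y (etens EP e (theta p)) = S (tau e p)"
  unfolding evh_Y by (simp only: tlift_etens[OF kbil_mu _ klin_laws(4)[OF theta_klin]] mu_tau)

end

section \<open>The shepherd of the composed herd\<close>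

context galois_pair
begin

abbreviation XC where "XC \<equiv> bimod_of C \<boxtimes>\<^bsub>H\<^esub> CCh"
abbreviation DY where "DY \<equiv> DDh \<boxtimes>\<^bsub>H\<^esub> bimod_of D"
abbreviation XDC where "XDC \<equiv> bimod_of C \<boxtimes>\<^bsub>H\<^esub> Bh"
abbreviation XDCY where "XDCY \<equiv> XDC \<boxtimes>\<^bsub>H\<^esub> bimod_of D"

lemma hbimod_XC [kl]: "C.hbimod XC" by (rule C.hbimod_tensor[OF C.hbimod_C hbimod_CCh])
lemma hbimod_DY [kl]: "C.hbimod DY" by (rule C.hbimod_tensor[OF hbimod_DDh D.hbimod_C])
lemma hbimod_XDC [kl]: "C.hbimod XDC" by (rule C.hbimod_tensor[OF C.hbimod_C hbimod_B])

subsection \<open>The middle map\<close>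

definition projX where
  "projX = tlift (kk H XC) (\<lambda>t z. tlift (kk H XC) (\<lambda>x p. etens XC x (etens CC p z)) t)"

definition projY where "projY = tlift (kk H DY) (\<lambda>t y. etens DY t y)"

definition mid where
  "mid u v = tlift (kk H XDCY) (\<lambda>x a. tlift (kk H XDCY) (\<lambda>b y. etens XDCY (etens XDC x (\<sigma> (etens Ah a b))) y) v) u"

text \<open>The last two legs of the shepherd are regrouped into one coproduct, because \<sigma> is
  prescribed on coproducts. For D the left bracketing supplies the coproduct already.\<close>

lemma projX_shep:
  assumes x: "x \<in> carrier Ck"
  shows "projX (C.shep x) = tlift (kk H XC) (\<lambda>u a. etens XC u (comult C a)) (comult C x)"
proof -
  have "projX (C.shep x) = tlift (kk H XC) (\<lambda>a z. tlift (kk H XC) (\<lambda>x p. etens XC x (etens CC p z)) (comult C a)) (comult C x)"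
    unfolding projX_def by (rule C.tlift_shep[OF _ x]) (assumption | rule kl)+
  also have "\<dots> = tlift (kk H XC) (\<lambda>u a. tlift (kk H XC) (\<lambda>p z. etens XC u (etens CC p z)) (comult C a)) (comult C x)"
    by (rule C.Cc.coassoc[OF _ x]) (assumption | rule kl)+
  also have "\<dots> = tlift (kk H XC) (\<lambda>u a. etens XC u (comult C a)) (comult C x)"
  proof (rule tlift_cong[OF _ _ C.Cc.comult_closed[OF x], symmetric])
    show "kbil k Ck Ck (kk H XC) (\<lambda>u a. etens XC u (comult C a))" by (assumption | rule kl)+
    fix u a assume ua: "u \<in> carrier Ck" "a \<in> carrier Ck"
    have l: "klin k CC (kk H XC) (\<lambda>t. etens XC u t)" by (assumption | rule kl ua)+
    show "etens XC u (comult C a) = tlift (kk H XC) (\<lambda>p z. etens XC u (etens CC p z)) (comult C a)"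
      by (rule tlift_klin_etens[OF l C.kmod_Ck C.kmod_Ck C.Cc.comult_closed[OF ua(2)], symmetric])
  qed
  finally show ?thesis .
qed

lemma projY_shep:
  assumes y: "y \<in> carrier Dk"
  shows "projY (D.shep y) = tlift (kk H DY) (\<lambda>b z. etens DY (comult D b) z) (comult D y)"
proof -
  have b: "kbil k DD Dk (kk H DY) (\<lambda>t y. etens DY t y)"
    by (rule kbil_intro[OF kmod_CC(2) D.kmod_Ck]) (assumption | rule kl)+
  show ?thesis unfolding projY_def by (rule D.tlift_shep[OF b y])
qed

lemma sigma_bihom: "\<sigma> \<in> bihom H H Ah Bh"
  using is_sigma_sigma unfolding is_sigma_def Let_def by (rule conjunct1)

lemmas sigma_laws = sigma_bihom[unfolded bihom_def, THEN CollectD]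

lemma sigma_closed: "t \<in> carrier Ah \<Longrightarrow> \<sigma> t \<in> carrier Bh"
  using hom_in_carrier[OF conjunct1[OF sigma_laws], unfolded monoid.simps partial_object.simps] .

lemma sigma_add: "t \<in> carrier Ah \<Longrightarrow> u \<in> carrier Ah \<Longrightarrow> \<sigma> (t \<oplus>\<^bsub>Ah\<^esub> u) = \<sigma> t \<oplus>\<^bsub>Bh\<^esub> \<sigma> u"
  using hom_mult[OF conjunct1[OF sigma_laws], unfolded monoid.simps partial_object.simps] .

lemmas sigma_act = conjunct1[OF conjunct2[OF sigma_laws], THEN bspec, THEN bspec]
  conjunct2[OF conjunct2[OF sigma_laws], THEN bspec, THEN bspec]

lemma sigma_klin: "klin k (kk H Ah) Bk \<sigma>"
proof (rule klinI[OF C.kmod_kk[OF hbimod_A] kmod_B]; unfold kk_sel)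
  fix t u a assume t: "t \<in> carrier Ah"
  show "\<sigma> t \<in> carrier Bh" by (rule sigma_closed[OF t])
  show "\<sigma> (t \<oplus>\<^bsub>Ah\<^esub> u) = \<sigma> t \<oplus>\<^bsub>Bh\<^esub> \<sigma> u" if "u \<in> carrier Ah" by (rule sigma_add[OF t that])
  show "\<sigma> (unit_map H a \<odot>\<^bsub>Ah\<^esub> t) = unit_map H a \<odot>\<^bsub>Bh\<^esub> \<sigma> t" if "a \<in> carrier k"
    by (rule sigma_act(1)[OF C.unit_map_closed[OF that] t])
qed

lemmas sigma_kl [kl] = klin_comp[OF sigma_klin] klin_laws(4)[OF sigma_klin]

lemma sigma_smult:
  assumes "t \<in> carrier CCh" "u \<in> carrier DDh" "h \<in> carrier H"
  shows "\<sigma> (etens Ah (h \<odot>\<^bsub>CCh\<^esub> t) u) = h \<odot>\<^bsub>Bh\<^esub> \<sigma> (etens Ah t u)"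
    "\<sigma> (etens Ah t (rsmult DDh u h)) = rsmult Bh (\<sigma> (etens Ah t u)) h"
proof -
  have "t \<in> carrier (kk H CCh)" "u \<in> carrier (kk H DDh)" using assms(1,2) unfolding kk_sel .
  from C.hetens_closed[OF this hbimod_CCh hbimod_DDh] have e: "etens Ah t u \<in> carrier Ah" unfolding kk_sel .
  show "\<sigma> (etens Ah (h \<odot>\<^bsub>CCh\<^esub> t) u) = h \<odot>\<^bsub>Bh\<^esub> \<sigma> (etens Ah t u)"
    unfolding C.hetens_smult(1)[OF hbimod_CCh hbimod_DDh assms(1,3,2), symmetric] by (rule sigma_act(1)[OF assms(3) e])
  show "\<sigma> (etens Ah t (rsmult DDh u h)) = rsmult Bh (\<sigma> (etens Ah t u)) h"
    unfolding C.hetens_smult(2)[OF hbimod_CCh hbimod_DDh assms(1,3,2), symmetric] by (rule sigma_act(2)[OF assms(3) e])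
qed

text \<open>The defining equation at \<open>h = 1\<close>: S(1) = 1, and the actions by 1
  disappear.\<close>

lemma sigma_comult:
  assumes c: "c \<in> carrier C" and d: "d \<in> carrier D"
  shows "\<sigma> (etens Ah (comult C c) (comult D d)) = etens Bh (comult D d) (comult C c)"
proof -
  note sp = is_sigma_sigma[unfolded is_sigma_def Let_def, THEN conjunct2, THEN bspec, OF c, THEN bspec, OF d, THEN bspec, OF C.A.one_closed]
  note e1 = D.twist_tmap[symmetric, of "\<one>\<^bsub>H\<^esub>" d, unfolded D.twist_one[OF d]]
    C.twist_tmap[symmetric, of "\<one>\<^bsub>H\<^esub>" c, unfolded C.twist_one[OF c]]
  show ?thesis
    by (rule sp[unfolded C.antipode_one CCh_ops(2) DDh_ops(2) e1])
qed

text \<open>Right H-linearity of \<sigma> carries an \<open>h\<close> from the right end of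
  \<open>DDh\<close> out to the right end of \<open>XDC\<close>, where it crosses to D. The balance
  on the C side, in \<open>hbal_mid2\<close>, rests on left linearity in the same way.\<close>

lemma hbal_mid1:
  assumes x: "x \<in> carrier Ck" and a: "a \<in> carrier (kk H CCh)"
  shows "C.hbal DDh (bimod_of D) (kk H XDCY) (\<lambda>b y. etens XDCY (etens XDC x (\<sigma> (etens Ah a b))) y)"
proof (rule C.hbalI[OF hbimod_DDh D.hbimod_C])
  show "kbil k (kk H DDh) Dk (kk H XDCY) (\<lambda>b y. etens XDCY (etens XDC x (\<sigma> (etens Ah a b))) y)"
    by (assumption | rule kl x a)+
  fix b h y assume b: "b \<in> carrier DDh" "h \<in> carrier H" "y \<in> carrier (bimod_of D)"
  have a': "a \<in> carrier CCh" and x': "x \<in> carrier (bimod_of C)" using x a by (simp_all only: kk_sel)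
  have b': "b \<in> carrier (kk H DDh)" using b by (simp only: kk_sel)
  have s0: "\<sigma> (etens Ah a b) \<in> carrier Bk" by (rule kl a b')+
  have s: "\<sigma> (etens Ah a b) \<in> carrier Bh" using s0 by (simp only: kk_sel)
  have w: "etens XDC x (\<sigma> (etens Ah a b)) \<in> carrier XDC"
    using C.hetens_closed[OF x s0 C.hbimod_C hbimod_B] by (simp only: kk_sel)
  show "etens XDCY (etens XDC x (\<sigma> (etens Ah a (rsmult DDh b h)))) y = etens XDCY (etens XDC x (\<sigma> (etens Ah a b))) (h \<odot>\<^bsub>bimod_of D\<^esub> y)"
    unfolding sigma_smult(2)[OF a' b(1,2)] C.hetens_smult(2)[OF C.hbimod_C hbimod_B x' b(2) s, symmetric]
    by (rule C.hetens_bal[OF hbimod_XDC D.hbimod_C w b(2,3)])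
qed

lemma hbal_mid2:
  assumes v: "v \<in> carrier (kk H DY)"
  shows "C.hbal (bimod_of C) CCh (kk H XDCY) (\<lambda>x a. tlift (kk H XDCY) (\<lambda>b y. etens XDCY (etens XDC x (\<sigma> (etens Ah a b))) y) v)"
proof (rule C.hbalI[OF C.hbimod_C hbimod_CCh])
  show "kbil k Ck (kk H CCh) (kk H XDCY) (\<lambda>x a. tlift (kk H XDCY) (\<lambda>b y. etens XDCY (etens XDC x (\<sigma> (etens Ah a b))) y) v)"
    by (assumption | rule kbil_intro C.htlift_param[OF v] hbal_mid1 | rule kl)+
  fix x h a assume xa: "x \<in> carrier (bimod_of C)" "h \<in> carrier H" "a \<in> carrier CCh"
  have x': "rsmult (bimod_of C) x h \<in> carrier Ck" "a \<in> carrier (kk H CCh)"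
    using is_bimodule_laws(5)[OF C.hbimod_bimodule[OF C.hbimod_C] xa(2,1)] xa by (simp_all only: kk_sel)
  show "tlift (kk H XDCY) (\<lambda>b y. etens XDCY (etens XDC (rsmult (bimod_of C) x h) (\<sigma> (etens Ah a b))) y) v =
    tlift (kk H XDCY) (\<lambda>b y. etens XDCY (etens XDC x (\<sigma> (etens Ah (h \<odot>\<^bsub>CCh\<^esub> a) b))) y) v"
  proof (rule C.htlift_cong(1)[OF hbal_mid1[OF x'] _ v])
    fix b y assume b: "b \<in> carrier (kk H DDh)" "y \<in> carrier Dk"
    have b': "b \<in> carrier DDh" using b by (simp only: kk_sel)
    have s0: "\<sigma> (etens Ah a b) \<in> carrier Bk" by (rule kl x' b)+
    have s: "\<sigma> (etens Ah a b) \<in> carrier Bh" using s0 by (simp only: kk_sel)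
    show "etens XDCY (etens XDC (rsmult (bimod_of C) x h) (\<sigma> (etens Ah a b))) y = etens XDCY (etens XDC x (\<sigma> (etens Ah (h \<odot>\<^bsub>CCh\<^esub> a) b))) y"
      unfolding sigma_smult(1)[OF xa(3) b' xa(2)] C.hetens_bal[OF C.hbimod_C hbimod_B xa(1,2) s] ..
  qed
qed

lemma kbil_mid: "kbil k (kk H XC) (kk H DY) (kk H XDCY) mid"
proof (rule kbil_intro[OF C.kmod_kk[OF hbimod_XC] C.kmod_kk[OF hbimod_DY]])
  show "klin k (kk H XC) (kk H XDCY) (\<lambda>u. mid u v)" if "v \<in> carrier (kk H DY)" for v
    unfolding mid_def by (rule C.klin_htlift[OF hbal_mid2[OF that]])
  show "klin k (kk H DY) (kk H XDCY) (\<lambda>v. mid u v)" if "u \<in> carrier (kk H XC)" for u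
    unfolding mid_def
    by (rule C.htlift_param[OF that C.kmod_kk[OF hbimod_DY] hbal_mid2]) (assumption | rule C.klin_htlift hbal_mid1)+
qed

lemma mid_etens:
  assumes x: "x \<in> carrier Ck" and a: "a \<in> carrier (kk H CCh)" and b: "b \<in> carrier (kk H DDh)" and y: "y \<in> carrier Dk"
  shows "mid (etens XC x a) (etens DY b y) = etens XDCY (etens XDC x (\<sigma> (etens Ah a b))) y"
proof -
  have e: "etens DY b y \<in> carrier (kk H DY)" by (rule kl b y)+
  show ?thesis
    unfolding mid_def C.htlift_etens[OF hbal_mid2[OF e] x a] by (rule C.htlift_etens[OF hbal_mid1[OF x a] b y])
qed

lemma mid_shep:
  assumes x: "x \<in> carrier Ck" and y: "y \<in> carrier Dk"
  shows "mid (projX (C.shep x)) (projY (D.shep y)) = tlift (kk H XDCY) (\<lambda>u a. tlift (kk H XDCY) (\<lambda>b z.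
    etens XDCY (etens XDC u (etens Bh (comult D b) (comult C a))) z) (comult D y)) (comult C x)"
proof -
  note dx = C.Cc.comult_closed[OF x] and dy = D.Cc.comult_closed[OF y]
  have by': "kbil k Dk Dk (kk H DY) (\<lambda>b z. etens DY (comult D b) z)" by (assumption | rule kl)+
  have pY: "projY (D.shep y) \<in> carrier (kk H DY)" unfolding projY_shep[OF y] by (rule tlift_closed[OF dy by'])
  show ?thesis unfolding projX_shep[OF x]
  proof (rule tlift_push[OF kbil_laws(4)[OF kbil_mid pY] _ dx])
    show "kbil k Ck Ck (kk H XC) (\<lambda>u a. etens XC u (comult C a))" by (assumption | rule kl)+
    fix u a assume ua: "u \<in> carrier Ck" "a \<in> carrier Ck"
    have a': "comult C a \<in> carrier (kk H CCh)" by (rule kl ua)+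
    have e: "etens XC u (comult C a) \<in> carrier (kk H XC)" by (rule kl ua)+
    show "mid (etens XC u (comult C a)) (projY (D.shep y)) = tlift (kk H XDCY) (\<lambda>b z.
      etens XDCY (etens XDC u (etens Bh (comult D b) (comult C a))) z) (comult D y)"
      unfolding projY_shep[OF y]
    proof (rule tlift_push[OF kbil_laws(5)[OF kbil_mid e] by' dy])
      fix b z assume bz: "b \<in> carrier Dk" "z \<in> carrier Dk"
      have b': "comult D b \<in> carrier (kk H DDh)" by (rule kl bz)+
      show "mid (etens XC u (comult C a)) (etens DY (comult D b) z) = etens XDCY (etens XDC u (etens Bh (comult D b) (comult C a))) z"
        unfolding mid_etens[OF ua(1) a' b' bz(2)] using sigma_comult[of a b] ua bz by simp
    qed
  qed
qed

subsection \<open>Reassociation\<close>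

text \<open>The six legs in the order of the target; both shepherds are brought into sums of
  these.\<close>

definition J where "J x y q p x' y' = etens EPE (etens EP (tens x y) (ptens q p)) (tens x' y')"

lemma kbil_ptens: "kbil k Dk Ck Pk ptens"
proof -
  have "kbil k Ck Dk Pk (\<lambda>c d. ptens d c)" by (rule C.hbal_laws(3)[OF hbal_theta])
  from kbil_laws(5,4)[OF this] show ?thesis by (rule kbil_intro[OF D.kmod_Ck C.kmod_Ck])
qed

lemmas ptens_kl [kl] = klin_comp[OF kbil_laws(4)[OF kbil_ptens]] klin_comp[OF kbil_laws(5)[OF kbil_ptens]]
  kbil_laws(6)[OF kbil_ptens]

lemma ptens_act:
  assumes "q \<in> carrier D" "p \<in> carrier C" "h \<in> carrier H"
  shows "ptens (S h \<odot>\<^bsub>D\<^esub> q) p = ptens q (S h \<odot>\<^bsub>C\<^esub> p)"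
  using C.hetens_bal[OF D.hbimod_Pen C.hbimod_Pen, of q h p] assms by simp

lemma kmod_EPE [kl]: "kmod k EPE" by (rule kl)+

definition G where "G x y' b a = tlift EPE (\<lambda>y q. tlift EPE (\<lambda>p x'. J x y q p x' y') a) b"

lemma J_kl [kl]:
  "klin k P Ck f \<Longrightarrow> y \<in> carrier Dk \<Longrightarrow> q \<in> carrier Dk \<Longrightarrow> p \<in> carrier Ck \<Longrightarrow> x' \<in> carrier Ck \<Longrightarrow> y' \<in> carrier Dk \<Longrightarrow>
    klin k P EPE (\<lambda>z. J (f z) y q p x' y')"
  "x \<in> carrier Ck \<Longrightarrow> klin k P Dk g \<Longrightarrow> q \<in> carrier Dk \<Longrightarrow> p \<in> carrier Ck \<Longrightarrow> x' \<in> carrier Ck \<Longrightarrow> y' \<in> carrier Dk \<Longrightarrow>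
    klin k P EPE (\<lambda>z. J x (g z) q p x' y')"
  "x \<in> carrier Ck \<Longrightarrow> y \<in> carrier Dk \<Longrightarrow> klin k P Dk g \<Longrightarrow> p \<in> carrier Ck \<Longrightarrow> x' \<in> carrier Ck \<Longrightarrow> y' \<in> carrier Dk \<Longrightarrow>
    klin k P EPE (\<lambda>z. J x y (g z) p x' y')"
  "x \<in> carrier Ck \<Longrightarrow> y \<in> carrier Dk \<Longrightarrow> q \<in> carrier Dk \<Longrightarrow> klin k P Ck f \<Longrightarrow> x' \<in> carrier Ck \<Longrightarrow> y' \<in> carrier Dk \<Longrightarrow>
    klin k P EPE (\<lambda>z. J x y q (f z) x' y')"
  "x \<in> carrier Ck \<Longrightarrow> y \<in> carrier Dk \<Longrightarrow> q \<in> carrier Dk \<Longrightarrow> p \<in> carrier Ck \<Longrightarrow> klin k P Ck f \<Longrightarrow> y' \<in> carrier Dk \<Longrightarrow>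
    klin k P EPE (\<lambda>z. J x y q p (f z) y')"
  "x \<in> carrier Ck \<Longrightarrow> y \<in> carrier Dk \<Longrightarrow> q \<in> carrier Dk \<Longrightarrow> p \<in> carrier Ck \<Longrightarrow> x' \<in> carrier Ck \<Longrightarrow> klin k P Dk g \<Longrightarrow>
    klin k P EPE (\<lambda>z. J x y q p x' (g z))"
  "x \<in> carrier Ck \<Longrightarrow> y \<in> carrier Dk \<Longrightarrow> q \<in> carrier Dk \<Longrightarrow> p \<in> carrier Ck \<Longrightarrow> x' \<in> carrier Ck \<Longrightarrow> y' \<in> carrier Dk \<Longrightarrow>
    J x y q p x' y' \<in> carrier EPE"
  unfolding J_def by (assumption | rule kl)+

lemma G_lin:
  assumes "b \<in> carrier DD" "a \<in> carrier CC"
  shows "y' \<in> carrier Dk \<Longrightarrow> klin k Ck EPE (\<lambda>x. G x y' b a)" "x \<in> carrier Ck \<Longrightarrow> klin k Dk EPE (\<lambda>y'. G x y' b a)"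
  unfolding G_def by ((assumption | rule kl assms)+)[2]

lemma kbil_G: "x \<in> carrier Ck \<Longrightarrow> y' \<in> carrier Dk \<Longrightarrow> kbil k DD CC EPE (G x y')"
  unfolding G_def[abs_def] by (assumption | rule kl)+

lemma G_etens:
  assumes "x \<in> carrier Ck" "y' \<in> carrier Dk" "y \<in> carrier Dk" "q \<in> carrier Dk" "p \<in> carrier Ck" "x' \<in> carrier Ck"
  shows "G x y' (etens DD y q) (etens CC p x') = J x y q p x' y'"
proof -
  have e: "etens CC p x' \<in> carrier CC" by (rule kl assms)+
  have 1: "kbil k Dk Dk EPE (\<lambda>y q. tlift EPE (\<lambda>p x'. J x y q p x' y') (etens CC p x'))" by (assumption | rule kl assms e)+
  have 2: "kbil k Ck Ck EPE (\<lambda>p x'. J x y q p x' y')" by (assumption | rule kl assms)+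
  show ?thesis unfolding G_def tlift_etens[OF 1 assms(3,4)] by (rule tlift_etens[OF 2 assms(5,6)])
qed

lemma kbil_G_hat:
  assumes "x \<in> carrier Ck" "y' \<in> carrier Dk" shows "kbil k (kk H DDh) (kk H CCh) EPE (G x y')"
  by (rule kbil_intro[OF C.kmod_kk[OF hbimod_DDh] C.kmod_kk[OF hbimod_CCh]])
    (simp_all only: kk_sel CCh_ops DDh_ops CCh_src DDh_src kbil_laws(4,5)[OF kbil_G[OF assms]])

lemma G_ext:
  assumes f: "kbil k DD CC A f" and g: "kbil k DD CC A g"
    and eq: "\<And>d d' c c'. d \<in> carrier Dk \<Longrightarrow> d' \<in> carrier Dk \<Longrightarrow> c \<in> carrier Ck \<Longrightarrow> c' \<in> carrier Ck \<Longrightarrow>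
      f (etens DD d d') (etens CC c c') = g (etens DD d d') (etens CC c c')"
    and u: "u \<in> carrier DDh" and t: "t \<in> carrier CCh"
  shows "f u t = g u t"
  by (rule tensor_ext2[OF f g D.kmod_Ck D.kmod_Ck C.kmod_Ck C.kmod_Ck eq u[unfolded DDh_ops] t[unfolded CCh_ops]])

text \<open>One law for each \<otimes>_H in \<open>XDCY\<close>. The \<open>h\<close> reappears
  between q and p, between x and y, and between x' and y', and each of these pairs is tensored over
  \<open>H\<close> in the target.\<close>

lemma G_bal:
  assumes x: "x \<in> carrier Ck" and y': "y' \<in> carrier Dk" and h: "h \<in> carrier H"
    and b: "b \<in> carrier DDh" and a: "a \<in> carrier CCh"
  shows "G x y' (rsmult DDh b h) a = G x y' b (h \<odot>\<^bsub>CCh\<^esub> a)"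
    "G (h \<odot>\<^bsub>C\<^esub> x) y' b a = G x y' (h \<odot>\<^bsub>DDh\<^esub> b) a"
    "G x (h \<odot>\<^bsub>D\<^esub> y') b a = G x y' b (rsmult CCh a h)"
proof -
  have h': "h \<in> carrier Hk" "S h \<in> carrier Hk" using h by simp_all
  have hx: "h \<odot>\<^bsub>C\<^esub> x \<in> carrier Ck" "h \<odot>\<^bsub>D\<^esub> y' \<in> carrier Dk" by (rule kl x y' h')+
  note cl = is_bimodule_laws(4,5)[OF C.hbimod_bimodule[OF hbimod_CCh] h, unfolded CCh_ops]
  note cl' = is_bimodule_laws(4,5)[OF C.hbimod_bimodule[OF hbimod_DDh] h, unfolded DDh_ops]
  note lc = hCC_lin(1,2)[OF CC_self(1) h'(1)] hDD_lin(1,2)[OF CC_self(2) h'(1)]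
  note B0 = kbil_G[OF x y'] and B1 = kbil_G_hat[OF x y']
  note Gc = klin_comp[OF kbil_laws(4)[OF B1]] klin_comp[OF kbil_laws(5)[OF B1]]
  have b1: "kbil k DD CC EPE (\<lambda>b a. G x y' (rsmult DDh b h) a)" "kbil k DD CC EPE (\<lambda>b a. G x y' (h \<odot>\<^bsub>DDh\<^esub> b) a)"
    by (rule kbil_intro[OF kmod_CC(2,1)]; (rule Gc(1)[OF _ lc(3)] Gc(1)[OF _ lc(4)] kbil_laws(5)[OF B0]; simp only: kk_sel CCh_ops cl'))+
  have b2: "kbil k DD CC EPE (\<lambda>b a. G x y' b (h \<odot>\<^bsub>CCh\<^esub> a))" "kbil k DD CC EPE (\<lambda>b a. G x y' b (rsmult CCh a h))"
    by (rule kbil_intro[OF kmod_CC(2,1)]; (rule Gc(2)[OF _ lc(1)] Gc(2)[OF _ lc(2)] kbil_laws(4)[OF B0]; simp only: kk_sel DDh_ops cl))+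
  show "G x y' (rsmult DDh b h) a = G x y' b (h \<odot>\<^bsub>CCh\<^esub> a)"
  proof (rule G_ext[OF b1(1) b2(1) _ b a])
    fix y q p x' assume g: "y \<in> carrier Dk" "q \<in> carrier Dk" "p \<in> carrier Ck" "x' \<in> carrier Ck"
    have g': "y \<in> carrier D" "q \<in> carrier D" "p \<in> carrier C" "x' \<in> carrier C" using g by simp_all
    have n: "S h \<odot>\<^bsub>D\<^esub> q \<in> carrier Dk" "S h \<odot>\<^bsub>C\<^esub> p \<in> carrier Ck" by (rule kl g h')+
    show "G x y' (rsmult DDh (etens DD y q) h) (etens CC p x') = G x y' (etens DD y q) (h \<odot>\<^bsub>CCh\<^esub> etens CC p x')"
      unfolding DDh_smult(2)[OF g'(1,2) h] CCh_smult(1)[OF g'(3,4) h] G_etens[OF x y' g(1) n(1) g(3,4)]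
        G_etens[OF x y' g(1,2) n(2) g(4)] J_def ptens_act[OF g'(2,3) h] ..
  qed
  show "G (h \<odot>\<^bsub>C\<^esub> x) y' b a = G x y' (h \<odot>\<^bsub>DDh\<^esub> b) a"
  proof (rule G_ext[OF kbil_G[OF hx(1) y'] b1(2) _ b a])
    fix y q p x' assume g: "y \<in> carrier Dk" "q \<in> carrier Dk" "p \<in> carrier Ck" "x' \<in> carrier Ck"
    have g': "x \<in> carrier C" "y \<in> carrier D" "q \<in> carrier D" using g x by simp_all
    have n: "h \<odot>\<^bsub>D\<^esub> y \<in> carrier Dk" by (rule kl g h')+
    show "G (h \<odot>\<^bsub>C\<^esub> x) y' (etens DD y q) (etens CC p x') = G x y' (h \<odot>\<^bsub>DDh\<^esub> etens DD y q) (etens CC p x')"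
      unfolding DDh_smult(1)[OF g'(2,3) h] G_etens[OF hx(1) y' g] G_etens[OF x y' n g(2-4)] J_def tens_bal[OF g'(1) h g'(2)] ..
  qed
  show "G x (h \<odot>\<^bsub>D\<^esub> y') b a = G x y' b (rsmult CCh a h)"
  proof (rule G_ext[OF kbil_G[OF x hx(2)] b2(2) _ b a])
    fix y q p x' assume g: "y \<in> carrier Dk" "q \<in> carrier Dk" "p \<in> carrier Ck" "x' \<in> carrier Ck"
    have g': "y' \<in> carrier D" "p \<in> carrier C" "x' \<in> carrier C" using g y' by simp_all
    have n: "h \<odot>\<^bsub>C\<^esub> x' \<in> carrier Ck" by (rule kl g h')+
    show "G x (h \<odot>\<^bsub>D\<^esub> y') (etens DD y q) (etens CC p x') = G x y' (etens DD y q) (rsmult CCh (etens CC p x') h)"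
      unfolding CCh_smult(2)[OF g'(2,3) h] G_etens[OF x hx(2) g] G_etens[OF x y' g(1-3) n] J_def tens_bal[OF g'(3) h g'(1)] ..
  qed
qed

lemma hbal_G: "x \<in> carrier Ck \<Longrightarrow> y' \<in> carrier Dk \<Longrightarrow> C.hbal DDh CCh EPE (G x y')"
  by (rule C.hbalI[OF hbimod_DDh hbimod_CCh kbil_G_hat]; (assumption | rule G_bal(1))+)

lemma hbal_G2:
  assumes y': "y' \<in> carrier Dk"
  shows "C.hbal (bimod_of C) Bh EPE (\<lambda>x r. tlift EPE (G x y') r)"
proof (rule C.hbalI[OF C.hbimod_C hbimod_B])
  show kb: "kbil k Ck Bk EPE (\<lambda>x r. tlift EPE (G x y') r)"
  proof (rule kbil_intro[OF C.kmod_Ck kmod_B])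
    show "klin k Ck EPE (\<lambda>x. tlift EPE (G x y') r)" if "r \<in> carrier Bk" for r
    proof (rule C.htlift_param[OF that C.kmod_Ck hbal_G[OF _ y']])
      show "klin k Ck EPE (\<lambda>x. G x y' b a)" if "b \<in> carrier (kk H DDh)" "a \<in> carrier (kk H CCh)" for b a
        by (rule G_lin(1)[OF _ _ y']) (use that in \<open>simp_all only: kk_sel CCh_ops DDh_ops\<close>)
    qed
    show "klin k Bk EPE (\<lambda>r. tlift EPE (G x y') r)" if "x \<in> carrier Ck" for x
      by (rule C.klin_htlift[OF hbal_G[OF that y']])
  qed
  fix x h r assume xh: "x \<in> carrier (bimod_of C)" "h \<in> carrier H" "r \<in> carrier Bh"
  have x: "x \<in> carrier Ck" and h': "h \<in> carrier Hk" and r: "r \<in> carrier Bk" using xh by (simp_all only: kk_sel bimod_of_sel)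
  have hx: "h \<odot>\<^bsub>C\<^esub> x \<in> carrier Ck" by (rule kl x h')+
  note l = C.klin_htlift[OF hbal_G[OF hx y']] and l2 = C.klin_htlift[OF hbal_G[OF x y']]
  have "tlift EPE (G (h \<odot>\<^bsub>C\<^esub> x) y') r = tlift EPE (G x y') (h \<odot>\<^bsub>Bh\<^esub> r)"
  proof (rule C.hext[OF l klin_comp[OF l2 hB_lin(1)[OF klin_id[OF kmod_B] h']] hbimod_DDh hbimod_CCh _ r])
    fix b a assume ba: "b \<in> carrier (kk H DDh)" "a \<in> carrier (kk H CCh)"
    have b: "b \<in> carrier DDh" and a: "a \<in> carrier CCh" using ba unfolding kk_sel .
    have hb: "h \<odot>\<^bsub>DDh\<^esub> b \<in> carrier (kk H DDh)"
      unfolding kk_sel by (rule is_bimodule_laws(4)[OF C.hbimod_bimodule[OF hbimod_DDh] xh(2) b])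
    show "tlift EPE (G (h \<odot>\<^bsub>C\<^esub> x) y') (etens Bh b a) = tlift EPE (G x y') (h \<odot>\<^bsub>Bh\<^esub> etens Bh b a)"
      unfolding C.hetens_smult(1)[OF hbimod_DDh hbimod_CCh b xh(2) a] C.htlift_etens[OF hbal_G[OF hx y'] ba]
        C.htlift_etens[OF hbal_G[OF x y'] hb ba(2)] by (rule G_bal(2)[OF x y' xh(2) b a])
  qed
  then show "tlift EPE (G (rsmult (bimod_of C) x h) y') r = tlift EPE (G x y') (h \<odot>\<^bsub>Bh\<^esub> r)"
    unfolding bimod_of_sel .
qed

lemma hbal_G3: "C.hbal XDC (bimod_of D) EPE (\<lambda>w y'. tlift EPE (\<lambda>x r. tlift EPE (G x y') r) w)"
proof (rule C.hbalI[OF hbimod_XDC D.hbimod_C])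
  show "kbil k (kk H XDC) Dk EPE (\<lambda>w y'. tlift EPE (\<lambda>x r. tlift EPE (G x y') r) w)"
  proof (rule kbil_intro[OF C.kmod_kk[OF hbimod_XDC] D.kmod_Ck])
    show "klin k (kk H XDC) EPE (\<lambda>w. tlift EPE (\<lambda>x r. tlift EPE (G x y') r) w)" if "y' \<in> carrier Dk" for y'
      by (rule C.klin_htlift[OF hbal_G2[OF that]])
    show "klin k Dk EPE (\<lambda>y'. tlift EPE (\<lambda>x r. tlift EPE (G x y') r) w)" if w: "w \<in> carrier (kk H XDC)" for w
    proof (rule C.htlift_param[OF w D.kmod_Ck hbal_G2], assumption)
      fix x r assume x: "x \<in> carrier Ck" and r: "r \<in> carrier Bk"
      show "klin k Dk EPE (\<lambda>y'. tlift EPE (G x y') r)"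
      proof (rule C.htlift_param[OF r D.kmod_Ck hbal_G[OF x]], assumption)
        show "klin k Dk EPE (\<lambda>y'. G x y' b a)" if "b \<in> carrier (kk H DDh)" "a \<in> carrier (kk H CCh)" for b a
          by (rule G_lin(2)[OF _ _ x]) (use that in \<open>simp_all only: kk_sel CCh_ops DDh_ops\<close>)
      qed
    qed
  qed
  fix w h y' assume wh: "w \<in> carrier XDC" "h \<in> carrier H" "y' \<in> carrier (bimod_of D)"
  have y: "y' \<in> carrier Dk" and h': "h \<in> carrier Hk" and w: "w \<in> carrier (kk H XDC)" using wh by (simp_all only: kk_sel bimod_of_sel)
  have hy: "h \<odot>\<^bsub>D\<^esub> y' \<in> carrier Dk" by (rule kl y h')+
  note l = C.klin_htlift[OF hbal_G2[OF y]] and l2 = C.klin_htlift[OF hbal_G2[OF hy]]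
  note rX = C.hsmult_lin(2)[OF klin_id[OF C.kmod_kk[OF hbimod_XDC]] h' hbimod_XDC]
  have "tlift EPE (\<lambda>x r. tlift EPE (G x y') r) (rsmult XDC w h) = tlift EPE (\<lambda>x r. tlift EPE (G x (h \<odot>\<^bsub>D\<^esub> y')) r) w"
  proof (rule C.hext[OF klin_comp[OF l rX] l2 C.hbimod_C hbimod_B _ w])
    fix x r assume x: "x \<in> carrier Ck" and r: "r \<in> carrier Bk"
    have x': "x \<in> carrier (bimod_of C)" and r': "r \<in> carrier Bh" using x r unfolding kk_sel .
    have hr: "rsmult Bh r h \<in> carrier Bk"
      unfolding kk_sel by (rule B_laws(5)[OF wh(2) r'])
    have "tlift EPE (G x y') (rsmult Bh r h) = tlift EPE (G x (h \<odot>\<^bsub>D\<^esub> y')) r"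
    proof (rule C.hext[OF klin_comp[OF C.klin_htlift[OF hbal_G[OF x y]] hB_lin(2)[OF klin_id[OF kmod_B] h']]
          C.klin_htlift[OF hbal_G[OF x hy]] hbimod_DDh hbimod_CCh _ r])
      fix b a assume ba: "b \<in> carrier (kk H DDh)" "a \<in> carrier (kk H CCh)"
      have b: "b \<in> carrier DDh" and a: "a \<in> carrier CCh" using ba unfolding kk_sel .
      have ha: "rsmult CCh a h \<in> carrier (kk H CCh)"
        unfolding kk_sel by (rule is_bimodule_laws(5)[OF C.hbimod_bimodule[OF hbimod_CCh] wh(2) a])
      show "tlift EPE (G x y') (rsmult Bh (etens Bh b a) h) = tlift EPE (G x (h \<odot>\<^bsub>D\<^esub> y')) (etens Bh b a)"
        unfolding C.hetens_smult(2)[OF hbimod_DDh hbimod_CCh b wh(2) a] C.htlift_etens[OF hbal_G[OF x hy] ba]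
          C.htlift_etens[OF hbal_G[OF x y] ba(1) ha] by (rule G_bal(3)[OF x y wh(2) b a, symmetric])
    qed
    then show "tlift EPE (\<lambda>x r. tlift EPE (G x y') r) (rsmult XDC (etens XDC x r) h) =
        tlift EPE (\<lambda>x r. tlift EPE (G x (h \<odot>\<^bsub>D\<^esub> y')) r) (etens XDC x r)"
      unfolding C.hetens_smult(2)[OF C.hbimod_C hbimod_B x' wh(2) r'] C.htlift_etens[OF hbal_G2[OF hy] x r]
        C.htlift_etens[OF hbal_G2[OF y] x hr] .
  qed
  then show "tlift EPE (\<lambda>x r. tlift EPE (G x y') r) (rsmult XDC w h) =
      tlift EPE (\<lambda>x r. tlift EPE (G x (h \<odot>\<^bsub>bimod_of D\<^esub> y')) r) w" unfolding bimod_of_sel .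
qed

definition reassoc where
  "reassoc = tlift EPE (\<lambda>w y'. tlift EPE (\<lambda>x r. tlift EPE (G x y') r) w)"

lemma reassoc_klin: "klin k (kk H XDCY) EPE reassoc"
  unfolding reassoc_def by (rule C.klin_htlift[OF hbal_G3])

lemma reassoc_etens:
  assumes x: "x \<in> carrier Ck" and b: "b \<in> carrier DD" and a: "a \<in> carrier CC" and y': "y' \<in> carrier Dk"
  shows "reassoc (etens XDCY (etens XDC x (etens Bh b a)) y') = G x y' b a"
proof -
  have ba: "b \<in> carrier (kk H DDh)" "a \<in> carrier (kk H CCh)" by (rule kl b a)+
  have r: "etens Bh b a \<in> carrier Bk" by (rule kl b a)+
  have w: "etens XDC x (etens Bh b a) \<in> carrier (kk H XDC)" by (rule kl x b a)+
  show ?thesis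
    unfolding reassoc_def C.htlift_etens[OF hbal_G3 w y'] C.htlift_etens[OF hbal_G2[OF y'] x r]
    by (rule C.htlift_etens[OF hbal_G[OF x y'] ba])
qed

end

section \<open>Comparison of the two shepherds\<close>

context galois_pair
begin

sublocale EG: galois k H EE by (rule galois_EE)

definition pmap where "pmap = tlift EP (\<lambda>e f. etens EP e (theta f))"
definition smap where "smap = tlift EPE (\<lambda>t z. etens EPE (pmap t) z)"

lemma kbil_pmap: "kbil k Ek Ek EP (\<lambda>e f. etens EP e (theta f))" by (assumption | rule kl)+

lemma pmap_klin: "klin k E2 EP pmap" unfolding pmap_def by (rule klin_tlift0[OF kbil_pmap])

lemmas pmap_kl [kl] = klin_comp[OF pmap_klin] klin_laws(4)[OF pmap_klin]

lemma pmap_etens: "e \<in> carrier Ek \<Longrightarrow> f \<in> carrier Ek \<Longrightarrow> pmap (etens E2 e f) = etens EP e (theta f)"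
  unfolding pmap_def by (rule tlift_etens[OF kbil_pmap])

lemma kbil_smap: "kbil k E2 Ek EPE (\<lambda>t z. etens EPE (pmap t) z)" by (assumption | rule kl)+

lemma smap_klin: "klin k E3 EPE smap" unfolding smap_def by (rule klin_tlift0[OF kbil_smap])

lemmas smap_kl [kl] = klin_comp[OF smap_klin] klin_laws(4)[OF smap_klin]

lemma smap_etens: "t \<in> carrier E2 \<Longrightarrow> z \<in> carrier Ek \<Longrightarrow> smap (etens E3 t z) = etens EPE (pmap t) z"
  unfolding smap_def by (rule tlift_etens[OF kbil_smap])

lemmas comultE_kl [kl] = klin_comp[OF comult_E_klin] klin_laws(4)[OF comult_E_klin]

lemma shep_E: "EG.shep e = tlift E3 (\<lambda>a z. etens E3 (comult EE a) z) (comult EE e)"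
  unfolding EG.shep_def keqv_cong_ops[OF keqv_EE3] keqv_cong_etens[OF keqv_EE3] ..

lemma kbil_shep_E: "kbil k Ek Ek E3 (\<lambda>a z. etens E3 (comult EE a) z)"
  by (assumption | rule kl)+

lemma shep_E_klin: "klin k Ek E3 EG.shep"
proof -
  have "klin k Ek E3 (\<lambda>e. tlift E3 (\<lambda>a z. etens E3 (comult EE a) z) (comult EE e))"
    by (rule klin_comp[OF klin_tlift0[OF kbil_shep_E] comult_E_klin])
  then show ?thesis by (rule klin_cong) (rule shep_E[symmetric])
qed

lemmas shep_E_kl [kl] = klin_comp[OF shep_E_klin] klin_laws(4)[OF shep_E_klin]

text \<open>A normal form: the coproduct of C \<otimes>_H D works leg by leg, so C and D both
  contribute their left bracketed iterated coproducts, and \<open>theta\<close> reverses the middle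
  pair.\<close>

lemma smap_shep_E:
  assumes x: "x \<in> carrier Ck" and y: "y \<in> carrier Dk"
  shows "smap (EG.shep (tens x y)) = tlift EPE (\<lambda>a x'. tlift EPE (\<lambda>b y'. tlift EPE (\<lambda>u p. tlift EPE (\<lambda>v q.
    J u v q p x' y') (comult D b)) (comult C a)) (comult D y)) (comult C x)"
proof -
  have x1: "x \<in> carrier C" and y1: "y \<in> carrier D" using x y by simp_all
  note dx = C.Cc.comult_closed[OF x] and dy = D.Cc.comult_closed[OF y]
  have e: "tens x y \<in> carrier Ek" by (rule tens_closed[OF x1 y1])
  have de: "comult EE (tens x y) \<in> carrier E2" by (rule kl e)+
  have 1: "etens EPE (pmap (comult EE (tens a b))) (tens x' y') =
      tlift EPE (\<lambda>u p. tlift EPE (\<lambda>v q. J u v q p x' y') (comult D b)) (comult C a)"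
    if ab: "a \<in> carrier Ck" "b \<in> carrier Dk" "x' \<in> carrier Ck" "y' \<in> carrier Dk" for a b x' y'
  proof -
    have ab1: "a \<in> carrier C" "b \<in> carrier D" "x' \<in> carrier C" "y' \<in> carrier D" using ab by simp_all
    note da = C.Cc.comult_closed[OF ab(1)] and db = D.Cc.comult_closed[OF ab(2)]
    have w: "tens x' y' \<in> carrier Ek" by (rule tens_closed[OF ab1(3,4)])
    have l: "klin k EP EPE (\<lambda>t. etens EPE t (tens x' y'))" by (assumption | rule kl w)+
    have F: "kbil k Ek Ek EPE (\<lambda>e f. etens EPE (etens EP e (theta f)) (tens x' y'))" by (assumption | rule kl w)+
    have "etens EPE (pmap (comult EE (tens a b))) (tens x' y') =
        tlift EPE (\<lambda>e f. etens EPE (etens EP e (theta f)) (tens x' y')) (comult EE (tens a b))"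
      unfolding pmap_def by (rule tlift_fusion[OF l kbil_pmap]) (rule kl tens_closed[OF ab1(1,2)])+
    also have "\<dots> = tlift EPE (\<lambda>u p. tlift EPE (\<lambda>v q. etens EPE (etens EP (tens u v) (theta (tens p q))) (tens x' y'))
        (comult D b)) (comult C a)"
      unfolding comult_E[OF ab1(1,2)] by (rule tlift_tmap2[OF F da db kbil_tens kbil_tens])
    also have "\<dots> = tlift EPE (\<lambda>u p. tlift EPE (\<lambda>v q. J u v q p x' y') (comult D b)) (comult C a)"
    proof (rule tlift_cong[OF _ _ da, symmetric])
      show "kbil k Ck Ck EPE (\<lambda>u p. tlift EPE (\<lambda>v q. J u v q p x' y') (comult D b))" by (assumption | rule kl ab)+
      fix u p assume up: "u \<in> carrier Ck" "p \<in> carrier Ck"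
      show "tlift EPE (\<lambda>v q. J u v q p x' y') (comult D b) =
        tlift EPE (\<lambda>v q. etens EPE (etens EP (tens u v) (theta (tens p q))) (tens x' y')) (comult D b)"
      proof (rule tlift_cong[OF _ _ db])
        show "kbil k Dk Dk EPE (\<lambda>v q. J u v q p x' y')" by (assumption | rule kl ab up)+
        fix v q assume "v \<in> carrier Dk" "q \<in> carrier Dk"
        then have "q \<in> carrier D" "p \<in> carrier C" using up by simp_all
        then show "J u v q p x' y' = etens EPE (etens EP (tens u v) (theta (tens p q))) (tens x' y')"
          unfolding J_def by (simp only: theta_tens)
      qed
    qed
    finally show ?thesis .
  qed
  have "smap (EG.shep (tens x y)) = tlift EPE (\<lambda>a z. etens EPE (pmap (comult EE a)) z) (comult EE (tens x y))"
    unfolding shep_E by (rule tlift_push[OF smap_klin kbil_shep_E de smap_etens[OF klin_laws(4)[OF comult_E_klin]]])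
  also have "\<dots> = tlift EPE (\<lambda>a x'. tlift EPE (\<lambda>b y'. etens EPE (pmap (comult EE (tens a b))) (tens x' y')) (comult D y)) (comult C x)"
    unfolding comult_E[OF x1 y1] by (rule tlift_tmap2[OF _ dx dy kbil_tens kbil_tens]) (assumption | rule kl)+
  also have "\<dots> = tlift EPE (\<lambda>a x'. tlift EPE (\<lambda>b y'. tlift EPE (\<lambda>u p. tlift EPE (\<lambda>v q.
    J u v q p x' y') (comult D b)) (comult C a)) (comult D y)) (comult C x)"
  proof (rule tlift_cong[OF _ _ dx])
    note tk = kbil_laws(3)[OF kbil_tens] klin_comp[OF kbil_laws(4)[OF kbil_tens]] klin_comp[OF kbil_laws(5)[OF kbil_tens]] kbil_laws(6)[OF kbil_tens]
    show "kbil k Ck Ck EPE (\<lambda>a x'. tlift EPE (\<lambda>b y'. etens EPE (pmap (comult EE (tens a b))) (tens x' y')) (comult D y))"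
      by (assumption | rule kl tk dy)+
    fix a x' assume ax: "a \<in> carrier Ck" "x' \<in> carrier Ck"
    show "tlift EPE (\<lambda>b y'. etens EPE (pmap (comult EE (tens a b))) (tens x' y')) (comult D y) =
      tlift EPE (\<lambda>b y'. tlift EPE (\<lambda>u p. tlift EPE (\<lambda>v q. J u v q p x' y') (comult D b)) (comult C a)) (comult D y)"
    proof (rule tlift_cong[OF _ _ dy])
      show "kbil k Dk Dk EPE (\<lambda>b y'. etens EPE (pmap (comult EE (tens a b))) (tens x' y'))"
        by (assumption | rule kl tk ax)+
    qed (rule 1[OF ax(1) _ ax(2)])
  qed
  finally show ?thesis .
qed

text \<open>In the composite the legs of C are bracketed to the right, because \<sigma> is evaluated
  at \<Delta>(c2), and those of D to the left. On the other side both are bracketed to the left, so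
  one use of coassociativity in C and a reordering of independent sums suffice.\<close>

lemma composed_shep:
  assumes x: "x \<in> carrier Ck" and y: "y \<in> carrier Dk"
  shows "reassoc (mid (projX (C.shep x)) (projY (D.shep y))) = smap (EG.shep (tens x y))"
proof -
  note dx = C.Cc.comult_closed[OF x] and dy = D.Cc.comult_closed[OF y]
  have b1: "kbil k Dk Dk (kk H XDCY) (\<lambda>b z. etens XDCY (etens XDC u (etens Bh (comult D b) (comult C a))) z)"
    if "u \<in> carrier Ck" "a \<in> carrier Ck" for u a by (assumption | rule kl that)+
  have "reassoc (mid (projX (C.shep x)) (projY (D.shep y))) =
      tlift EPE (\<lambda>u a. tlift EPE (\<lambda>b z. G u z (comult D b) (comult C a)) (comult D y)) (comult C x)"
    unfolding mid_shep[OF x y]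
  proof (rule tlift_push[OF reassoc_klin _ dx])
    show "kbil k Ck Ck (kk H XDCY) (\<lambda>u a. tlift (kk H XDCY) (\<lambda>b z. etens XDCY (etens XDC u (etens Bh (comult D b) (comult C a))) z) (comult D y))"
      by (assumption | rule kl dy)+
    fix u a assume ua: "u \<in> carrier Ck" "a \<in> carrier Ck"
    show "reassoc (tlift (kk H XDCY) (\<lambda>b z. etens XDCY (etens XDC u (etens Bh (comult D b) (comult C a))) z) (comult D y)) =
      tlift EPE (\<lambda>b z. G u z (comult D b) (comult C a)) (comult D y)"
      by (rule tlift_push[OF reassoc_klin b1[OF ua] dy])
        (rule reassoc_etens[OF ua(1) D.Cc.comult_closed C.Cc.comult_closed[OF ua(2)]])
  qed
  also have "\<dots> = tlift EPE (\<lambda>u a. tlift EPE (\<lambda>p x'. tlift EPE (\<lambda>b y'. tlift EPE (\<lambda>v q.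
      J u v q p x' y') (comult D b)) (comult D y)) (comult C a)) (comult C x)"
  proof (rule tlift_cong[OF _ _ dx])
    show "kbil k Ck Ck EPE (\<lambda>u a. tlift EPE (\<lambda>b z. G u z (comult D b) (comult C a)) (comult D y))"
      unfolding G_def by (assumption | rule kl dy)+
    fix u a assume ua: "u \<in> carrier Ck" "a \<in> carrier Ck"
    note da = C.Cc.comult_closed[OF ua(2)]
    have "tlift EPE (\<lambda>b z. G u z (comult D b) (comult C a)) (comult D y) =
      tlift EPE (\<lambda>b y'. tlift EPE (\<lambda>p x'. tlift EPE (\<lambda>v q. J u v q p x' y') (comult D b)) (comult C a)) (comult D y)"
    proof (rule tlift_cong[OF _ _ dy])
      show "kbil k Dk Dk EPE (\<lambda>b z. G u z (comult D b) (comult C a))"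
        unfolding G_def by (assumption | rule kl ua)+
      fix b y' assume b: "b \<in> carrier Dk" "y' \<in> carrier Dk"
      show "G u y' (comult D b) (comult C a) =
          tlift EPE (\<lambda>p x'. tlift EPE (\<lambda>v q. J u v q p x' y') (comult D b)) (comult C a)"
        unfolding G_def
        by (rule tlift_swap[OF D.Cc.comult_closed[OF b(1)] da]) (assumption | rule kl ua b)+
    qed
    also have "\<dots> = tlift EPE (\<lambda>p x'. tlift EPE (\<lambda>b y'. tlift EPE (\<lambda>v q. J u v q p x' y') (comult D b)) (comult D y)) (comult C a)"
      by (rule tlift_swap[OF dy da]) (assumption | rule kl ua)+
    finally show "tlift EPE (\<lambda>b z. G u z (comult D b) (comult C a)) (comult D y) =
      tlift EPE (\<lambda>p x'. tlift EPE (\<lambda>b y'. tlift EPE (\<lambda>v q. J u v q p x' y') (comult D b)) (comult D y)) (comult C a)" .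
  qed
  also have "\<dots> = tlift EPE (\<lambda>a x'. tlift EPE (\<lambda>u p. tlift EPE (\<lambda>b y'. tlift EPE (\<lambda>v q.
      J u v q p x' y') (comult D b)) (comult D y)) (comult C a)) (comult C x)"
    by (rule C.Cc.coassoc[OF _ x, symmetric]) (assumption | rule kl dy)+
  also have "\<dots> = tlift EPE (\<lambda>a x'. tlift EPE (\<lambda>b y'. tlift EPE (\<lambda>u p. tlift EPE (\<lambda>v q.
      J u v q p x' y') (comult D b)) (comult C a)) (comult D y)) (comult C x)"
  proof (rule tlift_cong[OF _ _ dx])
    show "kbil k Ck Ck EPE (\<lambda>a x'. tlift EPE (\<lambda>u p. tlift EPE (\<lambda>b y'. tlift EPE (\<lambda>v q.
      J u v q p x' y') (comult D b)) (comult D y)) (comult C a))" by (assumption | rule kl dy)+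
    fix a x' assume ax: "a \<in> carrier Ck" "x' \<in> carrier Ck"
    show "tlift EPE (\<lambda>u p. tlift EPE (\<lambda>b y'. tlift EPE (\<lambda>v q. J u v q p x' y') (comult D b)) (comult D y)) (comult C a) =
      tlift EPE (\<lambda>b y'. tlift EPE (\<lambda>u p. tlift EPE (\<lambda>v q. J u v q p x' y') (comult D b)) (comult C a)) (comult D y)"
      by (rule tlift_swap[OF C.Cc.comult_closed[OF ax(1)] dy]) (assumption | rule kl ax)+
  qed
  also have "\<dots> = smap (EG.shep (tens x y))" by (rule smap_shep_E[OF x y, symmetric])
  finally show ?thesis .
qed

lemma shepherd_Y:
  "shepherd Y = tlift EPE (\<lambda>x y. reassoc (mid (projX (C.shep x)) (projY (D.shep y))))"
  unfolding reassoc_def mid_def[abs_def] projX_def projY_def G_def[abs_def] J_def C.tlift_kk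
  by (simp only: compose_herds_def Let_def herd.simps C.herd_sel D.herd_sel C.tlift_ktensor C.etens_ktensor C.kk_ktensor CCh_ops)

text \<open>The formula for the composed shepherd has the same values on pairs as
  \<open>smap\<close> after the shepherd of C \<otimes>_H D. The latter is balanced as a linear
  function of \<open>tens\<close>, so \<open>htlift_cong\<close> hands balance over to the
  former.\<close>

lemma shepherd_Y_eq:
  assumes e: "e \<in> carrier Ek" shows "shepherd Y e = smap (EG.shep e)"
proof -
  have l: "klin k Ek EPE (\<lambda>e. smap (EG.shep e))" by (rule klin_comp[OF smap_klin shep_E_klin])
  note hb = C.hbal_comp[OF C.hbal_etens[OF C.hbimod_C D.hbimod_C] l]
  note ce = C.htlift_cong[OF hb composed_shep[symmetric] e]
  show ?thesis
    unfolding shepherd_Y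
  proof (rule E_ext[OF C.klin_htlift[OF ce(2)] l _ e])
    fix x y assume "x \<in> carrier C" "y \<in> carrier D"
    then have xy: "x \<in> carrier Ck" "y \<in> carrier Dk" by simp_all
    show "tlift EPE (\<lambda>x y. reassoc (mid (projX (C.shep x)) (projY (D.shep y)))) (tens x y) = smap (EG.shep (tens x y))"
      by (rule trans[OF C.htlift_etens[OF ce(2) xy] composed_shep[OF xy]])
  qed
qed

end

lemma tlift_map:
  assumes f: "klin k M M' f" and g: "klin k N N' g" and F: "kbil k M' N' A F" and t: "t \<in> carrier (M \<boxtimes>\<^bsub>k\<^esub> N)"
  shows "tlift A F (tlift (M' \<boxtimes>\<^bsub>k\<^esub> N') (\<lambda>x y. etens (M' \<boxtimes>\<^bsub>k\<^esub> N') (f x) (g y)) t) = tlift A (\<lambda>x y. F (f x) (g y)) t"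
proof (rule tlift_push[OF klin_tlift0[OF F] _ t])
  show "kbil k M N (M' \<boxtimes>\<^bsub>k\<^esub> N') (\<lambda>x y. etens (M' \<boxtimes>\<^bsub>k\<^esub> N') (f x) (g y))"
    by (assumption | rule kl f g klin_laws(1)[OF f] klin_laws(1)[OF g] klin_laws(2)[OF f] klin_laws(2)[OF g] klin_laws(4)[OF f] klin_laws(4)[OF g])+
qed (rule tlift_etens[OF F klin_laws(4)[OF f] klin_laws(4)[OF g]])

section \<open>The two herds coincide\<close>

context galois_pair
begin

abbreviation E4 where "E4 \<equiv> E3 \<boxtimes>\<^bsub>k\<^esub> Ek"
abbreviation E5 where "E5 \<equiv> E4 \<boxtimes>\<^bsub>k\<^esub> Ek"
abbreviation Y4 where "Y4 \<equiv> EPE \<boxtimes>\<^bsub>k\<^esub> Pk"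
abbreviation Y5 where "Y5 \<equiv> Y4 \<boxtimes>\<^bsub>k\<^esub> Ek"
abbreviation HE where "HE \<equiv> Hk \<boxtimes>\<^bsub>k\<^esub> Ek"
abbreviation EH where "EH \<equiv> Ek \<boxtimes>\<^bsub>k\<^esub> Hk"

lemma kmod_Y [kl]: "kmod k EP" "kmod k PE" "kmod k Y4" "kmod k Y5" "kmod k E2" "kmod k E3" "kmod k E4" "kmod k E5"
  by (rule kl)+

lemma keqv_Y:
  "keqv k (kk H (PT k H Y)) PE" "keqv k (kk H (TP k H Y)) EP" "keqv k (kk H (TPT k H Y)) EPE"
  "keqv k (kk H (rk H (TPT k H Y) \<boxtimes>\<^bsub>k\<^esub> lk H Ph)) Y4"
  "keqv k (kk H (rk H (rk H (TPT k H Y) \<boxtimes>\<^bsub>k\<^esub> lk H Ph) \<boxtimes>\<^bsub>k\<^esub> lk H Eh)) Y5"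
  unfolding PT_def TP_def TPT_def Y_sel C.kk_ktensor by (rule keqv_refl, rule kl)+

lemma carrier_EE: "carrier (kk H (bimod_of EE)) = carrier Ek"
  by (rule keqv_sel(1)[OF keqv_EE])

text \<open>With this identification the linearity and duality laws proved for every Galois
  co-object become laws of \<open>tau\<close>.\<close>

lemma tau_ev:
  assumes "e \<in> carrier Ek" "f \<in> carrier Ek"
  shows "galois_ev k H EE (etens E2 e f) = tau e f"
proof -
  have "etens E2 e f \<in> carrier E2" by (rule kl assms)+
  then show ?thesis using ev_EE EV_etens[OF assms] by simp
qed

lemma tau_smult:
  assumes "e \<in> carrier Ek" "f \<in> carrier Ek" "h \<in> carrier H"
  shows "tau (h \<odot>\<^bsub>Eh\<^esub> e) f = S h \<otimes>\<^bsub>H\<^esub> tau e f" "tau e (h \<odot>\<^bsub>Eh\<^esub> f) = h \<otimes>\<^bsub>H\<^esub> tau e f"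
proof -
  have h: "h \<in> carrier Hk" using assms by simp
  have a: "h \<odot>\<^bsub>Eh\<^esub> e \<in> carrier Ek" "h \<odot>\<^bsub>Eh\<^esub> f \<in> carrier Ek" by (rule kl assms h)+
  have c: "e \<in> carrier EE" "f \<in> carrier EE" using assms(1,2) unfolding EE_sel kk_sel .
  note l = EG.ev_act_l[OF c assms(3), unfolded keqv_cong_etens[OF keqv_EE2] EE_sel(4)]
  note r = EG.ev_act_r[OF c assms(3), unfolded keqv_cong_etens[OF keqv_EE2] EE_sel(4)]
  show "tau (h \<odot>\<^bsub>Eh\<^esub> e) f = S h \<otimes>\<^bsub>H\<^esub> tau e f" "tau e (h \<odot>\<^bsub>Eh\<^esub> f) = h \<otimes>\<^bsub>H\<^esub> tau e f"
    using l r unfolding tau_ev[OF assms(1,2)] tau_ev[OF a(1) assms(2)] tau_ev[OF assms(1) a(2)] .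
qed

lemma tau_dual:
  assumes "x \<in> carrier Ek" "p \<in> carrier Ek" "y \<in> carrier Ek"
  shows "S (tau x p) \<odot>\<^bsub>Eh\<^esub> y = tau p y \<odot>\<^bsub>Eh\<^esub> x"
proof -
  have c: "x \<in> carrier EE" "p \<in> carrier EE" "y \<in> carrier EE" using assms unfolding EE_sel kk_sel .
  show ?thesis
    using EG.ev_dual[OF c, unfolded keqv_cong_etens[OF keqv_EE2] EE_sel(4)]
    unfolding tau_ev[OF assms(1,2)] tau_ev[OF assms(2,3)] .
qed

lemma tau_closed: "e \<in> carrier Ek \<Longrightarrow> f \<in> carrier Ek \<Longrightarrow> tau e f \<in> carrier H"
  using kbil_laws(6)[OF kbil_tau, of e f] by (simp only: bimod_of_sel)

text \<open>Every element of the pen is some \<open>theta e\<close>. After this substitution an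
  action of \<open>h\<close> on the pen becomes the action of \<open>S h\<close> on C \<otimes>_H D,
  and the axioms reduce to laws of \<open>tau\<close>.\<close>

lemma formal_dual_Y: "formal_dual k H Y"
proof -
  note ops = C.keqv_ops(1)[OF keqv_Y(1)] C.keqv_ops(1)[OF keqv_Y(2)]
  have hb: "is_bimodule H H Eh" "k_central k H Eh" "is_bimodule H H Ph" "k_central k H Ph"
    using hbimod_E hbimod_P unfolding C.hbimod_def by blast+
  note E_laws = is_bimodule_laws[OF hb(1)]
  have car: "carrier Ek = carrier Eh" "carrier Pk = carrier Ph" by (rule kk_sel)+
  have ev: "ev Y \<in> bihom H H (PT k H Y) (bimod_of (regular H))"
    unfolding PT_def Y_sel
  proof (rule C.bihom_pairing[OF hbimod_P hbimod_E ev_Y_klin])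
    fix h p y assume a: "h \<in> carrier H" "p \<in> carrier Ph" "y \<in> carrier Eh"
    have y: "y \<in> carrier Ek" unfolding car by (rule a(3))
    have "p \<in> carrier Pk" unfolding car by (rule a(2))
    then obtain e where e: "e \<in> carrier Ek" "p = theta e" by (rule theta_cases)
    have Sh: "S h \<in> carrier H" using a(1) by simp
    have he: "S h \<odot>\<^bsub>Eh\<^esub> e \<in> carrier Ek" "h \<odot>\<^bsub>Eh\<^esub> y \<in> carrier Ek"
      using E_laws(4)[OF Sh] E_laws(4)[OF a(1,3)] e(1) unfolding car by blast+
    show "ev Y (etens PE (h \<odot>\<^bsub>Ph\<^esub> p) y) = h \<otimes>\<^bsub>H\<^esub> ev Y (etens PE p y)"
      unfolding e(2) theta_smult(1)[OF e(1) a(1)] ev_Y_etens[OF he(1) y] ev_Y_etens[OF e(1) y] tau_smult(1)[OF e(1) y Sh]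
        C.antipode_antipode[OF a(1)] ..
    show "ev Y (etens PE p (rsmult Eh y h)) = h \<otimes>\<^bsub>H\<^esub> ev Y (etens PE p y)"
      unfolding e(2) E_rsmult[OF a(1,3)] ev_Y_etens[OF e(1) he(2)] ev_Y_etens[OF e(1) y] by (rule tau_smult(2)[OF e(1) y a(1)])
  qed
  have evh: "evh Y \<in> bihom H H (TP k H Y) (bimod_of (regular H))"
    unfolding TP_def Y_sel
  proof (rule C.bihom_pairing[OF hbimod_E hbimod_P evh_Y_klin])
    fix h p y assume a: "h \<in> carrier H" "y \<in> carrier Eh" "p \<in> carrier Ph"
    have y: "y \<in> carrier Ek" unfolding car by (rule a(2))
    have "p \<in> carrier Pk" unfolding car by (rule a(3))
    then obtain e where e: "e \<in> carrier Ek" "p = theta e" by (rule theta_cases)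
    have Sh: "S h \<in> carrier H" using a(1) by simp
    have he: "S h \<odot>\<^bsub>Eh\<^esub> e \<in> carrier Ek" "h \<odot>\<^bsub>Eh\<^esub> y \<in> carrier Ek"
      using E_laws(4)[OF Sh] E_laws(4)[OF a(1,2)] e(1) unfolding car by blast+
    show "evh Y (etens EP (h \<odot>\<^bsub>Eh\<^esub> y) p) = h \<otimes>\<^bsub>H\<^esub> evh Y (etens EP y p)"
      unfolding e(2) evh_Y_etens[OF he(2) e(1)] evh_Y_etens[OF y e(1)] tau_smult(1)[OF y e(1) a(1)]
        C.antipode_mult[OF Sh tau_closed[OF y e(1)]] C.antipode_antipode[OF a(1)] ..
    show "evh Y (etens EP y (rsmult Ph p h)) = h \<otimes>\<^bsub>H\<^esub> evh Y (etens EP y p)"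
      unfolding e(2) theta_smult(2)[OF e(1) a(1)] evh_Y_etens[OF y he(1)] evh_Y_etens[OF y e(1)] tau_smult(2)[OF y e(1) Sh]
        C.antipode_mult[OF Sh tau_closed[OF y e(1)]] C.antipode_antipode[OF a(1)] ..
  qed
  have d1: "evh Y (etens EP x p) \<odot>\<^bsub>Eh\<^esub> y = rsmult Eh x (ev Y (etens PE p y))"
    if a: "x \<in> carrier Eh" "p \<in> carrier Ph" "y \<in> carrier Eh" for x p y
  proof -
    have xy: "x \<in> carrier Ek" "y \<in> carrier Ek" unfolding car by (rule a)+
    have "p \<in> carrier Pk" unfolding car by (rule a(2))
    then obtain e where e: "e \<in> carrier Ek" "p = theta e" by (rule theta_cases)
    show ?thesis
      unfolding e(2) evh_Y_etens[OF xy(1) e(1)] ev_Y_etens[OF e(1) xy(2)] E_rsmult[OF tau_closed[OF e(1) xy(2)] a(1)]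
      by (rule tau_dual[OF xy(1) e(1) xy(2)])
  qed
  have d2: "rsmult Ph p (evh Y (etens EP x q)) = ev Y (etens PE p x) \<odot>\<^bsub>Ph\<^esub> q"
    if a: "p \<in> carrier Ph" "x \<in> carrier Eh" "q \<in> carrier Ph" for x p q
  proof -
    have x: "x \<in> carrier Ek" unfolding car by (rule a)
    have "p \<in> carrier Pk" "q \<in> carrier Pk" unfolding car by (rule a)+
    then obtain e f where e: "e \<in> carrier Ek" "p = theta e" and f: "f \<in> carrier Ek" "q = theta f"
      using theta_cases by metis
    have St: "S (tau x f) \<in> carrier H" using tau_closed[OF x f(1)] by simp
    show ?thesis
      unfolding e(2) f(2) evh_Y_etens[OF x f(1)] ev_Y_etens[OF e(1) x] theta_smult(2)[OF e(1) St]
        theta_smult(1)[OF f(1) tau_closed[OF e(1) x]] C.antipode_antipode[OF tau_closed[OF x f(1)]]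
        tau_dual[OF e(1) x f(1)] ..
  qed
  show ?thesis
    unfolding formal_dual_def Let_def Y_sel ops
    by (intro conjI ballI) (rule hb ev evh d1 d2; assumption)+
qed

section \<open>Herd axioms of the composite, transported along the flip\<close>

lemma evh_pmap:
  assumes t: "t \<in> carrier E2" shows "evh Y (pmap t) = S (galois_ev k H EE t)"
proof -
  have l: "klin k E2 Hk (\<lambda>t. S (EV t))" by (rule C.antipode_lin[OF EV_klin])
  have "evh Y (pmap t) = S (EV t)"
  proof (rule tensor_ext[OF klin_comp[OF evh_Y_klin pmap_klin] l kmod_E kmod_E _ t])
    fix e f assume ef: "e \<in> carrier Ek" "f \<in> carrier Ek"
    show "evh Y (pmap (etens E2 e f)) = S (EV (etens E2 e f))"
      unfolding pmap_etens[OF ef] EV_etens[OF ef] by (rule evh_Y_etens[OF ef])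
  qed
  then show ?thesis unfolding ev_EE[OF t] .
qed

lemma smap_push:
  assumes "kbil k EP Ek A F" "s \<in> carrier E3"
  shows "tlift A F (smap s) = tlift A (\<lambda>t z. F (pmap t) z) s"
  unfolding smap_def by (rule tlift_map[OF pmap_klin klin_id[OF kmod_E] assms])

lemma pmap_push:
  assumes "kbil k Ek Pk A F" "s \<in> carrier E2"
  shows "tlift A F (pmap s) = tlift A (\<lambda>e f. F e (theta f)) s"
  unfolding pmap_def by (rule tlift_map[OF klin_id[OF kmod_E] theta_klin assms])

lemmas evY_kl [kl] = klin_comp[OF ev_Y_klin] klin_laws(4)[OF ev_Y_klin] klin_comp[OF evh_Y_klin] klin_laws(4)[OF evh_Y_klin]

lemma shep_Y_left:
  assumes x: "x \<in> carrier Ek"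
  shows "tlift HE (\<lambda>t z. etens HE (evh Y t) z) (shepherd Y x) = etens HE \<one>\<^bsub>H\<^esub> x"
proof -
  note kHF = keqv_tensor[OF keqv_refl[OF C.kmod_Hk] keqv_EE]
  have s: "EG.shep x \<in> carrier E3" by (rule kl x)+
  have "tlift HE (\<lambda>t z. etens HE (evh Y t) z) (shepherd Y x) = tlift HE (\<lambda>t z. etens HE (evh Y (pmap t)) z) (EG.shep x)"
    unfolding shepherd_Y_eq[OF x] by (rule smap_push[OF _ s]) (assumption | rule kl)+
  also have "\<dots> = tlift HE (\<lambda>t z. etens HE (S (galois_ev k H EE t)) z) (EG.shep x)"
  proof (rule tlift_cong[OF _ _ s])
    show "kbil k E2 Ek HE (\<lambda>t z. etens HE (evh Y (pmap t)) z)" by (assumption | rule kl)+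
    show "etens HE (evh Y (pmap t)) z = etens HE (S (galois_ev k H EE t)) z" if "t \<in> carrier E2" for t z
      unfolding evh_pmap[OF that] ..
  qed
  also have "\<dots> = etens HE \<one>\<^bsub>H\<^esub> x"
    using EG.ev_shep_left[unfolded keqv_cong_ops[OF kHF] keqv_cong_etens[OF kHF] carrier_EE, OF x] .
  finally show ?thesis .
qed

lemma shep_Y_right:
  assumes x: "x \<in> carrier Ek"
  shows "tlift EH (\<lambda>t z. tlift EH (\<lambda>y p. etens EH y (ev Y (etens PE p z))) t) (shepherd Y x) = etens EH x \<one>\<^bsub>H\<^esub>"
proof -
  note kFH = keqv_tensor[OF keqv_EE keqv_refl[OF C.kmod_Hk]]
  have s: "EG.shep x \<in> carrier E3" by (rule kl x)+
  have b: "kbil k Ek Pk EH (\<lambda>y p. etens EH y (ev Y (etens PE p z)))" if "z \<in> carrier Ek" for z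
    by (assumption | rule kl that)+
  have "tlift EH (\<lambda>t z. tlift EH (\<lambda>y p. etens EH y (ev Y (etens PE p z))) t) (shepherd Y x) =
      tlift EH (\<lambda>t z. tlift EH (\<lambda>y p. etens EH y (ev Y (etens PE p z))) (pmap t)) (EG.shep x)"
    unfolding shepherd_Y_eq[OF x] by (rule smap_push[OF _ s]) (assumption | rule kl)+
  also have "\<dots> = tlift EH (\<lambda>t z. tlift EH (\<lambda>y p. etens EH y (galois_ev k H EE (etens E2 p z))) t) (EG.shep x)"
  proof (rule tlift_cong[OF _ _ s])
    show "kbil k E2 Ek EH (\<lambda>t z. tlift EH (\<lambda>y p. etens EH y (ev Y (etens PE p z))) (pmap t))"
      by (assumption | rule kl)+
    fix t z assume t: "t \<in> carrier E2" and z: "z \<in> carrier Ek"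
    have "tlift EH (\<lambda>y p. etens EH y (ev Y (etens PE p z))) (pmap t) = tlift EH (\<lambda>y p. etens EH y (ev Y (etens PE (theta p) z))) t"
      by (rule pmap_push[OF b[OF z] t])
    also have "\<dots> = tlift EH (\<lambda>y p. etens EH y (galois_ev k H EE (etens E2 p z))) t"
    proof (rule tlift_cong[OF _ _ t])
      show "kbil k Ek Ek EH (\<lambda>y p. etens EH y (ev Y (etens PE (theta p) z)))" by (assumption | rule kl z)+
      show "etens EH y (ev Y (etens PE (theta p) z)) = etens EH y (galois_ev k H EE (etens E2 p z))" if "p \<in> carrier Ek" for y p
        unfolding ev_Y_etens[OF that z] tau_ev[OF that z] ..
    qed
    finally show "tlift EH (\<lambda>y p. etens EH y (ev Y (etens PE p z))) (pmap t) =
      tlift EH (\<lambda>y p. etens EH y (galois_ev k H EE (etens E2 p z))) t" .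
  qed
  also have "\<dots> = etens EH x \<one>\<^bsub>H\<^esub>"
    using EG.ev_shep_right[unfolded keqv_cong_ops[OF kFH] keqv_cong_etens[OF kFH] keqv_cong_etens[OF keqv_EE2] carrier_EE, OF x] .
  finally show ?thesis .
qed

lemma shepherd_Y_klin: "klin k Ek EPE (shepherd Y)"
  by (rule klin_cong[OF klin_comp[OF smap_klin shep_E_klin] shepherd_Y_eq[symmetric]])

lemmas shepY_kl [kl] = klin_comp[OF shepherd_Y_klin] klin_laws(4)[OF shepherd_Y_klin]

text \<open>With \<open>smap\<close> these apply the flip to the two pen legs, the second and the
  fourth, of a five-fold tensor.\<close>

definition smap4 where "smap4 = tlift Y4 (\<lambda>t p. etens Y4 (smap t) (theta p))"
definition smap5 where "smap5 = tlift Y5 (\<lambda>t z. etens Y5 (smap4 t) z)"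

lemma kbil_smap4: "kbil k E3 Ek Y4 (\<lambda>t p. etens Y4 (smap t) (theta p))" by (assumption | rule kl)+
lemma smap4_klin: "klin k E4 Y4 smap4" unfolding smap4_def by (rule klin_tlift0[OF kbil_smap4])
lemmas smap4_kl [kl] = klin_comp[OF smap4_klin] klin_laws(4)[OF smap4_klin]
lemma kbil_smap5: "kbil k E4 Ek Y5 (\<lambda>t z. etens Y5 (smap4 t) z)" by (assumption | rule kl)+
lemma smap5_klin: "klin k E5 Y5 smap5" unfolding smap5_def by (rule klin_tlift0[OF kbil_smap5])

lemma smap4_etens: "t \<in> carrier E3 \<Longrightarrow> p \<in> carrier Ek \<Longrightarrow> smap4 (etens E4 t p) = etens Y4 (smap t) (theta p)"
  unfolding smap4_def by (rule tlift_etens[OF kbil_smap4])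

lemma smap5_etens: "t \<in> carrier E4 \<Longrightarrow> z \<in> carrier Ek \<Longrightarrow> smap5 (etens E5 t z) = etens Y5 (smap4 t) z"
  unfolding smap5_def by (rule tlift_etens[OF kbil_smap5])

text \<open>Coassociativity of the shepherd of C \<otimes>_H D, with \<open>smap5\<close> applied to
  both sides and moved inward through the nested sums.\<close>

lemma shep_Y_coassoc:
  assumes x: "x \<in> carrier Ek"
  shows "tlift Y5 (\<lambda>t z. etens Y5 (tlift Y4 (\<lambda>t p. etens Y4 (shepherd Y t) p) t) z) (shepherd Y x) =
    tlift Y5 (\<lambda>t y. tlift Y5 (\<lambda>u z. tlift Y5 (\<lambda>w p. etens Y5 (etens Y4 (etens EPE t w) p) z) u) (shepherd Y y)) (shepherd Y x)"
proof -
  have s: "EG.shep x \<in> carrier E3" by (rule kl x)+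
  note k4 = keqv_tensor[OF keqv_EE3 keqv_EE]
  note k5 = keqv_tensor[OF k4 keqv_EE]
  have bE: "kbil k E2 Ek E5 (\<lambda>t z. etens E5 (tlift E4 (\<lambda>t p. etens E4 (EG.shep t) p) t) z)" by (assumption | rule kl)+
  have bE4: "kbil k Ek Ek E4 (\<lambda>t p. etens E4 (EG.shep t) p)" by (assumption | rule kl)+
  have bY4: "kbil k Ek Pk Y4 (\<lambda>t p. etens Y4 (shepherd Y t) p)" by (assumption | rule kl)+
  have "tlift Y5 (\<lambda>t z. etens Y5 (tlift Y4 (\<lambda>t p. etens Y4 (shepherd Y t) p) t) z) (shepherd Y x) =
      tlift Y5 (\<lambda>t z. etens Y5 (tlift Y4 (\<lambda>t p. etens Y4 (shepherd Y t) p) (pmap t)) z) (EG.shep x)"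
    unfolding shepherd_Y_eq[OF x] by (rule smap_push[OF _ s]) (assumption | rule kl)+
  also have "\<dots> = smap5 (tlift E5 (\<lambda>t z. etens E5 (tlift E4 (\<lambda>t p. etens E4 (EG.shep t) p) t) z) (EG.shep x))"
  proof (rule tlift_push[OF smap5_klin bE s, symmetric])
    fix t z assume t: "t \<in> carrier E2" and z: "z \<in> carrier Ek"
    have c: "tlift E4 (\<lambda>t p. etens E4 (EG.shep t) p) t \<in> carrier E4" by (rule tlift_closed[OF t bE4])
    have "smap4 (tlift E4 (\<lambda>t p. etens E4 (EG.shep t) p) t) = tlift Y4 (\<lambda>t p. etens Y4 (shepherd Y t) (theta p)) t"
    proof (rule tlift_push[OF smap4_klin bE4 t])
      fix e f assume ef: "e \<in> carrier Ek" "f \<in> carrier Ek"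
      have "EG.shep e \<in> carrier E3" by (rule kl ef)+
      then show "smap4 (etens E4 (EG.shep e) f) = etens Y4 (shepherd Y e) (theta f)"
        unfolding shepherd_Y_eq[OF ef(1)] by (rule smap4_etens[OF _ ef(2)])
    qed
    also have "\<dots> = tlift Y4 (\<lambda>t p. etens Y4 (shepherd Y t) p) (pmap t)"
      by (rule pmap_push[OF bY4 t, symmetric])
    finally show "smap5 (etens E5 (tlift E4 (\<lambda>t p. etens E4 (EG.shep t) p) t) z) =
        etens Y5 (tlift Y4 (\<lambda>t p. etens Y4 (shepherd Y t) p) (pmap t)) z"
      unfolding smap5_etens[OF c z] by (rule arg_cong)
  qed
  also have "tlift E5 (\<lambda>t z. etens E5 (tlift E4 (\<lambda>t p. etens E4 (EG.shep t) p) t) z) (EG.shep x) =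
    tlift E5 (\<lambda>t y. tlift E5 (\<lambda>u z. tlift E5 (\<lambda>w p. etens E5 (etens E4 (etens E3 t w) p) z) u) (EG.shep y)) (EG.shep x)"
    using EG.shep_coassoc[unfolded keqv_cong_ops[OF k4] keqv_cong_etens[OF k4] keqv_cong_ops[OF k5] keqv_cong_etens[OF k5]
        keqv_cong_etens[OF keqv_EE3] carrier_EE, OF x] .
  also have "smap5 \<dots> = tlift Y5 (\<lambda>t y. tlift Y5 (\<lambda>u z. tlift Y5 (\<lambda>w p.
      etens Y5 (etens Y4 (etens EPE (pmap t) w) p) z) u) (shepherd Y y)) (EG.shep x)"
  proof (rule tlift_push[OF smap5_klin _ s])
    show "kbil k E2 Ek E5 (\<lambda>t y. tlift E5 (\<lambda>u z. tlift E5 (\<lambda>w p. etens E5 (etens E4 (etens E3 t w) p) z) u) (EG.shep y))"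
      by (assumption | rule kl)+
    fix t y assume t: "t \<in> carrier E2" and y: "y \<in> carrier Ek"
    have sy: "EG.shep y \<in> carrier E3" by (rule kl y)+
    have pt: "pmap t \<in> carrier EP" by (rule kl t)+
    have "smap5 (tlift E5 (\<lambda>u z. tlift E5 (\<lambda>w p. etens E5 (etens E4 (etens E3 t w) p) z) u) (EG.shep y)) =
        tlift Y5 (\<lambda>u z. tlift Y5 (\<lambda>w p. etens Y5 (etens Y4 (etens EPE (pmap t) w) p) z) (pmap u)) (EG.shep y)"
    proof (rule tlift_push[OF smap5_klin _ sy])
      show "kbil k E2 Ek E5 (\<lambda>u z. tlift E5 (\<lambda>w p. etens E5 (etens E4 (etens E3 t w) p) z) u)" by (assumption | rule kl t)+
      fix u z assume u: "u \<in> carrier E2" and z: "z \<in> carrier Ek"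
      have bY: "kbil k Ek Pk Y5 (\<lambda>w p. etens Y5 (etens Y4 (etens EPE (pmap t) w) p) z)" by (assumption | rule kl pt z)+
      show "smap5 (tlift E5 (\<lambda>w p. etens E5 (etens E4 (etens E3 t w) p) z) u) =
          tlift Y5 (\<lambda>w p. etens Y5 (etens Y4 (etens EPE (pmap t) w) p) z) (pmap u)"
        unfolding pmap_push[OF bY u]
      proof (rule tlift_push[OF smap5_klin _ u])
        show "kbil k Ek Ek E5 (\<lambda>w p. etens E5 (etens E4 (etens E3 t w) p) z)" by (assumption | rule kl t z)+
        fix w p assume wp: "w \<in> carrier Ek" "p \<in> carrier Ek"
        have c: "etens E3 t w \<in> carrier E3" "etens E4 (etens E3 t w) p \<in> carrier E4" by (rule kl t wp)+
        show "smap5 (etens E5 (etens E4 (etens E3 t w) p) z) = etens Y5 (etens Y4 (etens EPE (pmap t) w) (theta p)) z"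
          unfolding smap5_etens[OF c(2) z] smap4_etens[OF c(1) wp(2)] smap_etens[OF t wp(1)] ..
      qed
    qed
    also have "\<dots> = tlift Y5 (\<lambda>u z. tlift Y5 (\<lambda>w p. etens Y5 (etens Y4 (etens EPE (pmap t) w) p) z) u) (shepherd Y y)"
      unfolding shepherd_Y_eq[OF y] by (rule smap_push[OF _ sy, symmetric]) (assumption | rule kl pt)+
    finally show "smap5 (tlift E5 (\<lambda>u z. tlift E5 (\<lambda>w p. etens E5 (etens E4 (etens E3 t w) p) z) u) (EG.shep y)) =
        tlift Y5 (\<lambda>u z. tlift Y5 (\<lambda>w p. etens Y5 (etens Y4 (etens EPE (pmap t) w) p) z) u) (shepherd Y y)" .
  qed
  also have "\<dots> = tlift Y5 (\<lambda>t y. tlift Y5 (\<lambda>u z. tlift Y5 (\<lambda>w p. etens Y5 (etens Y4 (etens EPE t w) p) z) u) (shepherd Y y)) (shepherd Y x)"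
    unfolding shepherd_Y_eq[OF x] by (rule smap_push[OF _ s, symmetric]) (assumption | rule kl)+
  finally show ?thesis .
qed

lemma herd_Y: "is_herd k H Y"
proof -
  let ?T3 = "TPT k H Y" and ?T4 = "rk H (TPT k H Y) \<boxtimes>\<^bsub>k\<^esub> lk H Ph"
  let ?T5 = "rk H (rk H (TPT k H Y) \<boxtimes>\<^bsub>k\<^esub> lk H Ph) \<boxtimes>\<^bsub>k\<^esub> lk H Eh"
  have e: "etens (PT k H Y) = etens PE" "etens ?T3 = etens EPE" "etens ?T4 = etens Y4" "etens ?T5 = etens Y5"
    by (rule C.keqv_ops(1)[OF keqv_Y(1)], rule C.keqv_ops(1)[OF keqv_Y(3)], rule C.keqv_ops(1)[OF keqv_Y(4)],
      rule C.keqv_ops(1)[OF keqv_Y(5)])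
  have t: "tlift ?T5 = tlift Y5" "tlift ?T5 = tlift Y5" "tmap ?T4 = tmap Y4" "tmap ?T5 = tmap Y5"
    by (rule C.keqv_ops(3)[OF keqv_Y(5)] C.keqv_ops(2)[OF keqv_Y(4)] C.keqv_ops(2)[OF keqv_Y(5)])+
  have g1: "tensor_group k Hk (lk H Eh) = tensor_group k Hk Ek"
    by (simp add: tensor_group_def tensor_relations_def)
  have g2: "tensor_group k (rk H Eh) Hk = tensor_group k Ek Hk"
    by (simp add: tensor_group_def tensor_relations_def)
  have h: "tmap (Hk \<boxtimes>\<^bsub>k\<^esub> lk H Eh) = tmap HE" "etens (Hk \<boxtimes>\<^bsub>k\<^esub> lk H Eh) = etens HE"
    "tlift (rk H Eh \<boxtimes>\<^bsub>k\<^esub> Hk) = tlift EH" "tlift (rk H Eh \<boxtimes>\<^bsub>k\<^esub> Hk) = tlift EH" "etens (rk H Eh \<boxtimes>\<^bsub>k\<^esub> Hk) = etens EH"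
    unfolding tensor_record_ops g1 g2 by (rule refl)+
  have sh: "shepherd Y \<in> bihom k k Ek (kk H ?T3)"
    by (rule klin_bihom, rule keqv_klin[OF keqv_refl[OF kmod_E] keqv_sym[OF keqv_Y(3)] shepherd_Y_klin])
  have c: "x \<in> carrier Ek" if "x \<in> carrier Eh" for x using that unfolding kk_sel .
  show ?thesis
    unfolding is_herd_def Let_def Y_sel e t h
    unfolding tmap_def
    by (intro conjI ballI formal_dual_Y sh) (rule shep_Y_left shep_Y_right shep_Y_coassoc, erule c)+
qed

lemma coincide: "herds_coincide_via k H (flip (pen Y)) (galois_herd k H EE) Y"
proof -
  note E_laws = is_bimodule_laws[OF C.hbimod_bimodule[OF hbimod_E]]
  have car: "carrier Ek = carrier Eh" "carrier Pk = carrier Ph" by (rule kk_sel)+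
  have i: "(\<lambda>x. x) \<in> biiso H H (bimod_of EE) Eh"
    unfolding biiso_def bihom_def
  proof (intro CollectI conjI ballI)
    show "(\<lambda>x. x) \<in> hom (add_monoid (bimod_of EE)) (add_monoid Eh)"
      by (rule homI) (simp_all only: monoid.simps partial_object.simps bimod_of_sel EE_sel)
    \<comment> \<open>\<open>bimod_of\<close> declares the right action to be the left one, whereas
      the right action on \<open>Eh\<close> comes from the factor D; balance over \<open>H\<close>
      reconciles them.\<close>
    show "rsmult (bimod_of EE) x s = rsmult Eh x s" if "s \<in> carrier H" "x \<in> carrier (bimod_of EE)" for s x
      using that E_rsmult[of s x] by (simp only: bimod_of_sel EE_sel)
  qed (simp_all only: bimod_of_sel EE_sel bij_betw_id[unfolded id_def])
  have th: "theta \<in> biiso H H EG.Pen Ph"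
    unfolding biiso_def bihom_def
  proof (intro CollectI conjI ballI)
    note tl = klin_laws(4,5)[OF theta_klin, unfolded kk_sel]
    show "theta \<in> hom (add_monoid EG.Pen) (add_monoid Ph)"
      by (rule homI; simp only: monoid.simps partial_object.simps C.pen_of_sel bimod_of_sel EE_sel)
        (rule tl; assumption)+
    show "theta (h \<odot>\<^bsub>EG.Pen\<^esub> x) = h \<odot>\<^bsub>Ph\<^esub> theta x" "theta (rsmult EG.Pen x h) = rsmult Ph (theta x) h"
      if "h \<in> carrier H" "x \<in> carrier EG.Pen" for h x
    proof -
      have "x \<in> carrier Ek" using that(2) unfolding car C.pen_of_sel bimod_of_sel EE_sel .
      note ts = theta_smult[OF this that(1)]
      show "theta (h \<odot>\<^bsub>EG.Pen\<^esub> x) = h \<odot>\<^bsub>Ph\<^esub> theta x" "theta (rsmult EG.Pen x h) = rsmult Ph (theta x) h"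
        unfolding ts C.pen_of_sel bimod_of_sel EE_sel C.antipode_inv[OF that(1)] by (rule refl)+
    qed
    have "bij_betw theta (carrier Ek) (carrier Pk)"
      by (rule bij_betw_byWitness[where f' = theta_inv])
        (auto simp only: theta_inverse theta_inv_inverse klin_laws(4)[OF theta_klin] klin_laws(4)[OF theta_inv_klin])
    then show "bij_betw theta (carrier EG.Pen) (carrier Ph)"
      unfolding car C.pen_of_sel bimod_of_sel EE_sel .
  qed
  have c2: "carrier (PT k H (galois_herd k H EE)) = carrier E2" "carrier (TP k H (galois_herd k H EE)) = carrier E2"
    using keqv_sel(1)[OF EG.keqv_PT] keqv_sel(1)[OF EG.keqv_TP] unfolding keqv_sel(1)[OF keqv_EE2] kk_sel .
  have o: "tmap (PT k H Y) = tmap PE" "tmap (TP k H Y) = tmap EP" "tmap (TPT k H Y) = tmap EPE"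
    by (rule C.keqv_ops(2)[OF keqv_Y(1)], rule C.keqv_ops(2)[OF keqv_Y(2)], rule C.keqv_ops(2)[OF keqv_Y(3)])
  have ev: "galois_ev k H EE t = ev Y (tmap PE theta (\<lambda>x. x) t)" if t: "t \<in> carrier E2" for t
  proof -
    have b: "kbil k Ek Ek PE (\<lambda>x y. etens PE (theta x) y)" by (assumption | rule kl)+
    have "EV t = ev Y (tlift PE (\<lambda>x y. etens PE (theta x) y) t)"
    proof (rule tensor_ext[OF EV_klin klin_comp[OF ev_Y_klin klin_tlift0[OF b]] kmod_E kmod_E _ t])
      fix e f assume ef: "e \<in> carrier Ek" "f \<in> carrier Ek"
      show "EV (etens E2 e f) = ev Y (tlift PE (\<lambda>x y. etens PE (theta x) y) (etens E2 e f))"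
        unfolding EV_etens[OF ef] tlift_etens[OF b ef] ev_Y_etens[OF ef] ..
    qed
    then show ?thesis unfolding ev_EE[OF t] tmap_def .
  qed
  have p: "tmap EP (\<lambda>x. x) theta = pmap" unfolding pmap_def tmap_def ..
  have s: "tmap EPE pmap (\<lambda>x. x) = smap" unfolding smap_def tmap_def ..
  show ?thesis
    unfolding herds_coincide_via_def Y_sel flip_theta EG.herd_sel c2 o p s
  proof (intro conjI ballI)
    show "is_herd k H (galois_herd k H EE)" by (rule EG.herd)
    show "is_herd k H Y" by (rule herd_Y)
    show "smap (EG.shep x) = shepherd Y x" if "x \<in> carrier (bimod_of EE)" for x
      by (rule shepherd_Y_eq[symmetric]) (use that in \<open>simp only: car bimod_of_sel EE_sel\<close>)
    show "S (galois_ev k H EE t) = evh Y (pmap t)" if "t \<in> carrier E2" for t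
      by (rule evh_pmap[OF that, symmetric])
  qed (rule i th ev; assumption?)+
qed

end

theorem theorem5p6:
  fixes k :: "'k ring" and H :: "('k, 'h) hopf"
    and C :: "('k, 'h, 'c) module_coalgebra" and D :: "('k, 'h, 'd) module_coalgebra"
  assumes universe: "infinite (UNIV :: 'u set)"
    "\<exists>f :: 'k \<Rightarrow> 'u. inj_on f (carrier k)" "\<exists>f :: 'h \<Rightarrow> 'u. inj_on f (carrier H)"
    "\<exists>f :: 'c \<Rightarrow> 'u. inj_on f (carrier C)" "\<exists>f :: 'd \<Rightarrow> 'u. inj_on f (carrier D)"
    and "cring k"
    and "commutative_hopf_algebra k H"
    and "faithfully_flat TYPE('u) k H"
    and "galois_coobject TYPE('u) k H C"
    and "galois_coobject TYPE('u) k H D"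
  shows "let X = galois_herd k H (compose_coobjects k H C D);
             Y = compose_herds k H (galois_herd k H C) (galois_herd k H D) (sigma k H C D)
         in herds_coincide_via k H (flip (pen Y)) X Y"
proof -
  obtain f :: "'c \<Rightarrow> 'u" and g :: "'h \<Rightarrow> 'u" and f' :: "'d \<Rightarrow> 'u"
    where inj: "inj_on f (carrier C)" "inj_on g (carrier H)" "inj_on f' (carrier D)"
    using universe by blast
  have mc: "is_module_coalgebra k H C" "is_module_coalgebra k H D"
    using assms(9,10) unfolding galois_coobject_def Let_def by blast+
  have ch: "comm_hopf k H" by (rule comm_hopf.intro[OF assms(6,7)])
  have mod: "mod_coalg k H C" "mod_coalg k H D"
    by (rule mod_coalg.intro[OF ch mod_coalg_axioms.intro[OF mc(1)]], rule mod_coalg.intro[OF ch mod_coalg_axioms.intro[OF mc(2)]])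
  have gal: "galois k H C" "galois k H D"
    by (rule galois.intro[OF mod(1) galois_axioms.intro[OF mod_coalg.galois_coobject_bij[OF mod(1) universe(1) inj(1,2) assms(9)]]],
      rule galois.intro[OF mod(2) galois_axioms.intro[OF mod_coalg.galois_coobject_bij[OF mod(2) universe(1) inj(3,2) assms(10)]]])
  interpret galois_pair k H C D by (rule galois_pair.intro[OF gal])
  show ?thesis unfolding Let_def by (rule coincide)
qed

end
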